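(* In the setting of the context, let $X_t$ satisfy the SDE $$X_t=x+\int_0^t\int_0^\infty\int_{|z|\le1}1_{[0,\sigma(X_{s-},z)]}(r)\,z\,\tilde{\mathcal N}(\mathrm{d}z,\mathrm{d}r,\mathrm{d}s)+\int_0^t\int_0^\infty\int_{|z|>1}1_{[0,\sigma(X_{s-},z)]}(r)\,z\,\mathcal N(\mathrm{d}z,\mathrm{d}r,\mathrm{d}s)+\int_0^tb(X_s)\,\mathrm{d}s,$$ and let $f\in C_b^\gamma(\mathbb{R}^d)$ with $\gamma>\alpha$. Then $$f(X_t)-f(x)-\int_0^t\mathscr L f(X_s)\,\mathrm{d}s=\int_0^t\int_0^\infty\int_{\mathbb{R}^d}\big[f\big(X_{s-}+1_{[0,\sigma(X_{s-},z)]}(r)z\big)-f(X_{s-})\big]\tilde{\mathcal N}(\mathrm{d}z,\mathrm{d}r,\mathrm{d}s),$$ where $\mathscr L=\mathscr L^\kappa_\alpha+b\cdot\nabla$.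
   Context: Setting: $d\ge1$, $\alpha\in(1,2)$; $\nu(\mathrm{d}z)=\tilde\kappa(z)|z|^{-d-\alpha}\mathrm{d}z$ with $\tilde\kappa:\mathbb{R}^d\to\mathbb{R}$ measurable, $\tilde\kappa(z)=\tilde\kappa(-z)$, $0<\kappa_0\le\tilde\kappa(z)\le\kappa_1$; $\sigma:\mathbb{R}^d\times\mathbb{R}^d\to\mathbb{R}$ is measurable with $\sigma(x,z)=\sigma(x,-z)$, $0<\tilde k_0\le\sigma(x,z)\le\tilde k_1$ and $|\sigma(x,z)-\sigma(y,z)|\le C_0|x-y|^\beta$ for all $x,y,z$, where $\beta\in(0,1)$ and $\alpha+\beta<2$; $b:\mathbb{R}^d\to\mathbb{R}^d$ is measurable. $\mathcal N$ is a Poisson random measure on $\mathbb{R}^d\times[0,\infty)\times[0,\infty)$ with intensity $\nu(\mathrm{d}z)\mathrm{d}r\mathrm{d}t$ and $\tilde{\mathcal N}(\mathrm{d}z,\mathrm{d}r,\mathrm{d}t)=\mathcal N(\mathrm{d}z,\mathrm{d}r,\mathrm{d}t)-\nu(\mathrm{d}z)\mathrm{d}r\mathrm{d}t$. With $\kappa(x,z)=\sigma(x,z)\tilde\kappa(z)$, $\mathscr L^\kappa_\alpha f(x)=\mathrm{p.v.}\int_{\mathbb{R}^d}[f(x+z)-f(x)]\frac{\kappa(x,z)}{|z|^{d+\alpha}}\mathrm{d}z=\frac12\int_{\mathbb{R}^d}[f(x+z)+f(x-z)-2f(x)]\frac{\kappa(x,z)}{|z|^{d+\alpha}}\mathrm{d}z$,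 which is well defined for $f\in C_b^\gamma(\mathbb{R}^d)$, $\gamma>\alpha$. Here $C_b^\gamma(\mathbb{R}^d)$ is the usual Hölder space with norm $\sum_{i=0}^{[\gamma]}\|\nabla^if\|_\infty+[\nabla^{[\gamma]}f]_{\gamma-[\gamma]}$, where $[\gamma]$ is the integer part and $[g]_\vartheta=\sup_{x\ne y}|g(x)-g(y)|/|x-y|^\vartheta$. *)

theory Defs
  imports "HOL-Probability.Probability"
begin

section \<open>Hoelder spaces\<close>

text \<open>The components of \<open>\<nabla>\<^sup>i f(x)\<close> are the values \<open>partials f vs x\<close> for lists \<open>vs\<close> of
  \<open>i\<close> basis vectors; tensors are measured in the Euclidean norm of their components.\<close>

primrec partials :: "('a::euclidean_space \<Rightarrow> real) \<Rightarrow> 'a list \<Rightarrow> 'a \<Rightarrow> real" where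
  "partials f [] = f"
| "partials f (v # vs) = (\<lambda>x. frechet_derivative (partials f vs) (at x) v)"

definition basis_lists :: "nat \<Rightarrow> 'a::euclidean_space list set" where
  "basis_lists i = {vs. set vs \<subseteq> Basis \<and> length vs = i}"

definition C_k :: "nat \<Rightarrow> ('a::euclidean_space \<Rightarrow> real) \<Rightarrow> bool" where
  "C_k k f \<longleftrightarrow>
     (\<forall>i<k. \<forall>vs\<in>basis_lists i. partials f vs differentiable_on UNIV) \<and>
     (\<forall>vs\<in>basis_lists k. continuous_on UNIV (partials f vs))"

definition holder_norm :: "real \<Rightarrow> ('a::euclidean_space \<Rightarrow> real) \<Rightarrow> ennreal" where
  "holder_norm \<gamma> f = (let k = nat \<lfloor>\<gamma>\<rfloor> in
     (\<Sum>i\<le>k. SUP x. ennreal (L2_set (\<lambda>vs. partials f vs x) (basis_lists i))) +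
     (SUP (x, y) \<in> {(x, y). x \<noteq> y}.
        ennreal (L2_set (\<lambda>vs. partials f vs x - partials f vs y) (basis_lists k)
          / norm (x - y) powr (\<gamma> - real k))))"

definition holder_space :: "real \<Rightarrow> ('a::euclidean_space \<Rightarrow> real) set" where
  "holder_space \<gamma> = {f. C_k (nat \<lfloor>\<gamma>\<rfloor>) f \<and> holder_norm \<gamma> f < \<infinity>}"


section \<open>The operator\<close>

definition grad :: "('a::euclidean_space \<Rightarrow> real) \<Rightarrow> 'a \<Rightarrow> 'a" where
  "grad f x = (\<Sum>i\<in>Basis. frechet_derivative f (at x) i *\<^sub>R i)"

definition stable_op ::
  "real \<Rightarrow> ('a::euclidean_space \<Rightarrow> 'a \<Rightarrow> real) \<Rightarrow> ('a \<Rightarrow> real) \<Rightarrow> 'a \<Rightarrow> real" where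
  "stable_op \<alpha> \<kappa> f x = Lim (at_right 0) (\<lambda>\<epsilon>.
     LINT z:{z. \<epsilon> < norm z}|lborel.
       (f (x + z) - f x) * (\<kappa> x z / norm z powr (real DIM('a) + \<alpha>)))"

definition generator_op ::
  "real \<Rightarrow> ('a::euclidean_space \<Rightarrow> 'a \<Rightarrow> real) \<Rightarrow> ('a \<Rightarrow> 'a) \<Rightarrow> ('a \<Rightarrow> real) \<Rightarrow> 'a \<Rightarrow> real" where
  "generator_op \<alpha> \<kappa> b f x = stable_op \<alpha> \<kappa> f x + b x \<bullet> grad f x"


section \<open>Poisson random measures\<close>

text \<open>The half-line \<open>[0,\<infinity>)\<close> with Lebesgue measure is represented by the measure on \<open>\<real>\<close> that is
  zero on the negative numbers.  A point of a random measure is a pair \<open>(e, s)\<close> of a mark \<open>e\<close> and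
  a time \<open>s\<close>; below the marks are themselves pairs \<open>(z, r)\<close>.\<close>

definition half_line :: "real measure" where
  "half_line = density lborel (indicator {0..})"

definition jump_measure :: "real \<Rightarrow> ('a::euclidean_space \<Rightarrow> real) \<Rightarrow> 'a measure" where
  "jump_measure \<alpha> \<kappa> =
     density lborel (\<lambda>z. ennreal (\<kappa> z * norm z powr (- real DIM('a) - \<alpha>)))"

definition mark_measure :: "real \<Rightarrow> ('a::euclidean_space \<Rightarrow> real) \<Rightarrow> ('a \<times> real) measure" where
  "mark_measure \<alpha> \<kappa> = jump_measure \<alpha> \<kappa> \<Otimes>\<^sub>M half_line"

definition intensity :: "'e measure \<Rightarrow> ('e \<times> real) measure" where
  "intensity m = m \<Otimes>\<^sub>M half_line"

definition poisson_random_measure ::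
  "'w measure \<Rightarrow> 'p measure \<Rightarrow> ('w \<Rightarrow> 'p measure) \<Rightarrow> bool" where
  "poisson_random_measure M \<mu> N \<longleftrightarrow>
     (\<forall>\<omega>\<in>space M. sets (N \<omega>) = sets \<mu>) \<and>
     (\<forall>A\<in>sets \<mu>. (\<lambda>\<omega>. emeasure (N \<omega>) A) \<in> borel_measurable M) \<and>
     (\<forall>A\<in>sets \<mu>. emeasure \<mu> A < \<infinity> \<longrightarrow>
        (\<forall>k::nat. measure M {\<omega>\<in>space M. emeasure (N \<omega>) A = of_nat k} =
           exp (- measure \<mu> A) * measure \<mu> A ^ k / fact k)) \<and>
     (\<forall>A::nat \<Rightarrow> 'p set. range A \<subseteq> sets \<mu> \<longrightarrow> disjoint_family A \<longrightarrow>
        prob_space.indep_vars M (\<lambda>_. borel) (\<lambda>i \<omega>. emeasure (N \<omega>) (A i)) UNIV)"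

text \<open>Compatibility with a filtration: the past of the random measure is adapted, its future is
  independent of the past.\<close>

definition adapted_random_measure ::
  "'w measure \<Rightarrow> (real \<Rightarrow> 'w measure) \<Rightarrow> 'e measure \<Rightarrow> ('w \<Rightarrow> ('e \<times> real) measure) \<Rightarrow> bool" where
  "adapted_random_measure M F m N \<longleftrightarrow> (\<forall>t\<ge>0.
     (\<forall>A\<in>sets (intensity m). A \<subseteq> space m \<times> {0..t} \<longrightarrow>
        (\<lambda>\<omega>. emeasure (N \<omega>) A) \<in> borel_measurable (F t)) \<and>
     prob_space.indep_set M (sets (F t))
       (sigma_sets (space M)
         {(\<lambda>\<omega>. emeasure (N \<omega>) A) -` B \<inter> space M | A B.
            A \<in> sets (intensity m) \<and> A \<subseteq> space m \<times> {t<..} \<and> B \<in> sets borel}))"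


section \<open>Integrals with respect to the compensated random measure\<close>

definition predictable_algebra ::
  "'w measure \<Rightarrow> (real \<Rightarrow> 'w measure) \<Rightarrow> 'e measure \<Rightarrow> ('w \<times> 'e \<times> real) measure" where
  "predictable_algebra M F m = sigma (space M \<times> (space m \<times> {0<..}))
     {H \<times> (B \<times> {s<..t}) | H B s t. H \<in> sets (F s) \<and> B \<in> sets m \<and> 0 \<le> s \<and> s \<le> t}"

definition predictable ::
  "'w measure \<Rightarrow> (real \<Rightarrow> 'w measure) \<Rightarrow> 'e measure \<Rightarrow>
   ('w \<Rightarrow> 'e \<Rightarrow> real \<Rightarrow> 'b::euclidean_space) \<Rightarrow> bool" where
  "predictable M F m g \<longleftrightarrow> (\<lambda>(\<omega>, e, s). g \<omega> e s) \<in> borel_measurable (predictable_algebra M F m)"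

text \<open>\<open>power_norm M m p t g\<close> is \<open>E \<integral>\<^sub>0\<^sup>t \<integral> |g|\<^sup>p dm ds\<close>.\<close>

definition power_norm ::
  "'w measure \<Rightarrow> 'e measure \<Rightarrow> nat \<Rightarrow> real \<Rightarrow> ('w \<Rightarrow> 'e \<Rightarrow> real \<Rightarrow> 'b::euclidean_space) \<Rightarrow> ennreal" where
  "power_norm M m p t g =
     (\<integral>\<^sup>+ (\<omega>, e, s). ennreal (norm (g \<omega> e s) ^ p) * indicator {0<..t} s \<partial>(M \<Otimes>\<^sub>M intensity m))"

definition pathwise_comp_integral ::
  "'e measure \<Rightarrow> ('w \<Rightarrow> ('e \<times> real) measure) \<Rightarrow> ('w \<Rightarrow> 'e \<Rightarrow> real \<Rightarrow> 'b::euclidean_space) \<Rightarrow>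
   real \<Rightarrow> 'w \<Rightarrow> 'b" where
  "pathwise_comp_integral m N g t \<omega> =
     (\<integral>(e, s). indicator {0<..t} s *\<^sub>R g \<omega> e s \<partial>N \<omega>) -
     (\<integral>(e, s). indicator {0<..t} s *\<^sub>R g \<omega> e s \<partial>intensity m)"

definition cadlag :: "(real \<Rightarrow> 'b::topological_space) \<Rightarrow> bool" where
  "cadlag x \<longleftrightarrow> (\<forall>t\<ge>0. (x \<longlongrightarrow> x t) (at_right t)) \<and> (\<forall>t>0. \<exists>l. (x \<longlongrightarrow> l) (at_left t))"

text \<open>\<open>has_comp_integral M F m N g Z\<close>: the process \<open>Z\<close> is a cadlag version of
  \<open>Z\<^sub>t = \<integral>\<^sub>0\<^sup>t \<integral> g(e, s) (N(de, ds) - m(de) ds)\<close>.  For predictable integrands in \<open>L\<^sup>1 \<inter> L\<^sup>2\<close> this is the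
  difference of two Lebesgue integrals; the integral of a general square integrable predictable
  integrand is its extension by the Ito isometry, that is, an \<open>L\<^sup>2\<close> limit along an
  approximating sequence \<open>h\<close> from \<open>L\<^sup>1 \<inter> L\<^sup>2\<close>; by the isometry the limit does not depend on \<open>h\<close>.\<close>

definition has_comp_integral ::
  "'w measure \<Rightarrow> (real \<Rightarrow> 'w measure) \<Rightarrow> 'e measure \<Rightarrow> ('w \<Rightarrow> ('e \<times> real) measure) \<Rightarrow>
   ('w \<Rightarrow> 'e \<Rightarrow> real \<Rightarrow> 'b::euclidean_space) \<Rightarrow> (real \<Rightarrow> 'w \<Rightarrow> 'b) \<Rightarrow> bool" where
  "has_comp_integral M F m N g Z \<longleftrightarrow>
     predictable M F m g \<and>
     (AE \<omega> in M. cadlag (\<lambda>t. Z t \<omega>)) \<and>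
     (\<forall>t\<ge>0. Z t \<in> borel_measurable M \<and> power_norm M m 2 t g < \<infinity> \<and>
        (\<exists>h :: nat \<Rightarrow> 'w \<Rightarrow> 'e \<Rightarrow> real \<Rightarrow> 'b.
           (\<forall>n. predictable M F m (h n) \<and>
                power_norm M m 1 t (h n) < \<infinity> \<and> power_norm M m 2 t (h n) < \<infinity>) \<and>
           (\<lambda>n. power_norm M m 2 t (\<lambda>\<omega> e s. h n \<omega> e s - g \<omega> e s)) \<longlonglongrightarrow> 0 \<and>
           (\<lambda>n. \<integral>\<^sup>+ \<omega>. ennreal (norm (pathwise_comp_integral m N (h n) t \<omega> - Z t \<omega>) ^ 2) \<partial>M)
             \<longlonglongrightarrow> 0))"


section \<open>The stochastic differential equation\<close>

definition left_lim :: "(real \<Rightarrow> 'w \<Rightarrow> 'a::t2_space) \<Rightarrow> real \<Rightarrow> 'w \<Rightarrow> 'a" where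
  "left_lim X s \<omega> = Lim (at_left s) (\<lambda>u. X u \<omega>)"

definition thinned_jump :: "('a::euclidean_space \<Rightarrow> 'a \<Rightarrow> real) \<Rightarrow> 'a \<Rightarrow> 'a \<times> real \<Rightarrow> 'a" where
  "thinned_jump \<sigma> y = (\<lambda>(z, r). indicator {0..\<sigma> y z} r *\<^sub>R z)"

definition sde_solution ::
  "'w measure \<Rightarrow> (real \<Rightarrow> 'w measure) \<Rightarrow> ('a::euclidean_space \<times> real) measure \<Rightarrow>
   ('w \<Rightarrow> (('a \<times> real) \<times> real) measure) \<Rightarrow> ('a \<Rightarrow> 'a \<Rightarrow> real) \<Rightarrow> ('a \<Rightarrow> 'a) \<Rightarrow> 'a \<Rightarrow>
   (real \<Rightarrow> 'w \<Rightarrow> 'a) \<Rightarrow> bool" where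
  "sde_solution M F m N \<sigma> b x X \<longleftrightarrow>
     (\<forall>t\<ge>0. X t \<in> borel_measurable (F t)) \<and>
     (\<forall>\<omega>\<in>space M. cadlag (\<lambda>t. X t \<omega>)) \<and>
     (\<exists>Z. has_comp_integral M F m N
            (\<lambda>\<omega> e s. indicator {e. norm (fst e) \<le> 1} e *\<^sub>R thinned_jump \<sigma> (left_lim X s \<omega>) e) Z \<and>
        (AE \<omega> in M. \<forall>t\<ge>0.
           integrable (N \<omega>) (\<lambda>(e, s). indicator {0<..t} s *\<^sub>R
             (indicator {e. 1 < norm (fst e)} e *\<^sub>R thinned_jump \<sigma> (left_lim X s \<omega>) e)) \<and>
           set_integrable lborel {0..t} (\<lambda>s. b (X s \<omega>)) \<and>
           X t \<omega> = x + Z t \<omega> +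
             (\<integral>(e, s). indicator {0<..t} s *\<^sub>R
               (indicator {e. 1 < norm (fst e)} e *\<^sub>R thinned_jump \<sigma> (left_lim X s \<omega>) e) \<partial>N \<omega>) +
             (LINT s:{0..t}|lborel. b (X s \<omega>))))"

end

(* The small jumps |z| <= 1/2^k are removed from the driving noise while the state inside the
   thinning indicator is kept: V k is x plus the jumps of X larger than 1/2^k plus the drift of X.  By
   the symmetry of sigma and kappa these jumps need no compensation, so V k is a finite sum of jumps
   plus an absolutely continuous function, and the change of variables formula for it is a pathwise
   statement (the atoms of N in a region of finite intensity are finitely many, with distinct times).
   Compensating the sum of the increments of f turns the dt-integral of the jump part into the
   truncated operator applied to f along V k.  The isometry for compensated integrals of predictable
   functions gives V k -> X in L2 at a geometric rate, hence almost surely, and identifies the limit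
   of the compensated integrals. *)

theory Submission
  imports Defs
begin

text \<open>Two constraints shape the proof. The function \<open>f\<close> enters only through a
  bounded gradient that is Hoelder of some exponent \<theta> > \<alpha> - 1, so no second-order
  expansion is at hand: the change of variables uses first derivatives along a path with finitely
  many jumps, and the operators converge because 1 + \<theta> > \<alpha> makes the Taylor remainder
  integrable against the jump measure. The random measure is controlled only up to null sets and
  through its counts: kernels are restricted to windows of finite intensity and set to zero where
  their mass is infinite, and left limits are taken along dyadic times with a default value, so that
  measurability and predictability hold everywhere while pathwise arguments stay on one almost sure
  event. Since \<open>X\<close> stays inside the thinning and the drift, \<open>X\<close> minus
  \<open>V k\<close> is exactly the compensated integral of the removed jumps, and convergence is a
  moment estimate instead of a stability estimate for the equation. Its rate comes from |z|^2 =
  |z|^\<delta> |z|^(2 - \<delta>) with \<delta> = 1 - \<alpha>/2: the first factor is geometric in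
  \<open>k\<close>, the second stays integrable because 2 - \<delta> > \<alpha>.\<close>

section \<open>Monotone classes and finite kernels\<close>

text \<open>Functional monotone class theorem: Dynkin's theorem settles indicators, then come simple
  functions and bounded limits. The closure rules hand over measurability and uniform bounds, so
  that for statements about expectations they become linearity and dominated convergence;
  \<open>cong\<close> lets \<open>P\<close> ignore values off \<open>\<Omega>\<close>.\<close>

lemma bounded_monotone_class:
  fixes P :: "('a \<Rightarrow> real) \<Rightarrow> bool"
  assumes G: "G \<subseteq> Pow \<Omega>" "Int_stable G"
    and basic: "\<And>A. A \<in> G \<Longrightarrow> P (indicator A)"
    and one: "P (\<lambda>_. 1)"
    and cong: "\<And>u v. P u \<Longrightarrow> (\<And>x. x \<in> \<Omega> \<Longrightarrow> u x = v x) \<Longrightarrow> P v"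
    and lin: "\<And>u v c B B'. u \<in> borel_measurable (sigma \<Omega> G) \<Longrightarrow> v \<in> borel_measurable (sigma \<Omega> G) \<Longrightarrow>
        (\<And>x. x \<in> \<Omega> \<Longrightarrow> \<bar>u x\<bar> \<le> B) \<Longrightarrow> (\<And>x. x \<in> \<Omega> \<Longrightarrow> \<bar>v x\<bar> \<le> B') \<Longrightarrow> P u \<Longrightarrow> P v \<Longrightarrow>
        P (\<lambda>x. u x + c * v x)"
    and lim: "\<And>u v B. (\<And>n. u n \<in> borel_measurable (sigma \<Omega> G)) \<Longrightarrow> (\<And>n::nat. P (u n)) \<Longrightarrow>
        (\<And>n x. x \<in> \<Omega> \<Longrightarrow> \<bar>u n x\<bar> \<le> B) \<Longrightarrow> (\<And>x. x \<in> \<Omega> \<Longrightarrow> (\<lambda>n. u n x) \<longlonglongrightarrow> v x) \<Longrightarrow>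
        v \<in> borel_measurable (sigma \<Omega> G) \<Longrightarrow> P v"
    and h: "h \<in> borel_measurable (sigma \<Omega> G)" "\<And>x. x \<in> \<Omega> \<Longrightarrow> \<bar>h x\<bar> \<le> K"
  shows "P h"
proof -
  have sets_eq: "sets (sigma \<Omega> G) = sigma_sets \<Omega> G" and space_eq: "space (sigma \<Omega> G) = \<Omega>"
    using G by (auto simp: sets_measure_of space_measure_of_conv)
  have zero: "P (\<lambda>_. 0)"
    using lin[of "\<lambda>_. 1" "\<lambda>_. 1" 1 1 "-1"] one by simp
  have sum: "P (\<lambda>x. \<Sum>i\<in>I. c i * u i x)"
    if "finite I" "\<And>i. i \<in> I \<Longrightarrow> P (u i)" "\<And>i. i \<in> I \<Longrightarrow> u i \<in> borel_measurable (sigma \<Omega> G)"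
      "\<And>i x. i \<in> I \<Longrightarrow> x \<in> \<Omega> \<Longrightarrow> \<bar>u i x\<bar> \<le> 1" for I :: "'i set" and c :: "'i \<Rightarrow> real" and u
    using that
  proof (induction I rule: finite_induct)
    case empty then show ?case using zero by simp
  next
    case (insert j J)
    have "P (\<lambda>x. (\<Sum>i\<in>J. c i * u i x) + c j * u j x)"
    proof (rule lin[where B = "\<Sum>i\<in>J. \<bar>c i\<bar>" and B' = 1])
      show "\<bar>\<Sum>i\<in>J. c i * u i x\<bar> \<le> (\<Sum>i\<in>J. \<bar>c i\<bar>)" if "x \<in> \<Omega>" for x
      proof (rule order_trans[OF sum_abs], rule sum_mono)
        fix i assume i: "i \<in> J"
        have "\<bar>u i x\<bar> \<le> 1" using insert.prems(3)[of i x] i that by blast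
        then show "\<bar>c i * u i x\<bar> \<le> \<bar>c i\<bar>"
          by (simp add: abs_mult mult_left_le)
      qed
    qed (use insert in \<open>auto intro!: borel_measurable_sum borel_measurable_times\<close>)
    then show ?case using insert.hyps by (simp add: add.commute)
  qed
  have ind: "P (indicator A)" if A: "A \<in> sigma_sets \<Omega> G" for A
    using G(2,1) A
  proof (induction rule: sigma_sets_induct_disjoint)
    case (basic A) then show ?case by (rule assms(3))
  next
    case empty then show ?case using zero by (simp add: indicator_def)
  next
    case (compl A)
    have m: "indicat_real A \<in> borel_measurable (sigma \<Omega> G)"
      using compl sets_eq by (intro borel_measurable_indicator) auto
    have "P (\<lambda>x. 1 + (-1) * indicator A x)"
      by (rule lin[where B = 1 and B' = 1]) (use m one compl in \<open>auto split: split_indicator\<close>)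
    then show ?case by (rule cong) (auto simp: indicator_def)
  next
    case (union A)
    have m: "indicat_real (A i) \<in> borel_measurable (sigma \<Omega> G)" for i
      using union sets_eq by (intro borel_measurable_indicator) auto
    \<comment> \<open>Disjointness turns the partial sums into indicators of finite unions, so they
      stay below 1 for every \<open>n\<close>.\<close>
    have eq: "(\<Sum>i<n. 1 * indicator (A i) x) = (indicator (\<Union>i<n. A i) x :: real)" for n x
      using union(1) by (subst indicator_UN_disjoint) (auto simp: disjoint_family_on_def)
    show ?case
    proof (rule lim[where u = "\<lambda>n x. \<Sum>i<n. 1 * indicator (A i) x" and B = 1])
      show "P (\<lambda>x. \<Sum>i<n. 1 * indicator (A i) x)" for n
        by (rule sum) (use m union in \<open>auto simp: indicator_le_1\<close>)
      show "(\<lambda>n. \<Sum>i<n. 1 * indicator (A i) x) \<longlonglongrightarrow> (indicator (\<Union>i. A i) x :: real)" for x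
        unfolding eq by (rule LIMSEQ_indicator_UN)
      show "\<bar>\<Sum>i<n. 1 * indicator (A i) x\<bar> \<le> (1::real)" for n x
        unfolding eq by (simp add: indicator_def)
      show "indicator (\<Union>i. A i) \<in> borel_measurable (sigma \<Omega> G)"
        using union sets_eq by (intro borel_measurable_indicator) (auto intro: sigma_sets.Union)
    qed (use m in auto)
  qed
  \<comment> \<open>The simple functions are dominated by 2|h|, which supplies the bound
    \<open>2 * K\<close> in the last step.\<close>
  obtain S where S: "\<And>i. simple_function (sigma \<Omega> G) (S i)"
    "\<And>x. x \<in> \<Omega> \<Longrightarrow> (\<lambda>i. S i x) \<longlonglongrightarrow> h x" "\<And>i x. x \<in> \<Omega> \<Longrightarrow> norm (S i x) \<le> 2 * norm (h x)"
    using borel_measurable_implies_sequence_metric[OF h(1), of 0] unfolding space_eq norm_conv_dist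
    by (metis)
  have Sm: "S i \<in> borel_measurable (sigma \<Omega> G)" for i
    using S(1) by (rule borel_measurable_simple_function)
  have PS: "P (S i)" for i
  proof -
    have fin: "finite (S i ` \<Omega>)" using S(1)[of i] space_eq by (auto simp: simple_function_def)
    have sub: "S i -` {y} \<inter> \<Omega> \<in> sigma_sets \<Omega> G" for y
      using measurable_sets[OF Sm, of "{y}" i] sets_eq space_eq by auto
    have "P (\<lambda>x. \<Sum>y\<in>S i ` \<Omega>. y * indicator (S i -` {y} \<inter> \<Omega>) x)"
      using fin
      by (rule sum) (use ind[OF sub] sub sets_eq in
          \<open>auto simp: indicator_le_1 intro!: borel_measurable_indicator\<close>)
    then show ?thesis
    proof (rule cong)
      fix x assume x: "x \<in> \<Omega>"
      have "(\<Sum>y\<in>S i ` \<Omega>. y * indicator (S i -` {y} \<inter> \<Omega>) x) = (\<Sum>y\<in>S i ` \<Omega>. if y = S i x then y else 0)"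
        using x by (intro sum.cong) (auto simp: indicator_def)
      also have "\<dots> = S i x" using fin x by simp
      finally show "(\<Sum>y\<in>S i ` \<Omega>. y * indicator (S i -` {y} \<inter> \<Omega>) x) = S i x" .
    qed
  qed
  show "P h"
  proof (rule lim[where u = S and B = "2 * K"])
    show "\<bar>S n x\<bar> \<le> 2 * K" if "x \<in> \<Omega>" for n x
      using S(3)[OF that, of n] h(2)[OF that] by simp
  qed (use S PS Sm h in auto)
qed

text \<open>The null measure replaces the restriction wherever \<open>E\<close> has infinite mass.
  The kernel is then finite on \<open>E\<close> for every \<omega> and not just for almost every
  one, so its integrals are measurable without completing a sigma-algebra.\<close>

definition fin_restr :: "('w \<Rightarrow> 'p measure) \<Rightarrow> 'p set \<Rightarrow> 'w \<Rightarrow> 'p measure" where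
  "fin_restr N E \<omega> =
     (if emeasure (N \<omega>) E < \<infinity> then density (N \<omega>) (indicator E) else null_measure (N \<omega>))"

lemma sets_fin_restr [simp]: "sets (fin_restr N E \<omega>) = sets (N \<omega>)"
  and space_fin_restr [simp]: "space (fin_restr N E \<omega>) = space (N \<omega>)"
  by (auto simp: fin_restr_def)

lemma emeasure_fin_restr:
  assumes "E \<in> sets (N \<omega>)" "A \<in> sets (N \<omega>)"
  shows "emeasure (fin_restr N E \<omega>) A =
    (if emeasure (N \<omega>) E < \<infinity> then emeasure (N \<omega>) (A \<inter> E) else 0)"
proof -
  have "emeasure (density (N \<omega>) (indicator E)) A = (\<integral>\<^sup>+x. indicator (A \<inter> E) x \<partial>N \<omega>)"
    using assms by (subst emeasure_density)
      (auto simp del: nn_integral_indicator intro!: nn_integral_cong split: split_indicator)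
  then show ?thesis using assms by (simp add: fin_restr_def)
qed

text \<open>Measurability is demanded only for subsets of \<open>E\<close>, so that \<open>G\<close>
  can be the past \<open>F t\<close> when \<open>E\<close> lies before time \<open>t\<close>;
  integrals over \<open>E\<close> then come out adapted.\<close>

locale finite_kernel =
  fixes G :: "'w measure" and \<mu> :: "'p measure" and N :: "'w \<Rightarrow> 'p measure" and E :: "'p set"
  assumes ne: "space \<mu> \<noteq> {}"
    and sets_N: "\<And>\<omega>. \<omega> \<in> space G \<Longrightarrow> sets (N \<omega>) = sets \<mu>"
    and E: "E \<in> sets \<mu>"
    and meas: "\<And>A. A \<in> sets \<mu> \<Longrightarrow> A \<subseteq> E \<Longrightarrow> (\<lambda>\<omega>. emeasure (N \<omega>) A) \<in> borel_measurable G"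
begin

text \<open>Dividing by one plus the mass gives a subprobability kernel and never divides by zero;
  multiplying by \<open>weight\<close> afterwards undoes it. In this way the measurability of
  integrals is carried over from subprobability kernels.\<close>

definition weight :: "'w \<Rightarrow> real" where "weight \<omega> = 1 + enn2real (emeasure (N \<omega>) E)"

definition normalized :: "'w \<Rightarrow> 'p measure" where
  "normalized \<omega> = density (fin_restr N E \<omega>) (\<lambda>_. ennreal (1 / weight \<omega>))"

lemma weight_pos: "0 < weight \<omega>" by (simp add: weight_def add_pos_nonneg)

lemma weight_measurable [measurable]: "weight \<in> borel_measurable G"
  unfolding weight_def using meas[OF E] by measurable

lemma emeasure_normalized:
  assumes "\<omega> \<in> space G" "A \<in> sets \<mu>"
  shows "emeasure (normalized \<omega>) A =
    ennreal (1 / weight \<omega>) * (if emeasure (N \<omega>) E < \<infinity> then emeasure (N \<omega>) (A \<inter> E) else 0)"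
proof -
  have "A \<in> sets (fin_restr N E \<omega>)" using assms sets_N by auto
  then have "emeasure (normalized \<omega>) A = ennreal (1 / weight \<omega>) * emeasure (fin_restr N E \<omega>) A"
    unfolding normalized_def by (subst emeasure_density_const) auto
  then show ?thesis using assms sets_N E by (simp add: emeasure_fin_restr)
qed

lemma normalized_kernel [measurable]: "normalized \<in> measurable G (subprob_algebra \<mu>)"
proof (rule measurable_subprob_algebra)
  fix \<omega> assume \<omega>: "\<omega> \<in> space G"
  show sets: "sets (normalized \<omega>) = sets \<mu>" using sets_N[OF \<omega>] by (simp add: normalized_def)
  then have space: "space (normalized \<omega>) = space \<mu>" by (rule sets_eq_imp_space_eq)
  show "subprob_space (normalized \<omega>)"
  proof
    have "space \<mu> \<inter> E = E" using E sets.sets_into_space by blast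
    then have "emeasure (normalized \<omega>) (space \<mu>) =
        ennreal (1 / weight \<omega>) * (if emeasure (N \<omega>) E < \<infinity> then emeasure (N \<omega>) E else 0)"
      using emeasure_normalized[OF \<omega>, of "space \<mu>"] by simp
    also have "\<dots> \<le> 1"
    proof (cases "emeasure (N \<omega>) E")
      case (real r)
      then show ?thesis by (simp add: weight_def ennreal_mult[symmetric] ennreal_le_1 divide_simps)
    qed (simp add: top_unique)
    finally show "emeasure (normalized \<omega>) (space (normalized \<omega>)) \<le> 1" using space by simp
    show "space (normalized \<omega>) \<noteq> {}" using space ne by simp
  qed
next
  fix A assume A: "A \<in> sets \<mu>"
  have [measurable]: "(\<lambda>\<omega>. emeasure (N \<omega>) (A \<inter> E)) \<in> borel_measurable G"
    "(\<lambda>\<omega>. emeasure (N \<omega>) E) \<in> borel_measurable G"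
    using A E by (auto intro!: meas)
  have "(\<lambda>\<omega>. ennreal (1 / weight \<omega>) * (if emeasure (N \<omega>) E < \<infinity> then emeasure (N \<omega>) (A \<inter> E) else 0)) \<in> borel_measurable G"
    by measurable
  then show "(\<lambda>\<omega>. emeasure (normalized \<omega>) A) \<in> borel_measurable G"
    by (rule measurable_cong[THEN iffD2, rotated]) (rule emeasure_normalized[OF _ A])
qed

lemma section_measurable:
  assumes f: "(\<lambda>(\<omega>, p). f \<omega> p) \<in> measurable (G \<Otimes>\<^sub>M \<mu>) L" and \<omega>: "\<omega> \<in> space G"
  shows "f \<omega> \<in> measurable (fin_restr N E \<omega>) L"
proof -
  have "f \<omega> \<in> measurable \<mu> L" using measurable_Pair2[OF f \<omega>] by simp
  then show ?thesis using sets_N[OF \<omega>] by (simp cong: measurable_cong_sets)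
qed

lemma nn_integral_fin_restr_measurable:
  assumes f: "(\<lambda>(\<omega>, p). f \<omega> p) \<in> borel_measurable (G \<Otimes>\<^sub>M \<mu>)"
  shows "(\<lambda>\<omega>. \<integral>\<^sup>+p. f \<omega> p \<partial>fin_restr N E \<omega>) \<in> borel_measurable G"
proof -
  have [measurable]: "(\<lambda>\<omega>. integral\<^sup>N (normalized \<omega>) (f \<omega>)) \<in> borel_measurable G"
    by (rule nn_integral_measurable_subprob_algebra2[OF f normalized_kernel])
  have "(\<lambda>\<omega>. ennreal (weight \<omega>) * integral\<^sup>N (normalized \<omega>) (f \<omega>)) \<in> borel_measurable G"
    by measurable
  moreover have "(\<integral>\<^sup>+p. f \<omega> p \<partial>fin_restr N E \<omega>) = ennreal (weight \<omega>) * integral\<^sup>N (normalized \<omega>) (f \<omega>)"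
    if "\<omega> \<in> space G" for \<omega>
    using section_measurable[OF f that] weight_pos[of \<omega>]
    by (simp add: normalized_def nn_integral_density nn_integral_cmult mult.assoc[symmetric]
        ennreal_mult[symmetric])
  ultimately show ?thesis by (simp cong: measurable_cong)
qed

lemma integral_fin_restr_measurable:
  fixes f :: "'w \<Rightarrow> 'p \<Rightarrow> 'b::{banach, second_countable_topology}"
  assumes f: "(\<lambda>(\<omega>, p). f \<omega> p) \<in> borel_measurable (G \<Otimes>\<^sub>M \<mu>)"
  shows "(\<lambda>\<omega>. \<integral>p. f \<omega> p \<partial>fin_restr N E \<omega>) \<in> borel_measurable G"
proof -
  note [measurable] = measurable_distr2 integral_measurable_subprob_algebra
  note [measurable] = f
  have fs: "f \<omega> \<in> borel_measurable (normalized \<omega>)" if "\<omega> \<in> space G" for \<omega>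
    using section_measurable[OF f that] by (simp add: normalized_def)
  have pr: "Pair \<omega> \<in> measurable (normalized \<omega>) (G \<Otimes>\<^sub>M \<mu>)" if "\<omega> \<in> space G" for \<omega>
    using that sets_N[OF that] by (simp add: normalized_def cong: measurable_cong_sets)
  \<comment> \<open>The integrand depends on \<omega>. Pushing the measure forward under
    \<open>Pair \<omega>\<close> makes it one fixed function on the product space, integrated
    against a measurable kernel.\<close>
  have "(\<lambda>\<omega>. integral\<^sup>L (distr (normalized \<omega>) (G \<Otimes>\<^sub>M \<mu>) (\<lambda>p. (\<omega>, p))) (\<lambda>(\<omega>, p). f \<omega> p)) \<in> borel_measurable G"
    by measurable
  then have [measurable]: "(\<lambda>\<omega>. integral\<^sup>L (normalized \<omega>) (f \<omega>)) \<in> borel_measurable G"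
    by (rule measurable_cong[THEN iffD1, rotated]) (simp add: integral_distr[OF pr f])
  have "(\<lambda>\<omega>. weight \<omega> *\<^sub>R integral\<^sup>L (normalized \<omega>) (f \<omega>)) \<in> borel_measurable G"
    by measurable
  moreover have "(\<integral>p. f \<omega> p \<partial>fin_restr N E \<omega>) = weight \<omega> *\<^sub>R integral\<^sup>L (normalized \<omega>) (f \<omega>)"
    if "\<omega> \<in> space G" for \<omega>
  proof -
    have "integral\<^sup>L (normalized \<omega>) (f \<omega>) = (\<integral>p. (1 / weight \<omega>) *\<^sub>R f \<omega> p \<partial>fin_restr N E \<omega>)"
      unfolding normalized_def using section_measurable[OF f that] weight_pos[of \<omega>]
      by (intro integral_density) auto
    then show ?thesis using weight_pos[of \<omega>] by simp
  qed
  ultimately show ?thesis by (simp cong: measurable_cong)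
qed

end

section \<open>Second moments of a Poisson random measure\<close>

lemma integrable_mult_of_squares:
  fixes f g :: "'a \<Rightarrow> real"
  assumes [measurable]: "f \<in> borel_measurable M" "g \<in> borel_measurable M"
    and sq: "integrable M (\<lambda>x. (f x)\<^sup>2)" "integrable M (\<lambda>x. (g x)\<^sup>2)"
  shows "integrable M (\<lambda>x. f x * g x)"
proof (rule Bochner_Integration.integrable_bound)
  show "integrable M (\<lambda>x. (f x)\<^sup>2 + (g x)\<^sup>2)" using sq by simp
  have "\<bar>a * b\<bar> \<le> a\<^sup>2 + b\<^sup>2" for a b :: real
    using sum_squares_bound[of "\<bar>a\<bar>" "\<bar>b\<bar>"] 
      mult_nonneg_nonneg[OF abs_ge_zero[of a] abs_ge_zero[of b]]
    unfolding abs_mult power2_abs by linarith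
  from order_trans[OF this abs_ge_self]
  show "AE x in M. norm (f x * g x) \<le> norm ((f x)\<^sup>2 + (g x)\<^sup>2)"
    unfolding real_norm_def by (rule AE_I2)
qed measurable

lemma sets_half_line [simp, measurable_cong]: "sets half_line = sets borel"
  and space_half_line [simp]: "space half_line = UNIV"
  by (auto simp: half_line_def)

lemma sigma_finite_half_line: "sigma_finite_measure half_line"
  unfolding half_line_def
  by (subst sigma_finite_measure.sigma_finite_iff_density_finite[OF lborel.sigma_finite_measure_axioms]) (auto split: split_indicator)

lemma emeasure_half_line_Ioc: "0 \<le> s \<Longrightarrow> s \<le> t \<Longrightarrow> emeasure half_line {s<..t} = ennreal (t - s)"
proof -
  assume *: "0 \<le> s" "s \<le> t"
  have "emeasure half_line {s<..t} = (\<integral>\<^sup>+x. indicator {s<..t} x \<partial>lborel)"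
    unfolding half_line_def using *
    by (subst emeasure_density) (auto intro!: nn_integral_cong simp del: nn_integral_indicator split: split_indicator)
  then show ?thesis using * by simp
qed

lemma sets_intensity: "sets (intensity m) = sets (m \<Otimes>\<^sub>M borel)"
  unfolding intensity_def by (rule sets_pair_measure_cong) auto

lemma space_intensity [simp]: "space (intensity m) = space m \<times> UNIV"
  by (simp add: intensity_def space_pair_measure)

section \<open>Counts on sets of finite intensity and their second moments\<close>

locale poisson_basis = prob_space M for M :: "'w measure" +
  fixes F :: "real \<Rightarrow> 'w measure" and m :: "'e measure" and N :: "'w \<Rightarrow> ('e \<times> real) measure"
  assumes filtration_F: "filtration (space M) F"
    and sub_F: "\<And>t. sets (F t) \<subseteq> sets M"
    and sigma_finite_m: "sigma_finite_measure m"
    and space_m: "space m \<noteq> {}"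
    and prm: "poisson_random_measure M (intensity m) N"
    and adapted: "adapted_random_measure M F m N"
begin

abbreviation \<mu> :: "('e \<times> real) measure" where "\<mu> \<equiv> intensity m"

lemma space_F [simp]: "space (F t) = space M"
  using filtration_F by (simp add: filtration.space_F)

lemma sets_F_mono: "s \<le> t \<Longrightarrow> sets (F s) \<subseteq> sets (F t)"
  using filtration_F by (simp add: filtration.sets_F_mono)

lemma measurable_F_M: "f \<in> measurable (F s) L \<Longrightarrow> f \<in> measurable M L"
  using measurable_mono[of L L "F s" M] sub_F[of s] by auto

lemma space_\<mu>: "space \<mu> \<noteq> {}" using space_m by simp

lemma sets_N: "\<omega> \<in> space M \<Longrightarrow> sets (N \<omega>) = sets \<mu>"
  using prm by (auto simp: poisson_random_measure_def)

lemma N_measurable: "A \<in> sets \<mu> \<Longrightarrow> (\<lambda>\<omega>. emeasure (N \<omega>) A) \<in> borel_measurable M"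
  using prm by (auto simp: poisson_random_measure_def)

lemma N_poisson: "A \<in> sets \<mu> \<Longrightarrow> emeasure \<mu> A < \<infinity> \<Longrightarrow>
    prob {\<omega>\<in>space M. emeasure (N \<omega>) A = of_nat k} = exp (- measure \<mu> A) * measure \<mu> A ^ k / fact k"
  using prm by (auto simp: poisson_random_measure_def)

lemma N_indep: "range A \<subseteq> sets \<mu> \<Longrightarrow> disjoint_family (A :: nat \<Rightarrow> _) \<Longrightarrow>
    indep_vars (\<lambda>_. borel) (\<lambda>i \<omega>. emeasure (N \<omega>) (A i)) UNIV"
  using prm by (auto simp: poisson_random_measure_def)

text \<open>The Poisson weights sum to 1 by the exponential series, so the events of a finite
  integer count exhaust the space up to a null set.\<close>

lemma AE_N_nat:
  assumes A: "A \<in> sets \<mu>" "emeasure \<mu> A < \<infinity>"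
  shows "AE \<omega> in M. \<exists>k::nat. emeasure (N \<omega>) A = of_nat k"
proof -
  note [measurable] = N_measurable[OF A(1)]
  define S where "S k = {\<omega>\<in>space M. emeasure (N \<omega>) A = of_nat k}" for k :: nat
  have S: "range S \<subseteq> events" unfolding S_def by auto
  have "disjoint_family S" unfolding S_def disjoint_family_on_def by auto
  from finite_measure_UNION[OF S this]
  have "(\<lambda>k. exp (- measure \<mu> A) * measure \<mu> A ^ k / fact k) sums prob (\<Union>k. S k)"
    unfolding S_def N_poisson[OF A] .
  moreover have "(\<lambda>k. exp (- measure \<mu> A) * (measure \<mu> A ^ k /\<^sub>R fact k)) sums (exp (- measure \<mu> A) * exp (measure \<mu> A))"
    by (intro sums_mult exp_converges)
  ultimately have "prob (\<Union>k. S k) = exp (- measure \<mu> A) * exp (measure \<mu> A)"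
    by (intro sums_unique2) (auto simp: field_simps)
  then have "prob (\<Union>k. S k) = 1" by (simp add: exp_minus)
  then have "AE \<omega> in M. \<omega> \<in> (\<Union>k. S k)" using S by (subst (asm) prob_eq_1) auto
  then show ?thesis by eventually_elim (auto simp: S_def)
qed

lemma nn_integral_poisson:
  assumes A: "A \<in> sets \<mu>" "emeasure \<mu> A < \<infinity>"
  shows "(\<integral>\<^sup>+\<omega>. \<phi> (emeasure (N \<omega>) A) \<partial>M) =
    (\<Sum>k. \<phi> (of_nat k) * ennreal (exp (- measure \<mu> A) * measure \<mu> A ^ k / fact k))"
proof -
  note [measurable] = N_measurable[OF A(1)]
  define S where "S k = {\<omega>\<in>space M. emeasure (N \<omega>) A = of_nat k}" for k :: nat
  have S[measurable]: "S k \<in> sets M" for k unfolding S_def by auto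
  have "(\<integral>\<^sup>+\<omega>. \<phi> (emeasure (N \<omega>) A) \<partial>M) = (\<integral>\<^sup>+\<omega>. (\<Sum>k. \<phi> (of_nat k) * indicator (S k) \<omega>) \<partial>M)"
  proof (rule nn_integral_cong_AE)
    show "AE \<omega> in M. \<phi> (emeasure (N \<omega>) A) = (\<Sum>k. \<phi> (of_nat k) * indicator (S k) \<omega>)"
      using AE_N_nat[OF A] AE_space
    proof eventually_elim
      case (elim \<omega>)
      then obtain k where k: "emeasure (N \<omega>) A = of_nat k" by auto
      have "(\<Sum>k. \<phi> (of_nat k) * indicator (S k) \<omega>) = (\<Sum>j\<in>{k}. \<phi> (of_nat j) * indicator (S j) \<omega>)"
        by (rule suminf_finite) (use k in \<open>auto simp: S_def split: split_indicator\<close>)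
      then show ?case using elim k by (simp add: S_def)
    qed
  qed
  also have "\<dots> = (\<Sum>k. \<integral>\<^sup>+\<omega>. \<phi> (of_nat k) * indicator (S k) \<omega> \<partial>M)"
    by (rule nn_integral_suminf) auto
  also have "\<dots> = (\<Sum>k. \<phi> (of_nat k) * ennreal (exp (- measure \<mu> A) * measure \<mu> A ^ k / fact k))"
    by (subst nn_integral_cmult_indicator) (auto simp: emeasure_eq_measure S_def N_poisson[OF A])
  finally show ?thesis .
qed

text \<open>Factorial moments: multiplying the weight by k or by k(k - 1) cancels leading factors of
  the factorial, so each series is the total mass shifted by one or two places and scaled by l or
  l^2; the dropped initial terms vanish.\<close>

lemma poisson_weights_sums:
  fixes l :: real
  shows "(\<lambda>k. real k * (exp (- l) * l ^ k / fact k)) sums l"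
    and "(\<lambda>k. real k * (real k - 1) * (exp (- l) * l ^ k / fact k)) sums (l\<^sup>2)"
proof -
  have base: "(\<lambda>k. exp (- l) * l ^ k / fact k) sums 1"
  proof -
    have "(\<lambda>k. exp (- l) * (l ^ k /\<^sub>R fact k)) sums (exp (- l) * exp l)"
      by (intro sums_mult exp_converges)
    then show ?thesis by (simp add: exp_minus field_simps)
  qed
  have "(\<lambda>k. l * (exp (- l) * l ^ k / fact k)) sums (l * 1)" by (intro sums_mult base)
  also have "(\<lambda>k. l * (exp (- l) * l ^ k / fact k)) = (\<lambda>k. real (Suc k) * (exp (- l) * l ^ Suc k / fact (Suc k)))"
    by (auto simp: field_simps simp del: of_nat_Suc)
  finally show "(\<lambda>k. real k * (exp (- l) * l ^ k / fact k)) sums l"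
    by (subst (asm) sums_Suc_iff) simp
  have "(\<lambda>k. l\<^sup>2 * (exp (- l) * l ^ k / fact k)) sums (l\<^sup>2 * 1)" by (intro sums_mult base)
  also have "(\<lambda>k. l\<^sup>2 * (exp (- l) * l ^ k / fact k)) =
     (\<lambda>k. real (Suc (Suc k)) * (real (Suc (Suc k)) - 1) * (exp (- l) * l ^ Suc (Suc k) / fact (Suc (Suc k))))"
  proof
    fix k
    have eq: "real (Suc (Suc k)) - 1 = real (Suc k)" by simp
    have *: "l\<^sup>2 * (e * l ^ k / fact k) = a * b * (e * l ^ Suc (Suc k) / (a * (b * fact k)))"
      if "0 < a" "0 < b" for a b e :: real
      using that by (simp add: power2_eq_square)
    show "l\<^sup>2 * (exp (- l) * l ^ k / fact k) =
      real (Suc (Suc k)) * (real (Suc (Suc k)) - 1) * (exp (- l) * l ^ Suc (Suc k) / fact (Suc (Suc k)))"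
      unfolding fact_Suc eq by (rule *) simp_all
  qed
  finally show "(\<lambda>k. real k * (real k - 1) * (exp (- l) * l ^ k / fact k)) sums (l\<^sup>2)"
    by (subst (asm) sums_Suc_iff, subst (asm) sums_Suc_iff) simp
qed

lemma AE_N_finite:
  assumes A: "A \<in> sets \<mu>" "emeasure \<mu> A < \<infinity>"
  shows "AE \<omega> in M. emeasure (N \<omega>) A < \<infinity>"
  using AE_N_nat[OF A] by eventually_elim (auto simp: of_nat_less_top)

lemma count_measurable: "A \<in> sets \<mu> \<Longrightarrow> (\<lambda>\<omega>. measure (N \<omega>) A) \<in> borel_measurable M"
  unfolding measure_def by (intro borel_measurable_enn2real N_measurable)

lemma has_integral_count:
  assumes A: "A \<in> sets \<mu>" "emeasure \<mu> A < \<infinity>"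
  shows "has_bochner_integral M (\<lambda>\<omega>. measure (N \<omega>) A) (measure \<mu> A)" (is ?th1)
    and "has_bochner_integral M (\<lambda>\<omega>. measure (N \<omega>) A * (measure (N \<omega>) A - 1)) ((measure \<mu> A)\<^sup>2)" (is ?th2)
proof -
  note [measurable] = count_measurable[OF A(1)]
  define l where "l = measure \<mu> A"
  have l: "0 \<le> l" unfolding l_def by (rule measure_nonneg)
  have *: "(\<integral>\<^sup>+\<omega>. ennreal (\<phi> (measure (N \<omega>) A)) \<partial>M) = ennreal v"
    if "(\<lambda>k. \<phi> (real k) * (exp (- l) * l ^ k / fact k)) sums v" "\<And>k::nat. 0 \<le> \<phi> (real k)" for \<phi> v
  proof -
    have "(\<integral>\<^sup>+\<omega>. ennreal (\<phi> (measure (N \<omega>) A)) \<partial>M) =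
      (\<Sum>k. ennreal (\<phi> (real k)) * ennreal (exp (- l) * l ^ k / fact k))"
      using nn_integral_poisson[OF A, of "\<lambda>a. ennreal (\<phi> (enn2real a))"]
      by (simp add: measure_def l_def)
    also have "\<dots> = (\<Sum>k. ennreal (\<phi> (real k) * (exp (- l) * l ^ k / fact k)))"
      using that(2) l by (simp add: ennreal_mult[symmetric])
    also have "\<dots> = ennreal v"
      using that l by (intro suminf_ennreal_eq) auto
    finally show ?thesis .
  qed
  \<comment> \<open>True for integers only: between 0 and 1 the expression is negative. It reaches
    the actual count through \<open>AE_N_nat\<close>, hence almost everywhere.\<close>
  have kk: "0 \<le> real k * (real k - 1)" for k :: nat by (cases k) auto
  show ?th1
    by (rule has_bochner_integral_nn_integral)
      (use *[OF poisson_weights_sums(1)] l in \<open>auto simp: l_def\<close>)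
  have "AE \<omega> in M. 0 \<le> measure (N \<omega>) A * (measure (N \<omega>) A - 1)"
    using AE_N_nat[OF A] by eventually_elim (auto simp: measure_def kk)
  then show ?th2
    by (intro has_bochner_integral_nn_integral)
      (use *[OF poisson_weights_sums(2) kk] l in \<open>auto simp: l_def\<close>)
qed

text \<open>\<open>measure\<close> reads an infinite mass as 0. For a set of finite intensity this
  matters only on a null set, so \<open>centered A\<close> is a real-valued version of the
  compensated count.\<close>

definition centered :: "('e \<times> real) set \<Rightarrow> 'w \<Rightarrow> real" where
  "centered A \<omega> = measure (N \<omega>) A - measure \<mu> A"

lemma centered_measurable: "A \<in> sets \<mu> \<Longrightarrow> centered A \<in> borel_measurable M"
  unfolding centered_def[abs_def] by (intro borel_measurable_diff borel_measurable_const count_measurable)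

lemma centered_moments:
  assumes A: "A \<in> sets \<mu>" "emeasure \<mu> A < \<infinity>"
  shows "integrable M (centered A)" "expectation (centered A) = 0"
    "integrable M (\<lambda>\<omega>. (centered A \<omega>)\<^sup>2)" "expectation (\<lambda>\<omega>. (centered A \<omega>)\<^sup>2) = measure \<mu> A"
proof -
  let ?n = "\<lambda>\<omega>. measure (N \<omega>) A" let ?l = "measure \<mu> A"
  note 1 = has_integral_count(1)[OF A] and 2 = has_integral_count(2)[OF A]
  have 3: "has_bochner_integral M (\<lambda>\<omega>. ?n \<omega> - ?l) (?l - ?l)"
    using 1 by (intro has_bochner_integral_diff) (auto simp: has_bochner_integral_iff prob_space)
  then show "integrable M (centered A)" "expectation (centered A) = 0"
    by (simp_all add: centered_def[abs_def] has_bochner_integral_iff)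
  \<comment> \<open>(n - l)^2 expressed through the factorial moments n(n - 1) and n, whose means
    are l^2 and l.\<close>
  have "has_bochner_integral M (\<lambda>\<omega>. ?n \<omega> * (?n \<omega> - 1) + (1 - 2 * ?l) * ?n \<omega> + ?l\<^sup>2) (?l\<^sup>2 + (1 - 2 * ?l) * ?l + ?l\<^sup>2)"
    using 1 2 by (intro has_bochner_integral_add has_bochner_integral_mult_right)
      (auto simp: has_bochner_integral_iff prob_space)
  also have "(\<lambda>\<omega>. ?n \<omega> * (?n \<omega> - 1) + (1 - 2 * ?l) * ?n \<omega> + ?l\<^sup>2) = (\<lambda>\<omega>. (centered A \<omega>)\<^sup>2)"
    by (auto simp: centered_def power2_eq_square algebra_simps)
  also have "?l\<^sup>2 + (1 - 2 * ?l) * ?l + ?l\<^sup>2 = ?l" by (simp add: power2_eq_square algebra_simps)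
  finally show "integrable M (\<lambda>\<omega>. (centered A \<omega>)\<^sup>2)" "expectation (\<lambda>\<omega>. (centered A \<omega>)\<^sup>2) = measure \<mu> A"
    by (simp_all add: has_bochner_integral_iff)
qed

lemma centered_mult_integrable:
  assumes A: "A \<in> sets \<mu>" "emeasure \<mu> A < \<infinity>" and B: "B \<in> sets \<mu>" "emeasure \<mu> B < \<infinity>"
  shows "integrable M (\<lambda>\<omega>. centered A \<omega> * centered B \<omega>)"
  by (intro integrable_mult_of_squares centered_measurable centered_moments assms)

lemma centered_indep:
  assumes A: "A \<in> sets \<mu>" "emeasure \<mu> A < \<infinity>" and B: "B \<in> sets \<mu>" "emeasure \<mu> B < \<infinity>"
    and disj: "A \<inter> B = {}"
  shows "expectation (\<lambda>\<omega>. centered A \<omega> * centered B \<omega>) = 0"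
proof -
  \<comment> \<open>Independence is postulated for sequences of disjoint sets, so the pair is padded
    with empty sets and then read off at the indices 0 and 1.\<close>
  define C where "C i = (if i = 0 then A else if i = 1 then B else {})" for i :: nat
  have "indep_vars (\<lambda>_. borel) (\<lambda>i \<omega>. emeasure (N \<omega>) (C i)) UNIV"
    using A B disj by (intro N_indep) (auto simp: C_def disjoint_family_on_def)
  then have "indep_vars (\<lambda>_. borel) (\<lambda>i \<omega>. emeasure (N \<omega>) (C i)) {0, 1}"
    by (rule indep_vars_subset) auto
  then have iv: "indep_vars (\<lambda>_. borel) (\<lambda>i \<omega>. enn2real (emeasure (N \<omega>) (C i)) - measure \<mu> (C i)) {0, 1}"
    by (rule indep_vars_compose2[where Y = "\<lambda>i a. enn2real a - measure \<mu> (C i)"]) auto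
  have eq: "enn2real (emeasure (N \<omega>) (C i)) - measure \<mu> (C i) = centered (C i) \<omega>" for i \<omega>
    by (simp add: centered_def measure_def)
  have "expectation (\<lambda>\<omega>. \<Prod>i\<in>{0, 1}. centered (C i) \<omega>) = (\<Prod>i\<in>{0, 1}. expectation (centered (C i)))"
    using indep_vars_lebesgue_integral[OF _ iv] unfolding eq
    by (rule meta_mp) (use A B in \<open>auto simp: C_def intro!: centered_moments\<close>)
  then show ?thesis using centered_moments(2)[OF A] by (simp add: C_def)
qed

lemma centered_Un:
  assumes A: "A \<in> sets \<mu>" "emeasure \<mu> A < \<infinity>" and B: "B \<in> sets \<mu>" "emeasure \<mu> B < \<infinity>"
    and disj: "A \<inter> B = {}"
  shows "AE \<omega> in M. centered (A \<union> B) \<omega> = centered A \<omega> + centered B \<omega>"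
  using AE_N_finite[OF A] AE_N_finite[OF B] AE_space
proof eventually_elim
  case (elim \<omega>)
  have "measure (N \<omega>) (A \<union> B) = measure (N \<omega>) A + measure (N \<omega>) B"
    using elim A B disj sets_N by (intro measure_Union) auto
  moreover have "measure \<mu> (A \<union> B) = measure \<mu> A + measure \<mu> B"
    using A B disj by (intro measure_Union) auto
  ultimately show ?case by (simp add: centered_def)
qed

text \<open>Over \<open>A \<inter> B\<close>, \<open>A - B\<close> and \<open>B - A\<close> the
  counts are independent and centered, so of the four products only the square over
  \<open>A \<inter> B\<close> survives, with the Poisson variance.\<close>

lemma centered_covariance:
  assumes A: "A \<in> sets \<mu>" "emeasure \<mu> A < \<infinity>" and B: "B \<in> sets \<mu>" "emeasure \<mu> B < \<infinity>"
  shows "expectation (\<lambda>\<omega>. centered A \<omega> * centered B \<omega>) = measure \<mu> (A \<inter> B)"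
proof -
  have fin: "emeasure \<mu> (A \<inter> B) < \<infinity>" "emeasure \<mu> (A - B) < \<infinity>" "emeasure \<mu> (B - A) < \<infinity>"
    using A B emeasure_mono[of "A \<inter> B" A \<mu>] emeasure_mono[of "A - B" A \<mu>] emeasure_mono[of "B - A" B \<mu>]
    by (auto simp: le_less_trans)
  have sets: "A \<inter> B \<in> sets \<mu>" "A - B \<in> sets \<mu>" "B - A \<in> sets \<mu>" using A B by auto
  let ?I = "A \<inter> B" and ?A = "A - B" and ?B = "B - A"
  have "AE \<omega> in M. centered (?I \<union> ?A) \<omega> = centered ?I \<omega> + centered ?A \<omega>"
    "AE \<omega> in M. centered (?I \<union> ?B) \<omega> = centered ?I \<omega> + centered ?B \<omega>"
    using fin sets by (auto intro!: centered_Un)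
  moreover have "?I \<union> ?A = A" "?I \<union> ?B = B" by auto
  ultimately have AE: "AE \<omega> in M. centered A \<omega> * centered B \<omega> = (centered ?I \<omega>)\<^sup>2 + centered ?I \<omega> * centered ?B \<omega> + centered ?A \<omega> * centered ?I \<omega> + centered ?A \<omega> * centered ?B \<omega>"
    by (auto simp: power2_eq_square algebra_simps)
  have "expectation (\<lambda>\<omega>. centered A \<omega> * centered B \<omega>) = expectation (\<lambda>\<omega>. (centered ?I \<omega>)\<^sup>2 + centered ?I \<omega> * centered ?B \<omega> + centered ?A \<omega> * centered ?I \<omega> + centered ?A \<omega> * centered ?B \<omega>)"
    using A B sets by (intro integral_cong_AE AE) (auto intro!: centered_measurable borel_measurable_add borel_measurable_times borel_measurable_power)
  also have "\<dots> = measure \<mu> ?I + 0 + 0 + 0"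
  proof (rule has_bochner_integral_integral_eq, intro has_bochner_integral_add)
    show "has_bochner_integral M (\<lambda>\<omega>. (centered ?I \<omega>)\<^sup>2) (measure \<mu> ?I)"
      using fin sets by (simp add: has_bochner_integral_iff centered_moments)
    have z: "has_bochner_integral M (\<lambda>\<omega>. centered C \<omega> * centered D \<omega>) 0"
      if "C \<in> sets \<mu>" "emeasure \<mu> C < \<infinity>" "D \<in> sets \<mu>" "emeasure \<mu> D < \<infinity>" "C \<inter> D = {}" for C D
      using centered_mult_integrable[OF that(1-4)] centered_indep[OF that] by (simp add: has_bochner_integral_iff)
    show "has_bochner_integral M (\<lambda>\<omega>. centered ?I \<omega> * centered ?B \<omega>) 0"
      "has_bochner_integral M (\<lambda>\<omega>. centered ?A \<omega> * centered ?I \<omega>) 0"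
      "has_bochner_integral M (\<lambda>\<omega>. centered ?A \<omega> * centered ?B \<omega>) 0"
      by (rule z; use fin sets in blast)+
  qed
  finally show ?thesis by simp
qed

text \<open>The generator repeats the one in \<open>adapted_random_measure\<close>, so that the
  independence clause there speaks about this very sigma-algebra.\<close>

definition future :: "real \<Rightarrow> 'w measure" where
  "future t = sigma (space M) {(\<lambda>\<omega>. emeasure (N \<omega>) A) -` B \<inter> space M | A B.
            A \<in> sets \<mu> \<and> A \<subseteq> space m \<times> {t<..} \<and> B \<in> sets borel}"

lemma space_future [simp]: "space (future t) = space M"
  unfolding future_def by (rule space_measure_of) auto

lemma sets_future: "sets (future t) = sigma_sets (space M) {(\<lambda>\<omega>. emeasure (N \<omega>) A) -` B \<inter> space M | A B.
            A \<in> sets \<mu> \<and> A \<subseteq> space m \<times> {t<..} \<and> B \<in> sets borel}"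
  unfolding future_def by (rule sets_measure_of) auto

lemma N_future: "A \<in> sets \<mu> \<Longrightarrow> A \<subseteq> space m \<times> {t<..} \<Longrightarrow> (\<lambda>\<omega>. emeasure (N \<omega>) A) \<in> borel_measurable (future t)"
  by (rule measurableI) (auto simp: sets_future intro!: sigma_sets.Basic)

lemma centered_future: "A \<in> sets \<mu> \<Longrightarrow> A \<subseteq> space m \<times> {t<..} \<Longrightarrow> centered A \<in> borel_measurable (future t)"
  unfolding centered_def[abs_def] measure_def
  by (intro borel_measurable_diff borel_measurable_const borel_measurable_enn2real N_future)

lemma N_past: "0 \<le> t \<Longrightarrow> A \<in> sets \<mu> \<Longrightarrow> A \<subseteq> space m \<times> {0..t} \<Longrightarrow> (\<lambda>\<omega>. emeasure (N \<omega>) A) \<in> borel_measurable (F t)"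
  using adapted by (auto simp: adapted_random_measure_def)

lemma centered_past: "0 \<le> t \<Longrightarrow> A \<in> sets \<mu> \<Longrightarrow> A \<subseteq> space m \<times> {0..t} \<Longrightarrow> centered A \<in> borel_measurable (F t)"
  unfolding centered_def[abs_def] measure_def
  by (intro borel_measurable_diff borel_measurable_const borel_measurable_enn2real N_past)

lemma past_future_indep:
  fixes U V :: "'w \<Rightarrow> real"
  assumes t: "0 \<le> t" and U: "U \<in> borel_measurable (F t)" and V: "V \<in> borel_measurable (future t)"
  shows "indep_var borel U borel V"
proof -
  have ind: "indep_set (sets (F t)) (sets (future t))"
    using adapted t unfolding sets_future by (auto simp: adapted_random_measure_def)
  have fM: "sets (future t) \<subseteq> sets M" using indep_setD_ev2[OF ind] .
  have VM: "V \<in> borel_measurable M" using V fM by (auto simp: measurable_def)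
  have UM: "U \<in> borel_measurable M" using measurable_F_M[OF U] .
  have a: "sigma_sets (space M) {U -` A \<inter> space M | A. A \<in> sets borel} \<subseteq> sets (F t)"
    using sets.sigma_sets_subset[of "{U -` A \<inter> space M | A. A \<in> sets borel}" "F t"]
      measurable_sets[OF U] by auto
  have b: "sigma_sets (space M) {V -` A \<inter> space M | A. A \<in> sets borel} \<subseteq> sets (future t)"
    using sets.sigma_sets_subset[of "{V -` A \<inter> space M | A. A \<in> sets borel}" "future t"]
      measurable_sets[OF V] by auto
  have "indep_set (sigma_sets (space M) {U -` A \<inter> space M | A. A \<in> sets borel})
     (sigma_sets (space M) {V -` A \<inter> space M | A. A \<in> sets borel})"
  proof (rule indep_setI)
    fix A B assume "A \<in> sigma_sets (space M) {U -` A \<inter> space M | A. A \<in> sets borel}"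
      "B \<in> sigma_sets (space M) {V -` A \<inter> space M | A. A \<in> sets borel}"
    then show "prob (A \<inter> B) = prob A * prob B" using a b by (intro indep_setD[OF ind]) blast+
  qed (use a b sub_F fM in blast)+
  then show ?thesis unfolding indep_var_eq using UM VM by blast
qed

end

section \<open>The isometry for compensated integrals\<close>

lemma integral_bounded_on_finite_set:
  fixes f :: "'a \<Rightarrow> real"
  assumes E: "E \<in> sets \<nu>" "emeasure \<nu> E < \<infinity>" and f: "f \<in> borel_measurable \<nu>"
    and bd: "\<And>x. x \<in> space \<nu> \<Longrightarrow> \<bar>f x\<bar> \<le> C * indicator E x"
  shows "integrable \<nu> f" "\<bar>\<integral>x. f x \<partial>\<nu>\<bar> \<le> C * measure \<nu> E"
proof -
  have i: "integrable \<nu> (\<lambda>x. C * indicator E x)" using E by simp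
  show int: "integrable \<nu> f"
    by (rule Bochner_Integration.integrable_bound[OF i f])
      (use bd in \<open>auto intro!: AE_I2 order_trans[OF _ abs_ge_self]\<close>)
  have "\<bar>\<integral>x. f x \<partial>\<nu>\<bar> \<le> (\<integral>x. \<bar>f x\<bar> \<partial>\<nu>)" by (rule integral_abs_bound)
  also have "\<dots> \<le> (\<integral>x. C * indicator E x \<partial>\<nu>)"
    using int i bd by (intro integral_mono) auto
  also have "\<dots> = C * measure \<nu> E" using E by simp
  finally show "\<bar>\<integral>x. f x \<partial>\<nu>\<bar> \<le> C * measure \<nu> E" .
qed

section \<open>Predictable rectangles and the past\<close>

context poisson_basis
begin

abbreviation PA :: "('w \<times> 'e \<times> real) measure" where "PA \<equiv> predictable_algebra M F m"

definition gens :: "('w \<times> 'e \<times> real) set set" where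
  "gens = {H \<times> (B \<times> {s<..t}) | H B s t. H \<in> sets (F s) \<and> B \<in> sets m \<and> 0 \<le> s \<and> s \<le> t}"

lemma PA_sigma: "PA = sigma (space M \<times> (space m \<times> {0<..})) gens"
  by (simp add: predictable_algebra_def gens_def)

lemma gens_subset: "gens \<subseteq> Pow (space M \<times> (space m \<times> {0<..}))"
proof
  fix A assume "A \<in> gens"
  then obtain H B s t where A: "A = H \<times> (B \<times> {s<..t})" "H \<in> sets (F s)" "B \<in> sets m" "0 \<le> s"
    by (auto simp: gens_def)
  have "H \<subseteq> space M" using sets.sets_into_space[OF A(2)] by simp
  moreover have "B \<subseteq> space m" using sets.sets_into_space[OF A(3)] .
  ultimately show "A \<in> Pow (space M \<times> (space m \<times> {0<..}))" using A by auto
qed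

text \<open>The monotone class argument needs a pi-system. For an intersection the later starting
  time is the right one, because both past events belong to its sigma-algebra.\<close>

lemma gens_Int_stable: "Int_stable gens"
proof (rule Int_stableI)
  fix A A' assume "A \<in> gens" "A' \<in> gens"
  then obtain H B s t H' B' s' t' where
    A: "A = H \<times> (B \<times> {s<..t})" "H \<in> sets (F s)" "B \<in> sets m" "0 \<le> s" "s \<le> t" and
    A': "A' = H' \<times> (B' \<times> {s'<..t'})" "H' \<in> sets (F s')" "B' \<in> sets m" "0 \<le> s'" "s' \<le> t'"
    by (auto simp: gens_def)
  have H: "H \<inter> H' \<in> sets (F (max s s'))"
    using A A' sets_F_mono[of s "max s s'"] sets_F_mono[of s' "max s s'"] by auto
  \<comment> \<open>The outer \<open>max\<close> in the right endpoint keeps the endpoints ordered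
    when the two time intervals are disjoint; the interval is then empty, as it should be.\<close>
  have "A \<inter> A' = (H \<inter> H') \<times> ((B \<inter> B') \<times> {max s s'<..max (max s s') (min t t')})"
    unfolding A A' by auto
  moreover have "B \<inter> B' \<in> sets m" "0 \<le> max s s'" "max s s' \<le> max (max s s') (min t t')"
    using A(3,4) A'(3,4) by auto
  ultimately show "A \<inter> A' \<in> gens"
    unfolding gens_def using H by blast
qed

lemma space_PA [simp]: "space PA = space M \<times> (space m \<times> {0<..})"
  unfolding PA_sigma by (rule space_measure_of[OF gens_subset])

lemma sets_PA: "sets PA = sigma_sets (space M \<times> (space m \<times> {0<..})) gens"
  unfolding PA_sigma by (rule sets_measure_of[OF gens_subset])

lemma pair_F_measurable: "f \<in> measurable (F t \<Otimes>\<^sub>M \<mu>) L \<Longrightarrow> f \<in> measurable (M \<Otimes>\<^sub>M \<mu>) L"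
proof -
  assume f: "f \<in> measurable (F t \<Otimes>\<^sub>M \<mu>) L"
  have "(\<lambda>x. x) \<in> measurable M (F t)" using measurable_F_M[OF measurable_ident] by (simp add: id_def)
  then have "(\<lambda>x. (fst x, snd x)) \<in> measurable (M \<Otimes>\<^sub>M \<mu>) (F t \<Otimes>\<^sub>M \<mu>)"
    by (intro measurable_Pair measurable_compose[OF measurable_fst] measurable_snd)
  from measurable_compose[OF this f] show ?thesis by simp
qed

lemma past_region: "space M \<times> (space m \<times> {0<..t}) \<in> sets (F t \<Otimes>\<^sub>M \<mu>)"
proof -
  have "space (F t) \<times> (space m \<times> {0<..t}) \<in> sets (F t \<Otimes>\<^sub>M \<mu>)"
    by (rule pair_measureI[OF sets.top]) (simp add: sets_intensity)
  then show ?thesis by simp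
qed

text \<open>Predictable sets cut off at time \<open>t\<close> are measurable for the past at
  \<open>t\<close>: a rectangle that starts by time \<open>t\<close> has its event in
  \<open>F t\<close>, and one that starts later misses the region. Adaptedness of all integrals up
  to \<open>t\<close> rests on this.\<close>

lemma PA_ident: "(\<lambda>x. x) \<in> measurable (restrict_space (F t \<Otimes>\<^sub>M \<mu>) (space M \<times> (space m \<times> {0<..t}))) PA"
  unfolding PA_sigma
proof (rule measurable_measure_of[OF gens_subset])
  let ?R = "restrict_space (F t \<Otimes>\<^sub>M \<mu>) (space M \<times> (space m \<times> {0<..t}))"
  have spR: "space ?R = space M \<times> (space m \<times> {0<..t})"
    by (auto simp: space_restrict_space space_pair_measure)
  show "(\<lambda>x. x) \<in> space ?R \<rightarrow> space M \<times> (space m \<times> {0<..})" unfolding spR by auto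
  fix A assume "A \<in> gens"
  then obtain H B s t' where A: "A = H \<times> (B \<times> {s<..t'})" "H \<in> sets (F s)" "B \<in> sets m" "0 \<le> s" "s \<le> t'"
    by (auto simp: gens_def)
  show "(\<lambda>x. x) -` A \<inter> space ?R \<in> sets ?R"
  proof (cases "s \<le> t")
    case True
    have "H \<in> sets (F t)" using A sets_F_mono[OF True] by auto
    moreover have "B \<times> {s<..min t t'} \<in> sets \<mu>" using A by (simp add: sets_intensity)
    ultimately have "H \<times> (B \<times> {s<..min t t'}) \<in> sets (F t \<Otimes>\<^sub>M \<mu>)" by (rule pair_measureI)
    moreover have "(\<lambda>x. x) -` A \<inter> space ?R = (space M \<times> (space m \<times> {0<..t})) \<inter> H \<times> (B \<times> {s<..min t t'})"
      unfolding spR A using A(4) sets.sets_into_space[OF A(2)] sets.sets_into_space[OF A(3)] by auto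
    ultimately show ?thesis unfolding sets_restrict_space by auto
  next
    case False
    then have "(\<lambda>x. x) -` A \<inter> space ?R = {}" unfolding spR A by auto
    then show ?thesis by simp
  qed
qed

lemma PA_measurable_past:
  fixes h :: "'w \<times> 'e \<times> real \<Rightarrow> 'b::real_normed_vector"
  assumes h: "h \<in> borel_measurable PA"
  shows "(\<lambda>x. indicator (space M \<times> (space m \<times> {0<..t})) x *\<^sub>R h x) \<in> borel_measurable (F t \<Otimes>\<^sub>M \<mu>)"
proof -
  let ?R = "space M \<times> (space m \<times> {0<..t})"
  have "h \<in> borel_measurable (restrict_space (F t \<Otimes>\<^sub>M \<mu>) ?R)"
    using measurable_compose[OF PA_ident h] by simp
  moreover have "?R \<inter> space (F t \<Otimes>\<^sub>M \<mu>) = ?R"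
    using sets.sets_into_space[OF past_region[of t]] by blast
  ultimately show ?thesis
    using past_region[of t] by (subst (asm) borel_measurable_restrict_space_iff) auto
qed

end

section \<open>Bounded predictable integrands on a window of finite intensity\<close>

locale poisson_window = poisson_basis M F m N for M :: "'w measure" and F and m :: "'e measure" and N +
  fixes B :: "'e set" and t :: real
  assumes B: "B \<in> sets m" "emeasure m B < \<infinity>" and t: "0 \<le> t"
begin

abbreviation E :: "('e \<times> real) set" where "E \<equiv> B \<times> {0<..t}"

lemma E_sets: "E \<in> sets \<mu>" using B by (simp add: sets_intensity)

lemma emeasure_E: "emeasure \<mu> E = emeasure m B * ennreal t"
  unfolding intensity_def using B t sigma_finite_half_line
  by (subst sigma_finite_measure.emeasure_pair_measure_Times)
    (auto simp: emeasure_half_line_Ioc)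

lemma E_finite: "emeasure \<mu> E < \<infinity>"
  using B by (simp add: emeasure_E ennreal_mult_less_top)

abbreviation K :: "'w \<Rightarrow> ('e \<times> real) measure" where "K \<equiv> fin_restr N E"

sublocale KF: finite_kernel "F t" \<mu> N E
proof
  fix A assume "A \<in> sets \<mu>" "A \<subseteq> E"
  moreover have "B \<subseteq> space m" using sets.sets_into_space[OF B(1)] .
  ultimately show "(\<lambda>\<omega>. emeasure (N \<omega>) A) \<in> borel_measurable (F t)"
    using t by (intro N_past) auto
qed (use space_\<mu> sets_N E_sets in auto)

lemma sets_K: "\<omega> \<in> space M \<Longrightarrow> sets (K \<omega>) = sets \<mu>" using sets_N by simp

lemma emeasure_K:
  "\<omega> \<in> space M \<Longrightarrow> A \<in> sets \<mu> \<Longrightarrow>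
    emeasure (K \<omega>) A = (if emeasure (N \<omega>) E < \<infinity> then emeasure (N \<omega>) (A \<inter> E) else 0)"
  using E_sets by (intro emeasure_fin_restr) (auto simp: sets_N)

lemma finite_K: "\<omega> \<in> space M \<Longrightarrow> emeasure (K \<omega>) E < \<infinity>"
  using E_sets by (simp add: emeasure_K)

lemma measure_K_le: "\<omega> \<in> space M \<Longrightarrow> measure (K \<omega>) E \<le> measure (N \<omega>) E"
  using E_sets by (simp add: measure_def emeasure_K)

definition cutoff :: "('w \<times> 'e \<times> real \<Rightarrow> real) \<Rightarrow> 'w \<Rightarrow> 'e \<times> real \<Rightarrow> real" where
  "cutoff h \<omega> p = indicator E p * h (\<omega>, p)"

text \<open>Uses the restricted kernel \<open>K\<close> in place of \<open>N\<close>: for a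
  predictable integrand it is measurable in \<omega> everywhere, and almost surely it equals the
  compensated integral over the window.\<close>

definition cint :: "('w \<times> 'e \<times> real \<Rightarrow> real) \<Rightarrow> 'w \<Rightarrow> real" where
  "cint h \<omega> = (\<integral>p. cutoff h \<omega> p \<partial>K \<omega>) - (\<integral>p. cutoff h \<omega> p \<partial>\<mu>)"

text \<open>A square integrable majorant: multiplied by a bound of the integrand it dominates
  \<open>cint\<close>, and so it serves all dominated convergence arguments for \<open>cint\<close>
  and for products of two of them.\<close>

definition envelope :: "'w \<Rightarrow> real" where
  "envelope \<omega> = measure (N \<omega>) E + measure \<mu> E"

definition bounded_pred :: "('w \<times> 'e \<times> real \<Rightarrow> real) \<Rightarrow> real \<Rightarrow> bool" where
  "bounded_pred h C \<longleftrightarrow> h \<in> borel_measurable PA \<and> (\<forall>x\<in>space PA. \<bar>h x\<bar> \<le> C)"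

lemma E_subset: "E \<subseteq> space m \<times> {0<..t}" using sets.sets_into_space[OF B(1)] by auto

lemma cutoff_measurable_F:
  assumes h: "h \<in> borel_measurable PA"
  shows "(\<lambda>(\<omega>, p). cutoff h \<omega> p) \<in> borel_measurable (F t \<Otimes>\<^sub>M \<mu>)"
proof -
  have 1: "(\<lambda>x. indicator (space M \<times> (space m \<times> {0<..t})) x *\<^sub>R h x) \<in> borel_measurable (F t \<Otimes>\<^sub>M \<mu>)"
    by (rule PA_measurable_past[OF h])
  have "(\<lambda>x. indicator E (snd x) * (indicator (space M \<times> (space m \<times> {0<..t})) x *\<^sub>R h x)) \<in> borel_measurable (F t \<Otimes>\<^sub>M \<mu>)"
    using E_sets by (intro borel_measurable_times 1 measurable_compose[OF measurable_snd] borel_measurable_indicator)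
  moreover have "indicator E (snd x) * (indicator (space M \<times> (space m \<times> {0<..t})) x *\<^sub>R h x)
      = (case x of (\<omega>, p) \<Rightarrow> cutoff h \<omega> p)" if "x \<in> space (F t \<Otimes>\<^sub>M \<mu>)" for x
    using that E_subset by (cases x; cases "snd x \<in> E") (auto simp: cutoff_def space_pair_measure)
  ultimately show ?thesis by (simp cong: measurable_cong)
qed

lemma cutoff_measurable_M: "h \<in> borel_measurable PA \<Longrightarrow> (\<lambda>(\<omega>, p). cutoff h \<omega> p) \<in> borel_measurable (M \<Otimes>\<^sub>M \<mu>)"
  by (rule pair_F_measurable[OF cutoff_measurable_F])

lemma cutoff_section: "h \<in> borel_measurable PA \<Longrightarrow> \<omega> \<in> space M \<Longrightarrow> cutoff h \<omega> \<in> borel_measurable \<mu>"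
  using measurable_Pair2[OF cutoff_measurable_M] by simp

lemma cutoff_section_K: "h \<in> borel_measurable PA \<Longrightarrow> \<omega> \<in> space M \<Longrightarrow> cutoff h \<omega> \<in> borel_measurable (K \<omega>)"
  using cutoff_section sets_K by (simp cong: measurable_cong_sets)

lemma sigma_finite_\<mu>: "sigma_finite_measure \<mu>"
proof -
  interpret pair_sigma_finite m half_line
    using sigma_finite_m sigma_finite_half_line by (simp add: pair_sigma_finite_def)
  show ?thesis unfolding intensity_def by (rule sigma_finite_measure_axioms)
qed

lemma cint_measurable: "h \<in> borel_measurable PA \<Longrightarrow> cint h \<in> borel_measurable M"
proof -
  assume h: "h \<in> borel_measurable PA"
  have 1: "(\<lambda>\<omega>. \<integral>p. cutoff h \<omega> p \<partial>K \<omega>) \<in> borel_measurable M"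
    using measurable_F_M[OF KF.integral_fin_restr_measurable[OF cutoff_measurable_F[OF h]]] .
  interpret sigma_finite_measure \<mu> by (rule sigma_finite_\<mu>)
  have 2: "(\<lambda>\<omega>. \<integral>p. cutoff h \<omega> p \<partial>\<mu>) \<in> borel_measurable M"
    by (rule borel_measurable_lebesgue_integral[OF cutoff_measurable_M[OF h]])
  show ?thesis unfolding cint_def[abs_def] by (rule borel_measurable_diff[OF 1 2])
qed

lemma cutoff_bound:
  assumes h: "bounded_pred h C" and \<omega>: "\<omega> \<in> space M"
  shows "\<bar>cutoff h \<omega> p\<bar> \<le> C * indicator E p"
proof (cases "p \<in> E")
  case True
  then have "(\<omega>, p) \<in> space PA" using \<omega> E_subset by auto
  then have "\<bar>h (\<omega>, p)\<bar> \<le> C" using h unfolding bounded_pred_def by blast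
  then show ?thesis using True by (simp add: cutoff_def)
qed (simp add: cutoff_def)

lemma cutoff_integral:
  assumes h: "bounded_pred h C" and \<omega>: "\<omega> \<in> space M"
  shows "integrable (K \<omega>) (cutoff h \<omega>)" "\<bar>\<integral>p. cutoff h \<omega> p \<partial>K \<omega>\<bar> \<le> C * measure (K \<omega>) E"
    "integrable \<mu> (cutoff h \<omega>)" "\<bar>\<integral>p. cutoff h \<omega> p \<partial>\<mu>\<bar> \<le> C * measure \<mu> E"
proof -
  have hm: "h \<in> borel_measurable PA" using h by (simp add: bounded_pred_def)
  have EK: "E \<in> sets (K \<omega>)" using E_sets sets_K[OF \<omega>] by blast
  show "integrable (K \<omega>) (cutoff h \<omega>)" "\<bar>\<integral>p. cutoff h \<omega> p \<partial>K \<omega>\<bar> \<le> C * measure (K \<omega>) E"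
    by (rule integral_bounded_on_finite_set[OF EK finite_K[OF \<omega>] cutoff_section_K[OF hm \<omega>] cutoff_bound[OF h \<omega>]])+
  show "integrable \<mu> (cutoff h \<omega>)" "\<bar>\<integral>p. cutoff h \<omega> p \<partial>\<mu>\<bar> \<le> C * measure \<mu> E"
    by (rule integral_bounded_on_finite_set[OF E_sets E_finite cutoff_section[OF hm \<omega>] cutoff_bound[OF h \<omega>]])+
qed

lemma bounded_pred_nonneg: "bounded_pred h C \<Longrightarrow> 0 \<le> C"
proof -
  assume h: "bounded_pred h C"
  obtain \<omega> e where "\<omega> \<in> space M" "e \<in> space m" using not_empty space_m by blast
  then have "(\<omega>, e, 1) \<in> space PA" by simp
  then have "\<bar>h (\<omega>, e, 1)\<bar> \<le> C" using h unfolding bounded_pred_def by blast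
  then show "0 \<le> C" by linarith
qed

lemma cint_bound:
  assumes h: "bounded_pred h C" and \<omega>: "\<omega> \<in> space M"
  shows "\<bar>cint h \<omega>\<bar> \<le> C * envelope \<omega>"
proof -
  have "\<bar>cint h \<omega>\<bar> \<le> C * measure (K \<omega>) E + C * measure \<mu> E"
    using cutoff_integral(2,4)[OF h \<omega>] unfolding cint_def by linarith
  also have "\<dots> \<le> C * envelope \<omega>"
    using mult_left_mono[OF measure_K_le[OF \<omega>] bounded_pred_nonneg[OF h]]
    by (simp add: envelope_def distrib_left)
  finally show ?thesis .
qed

lemma envelope_integrable: "integrable M envelope" "integrable M (\<lambda>\<omega>. (envelope \<omega>)\<^sup>2)"
proof -
  let ?n = "\<lambda>\<omega>. measure (N \<omega>) E" let ?l = "measure \<mu> E"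
  note 1 = has_integral_count(1)[OF E_sets E_finite, THEN integrable.intros]
    and 2 = has_integral_count(2)[OF E_sets E_finite, THEN integrable.intros]
  show "integrable M envelope" unfolding envelope_def[abs_def] using 1 by simp
  have "integrable M (\<lambda>\<omega>. ?n \<omega> * (?n \<omega> - 1) + (1 + 2 * ?l) * ?n \<omega> + ?l\<^sup>2)"
    using 1 2 by (intro Bochner_Integration.integrable_add integrable_mult_right) auto
  also have "(\<lambda>\<omega>. ?n \<omega> * (?n \<omega> - 1) + (1 + 2 * ?l) * ?n \<omega> + ?l\<^sup>2) = (\<lambda>\<omega>. (envelope \<omega>)\<^sup>2)"
    by (auto simp: envelope_def power2_eq_square algebra_simps)
  finally show "integrable M (\<lambda>\<omega>. (envelope \<omega>)\<^sup>2)" .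
qed

lemma cint_integrable: "bounded_pred h C \<Longrightarrow> integrable M (cint h)"
  by (rule Bochner_Integration.integrable_bound[of M "\<lambda>\<omega>. C * envelope \<omega>"])
    (auto simp: bounded_pred_def intro!: envelope_integrable cint_measurable AE_I2 order_trans[OF cint_bound abs_ge_self]
      integrable_mult_right)

lemma cint_mult_bound:
  assumes h: "bounded_pred h C" and k: "bounded_pred k C'" and \<omega>: "\<omega> \<in> space M"
  shows "\<bar>cint h \<omega> * cint k \<omega>\<bar> \<le> C * C' * (envelope \<omega>)\<^sup>2"
proof -
  have "\<bar>cint h \<omega> * cint k \<omega>\<bar> \<le> (C * envelope \<omega>) * (C' * envelope \<omega>)"
    unfolding abs_mult by (intro mult_mono cint_bound h k \<omega>)
      (auto intro!: mult_nonneg_nonneg bounded_pred_nonneg[OF h] simp: envelope_def)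
  then show ?thesis by (simp add: power2_eq_square mult_ac)
qed

lemma cint_mult_integrable:
  assumes h: "bounded_pred h C" and k: "bounded_pred k C'"
  shows "integrable M (\<lambda>\<omega>. cint h \<omega> * cint k \<omega>)"
  by (rule Bochner_Integration.integrable_bound[of M "\<lambda>\<omega>. C * C' * (envelope \<omega>)\<^sup>2"])
    (use h k in \<open>auto simp: bounded_pred_def intro!: envelope_integrable cint_measurable AE_I2
      order_trans[OF cint_mult_bound[OF h k] abs_ge_self] integrable_mult_right borel_measurable_times\<close>)

lemma cutoff_lin: "cutoff (\<lambda>x. u x + c * v x) \<omega> = (\<lambda>p. cutoff u \<omega> p + c * cutoff v \<omega> p)"
  by (auto simp: cutoff_def algebra_simps)

lemma cint_lin:
  assumes u: "bounded_pred u C" and v: "bounded_pred v C'" and \<omega>: "\<omega> \<in> space M"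
  shows "cint (\<lambda>x. u x + c * v x) \<omega> = cint u \<omega> + c * cint v \<omega>"
  using cutoff_integral(1,3)[OF u \<omega>] cutoff_integral(1,3)[OF v \<omega>]
  by (simp add: cint_def cutoff_lin algebra_simps)

lemma cint_cong:
  assumes "\<And>x. x \<in> space M \<times> E \<Longrightarrow> u x = v x" "\<omega> \<in> space M"
  shows "cint u \<omega> = cint v \<omega>"
proof -
  have "cutoff u \<omega> = cutoff v \<omega>" using assms by (auto simp: cutoff_def fun_eq_iff split: split_indicator)
  then show ?thesis by (simp add: cint_def)
qed

lemma cutoff_lim_integral:
  assumes u: "\<And>n. bounded_pred (u n) C" and v: "v \<in> borel_measurable PA"
    and lim: "\<And>x. x \<in> space PA \<Longrightarrow> (\<lambda>n. u n x) \<longlonglongrightarrow> v x" and \<omega>: "\<omega> \<in> space M"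
  shows "(\<lambda>n. \<integral>p. cutoff (u n) \<omega> p \<partial>K \<omega>) \<longlonglongrightarrow> (\<integral>p. cutoff v \<omega> p \<partial>K \<omega>)"
    "(\<lambda>n. \<integral>p. cutoff (u n) \<omega> p \<partial>\<mu>) \<longlonglongrightarrow> (\<integral>p. cutoff v \<omega> p \<partial>\<mu>)"
proof -
  have l: "(\<lambda>n. cutoff (u n) \<omega> p) \<longlonglongrightarrow> cutoff v \<omega> p" for p
  proof (cases "p \<in> E")
    case True
    then have "(\<omega>, p) \<in> space PA" using \<omega> E_subset by auto
    then show ?thesis using lim by (auto simp: cutoff_def intro!: tendsto_mult)
  qed (simp add: cutoff_def)
  have m: "u n \<in> borel_measurable PA" for n using u by (auto simp: bounded_pred_def)
  show "(\<lambda>n. \<integral>p. cutoff (u n) \<omega> p \<partial>K \<omega>) \<longlonglongrightarrow> (\<integral>p. cutoff v \<omega> p \<partial>K \<omega>)"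
    by (rule integral_dominated_convergence[where w = "\<lambda>p. C * indicator E p"])
      (use l cutoff_bound[OF u \<omega>] finite_K[OF \<omega>] E_sets sets_K[OF \<omega>] in
        \<open>auto intro!: AE_I2 cutoff_section_K v m \<omega> integrable_mult_right\<close>)
  show "(\<lambda>n. \<integral>p. cutoff (u n) \<omega> p \<partial>\<mu>) \<longlonglongrightarrow> (\<integral>p. cutoff v \<omega> p \<partial>\<mu>)"
    by (rule integral_dominated_convergence[where w = "\<lambda>p. C * indicator E p"])
      (use l cutoff_bound[OF u \<omega>] E_finite E_sets in
        \<open>auto intro!: AE_I2 cutoff_section v m \<omega> integrable_mult_right\<close>)
qed

lemma cint_lim:
  assumes "\<And>n. bounded_pred (u n) C" "v \<in> borel_measurable PA"
    "\<And>x. x \<in> space PA \<Longrightarrow> (\<lambda>n. u n x) \<longlonglongrightarrow> v x" "\<omega> \<in> space M"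
  shows "(\<lambda>n. cint (u n) \<omega>) \<longlonglongrightarrow> cint v \<omega>"
  unfolding cint_def
  by (rule tendsto_diff[OF cutoff_lim_integral(1)[OF assms] cutoff_lim_integral(2)[OF assms]])

lemma bounded_pred_mult:
  "bounded_pred u C \<Longrightarrow> bounded_pred v C' \<Longrightarrow> bounded_pred (\<lambda>x. u x * v x) (C * C')"
  using bounded_pred_nonneg[of u C] unfolding bounded_pred_def
  by (auto simp: abs_mult intro!: mult_mono)

lemma bounded_pred_gen: "A \<in> gens \<Longrightarrow> bounded_pred (indicator A) 1"
  unfolding bounded_pred_def using sets_PA by (auto intro!: borel_measurable_indicator sigma_sets.Basic simp: indicator_def)

text \<open>At a product \<open>k x * h x\<close> this is the inner product of \<open>k\<close> and
  \<open>h\<close> in L2 of probability times intensity over the window, the other side of the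
  isometry.\<close>

definition iprod :: "('w \<times> 'e \<times> real \<Rightarrow> real) \<Rightarrow> real" where
  "iprod h = expectation (\<lambda>\<omega>. \<integral>p. cutoff h \<omega> p \<partial>\<mu>)"

lemma mu_integral_measurable: "h \<in> borel_measurable PA \<Longrightarrow> (\<lambda>\<omega>. \<integral>p. cutoff h \<omega> p \<partial>\<mu>) \<in> borel_measurable M"
  using sigma_finite_measure.borel_measurable_lebesgue_integral[OF sigma_finite_\<mu> cutoff_measurable_M] .

lemma mu_integral_integrable: "bounded_pred h C \<Longrightarrow> integrable M (\<lambda>\<omega>. \<integral>p. cutoff h \<omega> p \<partial>\<mu>)"
  by (rule integrable_const_bound[where B = "C * measure \<mu> E"])
    (auto simp: bounded_pred_def intro!: AE_I2 cutoff_integral(4) mu_integral_measurable)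

lemma iprod_lin:
  assumes "bounded_pred u C" "bounded_pred v C'"
  shows "iprod (\<lambda>x. u x + c * v x) = iprod u + c * iprod v"
proof -
  have "iprod (\<lambda>x. u x + c * v x) = expectation (\<lambda>\<omega>. (\<integral>p. cutoff u \<omega> p \<partial>\<mu>) + c * (\<integral>p. cutoff v \<omega> p \<partial>\<mu>))"
    unfolding iprod_def by (intro Bochner_Integration.integral_cong refl)
      (simp add: cutoff_lin cutoff_integral[OF assms(1)] cutoff_integral[OF assms(2)])
  also have "\<dots> = iprod u + c * iprod v"
    unfolding iprod_def using mu_integral_integrable[OF assms(1)] mu_integral_integrable[OF assms(2)] by simp
  finally show ?thesis .
qed

lemma iprod_lim:
  assumes u: "\<And>n. bounded_pred (u n) C" and v: "v \<in> borel_measurable PA"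
    and lim: "\<And>x. x \<in> space PA \<Longrightarrow> (\<lambda>n. u n x) \<longlonglongrightarrow> v x"
  shows "(\<lambda>n. iprod (u n)) \<longlonglongrightarrow> iprod v"
  unfolding iprod_def
proof (rule integral_dominated_convergence[where w = "\<lambda>_. C * measure \<mu> E"])
  have m: "u n \<in> borel_measurable PA" for n using u by (simp add: bounded_pred_def)
  show "(\<lambda>\<omega>. \<integral>p. cutoff (u n) \<omega> p \<partial>\<mu>) \<in> borel_measurable M" for n by (rule mu_integral_measurable[OF m])
  show "(\<lambda>\<omega>. \<integral>p. cutoff v \<omega> p \<partial>\<mu>) \<in> borel_measurable M" by (rule mu_integral_measurable[OF v])
  show "AE \<omega> in M. (\<lambda>n. \<integral>p. cutoff (u n) \<omega> p \<partial>\<mu>) \<longlonglongrightarrow> (\<integral>p. cutoff v \<omega> p \<partial>\<mu>)"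
    by (intro AE_I2 cutoff_lim_integral(2)[OF u v lim])
  show "AE \<omega> in M. norm (\<integral>p. cutoff (u n) \<omega> p \<partial>\<mu>) \<le> C * measure \<mu> E" for n
    unfolding real_norm_def by (intro AE_I2 cutoff_integral(4) u)
qed simp

lemma cint_mult_lim:
  assumes u: "\<And>n. bounded_pred (u n) C" and v: "v \<in> borel_measurable PA"
    and lim: "\<And>x. x \<in> space PA \<Longrightarrow> (\<lambda>n. u n x) \<longlonglongrightarrow> v x" and k: "bounded_pred k C'"
  shows "(\<lambda>n. expectation (\<lambda>\<omega>. cint k \<omega> * cint (u n) \<omega>)) \<longlonglongrightarrow> expectation (\<lambda>\<omega>. cint k \<omega> * cint v \<omega>)"
proof (rule integral_dominated_convergence[where w = "\<lambda>\<omega>. C' * C * (envelope \<omega>)\<^sup>2"])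
  have m: "u n \<in> borel_measurable PA" "k \<in> borel_measurable PA" for n using u k by (auto simp: bounded_pred_def)
  show "(\<lambda>\<omega>. cint k \<omega> * cint (u n) \<omega>) \<in> borel_measurable M" for n
    by (intro borel_measurable_times cint_measurable m)
  show "(\<lambda>\<omega>. cint k \<omega> * cint v \<omega>) \<in> borel_measurable M"
    by (intro borel_measurable_times cint_measurable m v)
  show "AE \<omega> in M. (\<lambda>n. cint k \<omega> * cint (u n) \<omega>) \<longlonglongrightarrow> cint k \<omega> * cint v \<omega>"
    by (intro AE_I2 tendsto_mult tendsto_const cint_lim[OF u v lim])
  show "AE \<omega> in M. norm (cint k \<omega> * cint (u n) \<omega>) \<le> C' * C * (envelope \<omega>)\<^sup>2" for n
    unfolding real_norm_def by (intro AE_I2 cint_mult_bound k u)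
qed (intro integrable_mult_right envelope_integrable)

lemma cint_lim_expectation:
  assumes u: "\<And>n. bounded_pred (u n) C" and v: "v \<in> borel_measurable PA"
    and lim: "\<And>x. x \<in> space PA \<Longrightarrow> (\<lambda>n. u n x) \<longlonglongrightarrow> v x"
  shows "(\<lambda>n. expectation (cint (u n))) \<longlonglongrightarrow> expectation (cint v)"
proof (rule integral_dominated_convergence[where w = "\<lambda>\<omega>. C * envelope \<omega>"])
  have m: "u n \<in> borel_measurable PA" for n using u by (auto simp: bounded_pred_def)
  show "cint (u n) \<in> borel_measurable M" for n by (intro cint_measurable m)
  show "AE \<omega> in M. norm (cint (u n) \<omega>) \<le> C * envelope \<omega>" for n
    unfolding real_norm_def by (intro AE_I2 cint_bound u)
  show "AE \<omega> in M. (\<lambda>n. cint (u n) \<omega>) \<longlonglongrightarrow> cint v \<omega>"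
    by (intro AE_I2 cint_lim[OF u v lim])
qed (auto intro: cint_measurable v integrable_mult_right envelope_integrable)

end

section \<open>Orthogonality on predictable rectangles and its extension\<close>

context poisson_window
begin

lemma AE_E_finite: "AE \<omega> in M. emeasure (N \<omega>) E < \<infinity>"
  by (rule AE_N_finite[OF E_sets E_finite])

lemma integrable_indicator_event: "H \<in> sets M \<Longrightarrow> integrable M (indicat_real H)"
  by (intro integrable_real_indicator) (simp_all add: emeasure_eq_measure)

text \<open>On a rectangle \<open>cint\<close> is the elementary stochastic integral, a past event
  times a future centered count, for which independence can be used directly.\<close>

lemma cint_gen:
  assumes B': "B' \<in> sets m" and \<omega>: "\<omega> \<in> space M" and fin: "emeasure (N \<omega>) E < \<infinity>"
  shows "cint (indicator (H \<times> (B' \<times> {s<..t'}))) \<omega> = indicator H \<omega> * centered (E \<inter> B' \<times> {s<..t'}) \<omega>"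
proof -
  let ?C = "E \<inter> B' \<times> {s<..t'}"
  have C: "?C \<in> sets \<mu>" using B' E_sets by (intro sets.Int) (auto simp: sets_intensity)
  have c: "cutoff (indicator (H \<times> (B' \<times> {s<..t'}))) \<omega> = (\<lambda>p. indicator H \<omega> * indicator ?C p)"
    by (auto simp: cutoff_def fun_eq_iff split: split_indicator)
  have CK: "?C \<in> sets (K \<omega>)" using C sets_K[OF \<omega>] by blast
  have "?C \<inter> E = ?C" by auto
  then have "measure (K \<omega>) ?C = measure (N \<omega>) ?C"
    using emeasure_K[OF \<omega> C] fin by (simp add: measure_def)
  moreover have "(\<integral>p. indicator ?C p \<partial>K \<omega>) = measure (K \<omega>) ?C" "(\<integral>p. indicator ?C p \<partial>\<mu>) = measure \<mu> ?C"
    using sets.sets_into_space[OF CK] sets.sets_into_space[OF C] by (simp_all add: Int_absorb2)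
  ultimately show ?thesis by (simp add: cint_def c centered_def algebra_simps)
qed

lemma sub_E_finite: "C \<subseteq> E \<Longrightarrow> emeasure \<mu> C < \<infinity>"
  using emeasure_mono[OF _ E_sets, of C] E_finite by (auto intro: le_less_trans)

text \<open>\<open>C\<close> is cut at the later starting time \<open>s'\<close>. The piece up to
  \<open>s'\<close>, together with both events, belongs to the past and is independent of the
  centered count of \<open>C'\<close>, so it contributes 0. The piece after \<open>s'\<close> forms
  with \<open>C'\<close> a future product that is independent of the events and whose mean is the
  covariance.\<close>

lemma centered_shifted_covariance:
  assumes s: "0 \<le> s" "s \<le> s'" and H: "H \<in> sets (F s)" "H' \<in> sets (F s')"
    and C: "C \<in> sets \<mu>" "C \<subseteq> E" "C \<subseteq> space m \<times> {s<..}"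
    and C': "C' \<in> sets \<mu>" "C' \<subseteq> E" "C' \<subseteq> space m \<times> {s'<..}"
  shows "expectation (\<lambda>\<omega>. (indicator H \<omega> * centered C \<omega>) * (indicator H' \<omega> * centered C' \<omega>)) =
    prob (H \<inter> H') * measure \<mu> (C \<inter> C')"
proof -
  let ?L = "space m \<times> {..s'}" and ?R = "space m \<times> {s'<..}" and ?H = "H \<inter> H'"
  have H2: "?H \<in> sets (F s')" using H sets_F_mono[OF s(2)] by auto
  then have HM: "?H \<in> sets M" using sub_F by auto
  have LR: "?L \<in> sets \<mu>" "?R \<in> sets \<mu>" by (auto simp: sets_intensity)
  have CL: "C \<inter> ?L \<in> sets \<mu>" "C \<inter> ?R \<in> sets \<mu>" using C LR by auto
  have fin: "emeasure \<mu> (C \<inter> ?L) < \<infinity>" "emeasure \<mu> (C \<inter> ?R) < \<infinity>" "emeasure \<mu> C' < \<infinity>"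
    by (rule sub_E_finite; use C(2) C'(2) in blast)+
  have CU: "(C \<inter> ?L) \<union> (C \<inter> ?R) = C" using C by auto
  have CD: "(C \<inter> ?L) \<inter> (C \<inter> ?R) = {}" by auto
  have AE: "AE \<omega> in M. centered C \<omega> = centered (C \<inter> ?L) \<omega> + centered (C \<inter> ?R) \<omega>"
    using centered_Un[OF CL(1) fin(1) CL(2) fin(2) CD] unfolding CU .
  have past: "(\<lambda>\<omega>. indicator ?H \<omega> * centered (C \<inter> ?L) \<omega>) \<in> borel_measurable (F s')"
    using C(3) s H2 by (intro borel_measurable_times borel_measurable_indicator centered_past CL) auto
  have ind: "(indicat_real ?H) \<in> borel_measurable (F s')" using H2 by simp
  have fut: "centered C' \<in> borel_measurable (future s')" "(\<lambda>\<omega>. centered (C \<inter> ?R) \<omega> * centered C' \<omega>) \<in> borel_measurable (future s')"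
    using C' CL by (auto intro!: borel_measurable_times centered_future)
  have s': "0 \<le> s'" using s by simp
  have int1: "integrable M (\<lambda>\<omega>. indicator ?H \<omega> * centered (C \<inter> ?L) \<omega>)"
    using integrable_mult_indicator[OF HM centered_moments(1)[OF CL(1) fin(1)]] by simp
  have iv1: "indep_var borel (\<lambda>\<omega>. indicator ?H \<omega> * centered (C \<inter> ?L) \<omega>) borel (centered C')"
    by (rule past_future_indep[OF s' past fut(1)])
  have iv2: "indep_var borel (indicat_real ?H) borel (\<lambda>\<omega>. centered (C \<inter> ?R) \<omega> * centered C' \<omega>)"
    by (rule past_future_indep[OF s' ind fut(2)])
  have int2: "integrable M (indicat_real ?H)" by (rule integrable_indicator_event[OF HM])
  have int3: "integrable M (\<lambda>\<omega>. centered (C \<inter> ?R) \<omega> * centered C' \<omega>)"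
    by (rule centered_mult_integrable[OF CL(2) fin(2) C'(1) fin(3)])
  have b1: "has_bochner_integral M (\<lambda>\<omega>. indicator ?H \<omega> * centered (C \<inter> ?L) \<omega> * centered C' \<omega>) 0"
    using indep_var_lebesgue_integral[OF iv1 int1 centered_moments(1)[OF C'(1) fin(3)]]
      indep_var_integrable[OF iv1 int1 centered_moments(1)[OF C'(1) fin(3)]] centered_moments(2)[OF C'(1) fin(3)]
    by (simp add: has_bochner_integral_iff)
  have meq: "C \<inter> ?R \<inter> C' = C \<inter> C'" using C'(3) by auto
  have b2: "has_bochner_integral M (\<lambda>\<omega>. indicator ?H \<omega> * (centered (C \<inter> ?R) \<omega> * centered C' \<omega>)) (prob ?H * measure \<mu> (C \<inter> C'))"
    using indep_var_lebesgue_integral[OF iv2 int2 int3] indep_var_integrable[OF iv2 int2 int3] HM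
      centered_covariance[OF CL(2) fin(2) C'(1) fin(3)] sets.sets_into_space[OF HM]
    by (simp add: has_bochner_integral_iff meq Int_absorb2)
  have "expectation (\<lambda>\<omega>. (indicator H \<omega> * centered C \<omega>) * (indicator H' \<omega> * centered C' \<omega>)) =
    expectation (\<lambda>\<omega>. indicator ?H \<omega> * centered (C \<inter> ?L) \<omega> * centered C' \<omega> + indicator ?H \<omega> * (centered (C \<inter> ?R) \<omega> * centered C' \<omega>))"
  proof (rule integral_cong_AE)
    have "H \<in> sets M" "H' \<in> sets M" using H sub_F by auto
    then show "(\<lambda>\<omega>. (indicator H \<omega> * centered C \<omega>) * (indicator H' \<omega> * centered C' \<omega>)) \<in> borel_measurable M"
      using C C' by (intro borel_measurable_times borel_measurable_indicator centered_measurable)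
    show "(\<lambda>\<omega>. indicator ?H \<omega> * centered (C \<inter> ?L) \<omega> * centered C' \<omega> + indicator ?H \<omega> * (centered (C \<inter> ?R) \<omega> * centered C' \<omega>)) \<in> borel_measurable M"
      using HM CL C' by (intro borel_measurable_add borel_measurable_times borel_measurable_indicator centered_measurable)
    show "AE \<omega> in M. (indicator H \<omega> * centered C \<omega>) * (indicator H' \<omega> * centered C' \<omega>) =
      indicator ?H \<omega> * centered (C \<inter> ?L) \<omega> * centered C' \<omega> + indicator ?H \<omega> * (centered (C \<inter> ?R) \<omega> * centered C' \<omega>)"
      using AE by eventually_elim (auto simp: algebra_simps split: split_indicator)
  qed
  also have "\<dots> = 0 + prob ?H * measure \<mu> (C \<inter> C')"
    by (rule has_bochner_integral_integral_eq[OF has_bochner_integral_add[OF b1 b2]])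
  finally show ?thesis by simp
qed

lemma cint_gen_expectation:
  assumes A: "A \<in> gens"
  shows "expectation (cint (indicator A)) = 0"
proof -
  obtain H B' s t' where AA: "A = H \<times> (B' \<times> {s<..t'})" "H \<in> sets (F s)" "B' \<in> sets m" "0 \<le> s"
    using A by (auto simp: gens_def)
  let ?C = "E \<inter> B' \<times> {s<..t'}"
  have C: "?C \<in> sets \<mu>" using AA E_sets by (intro sets.Int) (auto simp: sets_intensity)
  have fin: "emeasure \<mu> ?C < \<infinity>" by (rule sub_E_finite) auto
  have HM: "H \<in> sets M" using AA sub_F by auto
  have sub: "?C \<subseteq> space m \<times> {s<..}" using E_subset by auto
  have ind: "(indicat_real H) \<in> borel_measurable (F s)" using AA by simp
  have iv: "indep_var borel (indicat_real H) borel (centered ?C)"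
    by (rule past_future_indep[OF AA(4) ind centered_future[OF C sub]])
  have int: "integrable M (indicat_real H)" by (rule integrable_indicator_event[OF HM])
  have "expectation (cint (indicator A)) = expectation (\<lambda>\<omega>. indicator H \<omega> * centered ?C \<omega>)"
  proof (rule integral_cong_AE)
    show "cint (indicator A) \<in> borel_measurable M"
      using bounded_pred_gen[OF A] by (intro cint_measurable) (simp add: bounded_pred_def)
    show "(\<lambda>\<omega>. indicator H \<omega> * centered ?C \<omega>) \<in> borel_measurable M"
      by (intro borel_measurable_times borel_measurable_indicator centered_measurable HM C)
    show "AE \<omega> in M. cint (indicator A) \<omega> = indicator H \<omega> * centered ?C \<omega>"
      using AE_E_finite AE_space by eventually_elim (simp only: AA(1) cint_gen[OF AA(3)])
  qed
  also have "\<dots> = 0"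
    using indep_var_lebesgue_integral[OF iv int centered_moments(1)[OF C fin]] centered_moments(2)[OF C fin] by simp
  finally show ?thesis .
qed

lemma cint_gen_product:
  assumes A: "A \<in> gens" and A': "A' \<in> gens"
  shows "expectation (\<lambda>\<omega>. cint (indicator A) \<omega> * cint (indicator A') \<omega>) = iprod (\<lambda>x. indicator A x * indicator A' x)"
proof -
  obtain H B1 s t1 where AA: "A = H \<times> (B1 \<times> {s<..t1})" "H \<in> sets (F s)" "B1 \<in> sets m" "0 \<le> s"
    using A by (auto simp: gens_def)
  obtain H' B1' s' t1' where AA': "A' = H' \<times> (B1' \<times> {s'<..t1'})" "H' \<in> sets (F s')" "B1' \<in> sets m" "0 \<le> s'"
    using A' by (auto simp: gens_def)
  let ?C = "E \<inter> B1 \<times> {s<..t1}" and ?C' = "E \<inter> B1' \<times> {s'<..t1'}"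
  have C: "?C \<in> sets \<mu>" "?C' \<in> sets \<mu>" using AA AA' E_sets by (auto simp: sets_intensity intro!: sets.Int)
  have HM: "H \<in> sets M" "H' \<in> sets M" using AA AA' sub_F by auto
  have "expectation (\<lambda>\<omega>. cint (indicator A) \<omega> * cint (indicator A') \<omega>) =
    expectation (\<lambda>\<omega>. (indicator H \<omega> * centered ?C \<omega>) * (indicator H' \<omega> * centered ?C' \<omega>))"
  proof (rule integral_cong_AE)
    show "(\<lambda>\<omega>. cint (indicator A) \<omega> * cint (indicator A') \<omega>) \<in> borel_measurable M"
      using bounded_pred_gen[OF A] bounded_pred_gen[OF A']
      by (intro borel_measurable_times cint_measurable) (simp_all add: bounded_pred_def)
    show "(\<lambda>\<omega>. (indicator H \<omega> * centered ?C \<omega>) * (indicator H' \<omega> * centered ?C' \<omega>)) \<in> borel_measurable M"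
      by (intro borel_measurable_times borel_measurable_indicator centered_measurable HM C)
    show "AE \<omega> in M. cint (indicator A) \<omega> * cint (indicator A') \<omega> =
        (indicator H \<omega> * centered ?C \<omega>) * (indicator H' \<omega> * centered ?C' \<omega>)"
      using AE_E_finite AE_space by eventually_elim (simp only: AA(1) AA'(1) cint_gen[OF AA(3)] cint_gen[OF AA'(3)])
  qed
  also have "\<dots> = prob (H \<inter> H') * measure \<mu> (?C \<inter> ?C')"
  proof -
    have sub: "?C \<subseteq> E" "?C' \<subseteq> E" "?C \<subseteq> space m \<times> {s<..}" "?C' \<subseteq> space m \<times> {s'<..}"
      using E_subset by auto
    \<comment> \<open>The covariance formula orders the starting times; the other order follows by
      exchanging the roles of the two rectangles.\<close>
    consider "s \<le> s'" | "s' \<le> s" by linarith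
    then show ?thesis
    proof cases
      case 1
      show ?thesis
        by (rule centered_shifted_covariance[OF AA(4) 1 AA(2) AA'(2) C(1) sub(1,3) C(2) sub(2,4)])
    next
      case 2
      show ?thesis
        using centered_shifted_covariance[OF AA'(4) 2 AA'(2) AA(2) C(2) sub(2,4) C(1) sub(1,3)]
        by (simp add: mult_ac Int_commute)
    qed
  qed
  also have "\<dots> = iprod (\<lambda>x. indicator A x * indicator A' x)"
  proof -
    have "cutoff (\<lambda>x. indicator A x * indicator A' x) \<omega> = (\<lambda>p. indicator (H \<inter> H') \<omega> * indicator (?C \<inter> ?C') p)" for \<omega>
      by (auto simp: cutoff_def AA AA' fun_eq_iff split: split_indicator)
    moreover have "?C \<inter> ?C' \<inter> space \<mu> = ?C \<inter> ?C'"
      using sets.sets_into_space[OF C(1)] by auto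
    ultimately have "iprod (\<lambda>x. indicator A x * indicator A' x) = expectation (\<lambda>\<omega>. indicator (H \<inter> H') \<omega> * measure \<mu> (?C \<inter> ?C'))"
      by (simp add: iprod_def)
    also have "\<dots> = prob (H \<inter> H') * measure \<mu> (?C \<inter> ?C')"
      using HM sets.sets_into_space[OF HM(1)] by (simp add: Int_absorb2 Int_absorb1 le_infI1)
    finally show ?thesis ..
  qed
  finally show ?thesis .
qed

text \<open>The monotone class argument needs the constant 1. On the window it coincides with the
  indicator of this rectangle, and \<open>cint\<close> and \<open>iprod\<close> depend on values in
  the window only.\<close>

lemma gen_one: "space M \<times> (space m \<times> {0<..t}) \<in> gens"
  unfolding gens_def using t sets.top[of "F 0"] by force

lemma one_cong: "x \<in> space M \<times> E \<Longrightarrow> (1::real) = indicator (space M \<times> (space m \<times> {0<..t})) x"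
  using E_subset by (auto split: split_indicator)

lemma E_subset_PA: "space M \<times> E \<subseteq> space M \<times> (space m \<times> {0<..})"
  using E_subset by auto

lemma iprod_cong: "(\<And>x. x \<in> space M \<times> E \<Longrightarrow> u x = v x) \<Longrightarrow> iprod u = iprod v"
  unfolding iprod_def by (intro Bochner_Integration.integral_cong refl) (auto simp: cutoff_def split: split_indicator)

lemma bounded_predI: "h \<in> borel_measurable PA \<Longrightarrow> (\<And>x. x \<in> space M \<times> (space m \<times> {0<..}) \<Longrightarrow> \<bar>h x\<bar> \<le> C) \<Longrightarrow> bounded_pred h C"
  unfolding bounded_pred_def space_PA by blast

lemma cint_expectation:
  assumes h: "bounded_pred h C"
  shows "expectation (cint h) = 0"
proof (rule bounded_monotone_class[OF gens_subset gens_Int_stable, folded PA_sigma, where P = "\<lambda>h. expectation (cint h) = 0" and h = h])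
  show "h \<in> borel_measurable PA" "\<And>x. x \<in> space M \<times> (space m \<times> {0<..}) \<Longrightarrow> \<bar>h x\<bar> \<le> C"
    using h unfolding bounded_pred_def space_PA by blast+
  have cong: "expectation (cint u) = expectation (cint v)" if "\<And>x. x \<in> space M \<times> E \<Longrightarrow> u x = v x" for u v
    by (intro Bochner_Integration.integral_cong refl cint_cong that)
  show "expectation (cint (\<lambda>_. 1)) = 0"
    using cong[OF one_cong] cint_gen_expectation[OF gen_one] by simp
  show "expectation (cint v) = 0" if "expectation (cint u) = 0" "\<And>x. x \<in> space M \<times> (space m \<times> {0<..}) \<Longrightarrow> u x = v x" for u v
    using that(1) cong[OF that(2)[OF subsetD[OF E_subset_PA]]] by simp
next
  fix u v :: "'w \<times> 'e \<times> real \<Rightarrow> real" and c B B'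
  assume uv: "u \<in> borel_measurable PA" "v \<in> borel_measurable PA"
    "\<And>x. x \<in> space M \<times> (space m \<times> {0<..}) \<Longrightarrow> \<bar>u x\<bar> \<le> B"
    "\<And>x. x \<in> space M \<times> (space m \<times> {0<..}) \<Longrightarrow> \<bar>v x\<bar> \<le> B'" and
    0: "expectation (cint u) = 0" "expectation (cint v) = 0"
  have b: "bounded_pred u B" "bounded_pred v B'" using uv by (auto intro!: bounded_predI)
  have "expectation (cint (\<lambda>x. u x + c * v x)) = expectation (\<lambda>\<omega>. cint u \<omega> + c * cint v \<omega>)"
    by (intro Bochner_Integration.integral_cong refl cint_lin[OF b])
  then show "expectation (cint (\<lambda>x. u x + c * v x)) = 0"
    using 0 cint_integrable[OF b(1)] cint_integrable[OF b(2)] by simp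
next
  fix u :: "nat \<Rightarrow> 'w \<times> 'e \<times> real \<Rightarrow> real" and v B
  assume u: "\<And>n. u n \<in> borel_measurable PA" "\<And>n. expectation (cint (u n)) = 0"
    "\<And>n x. x \<in> space M \<times> (space m \<times> {0<..}) \<Longrightarrow> \<bar>u n x\<bar> \<le> B"
    "\<And>x. x \<in> space M \<times> (space m \<times> {0<..}) \<Longrightarrow> (\<lambda>n. u n x) \<longlonglongrightarrow> v x" "v \<in> borel_measurable PA"
  have b: "bounded_pred (u n) B" for n using u by (auto intro!: bounded_predI)
  have "(\<lambda>n. expectation (cint (u n))) \<longlonglongrightarrow> expectation (cint v)"
    by (rule cint_lim_expectation[OF b u(5)]) (use u(4) in auto)
  then show "expectation (cint v) = 0" using u(2) by (simp add: LIMSEQ_const_iff)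
qed (rule cint_gen_expectation)

text \<open>A monotone class argument in the second factor with the first one fixed. It is applied
  twice, the first time with \<open>k\<close> the indicator of a rectangle, to reach the bilinear
  identity \<open>cint_product\<close>.\<close>

lemma cint_product_extend:
  assumes k: "bounded_pred k C'" and h: "bounded_pred h C"
    and basic: "\<And>A. A \<in> gens \<Longrightarrow> expectation (\<lambda>\<omega>. cint k \<omega> * cint (indicator A) \<omega>) = iprod (\<lambda>x. k x * indicator A x)"
  shows "expectation (\<lambda>\<omega>. cint k \<omega> * cint h \<omega>) = iprod (\<lambda>x. k x * h x)"
proof (rule bounded_monotone_class[OF gens_subset gens_Int_stable, folded PA_sigma,
      where P = "\<lambda>h. expectation (\<lambda>\<omega>. cint k \<omega> * cint h \<omega>) = iprod (\<lambda>x. k x * h x)" and h = h])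
  show "h \<in> borel_measurable PA" "\<And>x. x \<in> space M \<times> (space m \<times> {0<..}) \<Longrightarrow> \<bar>h x\<bar> \<le> C"
    using h unfolding bounded_pred_def space_PA by blast+
  have cong: "expectation (\<lambda>\<omega>. cint k \<omega> * cint u \<omega>) = expectation (\<lambda>\<omega>. cint k \<omega> * cint v \<omega>)"
      "iprod (\<lambda>x. k x * u x) = iprod (\<lambda>x. k x * v x)"
    if "\<And>x. x \<in> space M \<times> E \<Longrightarrow> u x = v x" for u v
    using cint_cong[OF that] that by (auto intro!: Bochner_Integration.integral_cong iprod_cong)
  show "expectation (\<lambda>\<omega>. cint k \<omega> * cint (\<lambda>_. 1) \<omega>) = iprod (\<lambda>x. k x * 1)"
    using cong(1)[OF one_cong] cong(2)[OF one_cong] basic[OF gen_one] by simp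
  show "expectation (\<lambda>\<omega>. cint k \<omega> * cint v \<omega>) = iprod (\<lambda>x. k x * v x)"
    if "expectation (\<lambda>\<omega>. cint k \<omega> * cint u \<omega>) = iprod (\<lambda>x. k x * u x)"
      "\<And>x. x \<in> space M \<times> (space m \<times> {0<..}) \<Longrightarrow> u x = v x" for u v
    using that(1) cong[OF that(2)[OF subsetD[OF E_subset_PA]]] by simp
next
  fix u v :: "'w \<times> 'e \<times> real \<Rightarrow> real" and c B B'
  assume uv: "u \<in> borel_measurable PA" "v \<in> borel_measurable PA"
    "\<And>x. x \<in> space M \<times> (space m \<times> {0<..}) \<Longrightarrow> \<bar>u x\<bar> \<le> B"
    "\<And>x. x \<in> space M \<times> (space m \<times> {0<..}) \<Longrightarrow> \<bar>v x\<bar> \<le> B'" and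
    0: "expectation (\<lambda>\<omega>. cint k \<omega> * cint u \<omega>) = iprod (\<lambda>x. k x * u x)"
      "expectation (\<lambda>\<omega>. cint k \<omega> * cint v \<omega>) = iprod (\<lambda>x. k x * v x)"
  have b: "bounded_pred u B" "bounded_pred v B'" using uv by (auto intro!: bounded_predI)
  have "expectation (\<lambda>\<omega>. cint k \<omega> * cint (\<lambda>x. u x + c * v x) \<omega>) = expectation (\<lambda>\<omega>. cint k \<omega> * cint u \<omega> + c * (cint k \<omega> * cint v \<omega>))"
    by (intro Bochner_Integration.integral_cong refl) (simp add: cint_lin[OF b] algebra_simps)
  also have "\<dots> = iprod (\<lambda>x. k x * u x) + c * iprod (\<lambda>x. k x * v x)"
    using 0 cint_mult_integrable[OF k b(1)] cint_mult_integrable[OF k b(2)] by simp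
  also have "\<dots> = iprod (\<lambda>x. k x * u x + c * (k x * v x))"
    by (rule iprod_lin[OF bounded_pred_mult[OF k b(1)] bounded_pred_mult[OF k b(2)], symmetric])
  finally show "expectation (\<lambda>\<omega>. cint k \<omega> * cint (\<lambda>x. u x + c * v x) \<omega>) = iprod (\<lambda>x. k x * (u x + c * v x))"
    by (simp add: algebra_simps)
next
  fix u :: "nat \<Rightarrow> 'w \<times> 'e \<times> real \<Rightarrow> real" and v B
  assume u: "\<And>n. u n \<in> borel_measurable PA" "\<And>n. expectation (\<lambda>\<omega>. cint k \<omega> * cint (u n) \<omega>) = iprod (\<lambda>x. k x * u n x)"
    "\<And>n x. x \<in> space M \<times> (space m \<times> {0<..}) \<Longrightarrow> \<bar>u n x\<bar> \<le> B"
    "\<And>x. x \<in> space M \<times> (space m \<times> {0<..}) \<Longrightarrow> (\<lambda>n. u n x) \<longlonglongrightarrow> v x" "v \<in> borel_measurable PA"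
  have b: "bounded_pred (u n) B" for n using u by (auto intro!: bounded_predI)
  have km: "k \<in> borel_measurable PA" using k by (simp add: bounded_pred_def)
  have 1: "(\<lambda>n. expectation (\<lambda>\<omega>. cint k \<omega> * cint (u n) \<omega>)) \<longlonglongrightarrow> expectation (\<lambda>\<omega>. cint k \<omega> * cint v \<omega>)"
    by (rule cint_mult_lim[OF b u(5) _ k]) (use u(4) in auto)
  have 2: "(\<lambda>n. iprod (\<lambda>x. k x * u n x)) \<longlonglongrightarrow> iprod (\<lambda>x. k x * v x)"
    by (rule iprod_lim[OF bounded_pred_mult[OF k b]])
      (use u(4,5) km in \<open>auto intro!: tendsto_mult borel_measurable_times\<close>)
  show "expectation (\<lambda>\<omega>. cint k \<omega> * cint v \<omega>) = iprod (\<lambda>x. k x * v x)"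
    using LIMSEQ_unique[OF 1] 2 u(2) by simp
qed (rule basic)

lemma cint_product:
  assumes k: "bounded_pred k C'" and h: "bounded_pred h C"
  shows "expectation (\<lambda>\<omega>. cint k \<omega> * cint h \<omega>) = iprod (\<lambda>x. k x * h x)"
proof (rule cint_product_extend[OF k h])
  fix A assume A: "A \<in> gens"
  have "expectation (\<lambda>\<omega>. cint (indicator A) \<omega> * cint k \<omega>) = iprod (\<lambda>x. indicator A x * k x)"
    by (rule cint_product_extend[OF bounded_pred_gen[OF A] k cint_gen_product[OF A]])
  then show "expectation (\<lambda>\<omega>. cint k \<omega> * cint (indicator A) \<omega>) = iprod (\<lambda>x. k x * indicator A x)"
    by (simp add: mult.commute)
qed

lemma iprod_nn_integral:
  assumes h: "bounded_pred h C" and pos: "\<And>x. 0 \<le> h x"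
  shows "ennreal (iprod h) = (\<integral>\<^sup>+\<omega>. \<integral>\<^sup>+p. ennreal (cutoff h \<omega> p) \<partial>\<mu> \<partial>M)"
proof -
  have c: "0 \<le> cutoff h \<omega> p" for \<omega> p using pos by (simp add: cutoff_def)
  have "ennreal (iprod h) = (\<integral>\<^sup>+\<omega>. ennreal (\<integral>p. cutoff h \<omega> p \<partial>\<mu>) \<partial>M)"
    unfolding iprod_def using mu_integral_integrable[OF h] c
    by (intro nn_integral_eq_integral[symmetric]) auto
  also have "\<dots> = (\<integral>\<^sup>+\<omega>. \<integral>\<^sup>+p. ennreal (cutoff h \<omega> p) \<partial>\<mu> \<partial>M)"
    using c by (intro nn_integral_cong nn_integral_eq_integral[symmetric] cutoff_integral(3)[OF h]) auto
  finally show ?thesis .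
qed

text \<open>Since \<open>cint h\<close> has mean 0, the integrals against the random measure and
  against its intensity have the same mean; positivity allows the statement in extended reals, where
  Fatou's lemma applies later.\<close>

lemma window_compensation:
  assumes h: "bounded_pred h C" and pos: "\<And>x. 0 \<le> h x"
  shows "(\<integral>\<^sup>+\<omega>. \<integral>\<^sup>+p. ennreal (cutoff h \<omega> p) \<partial>K \<omega> \<partial>M) = (\<integral>\<^sup>+\<omega>. \<integral>\<^sup>+p. ennreal (cutoff h \<omega> p) \<partial>\<mu> \<partial>M)"
proof -
  have c: "0 \<le> cutoff h \<omega> p" for \<omega> p using pos by (simp add: cutoff_def)
  have i: "integrable M (\<lambda>\<omega>. cint h \<omega> + (\<integral>p. cutoff h \<omega> p \<partial>\<mu>))"
    by (intro Bochner_Integration.integrable_add cint_integrable[OF h] mu_integral_integrable[OF h])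
  have "(\<integral>\<^sup>+\<omega>. \<integral>\<^sup>+p. ennreal (cutoff h \<omega> p) \<partial>K \<omega> \<partial>M) = (\<integral>\<^sup>+\<omega>. ennreal (\<integral>p. cutoff h \<omega> p \<partial>K \<omega>) \<partial>M)"
    using c by (intro nn_integral_cong nn_integral_eq_integral cutoff_integral(1)[OF h]) auto
  also have "\<dots> = (\<integral>\<^sup>+\<omega>. ennreal (cint h \<omega> + (\<integral>p. cutoff h \<omega> p \<partial>\<mu>)) \<partial>M)"
    by (simp add: cint_def)
  also have "\<dots> = ennreal (expectation (\<lambda>\<omega>. cint h \<omega> + (\<integral>p. cutoff h \<omega> p \<partial>\<mu>)))"
    using c by (intro nn_integral_eq_integral i) (auto simp: cint_def)
  also have "\<dots> = ennreal (iprod h)"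
    using cint_expectation[OF h] cint_integrable[OF h] mu_integral_integrable[OF h] by (simp add: iprod_def)
  finally show ?thesis unfolding iprod_nn_integral[OF h pos] .
qed

lemma window_isometry:
  assumes h: "bounded_pred h C"
  shows "(\<integral>\<^sup>+\<omega>. ennreal ((cint h \<omega>)\<^sup>2) \<partial>M) = (\<integral>\<^sup>+\<omega>. \<integral>\<^sup>+p. ennreal (cutoff (\<lambda>x. (h x)\<^sup>2) \<omega> p) \<partial>\<mu> \<partial>M)"
proof -
  have "(\<integral>\<^sup>+\<omega>. ennreal ((cint h \<omega>)\<^sup>2) \<partial>M) = ennreal (expectation (\<lambda>\<omega>. cint h \<omega> * cint h \<omega>))"
    unfolding power2_eq_square by (intro nn_integral_eq_integral cint_mult_integrable[OF h h]) auto
  also have "\<dots> = ennreal (iprod (\<lambda>x. h x * h x))" by (simp only: cint_product[OF h h])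
  also have "\<dots> = (\<integral>\<^sup>+\<omega>. \<integral>\<^sup>+p. ennreal (cutoff (\<lambda>x. h x * h x) \<omega> p) \<partial>\<mu> \<partial>M)"
    by (rule iprod_nn_integral[OF bounded_pred_mult[OF h h]]) simp
  finally show ?thesis by (simp add: power2_eq_square)
qed

lemma K_integral_measurable: "h \<in> borel_measurable PA \<Longrightarrow>
    (\<lambda>\<omega>. \<integral>\<^sup>+p. ennreal (cutoff h \<omega> p) \<partial>K \<omega>) \<in> borel_measurable M"
  by (rule measurable_F_M[OF KF.nn_integral_fin_restr_measurable])
    (use measurable_compose[OF cutoff_measurable_F measurable_ennreal] in \<open>simp add: case_prod_unfold\<close>)

lemma K_integral_eq:
  assumes h: "h \<in> borel_measurable PA" and \<omega>: "\<omega> \<in> space M" and fin: "emeasure (N \<omega>) E < \<infinity>"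
  shows "(\<integral>p. cutoff h \<omega> p \<partial>K \<omega>) = (\<integral>p. cutoff h \<omega> p \<partial>N \<omega>)"
    and "(\<integral>\<^sup>+p. ennreal (cutoff h \<omega> p) \<partial>K \<omega>) = (\<integral>\<^sup>+p. ennreal (cutoff h \<omega> p) \<partial>N \<omega>)"
proof -
  have K: "K \<omega> = density (N \<omega>) (\<lambda>p. ennreal (indicator E p))"
    using fin by (simp add: fin_restr_def ennreal_indicator)
  have m: "cutoff h \<omega> \<in> borel_measurable (N \<omega>)" "indicat_real E \<in> borel_measurable (N \<omega>)"
    using cutoff_section[OF h \<omega>] sets_N[OF \<omega>] E_sets by (auto cong: measurable_cong_sets)
  have c: "indicator E p * cutoff h \<omega> p = cutoff h \<omega> p" for p by (simp add: cutoff_def split: split_indicator)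
  show "(\<integral>p. cutoff h \<omega> p \<partial>K \<omega>) = (\<integral>p. cutoff h \<omega> p \<partial>N \<omega>)"
    unfolding K using m by (subst integral_density) (auto simp: c)
  have "(\<integral>\<^sup>+p. ennreal (cutoff h \<omega> p) \<partial>K \<omega>) = (\<integral>\<^sup>+p. ennreal (indicator E p) * ennreal (cutoff h \<omega> p) \<partial>N \<omega>)"
    unfolding K using m by (intro nn_integral_density) auto
  also have "\<dots> = (\<integral>\<^sup>+p. ennreal (cutoff h \<omega> p) \<partial>N \<omega>)"
    by (intro nn_integral_cong) (auto simp: cutoff_def split: split_indicator)
  finally show "(\<integral>\<^sup>+p. ennreal (cutoff h \<omega> p) \<partial>K \<omega>) = (\<integral>\<^sup>+p. ennreal (cutoff h \<omega> p) \<partial>N \<omega>)" .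
qed

end

section \<open>From bounded integrands on windows to predictable integrands in L1\<close>

definition past_part :: "real \<Rightarrow> ('w \<times> 'e \<times> real \<Rightarrow> 'b::real_normed_vector) \<Rightarrow> 'w \<Rightarrow> 'e \<times> real \<Rightarrow> 'b" where
  "past_part t h \<omega> q = indicator {0<..t} (snd q) *\<^sub>R h (\<omega>, q)"

context poisson_basis
begin

lemma past_part_measurable_F:
  fixes h :: "'w \<times> 'e \<times> real \<Rightarrow> 'b::real_normed_vector"
  assumes h: "h \<in> borel_measurable PA"
  shows "(\<lambda>(\<omega>, q). past_part t h \<omega> q) \<in> borel_measurable (F t \<Otimes>\<^sub>M \<mu>)"
proof (rule measurable_cong[THEN iffD1, OF _ PA_measurable_past[OF h]])
  fix x assume "x \<in> space (F t \<Otimes>\<^sub>M \<mu>)"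
  then show "indicator (space M \<times> space m \<times> {0<..t}) x *\<^sub>R h x = (case x of (\<omega>, q) \<Rightarrow> past_part t h \<omega> q)"
    by (cases "snd (snd x) \<in> {0<..t}") (auto simp: past_part_def space_pair_measure)
qed

lemma past_part_measurable:
  "h \<in> borel_measurable PA \<Longrightarrow> (\<lambda>(\<omega>, q). past_part t h \<omega> q) \<in> borel_measurable (M \<Otimes>\<^sub>M \<mu>)"
  by (rule pair_F_measurable[OF past_part_measurable_F])

lemma past_part_section: "h \<in> borel_measurable PA \<Longrightarrow> \<omega> \<in> space M \<Longrightarrow> past_part t h \<omega> \<in> borel_measurable \<mu>"
  using measurable_Pair2[OF past_part_measurable] by simp

lemma past_part_section_N: "h \<in> borel_measurable PA \<Longrightarrow> \<omega> \<in> space M \<Longrightarrow> past_part t h \<omega> \<in> borel_measurable (N \<omega>)"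
  using past_part_section sets_N by (simp cong: measurable_cong_sets)

lemma sigma_finite_intensity: "sigma_finite_measure \<mu>"
proof -
  interpret pair_sigma_finite m half_line
    using sigma_finite_m sigma_finite_half_line by (simp add: pair_sigma_finite_def)
  show ?thesis unfolding intensity_def by (rule sigma_finite_measure_axioms)
qed

lemma windows:
  assumes t: "0 \<le> t"
  obtains B :: "nat \<Rightarrow> 'e set" where "incseq B" "(\<Union>n. B n) = space m"
    "\<And>n. poisson_window M F m N (B n) t"
proof -
  obtain B :: "nat \<Rightarrow> 'e set" where B: "range B \<subseteq> sets m" "(\<Union>n. B n) = space m"
    "\<And>i. emeasure m (B i) \<noteq> \<infinity>" "incseq B"
    using sigma_finite_measure.sigma_finite_incseq[OF sigma_finite_m] by metis
  have "poisson_window M F m N (B n) t" for n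
    using B t by unfold_locales (auto simp: less_top)
  then show thesis using that B by blast
qed

text \<open>Fatou's lemma twice. Truncating |h| at level n on windows that exhaust the mark space
  gives bounded integrands, whose means under \<open>N\<close> and \<open>\<mu>\<close> agree. Fatou
  over \<omega> makes the lower limit of their integrals finite almost surely; Fatou under
  \<open>N \<omega>\<close> bounds the full integral by that lower limit.\<close>

lemma past_N_integrable:
  fixes h :: "'w \<times> 'e \<times> real \<Rightarrow> 'b::{banach, second_countable_topology}"
  assumes t: "0 \<le> t" and h: "h \<in> borel_measurable PA"
    and fin: "(\<integral>\<^sup>+\<omega>. \<integral>\<^sup>+q. ennreal (norm (past_part t h \<omega> q)) \<partial>\<mu> \<partial>M) < \<infinity>"
  shows "AE \<omega> in M. integrable (N \<omega>) (past_part t h \<omega>)"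
proof -
  obtain B where B: "incseq B" "(\<Union>n. B n) = space m" and win: "\<And>n. poisson_window M F m N (B n) t"
    using windows[OF t] by metis
  define hn where "hn n x = min (norm (h x)) (real n)" for n x
  have hm: "hn n \<in> borel_measurable PA" for n
    unfolding hn_def[abs_def] using h by simp
  have bp: "poisson_window.bounded_pred M F m (hn n) (real n)" for n
    unfolding poisson_window.bounded_pred_def[OF win] using hm by (simp add: hn_def)
  let ?c = "\<lambda>n. poisson_window.cutoff (B n) t (hn n)"
  note cd = poisson_window.cutoff_def[OF win]
  let ?K = "\<lambda>n \<omega>. \<integral>\<^sup>+p. ennreal (?c n \<omega> p) \<partial>fin_restr N (B n \<times> {0<..t}) \<omega>"
  have le: "ennreal (?c n \<omega> p) \<le> ennreal (norm (past_part t h \<omega> p))" for n \<omega> p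
    by (cases p) (auto simp: cd hn_def past_part_def split: split_indicator)
  have lim: "(\<lambda>n. ennreal (?c n \<omega> p)) \<longlonglongrightarrow> ennreal (norm (past_part t h \<omega> p))" if p: "p \<in> space \<mu>" for \<omega> p
  proof -
    obtain e s where p': "p = (e, s)" by (cases p)
    then obtain k where k: "e \<in> B k" using p B(2) by auto
    obtain j where j: "norm (h (\<omega>, p)) \<le> real j" using real_arch_simple by blast
    have "?c n \<omega> p = norm (past_part t h \<omega> p)" if "n \<ge> max k j" for n
    proof -
      have "e \<in> B n" using incseqD[OF B(1), of k n] k that by auto
      moreover have "norm (h (\<omega>, p)) \<le> real n" using j that by linarith
      ultimately show ?thesis by (simp add: cd hn_def past_part_def p' split: split_indicator)
    qed
    then have "\<forall>\<^sub>F n in sequentially. ennreal (?c n \<omega> p) = ennreal (norm (past_part t h \<omega> p))"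
      unfolding eventually_sequentially by (intro exI[of _ "max k j"]) auto
    then show ?thesis by (rule tendsto_eventually)
  qed
  have Km: "?K n \<in> borel_measurable M" for n
    by (rule poisson_window.K_integral_measurable[OF win hm])
  have "(\<integral>\<^sup>+\<omega>. liminf (\<lambda>n. ?K n \<omega>) \<partial>M) \<le> liminf (\<lambda>n. \<integral>\<^sup>+\<omega>. ?K n \<omega> \<partial>M)"
    by (rule nn_integral_liminf[OF Km])
  also have "\<dots> \<le> (\<integral>\<^sup>+\<omega>. \<integral>\<^sup>+q. ennreal (norm (past_part t h \<omega> q)) \<partial>\<mu> \<partial>M)"
  proof (rule Liminf_le[OF sequentially_bot], rule always_eventually, rule allI)
    fix n
    have "(\<integral>\<^sup>+\<omega>. ?K n \<omega> \<partial>M) = (\<integral>\<^sup>+\<omega>. \<integral>\<^sup>+p. ennreal (?c n \<omega> p) \<partial>\<mu> \<partial>M)"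
      by (rule poisson_window.window_compensation[OF win bp]) (simp add: hn_def)
    also have "\<dots> \<le> (\<integral>\<^sup>+\<omega>. \<integral>\<^sup>+q. ennreal (norm (past_part t h \<omega> q)) \<partial>\<mu> \<partial>M)"
      by (intro nn_integral_mono le)
    finally show "(\<integral>\<^sup>+\<omega>. ?K n \<omega> \<partial>M) \<le> (\<integral>\<^sup>+\<omega>. \<integral>\<^sup>+q. ennreal (norm (past_part t h \<omega> q)) \<partial>\<mu> \<partial>M)" .
  qed
  finally have "(\<integral>\<^sup>+\<omega>. liminf (\<lambda>n. ?K n \<omega>) \<partial>M) < \<infinity>" using fin by (rule le_less_trans)
  then have AE1: "AE \<omega> in M. liminf (\<lambda>n. ?K n \<omega>) \<noteq> \<infinity>"
    using Km by (intro nn_integral_PInf_AE borel_measurable_liminf) auto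
  have "AE \<omega> in M. \<forall>n. emeasure (N \<omega>) (B n \<times> {0<..t}) < \<infinity>"
    by (subst AE_all_countable) (use poisson_window.AE_E_finite[OF win] in auto)
  with AE1 AE_space show ?thesis
  proof eventually_elim
    case (elim \<omega>)
    have c: "(\<lambda>p. ennreal (?c n \<omega> p)) \<in> borel_measurable (N \<omega>)" for n
      using poisson_window.cutoff_section[OF win hm elim(2)] sets_N[OF elim(2)]
      by (simp cong: measurable_cong_sets)
    have spN: "space (N \<omega>) = space \<mu>" using sets_N[OF elim(2)] by (rule sets_eq_imp_space_eq)
    have "(\<integral>\<^sup>+q. ennreal (norm (past_part t h \<omega> q)) \<partial>N \<omega>) = (\<integral>\<^sup>+q. liminf (\<lambda>n. ennreal (?c n \<omega> q)) \<partial>N \<omega>)"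
      using lim spN by (intro nn_integral_cong lim_imp_Liminf[symmetric]) auto
    also have "\<dots> \<le> liminf (\<lambda>n. \<integral>\<^sup>+q. ennreal (?c n \<omega> q) \<partial>N \<omega>)"
      by (rule nn_integral_liminf[OF c])
    also have "\<dots> = liminf (\<lambda>n. ?K n \<omega>)"
      using elim by (simp add: poisson_window.K_integral_eq(2)[OF win hm])
    also have "\<dots> < \<infinity>" using elim(1) by (simp add: less_top)
    finally show ?case
      using past_part_section_N[OF h elim(2)] by (simp add: integrable_iff_bounded)
  qed
qed

lemma past_\<mu>_integrable:
  fixes h :: "'w \<times> 'e \<times> real \<Rightarrow> 'b::{banach, second_countable_topology}"
  assumes h: "h \<in> borel_measurable PA"
    and fin: "(\<integral>\<^sup>+\<omega>. \<integral>\<^sup>+q. ennreal (norm (past_part t h \<omega> q)) \<partial>\<mu> \<partial>M) < \<infinity>"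
  shows "AE \<omega> in M. integrable \<mu> (past_part t h \<omega>)"
proof -
  have "(\<lambda>x. ennreal (norm (case x of (\<omega>, q) \<Rightarrow> past_part t h \<omega> q))) \<in> borel_measurable (M \<Otimes>\<^sub>M \<mu>)"
    using past_part_measurable[OF h, of t] by simp
  from sigma_finite_measure.borel_measurable_nn_integral_fst[OF sigma_finite_intensity this]
  have "(\<lambda>\<omega>. \<integral>\<^sup>+q. ennreal (norm (past_part t h \<omega> q)) \<partial>\<mu>) \<in> borel_measurable M" by simp
  then have "AE \<omega> in M. (\<integral>\<^sup>+q. ennreal (norm (past_part t h \<omega> q)) \<partial>\<mu>) \<noteq> \<infinity>"
    using fin by (intro nn_integral_PInf_AE) auto
  with AE_space show ?thesis
    by eventually_elim (use past_part_section[OF h] in \<open>auto simp: integrable_iff_bounded less_top\<close>)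
qed

text \<open>\<open>P\<close> is a measurable version of the pathwise difference, whose own
  measurability in \<omega> is not evident from its definition through \<open>N \<omega>\<close>.
  Fatou's lemma turns the isometry on windows into an inequality, the form in which it is used for
  all later estimates.\<close>

lemma scalar_isometry:
  fixes h :: "'w \<times> 'e \<times> real \<Rightarrow> real"
  assumes t: "0 \<le> t" and h: "h \<in> borel_measurable PA"
    and fin: "(\<integral>\<^sup>+\<omega>. \<integral>\<^sup>+q. ennreal (norm (past_part t h \<omega> q)) \<partial>\<mu> \<partial>M) < \<infinity>"
  shows "\<exists>P\<in>borel_measurable M. (AE \<omega> in M. P \<omega> = (\<integral>q. past_part t h \<omega> q \<partial>N \<omega>) - (\<integral>q. past_part t h \<omega> q \<partial>\<mu>)) \<and>
    (\<integral>\<^sup>+\<omega>. ennreal ((P \<omega>)\<^sup>2) \<partial>M) \<le> (\<integral>\<^sup>+\<omega>. \<integral>\<^sup>+q. ennreal ((past_part t h \<omega> q)\<^sup>2) \<partial>\<mu> \<partial>M)"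
proof -
  obtain B where B: "incseq B" "(\<Union>n. B n) = space m" and win: "\<And>n. poisson_window M F m N (B n) t"
    using windows[OF t] by metis
  \<comment> \<open>Large values are replaced by 0, which keeps |hn| below both n and |h|; hence |h|
    serves as majorant for both integrals.\<close>
  define hn where "hn n x = (if \<bar>h x\<bar> \<le> real n then h x else 0)" for n x
  have hm: "hn n \<in> borel_measurable PA" for n
  proof -
    note [measurable] = h
    show ?thesis unfolding hn_def[abs_def] by measurable
  qed
  have bp: "poisson_window.bounded_pred M F m (hn n) (real n)" for n
    unfolding poisson_window.bounded_pred_def[OF win] using hm by (auto simp: hn_def)
  let ?c = "\<lambda>n. poisson_window.cutoff (B n) t (hn n)"
  let ?P = "\<lambda>n. poisson_window.cint m N (B n) t (hn n)"
  note cd = poisson_window.cutoff_def[OF win]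
  have le: "\<bar>?c n \<omega> p\<bar> \<le> \<bar>past_part t h \<omega> p\<bar>" for n \<omega> p
    by (cases p) (auto simp: cd hn_def past_part_def split: split_indicator)
  have lim: "(\<lambda>n. ?c n \<omega> p) \<longlonglongrightarrow> past_part t h \<omega> p" if p: "p \<in> space \<mu>" for \<omega> p
  proof -
    obtain e s where p': "p = (e, s)" by (cases p)
    then obtain k where k: "e \<in> B k" using p B(2) by auto
    obtain j where j: "\<bar>h (\<omega>, p)\<bar> \<le> real j" using real_arch_simple by blast
    have "?c n \<omega> p = past_part t h \<omega> p" if "n \<ge> max k j" for n
    proof -
      have "e \<in> B n" using incseqD[OF B(1), of k n] k that by auto
      moreover have "\<bar>h (\<omega>, p)\<bar> \<le> real n" using j that by linarith
      ultimately show ?thesis by (simp add: cd hn_def past_part_def p' split: split_indicator)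
    qed
    then have "\<forall>\<^sub>F n in sequentially. ?c n \<omega> p = past_part t h \<omega> p"
      unfolding eventually_sequentially by (intro exI[of _ "max k j"]) auto
    then show ?thesis by (rule tendsto_eventually)
  qed
  have Pm: "?P n \<in> borel_measurable M" for n by (rule poisson_window.cint_measurable[OF win hm])
  \<comment> \<open>\<open>lim\<close> has some value also where the sequence diverges, so
    \<open>P\<close> is measurable on the whole space and is the true limit almost surely.\<close>
  define P where "P \<omega> = lim (\<lambda>n. ?P n \<omega>)" for \<omega>
  have Pmeas: "P \<in> borel_measurable M" unfolding P_def[abs_def] by (rule borel_measurable_lim_metric[OF Pm])
  have finN: "AE \<omega> in M. \<forall>n. emeasure (N \<omega>) (B n \<times> {0<..t}) < \<infinity>"
    by (subst AE_all_countable) (use poisson_window.AE_E_finite[OF win] in auto)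
  have conv: "AE \<omega> in M. (\<lambda>n. ?P n \<omega>) \<longlonglongrightarrow> (\<integral>q. past_part t h \<omega> q \<partial>N \<omega>) - (\<integral>q. past_part t h \<omega> q \<partial>\<mu>)"
    using past_N_integrable[OF t h fin] past_\<mu>_integrable[OF h fin] finN AE_space
  proof eventually_elim
    case (elim \<omega>)
    have spN: "space (N \<omega>) = space \<mu>" using sets_N[OF elim(4)] by (rule sets_eq_imp_space_eq)
    have cm: "?c n \<omega> \<in> borel_measurable \<mu>" for n by (rule poisson_window.cutoff_section[OF win hm elim(4)])
    then have cN: "?c n \<omega> \<in> borel_measurable (N \<omega>)" for n
      using sets_N[OF elim(4)] by (simp cong: measurable_cong_sets)
    have "(\<lambda>n. \<integral>p. ?c n \<omega> p \<partial>N \<omega>) \<longlonglongrightarrow> (\<integral>q. past_part t h \<omega> q \<partial>N \<omega>)"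
      by (rule integral_dominated_convergence[where w = "\<lambda>q. \<bar>past_part t h \<omega> q\<bar>"])
        (use elim lim le cN spN past_part_section_N[OF h] in auto)
    moreover have "(\<lambda>n. \<integral>p. ?c n \<omega> p \<partial>\<mu>) \<longlonglongrightarrow> (\<integral>q. past_part t h \<omega> q \<partial>\<mu>)"
      by (rule integral_dominated_convergence[where w = "\<lambda>q. \<bar>past_part t h \<omega> q\<bar>"])
        (use elim lim le cm past_part_section[OF h] in auto)
    moreover have "?P n \<omega> = (\<integral>p. ?c n \<omega> p \<partial>N \<omega>) - (\<integral>p. ?c n \<omega> p \<partial>\<mu>)" for n
      unfolding poisson_window.cint_def[OF win]
      using poisson_window.K_integral_eq(1)[OF win hm elim(4)] elim(3) by simp
    ultimately show ?case by (simp add: tendsto_diff)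
  qed
  have Peq: "AE \<omega> in M. P \<omega> = (\<integral>q. past_part t h \<omega> q \<partial>N \<omega>) - (\<integral>q. past_part t h \<omega> q \<partial>\<mu>)"
    using conv by eventually_elim (simp add: P_def limI)
  have "(\<integral>\<^sup>+\<omega>. ennreal ((P \<omega>)\<^sup>2) \<partial>M) = (\<integral>\<^sup>+\<omega>. liminf (\<lambda>n. ennreal ((?P n \<omega>)\<^sup>2)) \<partial>M)"
  proof (rule nn_integral_cong_AE)
    show "AE \<omega> in M. ennreal ((P \<omega>)\<^sup>2) = liminf (\<lambda>n. ennreal ((?P n \<omega>)\<^sup>2))"
      using conv
    proof eventually_elim
      case (elim \<omega>)
      then have "(\<lambda>n. ?P n \<omega>) \<longlonglongrightarrow> P \<omega>" by (simp add: P_def limI)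
      then have "(\<lambda>n. ennreal ((?P n \<omega>)\<^sup>2)) \<longlonglongrightarrow> ennreal ((P \<omega>)\<^sup>2)"
        by (intro tendsto_ennrealI tendsto_power)
      then show ?case using lim_imp_Liminf[OF sequentially_bot] by metis
    qed
  qed
  also have "\<dots> \<le> liminf (\<lambda>n. \<integral>\<^sup>+\<omega>. ennreal ((?P n \<omega>)\<^sup>2) \<partial>M)"
    using Pm by (intro nn_integral_liminf) auto
  also have "\<dots> \<le> (\<integral>\<^sup>+\<omega>. \<integral>\<^sup>+q. ennreal ((past_part t h \<omega> q)\<^sup>2) \<partial>\<mu> \<partial>M)"
  proof (rule Liminf_le[OF sequentially_bot], rule always_eventually, rule allI)
    fix n
    have "(\<integral>\<^sup>+\<omega>. ennreal ((?P n \<omega>)\<^sup>2) \<partial>M) =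
        (\<integral>\<^sup>+\<omega>. \<integral>\<^sup>+p. ennreal (poisson_window.cutoff (B n) t (\<lambda>x. (hn n x)\<^sup>2) \<omega> p) \<partial>\<mu> \<partial>M)"
      by (rule poisson_window.window_isometry[OF win bp])
    also have "\<dots> \<le> (\<integral>\<^sup>+\<omega>. \<integral>\<^sup>+q. ennreal ((past_part t h \<omega> q)\<^sup>2) \<partial>\<mu> \<partial>M)"
    proof (intro nn_integral_mono ennreal_leI)
      fix \<omega> p
      have "poisson_window.cutoff (B n) t (\<lambda>x. (hn n x)\<^sup>2) \<omega> p = (?c n \<omega> p)\<^sup>2"
        by (simp add: cd split: split_indicator)
      then show "poisson_window.cutoff (B n) t (\<lambda>x. (hn n x)\<^sup>2) \<omega> p \<le> (past_part t h \<omega> p)\<^sup>2"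
        using le[of n \<omega> p] by (simp add: abs_le_square_iff)
    qed
    finally show "(\<integral>\<^sup>+\<omega>. ennreal ((?P n \<omega>)\<^sup>2) \<partial>M) \<le> (\<integral>\<^sup>+\<omega>. \<integral>\<^sup>+q. ennreal ((past_part t h \<omega> q)\<^sup>2) \<partial>\<mu> \<partial>M)" .
  qed
  finally show ?thesis using Pmeas Peq by blast
qed

lemma power_norm_eq:
  assumes g: "predictable M F m g"
  shows "power_norm M m p t g =
    (\<integral>\<^sup>+\<omega>. \<integral>\<^sup>+q. ennreal (norm (g \<omega> (fst q) (snd q)) ^ p) * indicator {0<..t} (snd q) \<partial>\<mu> \<partial>M)"
    "(\<lambda>(\<omega>, e, s). ennreal (norm (g \<omega> e s) ^ p) * indicator {0<..t} s) \<in> borel_measurable (M \<Otimes>\<^sub>M \<mu>)"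
proof -
  let ?h = "\<lambda>(\<omega>, e, s). g \<omega> e s"
  have h: "?h \<in> borel_measurable PA" using g by (simp add: predictable_def)
  have 1: "(\<lambda>(\<omega>, q). past_part t ?h \<omega> q) \<in> borel_measurable (M \<Otimes>\<^sub>M \<mu>)"
    by (rule past_part_measurable[OF h])
  have "(\<lambda>x. indicator {0<..t} (snd (snd x)) :: ennreal) \<in> borel_measurable (M \<Otimes>\<^sub>M \<mu>)"
    by (intro measurable_compose[OF measurable_snd] measurable_compose[OF measurable_snd[of m half_line], folded intensity_def]
      borel_measurable_indicator) auto
  with 1 have "(\<lambda>x. ennreal (norm (case x of (\<omega>, q) \<Rightarrow> past_part t ?h \<omega> q) ^ p) * indicator {0<..t} (snd (snd x)))
      \<in> borel_measurable (M \<Otimes>\<^sub>M \<mu>)" by measurable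
  also have "(\<lambda>x. ennreal (norm (case x of (\<omega>, q) \<Rightarrow> past_part t ?h \<omega> q) ^ p) * indicator {0<..t} (snd (snd x)))
      = (\<lambda>(\<omega>, e, s). ennreal (norm (g \<omega> e s) ^ p) * indicator {0<..t} s)"
    by (auto simp: past_part_def fun_eq_iff split: split_indicator)
  finally show m: "(\<lambda>(\<omega>, e, s). ennreal (norm (g \<omega> e s) ^ p) * indicator {0<..t} s) \<in> borel_measurable (M \<Otimes>\<^sub>M \<mu>)" .
  show "power_norm M m p t g =
    (\<integral>\<^sup>+\<omega>. \<integral>\<^sup>+q. ennreal (norm (g \<omega> (fst q) (snd q)) ^ p) * indicator {0<..t} (snd q) \<partial>\<mu> \<partial>M)"
    unfolding power_norm_def
    by (subst sigma_finite_measure.nn_integral_fst[OF sigma_finite_intensity m, symmetric])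
      (simp add: case_prod_unfold)
qed

text \<open>Applied coordinate by coordinate: squared coordinates add up to the squared norm on both
  sides, so vector values cost no extra constant.\<close>

lemma comp_isometry:
  fixes g :: "'w \<Rightarrow> 'e \<Rightarrow> real \<Rightarrow> 'b::euclidean_space"
  assumes t: "0 \<le> t" and g: "predictable M F m g" and fin: "power_norm M m 1 t g < \<infinity>"
  shows "AE \<omega> in M. integrable (N \<omega>) (\<lambda>(e, s). indicator {0<..t} s *\<^sub>R g \<omega> e s) \<and>
      integrable \<mu> (\<lambda>(e, s). indicator {0<..t} s *\<^sub>R g \<omega> e s)" (is "AE \<omega> in M. ?int \<omega>")
    and "\<exists>P\<in>borel_measurable M. (AE \<omega> in M. P \<omega> = pathwise_comp_integral m N g t \<omega>) \<and>
      (\<integral>\<^sup>+\<omega>. ennreal (norm (P \<omega>) ^ 2) \<partial>M) \<le> power_norm M m 2 t g"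
proof -
  define h where "h = (\<lambda>(\<omega>, e, s). g \<omega> e s)"
  have h: "h \<in> borel_measurable PA" using g by (simp add: predictable_def h_def)
  have pp: "past_part t h \<omega> = (\<lambda>(e, s). indicator {0<..t} s *\<^sub>R g \<omega> e s)" for \<omega>
    by (auto simp: past_part_def h_def)
  have "(\<integral>\<^sup>+\<omega>. \<integral>\<^sup>+q. ennreal (norm (past_part t h \<omega> q)) \<partial>\<mu> \<partial>M) = power_norm M m 1 t g"
    unfolding power_norm_eq(1)[OF g]
    by (intro nn_integral_cong) (auto simp: pp split: split_indicator)
  then have fin': "(\<integral>\<^sup>+\<omega>. \<integral>\<^sup>+q. ennreal (norm (past_part t h \<omega> q)) \<partial>\<mu> \<partial>M) < \<infinity>" using fin by simp
  show int: "AE \<omega> in M. ?int \<omega>"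
    using past_N_integrable[OF t h fin'] past_\<mu>_integrable[OF h fin'] unfolding pp by eventually_elim simp
  have comp: "past_part t (\<lambda>x. h x \<bullet> b) \<omega> q = past_part t h \<omega> q \<bullet> b" for b \<omega> q by (simp add: past_part_def)
  define R where "R b P \<longleftrightarrow> P \<in> borel_measurable M \<and>
    (AE \<omega> in M. P \<omega> = (\<integral>q. past_part t h \<omega> q \<bullet> b \<partial>N \<omega>) - (\<integral>q. past_part t h \<omega> q \<bullet> b \<partial>\<mu>)) \<and>
    (\<integral>\<^sup>+\<omega>. ennreal ((P \<omega>)\<^sup>2) \<partial>M) \<le> (\<integral>\<^sup>+\<omega>. \<integral>\<^sup>+q. ennreal ((past_part t h \<omega> q \<bullet> b)\<^sup>2) \<partial>\<mu> \<partial>M)" for b and P :: "'w \<Rightarrow> real"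
  have "\<exists>P. R b P" if b: "b \<in> Basis" for b
  proof -
    have hb: "(\<lambda>x. h x \<bullet> b) \<in> borel_measurable PA" using h by simp
    have "(\<integral>\<^sup>+\<omega>. \<integral>\<^sup>+q. ennreal (norm (past_part t h \<omega> q \<bullet> b)) \<partial>\<mu> \<partial>M) \<le> (\<integral>\<^sup>+\<omega>. \<integral>\<^sup>+q. ennreal (norm (past_part t h \<omega> q)) \<partial>\<mu> \<partial>M)"
      using b by (intro nn_integral_mono ennreal_leI) (simp add: Basis_le_norm)
    then have "(\<integral>\<^sup>+\<omega>. \<integral>\<^sup>+q. ennreal (norm (past_part t (\<lambda>x. h x \<bullet> b) \<omega> q)) \<partial>\<mu> \<partial>M) < \<infinity>"
      unfolding comp using fin' by (rule le_less_trans)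
    from scalar_isometry[OF t hb this] show ?thesis unfolding comp R_def by blast
  qed
  then have "\<forall>b\<in>Basis. \<exists>P. R b P" by blast
  from bchoice[OF this] obtain P where "\<forall>b\<in>Basis. R b (P b)" ..
  then have P: "\<And>b. b \<in> Basis \<Longrightarrow> P b \<in> borel_measurable M"
    "\<And>b. b \<in> Basis \<Longrightarrow> AE \<omega> in M. P b \<omega> = (\<integral>q. past_part t h \<omega> q \<bullet> b \<partial>N \<omega>) - (\<integral>q. past_part t h \<omega> q \<bullet> b \<partial>\<mu>)"
    "\<And>b. b \<in> Basis \<Longrightarrow> (\<integral>\<^sup>+\<omega>. ennreal ((P b \<omega>)\<^sup>2) \<partial>M) \<le> (\<integral>\<^sup>+\<omega>. \<integral>\<^sup>+q. ennreal ((past_part t h \<omega> q \<bullet> b)\<^sup>2) \<partial>\<mu> \<partial>M)"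
    unfolding R_def by blast+
  define Q where "Q \<omega> = (\<Sum>b\<in>Basis. P b \<omega> *\<^sub>R b)" for \<omega>
  have Qm: "Q \<in> borel_measurable M" unfolding Q_def[abs_def] using P(1) by (intro borel_measurable_sum borel_measurable_scaleR) auto
  have "AE \<omega> in M. \<forall>b\<in>Basis. P b \<omega> = (\<integral>q. past_part t h \<omega> q \<bullet> b \<partial>N \<omega>) - (\<integral>q. past_part t h \<omega> q \<bullet> b \<partial>\<mu>)"
    using P(2) by (intro AE_finite_allI) auto
  with int have Qeq: "AE \<omega> in M. Q \<omega> = pathwise_comp_integral m N g t \<omega>"
  proof eventually_elim
    case (elim \<omega>)
    have "P b \<omega> = pathwise_comp_integral m N g t \<omega> \<bullet> b" if "b \<in> Basis" for b
      using elim that unfolding pp[symmetric] pathwise_comp_integral_def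
      by (simp add: inner_diff_left)
    then show ?case unfolding Q_def by (simp add: euclidean_representation)
  qed
  have Qsq: "norm (Q \<omega>) ^ 2 = (\<Sum>b\<in>Basis. (P b \<omega>)\<^sup>2)" for \<omega>
  proof -
    have "Q \<omega> \<bullet> b = P b \<omega>" if "b \<in> Basis" for b
      using that unfolding Q_def by (simp add: inner_sum_left inner_Basis if_distrib cong: if_cong)
    then show ?thesis
      unfolding power2_norm_eq_inner euclidean_inner[of "Q \<omega>" "Q \<omega>"] by (simp add: power2_eq_square)
  qed
  have ppm: "(\<lambda>x. ennreal ((case x of (\<omega>, q) \<Rightarrow> past_part t h \<omega> q \<bullet> b)\<^sup>2)) \<in> borel_measurable (M \<Otimes>\<^sub>M \<mu>)" for b
  proof -
    have "(\<lambda>x. (case x of (\<omega>, q) \<Rightarrow> past_part t h \<omega> q) \<bullet> b) \<in> borel_measurable (M \<Otimes>\<^sub>M \<mu>)"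
      using past_part_measurable[OF h, of t] by simp
    then show ?thesis by (simp add: case_prod_unfold)
  qed
  have "(\<integral>\<^sup>+\<omega>. ennreal (norm (Q \<omega>) ^ 2) \<partial>M) = (\<Sum>b\<in>Basis. \<integral>\<^sup>+\<omega>. ennreal ((P b \<omega>)\<^sup>2) \<partial>M)"
    unfolding Qsq using P(1) by (subst nn_integral_sum[symmetric]) (auto simp: sum_ennreal)
  also have "\<dots> \<le> (\<Sum>b\<in>Basis. \<integral>\<^sup>+\<omega>. \<integral>\<^sup>+q. ennreal ((past_part t h \<omega> q \<bullet> b)\<^sup>2) \<partial>\<mu> \<partial>M)"
    by (intro sum_mono P(3))
  also have "\<dots> = (\<integral>\<^sup>+\<omega>. (\<Sum>b\<in>Basis. \<integral>\<^sup>+q. ennreal ((past_part t h \<omega> q \<bullet> b)\<^sup>2) \<partial>\<mu>) \<partial>M)"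
    using sigma_finite_measure.borel_measurable_nn_integral_fst[OF sigma_finite_intensity ppm]
    by (intro nn_integral_sum[symmetric]) auto
  also have "\<dots> = (\<integral>\<^sup>+\<omega>. \<integral>\<^sup>+q. (\<Sum>b\<in>Basis. ennreal ((past_part t h \<omega> q \<bullet> b)\<^sup>2)) \<partial>\<mu> \<partial>M)"
    using past_part_section[OF h] by (intro nn_integral_cong nn_integral_sum[symmetric]) auto
  also have "\<dots> = power_norm M m 2 t g"
    unfolding power_norm_eq(1)[OF g]
  proof (intro nn_integral_cong)
    fix \<omega> q
    have "(\<Sum>b\<in>Basis. ennreal ((past_part t h \<omega> q \<bullet> b)\<^sup>2)) = ennreal (norm (past_part t h \<omega> q) ^ 2)"
      unfolding power2_norm_eq_inner euclidean_inner[of "past_part t h \<omega> q" "past_part t h \<omega> q"]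
      by (simp add: sum_ennreal power2_eq_square)
    then show "(\<Sum>b\<in>Basis. ennreal ((past_part t h \<omega> q \<bullet> b)\<^sup>2)) = ennreal (norm (g \<omega> (fst q) (snd q)) ^ 2) * indicator {0<..t} (snd q)"
      by (auto simp: pp case_prod_unfold split: split_indicator)
  qed
  finally show "\<exists>P\<in>borel_measurable M. (AE \<omega> in M. P \<omega> = pathwise_comp_integral m N g t \<omega>) \<and>
      (\<integral>\<^sup>+\<omega>. ennreal (norm (P \<omega>) ^ 2) \<partial>M) \<le> power_norm M m 2 t g"
    using Qm Qeq by blast
qed

lemma norm_add_sq_le: "ennreal (norm (a + b) ^ 2) \<le> 2 * ennreal (norm a ^ 2) + 2 * ennreal (norm b ^ 2)"
  for a b :: "'b::real_normed_vector"
proof -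
  have "norm (a + b) ^ 2 \<le> (norm a + norm b) ^ 2" by (intro power_mono norm_triangle_ineq) simp
  also have "\<dots> \<le> 2 * norm a ^ 2 + 2 * norm b ^ 2"
    using sum_squares_bound[of "norm a" "norm b"] by (simp add: power2_sum)
  finally have "ennreal (norm (a + b) ^ 2) \<le> ennreal (2 * norm a ^ 2 + 2 * norm b ^ 2)" by (rule ennreal_leI)
  then show ?thesis by (simp add: ennreal_plus ennreal_mult')
qed

lemma power_norm_add:
  fixes u v :: "'w \<Rightarrow> 'e \<Rightarrow> real \<Rightarrow> 'b::euclidean_space"
  assumes u: "predictable M F m u" and v: "predictable M F m v"
  shows "power_norm M m 2 t (\<lambda>\<omega> e s. u \<omega> e s + v \<omega> e s) \<le> 2 * power_norm M m 2 t u + 2 * power_norm M m 2 t v"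
    and "power_norm M m 1 t (\<lambda>\<omega> e s. u \<omega> e s + v \<omega> e s) \<le> power_norm M m 1 t u + power_norm M m 1 t v"
proof -
  note um = power_norm_eq(2)[OF u, of _ t] and vm = power_norm_eq(2)[OF v, of _ t]
  have "power_norm M m 2 t (\<lambda>\<omega> e s. u \<omega> e s + v \<omega> e s) \<le>
    (\<integral>\<^sup>+x. 2 * (case x of (\<omega>, e, s) \<Rightarrow> ennreal (norm (u \<omega> e s) ^ 2) * indicator {0<..t} s) +
      2 * (case x of (\<omega>, e, s) \<Rightarrow> ennreal (norm (v \<omega> e s) ^ 2) * indicator {0<..t} s) \<partial>(M \<Otimes>\<^sub>M \<mu>))"
    unfolding power_norm_def
    by (intro nn_integral_mono) (auto split: split_indicator intro!: norm_add_sq_le)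
  also have "\<dots> = 2 * power_norm M m 2 t u + 2 * power_norm M m 2 t v"
    unfolding power_norm_def using um vm by (subst nn_integral_add) (auto simp: nn_integral_cmult)
  finally show "power_norm M m 2 t (\<lambda>\<omega> e s. u \<omega> e s + v \<omega> e s) \<le> 2 * power_norm M m 2 t u + 2 * power_norm M m 2 t v" .
  have "power_norm M m 1 t (\<lambda>\<omega> e s. u \<omega> e s + v \<omega> e s) \<le>
    (\<integral>\<^sup>+x. (case x of (\<omega>, e, s) \<Rightarrow> ennreal (norm (u \<omega> e s) ^ 1) * indicator {0<..t} s) +
      (case x of (\<omega>, e, s) \<Rightarrow> ennreal (norm (v \<omega> e s) ^ 1) * indicator {0<..t} s) \<partial>(M \<Otimes>\<^sub>M \<mu>))"
    unfolding power_norm_def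
    by (intro nn_integral_mono) (auto split: split_indicator simp del: ennreal_plus simp: ennreal_plus[symmetric] norm_triangle_ineq intro!: ennreal_leI)
  also have "\<dots> = power_norm M m 1 t u + power_norm M m 1 t v"
    unfolding power_norm_def using um[of 1] vm[of 1] by (intro nn_integral_add) auto
  finally show "power_norm M m 1 t (\<lambda>\<omega> e s. u \<omega> e s + v \<omega> e s) \<le> power_norm M m 1 t u + power_norm M m 1 t v" .
qed

lemma power_norm_minus: "power_norm M m p t (\<lambda>\<omega> e s. - u \<omega> e s) = power_norm M m p t u"
  by (simp add: power_norm_def)

lemma predictable_minus: "predictable M F m u \<Longrightarrow> predictable M F m (\<lambda>\<omega> e s. - u \<omega> e s)"
  and predictable_diff: "predictable M F m u \<Longrightarrow> predictable M F m v \<Longrightarrow> predictable M F m (\<lambda>\<omega> e s. u \<omega> e s - v \<omega> e s)"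
  unfolding predictable_def case_prod_unfold by simp_all

lemma power_norm_diff:
  fixes u v w :: "'w \<Rightarrow> 'e \<Rightarrow> real \<Rightarrow> 'b::euclidean_space"
  assumes u: "predictable M F m u" and v: "predictable M F m v" and w: "predictable M F m w"
  shows "power_norm M m 2 t (\<lambda>\<omega> e s. u \<omega> e s - w \<omega> e s) \<le>
    2 * power_norm M m 2 t (\<lambda>\<omega> e s. u \<omega> e s - v \<omega> e s) + 2 * power_norm M m 2 t (\<lambda>\<omega> e s. v \<omega> e s - w \<omega> e s)"
  using power_norm_add(1)[OF predictable_diff[OF u v] predictable_diff[OF v w], of t] by simp

lemma comp_isometry_diff:
  fixes g h :: "'w \<Rightarrow> 'e \<Rightarrow> real \<Rightarrow> 'b::euclidean_space"
  assumes t: "0 \<le> t" and g: "predictable M F m g" "power_norm M m 1 t g < \<infinity>"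
    and h: "predictable M F m h" "power_norm M m 1 t h < \<infinity>"
  shows "(\<integral>\<^sup>+\<omega>. ennreal (norm (pathwise_comp_integral m N g t \<omega> - pathwise_comp_integral m N h t \<omega>) ^ 2) \<partial>M)
    \<le> power_norm M m 2 t (\<lambda>\<omega> e s. g \<omega> e s - h \<omega> e s)"
proof -
  let ?d = "\<lambda>\<omega> e s. g \<omega> e s - h \<omega> e s"
  have "power_norm M m 1 t ?d \<le> power_norm M m 1 t g + power_norm M m 1 t h"
    using power_norm_add(2)[OF g(1) predictable_minus[OF h(1)], of t] by (simp add: power_norm_minus)
  then have fin: "power_norm M m 1 t ?d < \<infinity>" using g(2) h(2) by (simp add: le_less_trans)
  obtain P where P: "P \<in> borel_measurable M" "AE \<omega> in M. P \<omega> = pathwise_comp_integral m N ?d t \<omega>"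
    "(\<integral>\<^sup>+\<omega>. ennreal (norm (P \<omega>) ^ 2) \<partial>M) \<le> power_norm M m 2 t ?d"
    using comp_isometry(2)[OF t predictable_diff[OF g(1) h(1)] fin] by blast
  have "AE \<omega> in M. pathwise_comp_integral m N g t \<omega> - pathwise_comp_integral m N h t \<omega> = P \<omega>"
    using comp_isometry(1)[OF t g] comp_isometry(1)[OF t h] P(2)
  proof eventually_elim
    case (elim \<omega>)
    let ?u = "\<lambda>(e, s). indicator {0<..t} s *\<^sub>R g \<omega> e s" and ?v = "\<lambda>(e, s). indicator {0<..t} s *\<^sub>R h \<omega> e s"
    have eq: "(\<lambda>(e, s). indicator {0<..t} s *\<^sub>R ?d \<omega> e s) = (\<lambda>q. ?u q - ?v q)"
      by (auto simp: scaleR_diff_right)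
    have d: "(\<integral>q. ?u q - ?v q \<partial>N \<omega>) = (\<integral>q. ?u q \<partial>N \<omega>) - (\<integral>q. ?v q \<partial>N \<omega>)"
      "(\<integral>q. ?u q - ?v q \<partial>\<mu>) = (\<integral>q. ?u q \<partial>\<mu>) - (\<integral>q. ?v q \<partial>\<mu>)"
      using elim by (blast intro: Bochner_Integration.integral_diff)+
    then show ?case unfolding elim(3) pathwise_comp_integral_def eq d by simp
  qed
  then have "(\<integral>\<^sup>+\<omega>. ennreal (norm (pathwise_comp_integral m N g t \<omega> - pathwise_comp_integral m N h t \<omega>) ^ 2) \<partial>M)
    = (\<integral>\<^sup>+\<omega>. ennreal (norm (P \<omega>) ^ 2) \<partial>M)"
    by (intro nn_integral_cong_AE) auto
  with P(3) show ?thesis by simp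
qed

text \<open>Any version \<open>Z\<close> of the integral is compared with the pathwise integral of
  an integrable \<open>h\<close> by way of the approximating sequence that defines \<open>Z\<close>.
  Splitting a square twice, once for the integrals and once for the integrands, gives the factor 4;
  the terms with the approximation error vanish in the limit.\<close>

lemma has_comp_integral_estimate:
  fixes g h :: "'w \<Rightarrow> 'e \<Rightarrow> real \<Rightarrow> 'b::euclidean_space"
  assumes t: "0 \<le> t" and Z: "has_comp_integral M F m N g Z"
    and h: "predictable M F m h" "power_norm M m 1 t h < \<infinity>"
  shows "(\<integral>\<^sup>+\<omega>. ennreal (norm (Z t \<omega> - pathwise_comp_integral m N h t \<omega>) ^ 2) \<partial>M)
    \<le> 4 * power_norm M m 2 t (\<lambda>\<omega> e s. g \<omega> e s - h \<omega> e s)"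
proof -
  have g: "predictable M F m g" and Zm: "Z t \<in> borel_measurable M"
    using Z t by (auto simp: has_comp_integral_def)
  obtain k :: "nat \<Rightarrow> 'w \<Rightarrow> 'e \<Rightarrow> real \<Rightarrow> 'b" where k: "\<And>n. predictable M F m (k n)" "\<And>n. power_norm M m 1 t (k n) < \<infinity>"
    and k1: "(\<lambda>n. power_norm M m 2 t (\<lambda>\<omega> e s. k n \<omega> e s - g \<omega> e s)) \<longlonglongrightarrow> 0"
    and k2: "(\<lambda>n. \<integral>\<^sup>+ \<omega>. ennreal (norm (pathwise_comp_integral m N (k n) t \<omega> - Z t \<omega>) ^ 2) \<partial>M) \<longlonglongrightarrow> 0"
    using Z t unfolding has_comp_integral_def by blast
  let ?I = "pathwise_comp_integral m N"
  obtain Ph where Ph: "Ph \<in> borel_measurable M" "AE \<omega> in M. Ph \<omega> = ?I h t \<omega>"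
    using comp_isometry(2)[OF t h] by blast
  have "\<exists>P\<in>borel_measurable M. AE \<omega> in M. P \<omega> = ?I (k n) t \<omega>" for n
    using comp_isometry(2)[OF t k(1,2)[of n]] by blast
  then obtain Pk where Pk: "\<And>n. Pk n \<in> borel_measurable M" "\<And>n. AE \<omega> in M. Pk n \<omega> = ?I (k n) t \<omega>"
    by metis
  let ?G = "power_norm M m 2 t (\<lambda>\<omega> e s. g \<omega> e s - h \<omega> e s)"
  let ?a = "\<lambda>n. \<integral>\<^sup>+ \<omega>. ennreal (norm (?I (k n) t \<omega> - Z t \<omega>) ^ 2) \<partial>M"
  let ?b = "\<lambda>n. power_norm M m 2 t (\<lambda>\<omega> e s. k n \<omega> e s - g \<omega> e s)"
  have bound: "(\<integral>\<^sup>+\<omega>. ennreal (norm (Z t \<omega> - ?I h t \<omega>) ^ 2) \<partial>M) \<le> 2 * ?a n + 4 * ?b n + 4 * ?G" for n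
  proof -
    have "(\<integral>\<^sup>+\<omega>. ennreal (norm (Z t \<omega> - ?I h t \<omega>) ^ 2) \<partial>M) = (\<integral>\<^sup>+\<omega>. ennreal (norm (Z t \<omega> - Ph \<omega>) ^ 2) \<partial>M)"
      using Ph(2) by (intro nn_integral_cong_AE) auto
    also have "\<dots> \<le> (\<integral>\<^sup>+\<omega>. 2 * ennreal (norm (Pk n \<omega> - Z t \<omega>) ^ 2) + 2 * ennreal (norm (Pk n \<omega> - Ph \<omega>) ^ 2) \<partial>M)"
    proof (rule nn_integral_mono)
      fix \<omega>
      show "ennreal (norm (Z t \<omega> - Ph \<omega>) ^ 2) \<le> 2 * ennreal (norm (Pk n \<omega> - Z t \<omega>) ^ 2) + 2 * ennreal (norm (Pk n \<omega> - Ph \<omega>) ^ 2)"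
        using norm_add_sq_le[of "Z t \<omega> - Pk n \<omega>" "Pk n \<omega> - Ph \<omega>"] by (simp add: norm_minus_commute)
    qed
    also have "\<dots> = 2 * (\<integral>\<^sup>+\<omega>. ennreal (norm (Pk n \<omega> - Z t \<omega>) ^ 2) \<partial>M) + 2 * (\<integral>\<^sup>+\<omega>. ennreal (norm (Pk n \<omega> - Ph \<omega>) ^ 2) \<partial>M)"
      using Pk(1)[of n] Ph(1) Zm by (subst nn_integral_add) (auto simp: nn_integral_cmult)
    also have "(\<integral>\<^sup>+\<omega>. ennreal (norm (Pk n \<omega> - Z t \<omega>) ^ 2) \<partial>M) = ?a n"
      using Pk(2)[of n] by (intro nn_integral_cong_AE) auto
    also have "(\<integral>\<^sup>+\<omega>. ennreal (norm (Pk n \<omega> - Ph \<omega>) ^ 2) \<partial>M) = (\<integral>\<^sup>+\<omega>. ennreal (norm (?I (k n) t \<omega> - ?I h t \<omega>) ^ 2) \<partial>M)"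
      using Pk(2)[of n] Ph(2) by (intro nn_integral_cong_AE) auto
    also have "2 * ?a n + 2 * \<dots> \<le> 2 * ?a n + 2 * (2 * ?b n + 2 * ?G)"
      by (intro add_left_mono mult_left_mono order_trans[OF comp_isometry_diff[OF t k(1,2) h] power_norm_diff[OF k(1) g h(1)]]) auto
    also have "\<dots> = 2 * ?a n + 4 * ?b n + 4 * ?G"
      by (simp add: distrib_left mult.assoc[symmetric] add.assoc)
    finally show ?thesis .
  qed
  have "(\<lambda>n. 2 * ?a n + 4 * ?b n + 4 * ?G) \<longlonglongrightarrow> 2 * 0 + 4 * 0 + 4 * ?G"
    by (intro tendsto_add tendsto_const ennreal_tendsto_cmult k1 k2) auto
  then show ?thesis
    by (intro LIMSEQ_le_const[where X = "\<lambda>n. 2 * ?a n + 4 * ?b n + 4 * ?G"]) (use bound in auto)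
qed

end

section \<open>Atoms of a Poisson random measure\<close>

text \<open>A point that is no atom has a neighbourhood of mass less than one, hence zero; by
  separability the complement of the atoms is a null set.\<close>

lemma integer_valued_measure_atoms:
  fixes \<nu> :: "'p::{metric_space, second_countable_topology} measure"
  assumes sets: "sets \<nu> = sets borel" and fin: "emeasure \<nu> UNIV < \<infinity>"
    and BB: "countable BB" "topological_basis BB"
    and nat: "\<And>U. U \<in> BB \<Longrightarrow> \<exists>k::nat. emeasure \<nu> U = of_nat k"
  defines "S \<equiv> {p. 1 \<le> emeasure \<nu> {p}}"
  shows "finite S" "A \<in> sets borel \<Longrightarrow> emeasure \<nu> A = (\<Sum>p\<in>A \<inter> S. emeasure \<nu> {p})"
proof -
  have sp: "space \<nu> = UNIV" using sets_eq_imp_space_eq[OF sets] by simp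
  interpret finite_measure \<nu> by standard (use fin sp in auto)
  have pt: "{p} \<in> sets \<nu>" for p using sets by simp
  show finS: "finite S"
  proof (rule ccontr)
    assume "infinite S"
    obtain k :: nat where k: "measure \<nu> UNIV < real k" using reals_Archimedean2 by blast
    obtain T where T: "finite T" "card T = k" "T \<subseteq> S"
      using infinite_arbitrarily_large[OF \<open>infinite S\<close>] by blast
    have one: "1 \<le> measure \<nu> {p}" if "p \<in> S" for p
      using that unfolding S_def by (simp add: emeasure_eq_measure)
    have "real k \<le> (\<Sum>p\<in>T. measure \<nu> {p})"
      using sum_mono[of T "\<lambda>_. 1::real" "\<lambda>p. measure \<nu> {p}"] T one by auto
    also have "\<dots> = measure \<nu> T"
      using T(1) pt by (intro measure_eq_sum_singleton[symmetric]) auto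
    also have "\<dots> \<le> measure \<nu> UNIV" using sets.top[of \<nu>] sp by (intro finite_measure_mono) auto
    finally show False using k by simp
  qed
  have null: "\<exists>U\<in>BB. p \<in> U \<and> emeasure \<nu> U = 0" if p: "p \<notin> S" for p
  proof -
    let ?B = "\<lambda>n. ball p (1 / real (Suc n))"
    have inter: "(\<Inter>n. ?B n) = {p}"
    proof (intro equalityI subsetI)
      fix q assume q: "q \<in> (\<Inter>n. ?B n)"
      have "dist p q < 1 / real (Suc n)" for n using q by auto
      then have "dist p q \<le> 0"
        using nat_approx_posE[of "dist p q"] by (metis less_asym not_le)
      then show "q \<in> {p}" by simp
    qed auto
    have "decseq ?B"
      unfolding decseq_def by (auto intro!: subset_ball divide_left_mono)
    moreover have "range ?B \<subseteq> sets \<nu>" unfolding sets by auto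
    ultimately have "(\<lambda>n. measure \<nu> (?B n)) \<longlonglongrightarrow> measure \<nu> (\<Inter>n. ?B n)"
      by (intro finite_Lim_measure_decseq)
    then have "(\<lambda>n. measure \<nu> (?B n)) \<longlonglongrightarrow> measure \<nu> {p}" unfolding inter .
    moreover have "measure \<nu> {p} < 1"
      using p unfolding S_def by (simp add: emeasure_eq_measure not_le)
    ultimately have "\<forall>\<^sub>F n in sequentially. measure \<nu> (?B n) < 1" by (rule order_tendstoD(2))
    then obtain n where n: "measure \<nu> (?B n) < 1" by (auto simp: eventually_sequentially)
    obtain U where U: "U \<in> BB" "p \<in> U" "U \<subseteq> ?B n"
      using topological_basisE[OF BB(2), of "?B n" p] by auto
    obtain k :: nat where k: "emeasure \<nu> U = of_nat k" using nat[OF U(1)] by blast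
    have "measure \<nu> U < 1"
      using finite_measure_mono[OF U(3)] sets n by auto
    then have "k = 0" using k by (simp add: emeasure_eq_measure ennreal_of_nat_eq_real_of_nat)
    then show ?thesis using U k by auto
  qed
  let ?C = "{U \<in> BB. emeasure \<nu> U = 0}"
  have Scm: "- S \<in> sets \<nu>" unfolding sets using finS by (intro borel_open open_Compl finite_imp_closed)
  have "(\<Union>U\<in>?C. U) \<in> null_sets \<nu>"
    using BB(1) topological_basis_open[OF BB(2)] sets by (intro null_sets_UN' null_setsI) auto
  moreover have "- S \<subseteq> (\<Union>U\<in>?C. U)" using null by blast
  ultimately have Sc: "emeasure \<nu> (- S) = 0"
    using null_sets_subset[OF _ Scm] by blast
  assume A: "A \<in> sets borel"
  have Sm: "S \<in> sets \<nu>" unfolding sets using finS by (intro borel_closed finite_imp_closed)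
  have "emeasure \<nu> A = emeasure \<nu> ((A \<inter> S) \<union> (A - S))" by (simp add: Int_Diff_Un)
  also have "\<dots> = emeasure \<nu> (A \<inter> S) + emeasure \<nu> (A - S)"
    using A Sm sets by (intro plus_emeasure[symmetric]) auto
  also have "emeasure \<nu> (A - S) = 0"
    using emeasure_mono[of "A - S" "- S" \<nu>] Sc Scm by auto
  also have "emeasure \<nu> (A \<inter> S) = (\<Sum>p\<in>A \<inter> S. emeasure \<nu> {p})"
    using finS pt by (intro emeasure_eq_sum_singleton) auto
  finally show "emeasure \<nu> A = (\<Sum>p\<in>A \<inter> S. emeasure \<nu> {p})" by simp
qed

section \<open>Almost surely no two points of a window share a time\<close>

context poisson_basis
begin

text \<open>At an integer n the indicator of n \<ge> 2 is at most n(n - 1), whose mean under the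
  Poisson law is the square of the intensity.\<close>

lemma prob_two_points_le:
  assumes A: "A \<in> sets \<mu>" "emeasure \<mu> A < \<infinity>"
  shows "prob {\<omega>\<in>space M. 2 \<le> emeasure (N \<omega>) A} \<le> (measure \<mu> A)\<^sup>2"
proof -
  let ?T = "{\<omega>\<in>space M. 2 \<le> emeasure (N \<omega>) A}"
  note [measurable] = N_measurable[OF A(1)]
  have T: "?T \<in> sets M" by measurable
  have "prob ?T = expectation (indicat_real ?T)"
    using T sets.sets_into_space[OF T] by (simp add: Int_absorb2)
  also have "\<dots> \<le> expectation (\<lambda>\<omega>. measure (N \<omega>) A * (measure (N \<omega>) A - 1))"
  proof (rule integral_mono_AE)
    show "integrable M (indicat_real ?T)"
      using T by (intro integrable_real_indicator) (simp_all add: emeasure_eq_measure)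
    show "integrable M (\<lambda>\<omega>. measure (N \<omega>) A * (measure (N \<omega>) A - 1))"
      using has_integral_count(2)[OF A] by (rule integrable.intros)
    show "AE \<omega> in M. indicat_real ?T \<omega> \<le> measure (N \<omega>) A * (measure (N \<omega>) A - 1)"
      using AE_N_nat[OF A]
    proof eventually_elim
      case (elim \<omega>)
      then obtain k :: nat where k: "emeasure (N \<omega>) A = of_nat k" by blast
      then have mk: "measure (N \<omega>) A = real k" by (simp add: measure_def)
      have "0 \<le> real k * (real k - 1)" by (cases k) auto
      moreover have "1 \<le> real k * (real k - 1)" if "2 \<le> k"
        using mult_mono[of 1 "real k" 1 "real k - 1"] that by auto
      moreover have "2 \<le> k" if "\<omega> \<in> ?T"
        using that k by (simp add: ennreal_of_nat_eq_real_of_nat)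
      ultimately show ?case unfolding mk by (cases "\<omega> \<in> ?T") auto
    qed
  qed
  also have "\<dots> = (measure \<mu> A)\<^sup>2" by (rule has_bochner_integral_integral_eq[OF has_integral_count(2)[OF A]])
  finally show ?thesis .
qed

end

context poisson_window
begin

definition strip :: "nat \<Rightarrow> nat \<Rightarrow> ('e \<times> real) set" where
  "strip n j = B \<times> {t * real j / real n <.. t * real (Suc j) / real n}"

lemma strip_sets: "strip n j \<in> sets \<mu>"
  using B by (simp add: sets_intensity strip_def)

lemma measure_strip:
  assumes "0 < n"
  shows "emeasure \<mu> (strip n j) = ennreal (measure m B * t / real n)" "measure \<mu> (strip n j) = measure m B * t / real n"
proof -
  have "emeasure \<mu> (strip n j) = emeasure m B * emeasure half_line {t * real j / real n <.. t * real (Suc j) / real n}"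
    unfolding intensity_def strip_def using B sigma_finite_half_line
    by (intro sigma_finite_measure.emeasure_pair_measure_Times) auto
  also have "\<dots> = emeasure m B * ennreal (t / real n)"
  proof -
    have "t * real (Suc j) / real n - t * real j / real n = t / real n"
      by (simp add: diff_divide_distrib[symmetric] algebra_simps)
    then show ?thesis using t assms
      by (subst emeasure_half_line_Ioc) (auto intro!: divide_right_mono mult_left_mono)
  qed
  also have "\<dots> = ennreal (measure m B * t / real n)"
    using B t by (subst emeasure_eq_ennreal_measure) (auto simp: ennreal_mult[symmetric])
  finally show *: "emeasure \<mu> (strip n j) = ennreal (measure m B * t / real n)" .
  show "measure \<mu> (strip n j) = measure m B * t / real n"
    unfolding measure_def * using t by simp
qed

text \<open>With c the intensity of the window, one of n equal strips contains two points with
  probability at most (c/n)^2, hence any of them does with probability at most c^2/n. As n grows,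
  the event that every subdivision fails has probability 0.\<close>

lemma AE_strips: "AE \<omega> in M. \<exists>n>0. \<forall>j<n. emeasure (N \<omega>) (strip n j) < 2"
proof -
  define bad where "bad n = (\<Union>j<n. {\<omega>\<in>space M. 2 \<le> emeasure (N \<omega>) (strip n j)})" for n
  have badm: "bad n \<in> sets M" for n
  proof -
    note [measurable] = N_measurable[OF strip_sets]
    show ?thesis unfolding bad_def by (intro sets.finite_UN) auto
  qed
  let ?c = "measure m B * t"
  have bound: "prob (bad n) \<le> ?c\<^sup>2 / real n" if n: "0 < n" for n
  proof -
    note [measurable] = N_measurable[OF strip_sets]
    have "prob (bad n) \<le> (\<Sum>j<n. prob {\<omega>\<in>space M. 2 \<le> emeasure (N \<omega>) (strip n j)})"
      unfolding bad_def by (intro finite_measure_subadditive_finite) auto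
    also have "\<dots> \<le> (\<Sum>j<n. (?c / real n)\<^sup>2)"
      using n by (intro sum_mono order_trans[OF prob_two_points_le[OF strip_sets]])
        (auto simp: measure_strip)
    also have "\<dots> = ?c\<^sup>2 / real n" using n by (simp add: power2_eq_square field_simps)
    finally show ?thesis .
  qed
  have "prob (\<Inter>n\<in>{0<..}. bad n) = 0"
  proof (rule ccontr)
    assume "prob (\<Inter>n\<in>{0<..}. bad n) \<noteq> 0"
    then have pos: "0 < prob (\<Inter>n\<in>{0<..}. bad n)" by (simp add: zero_less_measure_iff)
    obtain n :: nat where n: "?c\<^sup>2 / prob (\<Inter>n\<in>{0<..}. bad n) < real n" using reals_Archimedean2 by blast
    have "0 \<le> ?c\<^sup>2 / prob (\<Inter>n\<in>{0<..}. bad n)" using pos by simp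
    then have "0 < real n" using n by linarith
    then have n0: "0 < n" by simp
    have "prob (\<Inter>n\<in>{0<..}. bad n) \<le> prob (bad n)"
      using n0 badm by (intro finite_measure_mono) auto
    also have "\<dots> \<le> ?c\<^sup>2 / real n" by (rule bound[OF n0])
    also have "\<dots> < prob (\<Inter>n\<in>{0<..}. bad n)" using n pos n0 by (simp add: field_simps)
    finally show False by simp
  qed
  moreover have "(\<Inter>n\<in>{0<..}. bad n) \<in> sets M" using badm by (intro sets.countable_INT) auto
  ultimately have "(\<Inter>n\<in>{0<..}. bad n) \<in> null_sets M"
    by (intro null_setsI) (auto simp: emeasure_eq_measure)
  then have "AE \<omega> in M. \<omega> \<notin> (\<Inter>n\<in>{0<..}. bad n)" by (rule AE_not_in)
  with AE_space show ?thesis by eventually_elim (auto simp: bad_def not_le)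
qed

end

section \<open>The points of the random measure in a window\<close>

locale euclidean_window = poisson_window M F m N B t
  for M :: "'w measure" and F and m :: "'e::euclidean_space measure" and N and B t +
  assumes sets_m: "sets m = sets borel"
begin

lemma sets_\<mu>_borel: "sets \<mu> = sets borel"
  unfolding sets_intensity borel_prod[symmetric] by (rule sets_pair_measure_cong[OF sets_m refl])

text \<open>On the window \<open>N \<omega>\<close> is the counting measure of \<open>S\<close>.
  Injectivity of \<open>snd\<close> says that the points have distinct times, so that jumps can
  later be indexed by their times.\<close>

definition atoms_of :: "'w \<Rightarrow> ('e \<times> real) set \<Rightarrow> bool" where
  "atoms_of \<omega> S \<longleftrightarrow> finite S \<and> S \<subseteq> E \<and> inj_on snd S \<and>
     (\<forall>A\<in>sets borel. emeasure (N \<omega>) (A \<inter> E) = of_nat (card (A \<inter> S)))"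

text \<open>Integer values are requested only on a countable base, which keeps the exceptional set
  null. The subdivision into strips then does two things: it separates the times of the atoms, and
  it forces the mass of each atom below 2 and therefore to be 1.\<close>

lemma AE_atoms: "AE \<omega> in M. \<exists>S. atoms_of \<omega> S"
proof -
  obtain BB :: "('e \<times> real) set set" where BB: "countable BB" "topological_basis BB"
    using ex_countable_basis by blast
  have Bs: "U \<inter> E \<in> sets \<mu>" if "U \<in> BB" for U
    using topological_basis_open[OF BB(2) that] E_sets sets_\<mu>_borel by auto
  have fin: "emeasure \<mu> (U \<inter> E) < \<infinity>" for U by (rule sub_E_finite) simp
  have "AE \<omega> in M. \<forall>U\<in>BB. \<exists>k::nat. emeasure (N \<omega>) (U \<inter> E) = of_nat k"
    using BB(1) by (subst AE_ball_countable) (use AE_N_nat[OF Bs fin] in auto)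
  then show ?thesis using AE_strips AE_E_finite AE_space
  proof eventually_elim
    case (elim \<omega>)
    have sK: "sets (K \<omega>) = sets borel" using sets_K[OF elim(4)] sets_\<mu>_borel by simp
    have K: "emeasure (K \<omega>) A = emeasure (N \<omega>) (A \<inter> E)" if "A \<in> sets borel" for A
      using emeasure_K[OF elim(4), of A] elim(3) that sets_\<mu>_borel by simp
    define S where "S = {p. 1 \<le> emeasure (K \<omega>) {p}}"
    have Kfin: "emeasure (K \<omega>) UNIV < \<infinity>" using K[of UNIV] elim(3) by simp
    have Knat: "\<exists>k::nat. emeasure (K \<omega>) U = of_nat k" if "U \<in> BB" for U
      using K[of U] topological_basis_open[OF BB(2) that] elim(1) that by auto
    have S: "finite S" "A \<in> sets borel \<Longrightarrow> emeasure (K \<omega>) A = (\<Sum>p\<in>A \<inter> S. emeasure (K \<omega>) {p})" for A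
      unfolding S_def by (rule integer_valued_measure_atoms[OF sK Kfin BB]; use Knat in blast)+
    have SE: "S \<subseteq> E"
    proof
      fix p assume "p \<in> S"
      then have "1 \<le> emeasure (N \<omega>) ({p} \<inter> E)" unfolding S_def using K[of "{p}"] by simp
      then show "p \<in> E" by (cases "p \<in> E") auto
    qed
    obtain n where n: "0 < n" "\<forall>j<n. emeasure (N \<omega>) (strip n j) < 2" using elim(2) by blast
    have in_strip: "\<exists>j<n. p \<in> strip n j" if p: "p \<in> E" for p
    proof -
      obtain e s where p': "p = (e, s)" "e \<in> B" "0 < s" "s \<le> t" using p by auto
      then have t0: "0 < t" by simp
      \<comment> \<open>Strips are open on the left and closed on the right, hence the ceiling minus
        one.\<close>
      define j where "j = nat (\<lceil>s * real n / t\<rceil> - 1)"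
      have r: "0 < s * real n / t" "s * real n / t \<le> real n" using p' t0 n(1) by (auto simp: field_simps)
      then have c: "1 \<le> \<lceil>s * real n / t\<rceil>" "\<lceil>s * real n / t\<rceil> \<le> int n" by (simp_all add: ceiling_le_iff one_le_ceiling)
      have j: "real j = real_of_int \<lceil>s * real n / t\<rceil> - 1" using c by (simp add: j_def)
      have "j < n" unfolding j_def using c by linarith
      moreover have "real j < s * real n / t" "s * real n / t \<le> real (Suc j)"
        using j by (simp_all, linarith+)
      then have "t * real j / real n < s" "s \<le> t * real (Suc j) / real n"
        using t0 n(1) by (simp_all add: field_simps)
      ultimately show ?thesis using p' by (auto simp: strip_def)
    qed
    have stripE: "strip n j \<subseteq> E" if "j < n" for j
    proof
      fix p assume "p \<in> strip n j"
      then obtain e s where p: "p = (e, s)" "e \<in> B" "t * real j / real n < s" "s \<le> t * real (Suc j) / real n"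
        by (auto simp: strip_def)
      have "0 \<le> t * real j / real n" using t by simp
      moreover have "t * real (Suc j) / real n \<le> t * 1"
        using that n(1) t mult_left_mono[of "real (Suc j) / real n" 1 t] by simp
      ultimately show "p \<in> E" using p by auto
    qed
    have le1: "emeasure (K \<omega>) T < 2" if "T \<subseteq> strip n j" "j < n" "T \<in> sets borel" for T j
    proof -
      have "emeasure (K \<omega>) T \<le> emeasure (K \<omega>) (strip n j)"
        using that strip_sets sets_\<mu>_borel sK by (intro emeasure_mono) auto
      also have "\<dots> = emeasure (N \<omega>) (strip n j)"
        using K[of "strip n j"] strip_sets sets_\<mu>_borel stripE[OF that(2)] by (simp add: Int_absorb2)
      also have "\<dots> < 2" using n that by blast
      finally show ?thesis .
    qed
    have inj: "inj_on snd S"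
    proof (rule inj_onI, rule ccontr)
      fix p q assume pq: "p \<in> S" "q \<in> S" "snd p = snd q" "p \<noteq> q"
      obtain j where j: "j < n" "p \<in> strip n j" using in_strip pq SE by blast
      then have q: "q \<in> strip n j" using pq SE by (auto simp: strip_def)
      have "emeasure (K \<omega>) {p, q} = (\<Sum>x\<in>{p, q} \<inter> S. emeasure (K \<omega>) {x})"
        by (rule S(2)[OF borel_closed]) (simp add: finite_imp_closed)
      also have "\<dots> = emeasure (K \<omega>) {p} + emeasure (K \<omega>) {q}" using pq by simp
      also have "\<dots> \<ge> 1 + 1" using pq(1,2) unfolding S_def by (intro add_mono) auto
      finally have "2 \<le> emeasure (K \<omega>) {p, q}" by simp
      moreover have "emeasure (K \<omega>) {p, q} < 2"
        by (rule le1[OF _ j(1) borel_closed]) (use j q in \<open>auto simp: finite_imp_closed\<close>)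
      ultimately show False by simp
    qed
    have one: "emeasure (K \<omega>) {p} = 1" if p: "p \<in> S" for p
    proof -
      obtain j where j: "j < n" "p \<in> strip n j" using in_strip p SE by blast
      have lt: "emeasure (K \<omega>) {p} < 2" by (rule le1[OF _ j(1)]) (use j in auto)
      \<comment> \<open>A base set that isolates \<open>p\<close> among the atoms has the same mass
        as \<open>{p}\<close>, which is thereby an integer.\<close>
      obtain U where U: "U \<in> BB" "p \<in> U" "U \<inter> S \<subseteq> {p}"
      proof -
        have "open (- (S - {p}))" using S(1) by (intro open_Compl finite_imp_closed) auto
        then obtain U where "U \<in> BB" "p \<in> U" "U \<subseteq> - (S - {p})"
          using topological_basisE[OF BB(2), of "- (S - {p})" p] by auto
        then show thesis using that by blast
      qed
      have "emeasure (K \<omega>) U = (\<Sum>x\<in>U \<inter> S. emeasure (K \<omega>) {x})"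
        by (rule S(2)) (use topological_basis_open[OF BB(2) U(1)] in auto)
      also have "U \<inter> S = {p}" using U p by auto
      finally have "emeasure (K \<omega>) {p} = emeasure (K \<omega>) U" by simp
      then obtain k :: nat where k: "emeasure (K \<omega>) {p} = of_nat k" using Knat[OF U(1)] by auto
      have "1 \<le> k" using p k unfolding S_def by (simp add: ennreal_of_nat_eq_real_of_nat)
      moreover have "k < 2" using lt k by (simp add: ennreal_of_nat_eq_real_of_nat)
      ultimately show ?thesis using k by (simp add: numeral_2_eq_2 le_less_Suc_eq)
    qed
    have "emeasure (N \<omega>) (A \<inter> E) = of_nat (card (A \<inter> S))" if A: "A \<in> sets borel" for A
    proof -
      have "emeasure (N \<omega>) (A \<inter> E) = (\<Sum>p\<in>A \<inter> S. emeasure (K \<omega>) {p})" using S(2)[OF A] K[OF A] by simp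
      also have "\<dots> = (\<Sum>p\<in>A \<inter> S. 1)" using one by (intro sum.cong) auto
      finally show ?thesis by simp
    qed
    then show ?case using S(1) SE inj unfolding atoms_of_def by blast
  qed
qed

lemma atoms_integral:
  fixes f :: "'e \<times> real \<Rightarrow> 'b::{banach, second_countable_topology}"
  assumes S: "atoms_of \<omega> S" and \<omega>: "\<omega> \<in> space M"
    and f: "f \<in> borel_measurable borel" and out: "\<And>p. p \<notin> E \<Longrightarrow> f p = 0"
  shows "integrable (N \<omega>) f" "(\<integral>p. f p \<partial>N \<omega>) = (\<Sum>p\<in>S. f p)"
proof -
  have sN: "sets (N \<omega>) = sets borel" using sets_N[OF \<omega>] sets_\<mu>_borel by simp
  have finS: "finite S" and SE: "S \<subseteq> E" using S by (auto simp: atoms_of_def)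
  have cS: "emeasure (N \<omega>) (A \<inter> E) = of_nat (card (A \<inter> S))" if "A \<in> sets borel" for A
    using S that by (auto simp: atoms_of_def)
  have fm: "f \<in> borel_measurable (N \<omega>)" using f sN by (simp cong: measurable_cong_sets)
  have Sb: "S \<in> sets borel" using finS by (intro borel_closed finite_imp_closed)
  have pt: "emeasure (N \<omega>) {p} = 1" if "p \<in> S" for p
    using cS[of "{p}"] that SE by (simp add: Int_absorb2 Int_absorb1 subset_eq)
  have "has_bochner_integral (N \<omega>) (\<lambda>q. \<Sum>p\<in>S. indicator {p} q *\<^sub>R f p) (\<Sum>p\<in>S. measure (N \<omega>) {p} *\<^sub>R f p)"
    by (intro has_bochner_integral_sum has_bochner_integral_indicator) (use pt sN in auto)
  moreover have "(\<Sum>p\<in>S. measure (N \<omega>) {p} *\<^sub>R f p) = (\<Sum>p\<in>S. f p)"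
    using pt by (intro sum.cong) (auto simp: measure_def)
  moreover have "AE q in N \<omega>. f q = (\<Sum>p\<in>S. indicator {p} q *\<^sub>R f p)"
  proof (rule AE_I')
    have "emeasure (N \<omega>) (- S \<inter> E) = 0" using cS[of "- S"] Sb by (simp add: Int_commute)
    then show "- S \<inter> E \<in> null_sets (N \<omega>)"
      using Sb E_sets sN sets_\<mu>_borel by (intro null_setsI) auto
    show "{q \<in> space (N \<omega>). f q \<noteq> (\<Sum>p\<in>S. indicator {p} q *\<^sub>R f p)} \<subseteq> - S \<inter> E"
    proof
      fix q assume q: "q \<in> {q \<in> space (N \<omega>). f q \<noteq> (\<Sum>p\<in>S. indicator {p} q *\<^sub>R f p)}"
      have eq: "(\<Sum>p\<in>S. indicator {p} q *\<^sub>R f p) = (if q \<in> S then f q else 0)"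
      proof -
        have "(\<Sum>p\<in>S. indicator {p} q *\<^sub>R f p) = (\<Sum>p\<in>S. if p = q then f q else 0)"
          by (intro sum.cong) (auto simp: indicator_def)
        then show ?thesis using finS by simp
      qed
      then show "q \<in> - S \<inter> E" using q out[of q] by (auto split: if_splits)
    qed
  qed
  ultimately have hb: "has_bochner_integral (N \<omega>) f (\<Sum>p\<in>S. f p)"
    using has_bochner_integral_cong_AE[of f "N \<omega>" "\<lambda>q. \<Sum>p\<in>S. indicator {p} q *\<^sub>R f p"] fm by auto
  then show "integrable (N \<omega>) f" "(\<integral>p. f p \<partial>N \<omega>) = (\<Sum>p\<in>S. f p)"
    by (auto simp: has_bochner_integral_iff)
qed

end

section \<open>Hoelder functions\<close>

lemma finite_basis_lists: "finite (basis_lists i :: 'a::euclidean_space list set)"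
  unfolding basis_lists_def using finite_lists_length_eq[of "Basis::'a set" i] by simp

lemma holder_term_bound:
  assumes "f \<in> holder_space \<gamma>" "i \<le> nat \<lfloor>\<gamma>\<rfloor>"
  obtains C where "0 \<le> C" "\<And>vs x. vs \<in> basis_lists i \<Longrightarrow> \<bar>partials f vs x\<bar> \<le> C"
proof -
  let ?s = "SUP x. ennreal (L2_set (\<lambda>vs. partials f vs x) (basis_lists i))"
  have "?s \<le> (\<Sum>i\<le>nat \<lfloor>\<gamma>\<rfloor>. SUP x. ennreal (L2_set (\<lambda>vs. partials f vs x) (basis_lists i)))"
    using assms(2) by (intro member_le_sum) auto
  also have "\<dots> \<le> holder_norm \<gamma> f" unfolding holder_norm_def Let_def by simp
  also have "\<dots> < \<infinity>" using assms(1) by (simp add: holder_space_def)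
  finally have fin: "?s < \<infinity>" .
  have "\<bar>partials f vs x\<bar> \<le> enn2real ?s" if "vs \<in> basis_lists i" for vs x
  proof -
    have "\<bar>partials f vs x\<bar> = sqrt ((partials f vs x)\<^sup>2)" by simp
    also have "\<dots> \<le> L2_set (\<lambda>vs. partials f vs x) (basis_lists i)"
      unfolding L2_set_def using that finite_basis_lists[of i]
      by (intro real_sqrt_le_mono member_le_sum) auto
    also have "\<dots> = enn2real (ennreal (L2_set (\<lambda>vs. partials f vs x) (basis_lists i)))"
      by (simp add: L2_set_nonneg)
    also have "\<dots> \<le> enn2real ?s"
      using fin by (intro enn2real_mono SUP_upper) auto
    finally show ?thesis .
  qed
  then show thesis using that[of "enn2real ?s"] by simp
qed

lemma onorm_inner_le:
  assumes "norm a \<le> C"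
  shows "onorm (\<lambda>v. a \<bullet> v) \<le> C"
proof (rule onorm_bound)
  show "0 \<le> C" using assms norm_ge_zero[of a] by linarith
  show "norm (a \<bullet> v) \<le> C * norm v" for v
    using order_trans[OF Cauchy_Schwarz_ineq2[of a v] mult_right_mono[OF assms norm_ge_zero]] by simp
qed

lemma grad_inner:
  assumes "f differentiable (at x)"
  shows "grad f x \<bullet> v = frechet_derivative f (at x) v" "(f has_derivative (\<lambda>v. grad f x \<bullet> v)) (at x)"
proof -
  have d: "(f has_derivative frechet_derivative f (at x)) (at x)"
    using assms by (simp add: frechet_derivative_works)
  interpret linear "frechet_derivative f (at x)" using d by (rule has_derivative_linear)
  have *: "grad f x \<bullet> v = frechet_derivative f (at x) v" for v
  proof -
    have "frechet_derivative f (at x) v = frechet_derivative f (at x) (\<Sum>i\<in>Basis. (v \<bullet> i) *\<^sub>R i)"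
      by (simp add: euclidean_representation)
    also have "\<dots> = (\<Sum>i\<in>Basis. (v \<bullet> i) * frechet_derivative f (at x) i)"
      by (simp add: sum scale)
    also have "\<dots> = grad f x \<bullet> v"
      unfolding grad_def inner_sum_left by (intro sum.cong) (simp_all add: inner_commute mult.commute)
    finally show ?thesis ..
  qed
  show "grad f x \<bullet> v = frechet_derivative f (at x) v" by (rule *)
  show "(f has_derivative (\<lambda>v. grad f x \<bullet> v)) (at x)" unfolding * by (rule d)
qed

lemma grad_component: "i \<in> Basis \<Longrightarrow> grad f x \<bullet> i = partials f [i] x"
  unfolding grad_def by (simp add: inner_sum_left inner_Basis if_distrib cong: if_cong)

text \<open>If \<gamma> has integer part 1, the exponent is \<gamma> - 1; otherwise the second
  derivatives are bounded, the gradient is Lipschitz and \<theta> = 1. Both exceed \<alpha> - 1, and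
  this is all that is used of the Hoelder space afterwards.\<close>

lemma holder_space_regularity:
  fixes f :: "'a::euclidean_space \<Rightarrow> real"
  assumes f: "f \<in> holder_space \<gamma>" and g: "1 < \<alpha>" "\<alpha> < 2" "\<alpha> < \<gamma>"
  obtains C \<theta> where "0 < C" "\<alpha> - 1 < \<theta>" "0 < \<theta>" "\<theta> \<le> 1"
    "\<And>x. (f has_derivative (\<lambda>v. grad f x \<bullet> v)) (at x)"
    "\<And>x. \<bar>f x\<bar> \<le> C" "\<And>x. norm (grad f x) \<le> C"
    "\<And>x y. norm (grad f x - grad f y) \<le> C * norm (x - y) powr \<theta>"
proof -
  define k where "k = nat \<lfloor>\<gamma>\<rfloor>"
  have k1: "1 \<le> k" using g unfolding k_def by (simp add: le_nat_iff le_floor_iff)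
  have Ck: "C_k k f" and hn: "holder_norm \<gamma> f < \<infinity>" using f by (auto simp: holder_space_def k_def)
  have df: "f differentiable (at x)" for x
  proof -
    have "partials f [] differentiable_on UNIV"
      using Ck k1 unfolding C_k_def basis_lists_def by (auto dest!: spec[of _ 0])
    then show ?thesis by (simp add: differentiable_on_def)
  qed
  obtain C0 where C0: "0 \<le> C0" "\<And>vs x. vs \<in> basis_lists 0 \<Longrightarrow> \<bar>partials f vs x\<bar> \<le> C0"
    using holder_term_bound[OF f, of 0] by blast
  obtain C1 where C1: "0 \<le> C1" "\<And>vs x. vs \<in> basis_lists 1 \<Longrightarrow> \<bar>partials f vs x\<bar> \<le> C1"
    using holder_term_bound[OF f, of 1] k1 k_def by auto
  have b1: "[i] \<in> basis_lists 1" if "i \<in> Basis" for i :: 'a using that by (simp add: basis_lists_def)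
  have f0: "\<bar>f x\<bar> \<le> C0" for x using C0(2)[of "[]" x] by (simp add: basis_lists_def)
  let ?d = "real DIM('a)"
  have l1: "norm (a :: 'a) \<le> ?d * K" if "\<And>i. i \<in> Basis \<Longrightarrow> \<bar>a \<bullet> i\<bar> \<le> K" for a K
    using order_trans[OF norm_le_l1 sum_mono[of Basis "\<lambda>i. \<bar>a \<bullet> i\<bar>" "\<lambda>_. K"]] that by simp
  have g1: "norm (grad f x) \<le> ?d * C1" for x
    using C1(2)[OF b1] by (intro l1) (simp add: grad_component)
  have "\<exists>\<theta> K. \<alpha> - 1 < \<theta> \<and> 0 < \<theta> \<and> \<theta> \<le> 1 \<and> 0 \<le> K \<and> (\<forall>x y. \<forall>i\<in>Basis. \<bar>(grad f x - grad f y) \<bullet> i\<bar> \<le> K * norm (x - y) powr \<theta>)"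
  proof (cases "k = 1")
    case True
    have g2: "\<gamma> < 2"
    proof (rule ccontr)
      assume "\<not> \<gamma> < 2"
      then have "2 \<le> nat \<lfloor>\<gamma>\<rfloor>" by (simp add: le_nat_iff le_floor_iff)
      then show False using True unfolding k_def by simp
    qed
    let ?q = "\<lambda>x y. L2_set (\<lambda>vs. partials f vs x - partials f vs y) (basis_lists 1)"
    let ?s = "SUP (x, y) \<in> {(x, y). x \<noteq> y}. ennreal (?q x y / norm (x - y) powr (\<gamma> - real 1))"
    have "?s \<le> holder_norm \<gamma> f"
      using True unfolding holder_norm_def Let_def k_def[symmetric] by simp
    then have fin: "?s < \<infinity>" using hn by (rule le_less_trans)
    define K where "K = enn2real ?s"
    have "\<bar>(grad f x - grad f y) \<bullet> i\<bar> \<le> K * norm (x - y) powr (\<gamma> - 1)" if i: "i \<in> Basis" for x y i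
    proof (cases "x = y")
      case False
      then have pos: "0 < norm (x - y) powr (\<gamma> - 1)" by simp
      have "\<bar>(grad f x - grad f y) \<bullet> i\<bar> = sqrt ((partials f [i] x - partials f [i] y)\<^sup>2)"
        using i by (simp add: inner_diff_left grad_component)
      also have "\<dots> \<le> ?q x y"
        unfolding L2_set_def using b1[OF i] finite_basis_lists[of 1]
        by (intro real_sqrt_le_mono member_le_sum[of "[i]"]) auto
      finally have 1: "\<bar>(grad f x - grad f y) \<bullet> i\<bar> \<le> ?q x y" .
      have "?q x y / norm (x - y) powr (\<gamma> - 1) = enn2real (ennreal (?q x y / norm (x - y) powr (\<gamma> - real 1)))"
        by (simp add: L2_set_nonneg)
      also have "\<dots> \<le> K"
        unfolding K_def using fin False by (intro enn2real_mono SUP_upper2[of "(x, y)"]) auto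
      finally have "?q x y \<le> K * norm (x - y) powr (\<gamma> - 1)" using pos by (simp add: pos_divide_le_eq)
      with 1 show ?thesis by linarith
    qed simp
    then show ?thesis using g g2 unfolding K_def
      by (intro exI[of _ "\<gamma> - 1"] exI[of _ "enn2real ?s"]) auto
  next
    case False
    then have k2: "2 \<le> k" using k1 by simp
    obtain C2 where C2: "0 \<le> C2" "\<And>vs x. vs \<in> basis_lists 2 \<Longrightarrow> \<bar>partials f vs x\<bar> \<le> C2"
      using holder_term_bound[OF f, of 2] k2 k_def by auto
    have "\<bar>(grad f x - grad f y) \<bullet> i\<bar> \<le> (?d * C2) * norm (x - y) powr 1" if i: "i \<in> Basis" for x y i
    proof -
      have "partials f [i] differentiable_on UNIV"
      proof -
        have "1 < k" using k2 by simp
        then have "\<forall>vs\<in>basis_lists 1. partials f vs differentiable_on UNIV" using Ck unfolding C_k_def by blast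
        then show ?thesis using b1[OF i] by blast
      qed
      then have d2: "partials f [i] differentiable (at x)" for x by (simp add: differentiable_on_def)
      have gb: "norm (grad (partials f [i]) x) \<le> ?d * C2" for x
      proof (rule l1)
        fix j :: 'a assume j: "j \<in> Basis"
        have "[j, i] \<in> basis_lists 2" using i j by (simp add: basis_lists_def)
        from C2(2)[OF this, of x] show "\<bar>grad (partials f [i]) x \<bullet> j\<bar> \<le> C2"
          using j grad_component[OF j, of "partials f [i]" x] by simp
      qed
      have "norm (partials f [i] x - partials f [i] y) \<le> (?d * C2) * norm (x - y)"
      proof (rule differentiable_bound[OF convex_UNIV])
        show "(partials f [i] has_derivative (\<lambda>v. grad (partials f [i]) z \<bullet> v)) (at z within UNIV)" for z
          using grad_inner(2)[OF d2] by simp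
        show "onorm (\<lambda>v. grad (partials f [i]) z \<bullet> v) \<le> ?d * C2" for z
          by (rule onorm_inner_le[OF gb])
      qed auto
      then show ?thesis using i by (cases "x = y") (simp_all add: inner_diff_left grad_component)
    qed
    then show ?thesis using g C2(1) by (intro exI[of _ 1] exI[of _ "?d * C2"]) auto
  qed
  then obtain \<theta> K where \<theta>: "\<alpha> - 1 < \<theta>" "0 < \<theta>" "\<theta> \<le> 1" "0 \<le> K"
    and K: "\<And>x y i. i \<in> Basis \<Longrightarrow> \<bar>(grad f x - grad f y) \<bullet> i\<bar> \<le> K * norm (x - y) powr \<theta>" by blast
  \<comment> \<open>One constant for all three bounds; the summand 1 makes it positive.\<close>
  define C where "C = 1 + C0 + ?d * C1 + ?d * K"
  have nn: "0 \<le> ?d * C1" "0 \<le> ?d * K" using C1 \<theta> by auto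
  show thesis
  proof (rule that[OF _ \<theta>(1-3)])
    show "0 < C" using nn C0 by (simp add: C_def)
    show "(f has_derivative (\<lambda>v. grad f x \<bullet> v)) (at x)" for x by (rule grad_inner(2)[OF df])
    show "\<bar>f x\<bar> \<le> C" for x using f0[of x] nn by (simp add: C_def)
    show "norm (grad f x) \<le> C" for x using g1[of x] nn C0 by (simp add: C_def)
    fix x y
    have "norm (grad f x - grad f y) \<le> ?d * (K * norm (x - y) powr \<theta>)" by (rule l1) (rule K)
    also have "\<dots> \<le> C * norm (x - y) powr \<theta>"
      unfolding mult.assoc[symmetric] using nn C0 by (intro mult_right_mono) (auto simp: C_def)
    finally show "norm (grad f x - grad f y) \<le> C * norm (x - y) powr \<theta>" .
  qed
qed

lemma grad_increment_bound:
  fixes f :: "'a::euclidean_space \<Rightarrow> real"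
  assumes d: "\<And>x. (f has_derivative (\<lambda>v. grad f x \<bullet> v)) (at x)" and C: "0 < C"
    and b: "\<And>x. norm (grad f x) \<le> C"
  shows "\<bar>f (y + z) - f y\<bar> \<le> C * norm z"
proof -
  have "norm (f (y + z) - f y) \<le> C * norm ((y + z) - y)"
  proof (rule differentiable_bound[OF convex_UNIV])
    show "onorm (\<lambda>v. grad f x \<bullet> v) \<le> C" for x
      by (rule onorm_inner_le[OF b])
  qed (use d in auto)
  then show ?thesis by simp
qed

text \<open>Mean value inequality for \<open>f\<close> minus its linear part at \<open>y\<close>, on
  the ball of radius |z| around \<open>y\<close>: the gradient there differs from the one at
  \<open>y\<close> by at most C |z|^\<theta>.\<close>

lemma grad_taylor_bound:
  fixes f :: "'a::euclidean_space \<Rightarrow> real"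
  assumes d: "\<And>x. (f has_derivative (\<lambda>v. grad f x \<bullet> v)) (at x)" and C: "0 < C" and \<theta>: "0 < \<theta>"
    and h: "\<And>x y. norm (grad f x - grad f y) \<le> C * norm (x - y) powr \<theta>"
  shows "\<bar>f (y + z) - f y - grad f y \<bullet> z\<bar> \<le> C * norm z powr (1 + \<theta>)"
proof -
  let ?g = "\<lambda>x. f x - grad f y \<bullet> x"
  have "norm (?g (y + z) - ?g y) \<le> (C * norm z powr \<theta>) * norm ((y + z) - y)"
  proof (rule differentiable_bound[of "cball y (norm z)" _ "\<lambda>x v. (grad f x - grad f y) \<bullet> v"])
    fix x assume x: "x \<in> cball y (norm z)"
    show "(?g has_derivative (\<lambda>v. (grad f x - grad f y) \<bullet> v)) (at x within cball y (norm z))"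
      unfolding inner_diff_left
      by (intro has_derivative_diff has_derivative_at_withinI[OF d] has_derivative_inner_right has_derivative_ident)
    have "norm (grad f x - grad f y) \<le> C * norm (x - y) powr \<theta>" by (rule h)
    also have "\<dots> \<le> C * norm z powr \<theta>"
      using x C \<theta> by (intro mult_left_mono powr_mono2) (auto simp: dist_norm norm_minus_commute)
    finally have *: "norm (grad f x - grad f y) \<le> C * norm z powr \<theta>" .
    show "onorm (\<lambda>v. (grad f x - grad f y) \<bullet> v) \<le> C * norm z powr \<theta>"
      by (rule onorm_inner_le[OF *])
  qed (auto simp: dist_norm)
  also have "(C * norm z powr \<theta>) * norm ((y + z) - y) = C * norm z powr (1 + \<theta>)"
    by (cases "z = 0") (simp_all add: powr_add powr_one)
  finally show ?thesis by (simp add: inner_add_right algebra_simps)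
qed

section \<open>The stable Levy measure\<close>

text \<open>A substitute for polar coordinates: on each shell the weight is bounded and the volume
  is at most that of a ball, so finiteness reduces to a numerical series.\<close>

lemma shells_finite:
  fixes w :: "'a::euclidean_space \<Rightarrow> real"
  assumes w: "w \<in> borel_measurable borel" and S: "\<And>k. S k \<in> sets borel"
    and sub: "\<And>k. S k \<subseteq> cball 0 (r k)" and r: "\<And>k. 0 < r k"
    and c: "\<And>k z. z \<in> S k \<Longrightarrow> w z \<le> c k" "\<And>k. 0 \<le> c k"
    and cover: "A \<subseteq> (\<Union>k. S k)" "A \<in> sets borel"
    and sum: "summable (\<lambda>k. c k * r k ^ DIM('a))"
  shows "(\<integral>\<^sup>+z. ennreal (w z) * indicator A z \<partial>lborel) < \<infinity>"
proof -
  note [measurable] = w S cover(2)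
  let ?v = "unit_ball_vol (real DIM('a))"
  have "(\<integral>\<^sup>+z. ennreal (w z) * indicator A z \<partial>lborel) \<le> (\<integral>\<^sup>+z. (\<Sum>k. ennreal (w z) * indicator (S k) z) \<partial>lborel)"
  proof (rule nn_integral_mono)
    fix z
    show "ennreal (w z) * indicator A z \<le> (\<Sum>k. ennreal (w z) * indicator (S k) z)"
    proof (cases "z \<in> A")
      case True
      then obtain k where k: "z \<in> S k" using cover by auto
      define g where "g j = ennreal (w z) * indicator (S j) z" for j
      have "g k \<le> suminf g" using sum_le_suminf[of g "{k}"] by simp
      then show ?thesis using True k unfolding g_def[abs_def] by simp
    qed simp
  qed
  also have "\<dots> = (\<Sum>k. \<integral>\<^sup>+z. ennreal (w z) * indicator (S k) z \<partial>lborel)"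
    by (rule nn_integral_suminf) measurable
  also have "\<dots> \<le> (\<Sum>k. ennreal (c k * (?v * r k ^ DIM('a))))"
  proof (intro suminf_le summableI)
    fix k
    have "(\<integral>\<^sup>+z. ennreal (w z) * indicator (S k) z \<partial>lborel) \<le> (\<integral>\<^sup>+z. ennreal (c k) * indicator (cball (0::'a) (r k)) z \<partial>lborel)"
    proof (rule nn_integral_mono)
      fix z
      show "ennreal (w z) * indicator (S k) z \<le> ennreal (c k) * indicator (cball 0 (r k)) z"
      proof (cases "z \<in> S k")
        case True
        then have "z \<in> cball 0 (r k)" using sub[of k] by blast
        then show ?thesis using True c(1)[OF True] by (simp add: ennreal_leI)
      qed simp
    qed
    also have "\<dots> = ennreal (c k) * ennreal (?v * r k ^ DIM('a))"
      using r[of k] by (subst nn_integral_cmult_indicator) (auto simp: emeasure_cball)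
    finally show "(\<integral>\<^sup>+z. ennreal (w z) * indicator (S k) z \<partial>lborel) \<le> ennreal (c k * (?v * r k ^ DIM('a)))"
      using c(2)[of k] r[of k] by (simp add: ennreal_mult[symmetric] less_imp_le)
  qed
  also have "\<dots> < \<infinity>"
  proof -
    have "summable (\<lambda>k. ?v * (c k * r k ^ DIM('a)))" by (rule summable_mult[OF sum])
    then have s: "summable (\<lambda>k. c k * (?v * r k ^ DIM('a)))" by (simp add: mult_ac)
    have "0 \<le> c k * (?v * r k ^ DIM('a))" for k using c(2)[of k] r[of k] by (simp add: less_imp_le)
    from suminf_ennreal2[OF this s] show ?thesis by simp
  qed
  finally show ?thesis .
qed

lemma pos_dyadic_bounds:
  fixes x :: real
  assumes "0 < x" "x \<le> 1"
  obtains k :: nat where "(1/2) ^ Suc k < x" "x \<le> (1/2) ^ k"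
proof -
  obtain n where n: "(1/2) ^ n < x" using real_arch_pow_inv[of x "1/2"] assms by auto
  define j where "j = (LEAST n. (1/2) ^ n < x)"
  have j: "(1/2) ^ j < x" unfolding j_def by (rule LeastI[of "\<lambda>n. (1/2) ^ n < x", OF n])
  have "j \<noteq> 0" using j assms by (cases j) auto
  then obtain k where k: "j = Suc k" by (cases j) auto
  have "\<not> (1/2) ^ k < x" using not_less_Least[of k "\<lambda>n. (1/2) ^ n < x"] k j_def by simp
  then show thesis using that[of k] j k by simp
qed

lemma two_powr_pow: "(2::real) powr (real k * a) = (2 powr a) ^ k"
  by (simp add: powr_realpow[symmetric] powr_powr mult.commute)

lemma stable_small_finite:
  fixes p \<alpha> :: real
  assumes p: "\<alpha> < p" "0 < p" and \<alpha>: "0 < \<alpha>"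
  shows "(\<integral>\<^sup>+z. ennreal (norm (z::'a::euclidean_space) powr p * norm z powr (- real DIM('a) - \<alpha>)) * indicator {z. norm z \<le> 1} z \<partial>lborel) < \<infinity>"
proof -
  let ?d = "real DIM('a)" let ?w = "\<lambda>z::'a. norm z powr p * norm z powr (- ?d - \<alpha>)"
  let ?S = "\<lambda>k::nat. {z::'a. (1/2) ^ Suc k < norm z \<and> norm z \<le> (1/2) ^ k}"
  let ?c = "\<lambda>k::nat. ((1/2) ^ k) powr p * ((1/2) ^ Suc k) powr (- ?d - \<alpha>)"
  have "(\<integral>\<^sup>+z. ennreal (?w z) * indicator {z. norm z \<le> 1} z \<partial>lborel) = (\<integral>\<^sup>+z. ennreal (?w z) * indicator {z. 0 < norm z \<and> norm z \<le> 1} z \<partial>lborel)"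
    by (intro nn_integral_cong) (auto split: split_indicator)
  also have "\<dots> < \<infinity>"
  proof (rule shells_finite[where S = ?S and r = "\<lambda>k. (1/2) ^ k" and c = ?c])
    show "?w \<in> borel_measurable borel" by measurable
    show "?S k \<in> sets borel" for k by measurable
    show "{z::'a. 0 < norm z \<and> norm z \<le> 1} \<subseteq> (\<Union>k. ?S k)"
    proof
      fix z :: 'a assume "z \<in> {z. 0 < norm z \<and> norm z \<le> 1}"
      then obtain k where "(1/2) ^ Suc k < norm z" "norm z \<le> (1/2) ^ k"
        using pos_dyadic_bounds[of "norm z"] by blast
      then show "z \<in> (\<Union>k. ?S k)" by blast
    qed
    show "{z::'a. 0 < norm z \<and> norm z \<le> 1} \<in> sets borel" by measurable
    show "?w z \<le> ?c k" if z: "z \<in> ?S k" for k z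
    proof (rule mult_mono)
      have pos: "0 < (1/2::real) ^ Suc k" by (rule zero_less_power) simp
      then show "norm z powr p \<le> ((1/2) ^ k) powr p" using z p by (intro powr_mono2) auto
      show "norm z powr (- ?d - \<alpha>) \<le> ((1/2) ^ Suc k) powr (- ?d - \<alpha>)"
        using z \<alpha> pos by (intro powr_mono2') auto
    qed auto
    have pw: "((1/2::real) ^ j) powr a = 2 powr (- (real j * a))" for j a
    proof -
      have "(1/2::real) ^ j = 2 powr (- real j)"
        by (simp add: powr_minus_divide powr_realpow power_one_over)
      then show ?thesis by (simp add: powr_powr)
    qed
    \<comment> \<open>The dimension cancels between density and volume, which leaves a geometric
      series of ratio 2^(\<alpha> - p) < 1.\<close>
    have "?c k * ((1/2) ^ k) ^ DIM('a) = 2 powr (?d + \<alpha>) * (2 powr (\<alpha> - p)) ^ k" for k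
    proof -
      have "((1/2::real) ^ k) ^ DIM('a) = ((1/2) ^ k) powr ?d" by (simp add: powr_realpow)
      then have "?c k * ((1/2) ^ k) ^ DIM('a) = 2 powr (- (real k * p)) * 2 powr (- (real (Suc k) * (- ?d - \<alpha>))) * 2 powr (- (real k * ?d))"
        by (simp only: pw)
      also have "\<dots> = 2 powr (- (real k * p) + - (real (Suc k) * (- ?d - \<alpha>)) + - (real k * ?d))"
        by (simp only: powr_add)
      also have "- (real k * p) + - (real (Suc k) * (- ?d - \<alpha>)) + - (real k * ?d) = (?d + \<alpha>) + real k * (\<alpha> - p)"
        by (simp add: algebra_simps)
      finally show ?thesis by (simp only: powr_add two_powr_pow)
    qed
    moreover have "summable (\<lambda>k. 2 powr (?d + \<alpha>) * (2 powr (\<alpha> - p)) ^ k)"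
      using p by (intro summable_mult summable_geometric) (simp add: powr_less_one)
    ultimately show "summable (\<lambda>k. ?c k * ((1/2) ^ k) ^ DIM('a))" by simp
  qed auto
  finally show ?thesis .
qed

lemma stable_large_finite:
  fixes \<alpha> :: real
  assumes \<alpha>: "0 < \<alpha>"
  shows "(\<integral>\<^sup>+z. ennreal (norm (z::'a::euclidean_space) powr (- real DIM('a) - \<alpha>)) * indicator {z. 1 < norm z} z \<partial>lborel) < \<infinity>"
proof -
  let ?d = "real DIM('a)" let ?w = "\<lambda>z::'a. norm z powr (- ?d - \<alpha>)"
  let ?S = "\<lambda>k::nat. {z::'a. 2 ^ k \<le> norm z \<and> norm z \<le> 2 ^ Suc k}"
  let ?c = "\<lambda>k::nat. ((2::real) ^ k) powr (- ?d - \<alpha>)"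
  show ?thesis
  proof (rule shells_finite[where S = ?S and r = "\<lambda>k. 2 ^ Suc k" and c = ?c])
    show "?w \<in> borel_measurable borel" by measurable
    show "?S k \<in> sets borel" for k by measurable
    show "{z::'a. 1 < norm z} \<subseteq> (\<Union>k. ?S k)"
    proof
      fix z :: 'a assume z: "z \<in> {z. 1 < norm z}"
      then have nz: "0 < norm z" "1 \<le> norm z" by auto
      then have "0 < 1 / norm z" "1 / norm z \<le> 1" by (simp_all add: divide_le_eq)
      then obtain k where k: "(1/2) ^ Suc k < 1 / norm z" "1 / norm z \<le> (1/2) ^ k"
        by (rule pos_dyadic_bounds)
      have "inverse (2 ^ Suc k) < inverse (norm z)" "inverse (norm z) \<le> inverse (2 ^ k)"
        using k by (simp_all only: power_one_over inverse_eq_divide)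
      then have "norm z < 2 ^ Suc k" "2 ^ k \<le> norm z"
        using inverse_less_imp_less[of "2 ^ Suc k" "norm z"] inverse_le_imp_le[of "norm z" "2 ^ k"] nz(1)
        by (simp_all only: positive_imp_inverse_positive zero_less_power zero_less_numeral)
      then have "z \<in> ?S k" by simp
      then show "z \<in> (\<Union>k. ?S k)" by blast
    qed
    show "{z::'a. 1 < norm z} \<in> sets borel" by measurable
    show "?w z \<le> ?c k" if z: "z \<in> ?S k" for k z
      using z \<alpha> by (intro powr_mono2') auto
    \<comment> \<open>Again the dimension cancels, now with ratio 2^(-\<alpha>) < 1.\<close>
    have "?c k * (2 ^ Suc k) ^ DIM('a) = 2 powr ?d * (2 powr (- \<alpha>)) ^ k" for k
    proof -
      have "((2::real) ^ Suc k) ^ DIM('a) = (2 powr real (Suc k)) powr ?d" by (simp add: powr_realpow del: power_Suc of_nat_Suc)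
      moreover have "(2::real) ^ k = 2 powr real k" by (simp add: powr_realpow)
      ultimately have "?c k * (2 ^ Suc k) ^ DIM('a) = 2 powr (real k * (- ?d - \<alpha>)) * 2 powr (real (Suc k) * ?d)"
        by (simp only: powr_powr)
      also have "\<dots> = 2 powr (real k * (- ?d - \<alpha>) + real (Suc k) * ?d)" by (simp only: powr_add)
      also have "real k * (- ?d - \<alpha>) + real (Suc k) * ?d = ?d + real k * (- \<alpha>)" by (simp add: algebra_simps)
      finally show ?thesis by (simp only: powr_add two_powr_pow)
    qed
    moreover have "summable (\<lambda>k. 2 powr ?d * (2 powr (- \<alpha>)) ^ k)"
      using \<alpha> by (intro summable_mult summable_geometric) (simp add: powr_less_one)
    ultimately show "summable (\<lambda>k. ?c k * (2 ^ Suc k) ^ DIM('a))" by simp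
  qed auto
qed

locale stable_measure =
  fixes \<alpha> \<kappa>\<^sub>1 :: real and \<kappa>t :: "'a::euclidean_space \<Rightarrow> real"
  assumes \<alpha>: "1 < \<alpha>" "\<alpha> < 2"
    and kt_meas [measurable]: "\<kappa>t \<in> borel_measurable borel"
    and kt_sym: "\<And>z. \<kappa>t z = \<kappa>t (- z)"
    and kt_bounds: "\<And>z. 0 \<le> \<kappa>t z" "\<And>z. \<kappa>t z \<le> \<kappa>\<^sub>1"
begin

definition wt :: "'a \<Rightarrow> real" where
  "wt z = \<kappa>t z * norm z powr (- real DIM('a) - \<alpha>)"

lemma wt_nonneg: "0 \<le> wt z" using kt_bounds by (simp add: wt_def)

lemma wt_measurable [measurable]: "wt \<in> borel_measurable borel"
  unfolding wt_def[abs_def] by measurable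

abbreviation \<nu> :: "'a measure" where "\<nu> \<equiv> jump_measure \<alpha> \<kappa>t"

lemma nu_eq: "\<nu> = density lborel (\<lambda>z. ennreal (wt z))"
  by (simp add: jump_measure_def wt_def)

lemma sets_nu [simp, measurable_cong]: "sets \<nu> = sets borel" and space_nu [simp]: "space \<nu> = UNIV"
  by (simp_all add: nu_eq)

lemma sigma_finite_nu: "sigma_finite_measure \<nu>"
  unfolding nu_eq
  by (subst sigma_finite_measure.sigma_finite_iff_density_finite[OF lborel.sigma_finite_measure_axioms]) auto

lemma nn_integral_nu:
  "f \<in> borel_measurable borel \<Longrightarrow> (\<integral>\<^sup>+z. f z \<partial>\<nu>) = (\<integral>\<^sup>+z. ennreal (wt z) * f z \<partial>lborel)"
  unfolding nu_eq by (subst nn_integral_density) auto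

lemma integral_nu:
  fixes f :: "'a \<Rightarrow> 'b::{banach, second_countable_topology}"
  shows "f \<in> borel_measurable borel \<Longrightarrow> (\<integral>z. f z \<partial>\<nu>) = (\<integral>z. wt z *\<^sub>R f z \<partial>lborel)"
  unfolding nu_eq using wt_nonneg by (subst integral_density) auto

lemma distr_lborel_uminus: "distr lborel borel (\<lambda>z::'a. - z) = lborel"
proof -
  have "(lborel :: 'a measure) = density (distr lborel borel (\<lambda>x. 0 + (-1) *\<^sub>R x)) (\<lambda>_. ennreal (\<bar>-1\<bar> ^ DIM('a)))"
    by (rule lborel_affine) simp
  then show ?thesis by (simp add: density_1)
qed

text \<open>The reflection of z preserves the density and gives I = -I. The substitution rule is
  valid also for integrals that carry the default value 0, so measurability is the only analytic
  assumption.\<close>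

lemma integral_odd_zero:
  fixes f :: "'a \<Rightarrow> 'b::{banach, second_countable_topology}"
  assumes f: "f \<in> borel_measurable borel" and odd: "\<And>z. f (- z) = - f z"
  shows "(\<integral>z. f z \<partial>\<nu>) = 0"
proof -
  have "(\<integral>z. f z \<partial>\<nu>) = (\<integral>z. wt z *\<^sub>R f z \<partial>lborel)" by (rule integral_nu[OF f])
  also have "\<dots> = (\<integral>z. wt z *\<^sub>R f z \<partial>distr lborel borel (\<lambda>z. - z))" by (simp add: distr_lborel_uminus)
  also have "\<dots> = (\<integral>z. wt (- z) *\<^sub>R f (- z) \<partial>lborel)"
    using f by (subst integral_distr) auto
  also have "\<dots> = - (\<integral>z. wt z *\<^sub>R f z \<partial>lborel)"
    using kt_sym by (simp add: odd wt_def)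
  also have "\<dots> = - (\<integral>z. f z \<partial>\<nu>)" by (simp add: integral_nu[OF f])
  finally have "(\<integral>z. f z \<partial>\<nu>) = - (\<integral>z. f z \<partial>\<nu>)" .
  then have "2 *\<^sub>R (\<integral>z. f z \<partial>\<nu>) = 0" by (metis add.right_inverse scaleR_2)
  then show ?thesis by simp
qed

text \<open>For p > 0 this is min(1, |z|^p), the scale in which jumps and increments of
  \<open>f\<close> are measured; against the jump measure it is integrable as soon as p >
  \<alpha>.\<close>

definition gauge :: "real \<Rightarrow> 'a \<Rightarrow> real" where
  "gauge p z = (if norm z \<le> 1 then norm z powr p else 1)"

lemma gauge_measurable [measurable]: "gauge p \<in> borel_measurable borel"
  unfolding gauge_def[abs_def] by measurable

lemma gauge_nonneg: "0 \<le> gauge p z" by (simp add: gauge_def)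

lemma gauge_integrable:
  assumes p: "\<alpha> < p"
  shows "integrable \<nu> (gauge p)"
proof -
  have k1: "0 \<le> \<kappa>\<^sub>1" using kt_bounds[of 0] by linarith
  let ?d = "real DIM('a)"
  let ?s = "\<lambda>z::'a. ennreal (norm z powr p * norm z powr (- ?d - \<alpha>)) * indicator {z. norm z \<le> 1} z"
  let ?l = "\<lambda>z::'a. ennreal (norm z powr (- ?d - \<alpha>)) * indicator {z. 1 < norm z} z"
  have "(\<integral>\<^sup>+z. ennreal (gauge p z) \<partial>\<nu>) = (\<integral>\<^sup>+z. ennreal (wt z) * ennreal (gauge p z) \<partial>lborel)"
    by (rule nn_integral_nu) simp
  also have "\<dots> \<le> (\<integral>\<^sup>+z. ennreal \<kappa>\<^sub>1 * (?s z + ?l z) \<partial>lborel)"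
  proof (rule nn_integral_mono)
    fix z :: 'a
    have "wt z * gauge p z \<le> \<kappa>\<^sub>1 * (norm z powr (- ?d - \<alpha>) * gauge p z)"
      unfolding wt_def mult.assoc using kt_bounds(2)[of z] gauge_nonneg[of p z] by (intro mult_right_mono) auto
    then have "ennreal (wt z) * ennreal (gauge p z) \<le> ennreal (\<kappa>\<^sub>1 * (norm z powr (- ?d - \<alpha>) * gauge p z))"
      using wt_nonneg gauge_nonneg by (simp add: ennreal_mult[symmetric] ennreal_leI)
    also have "\<dots> = ennreal \<kappa>\<^sub>1 * ennreal (norm z powr (- ?d - \<alpha>) * gauge p z)"
      using k1 gauge_nonneg[of p z] by (simp add: ennreal_mult)
    also have "ennreal (norm z powr (- ?d - \<alpha>) * gauge p z) = ?s z + ?l z"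
      by (cases "norm z \<le> 1") (simp_all add: gauge_def mult.commute)
    finally show "ennreal (wt z) * ennreal (gauge p z) \<le> ennreal \<kappa>\<^sub>1 * (?s z + ?l z)" .
  qed
  also have "\<dots> = ennreal \<kappa>\<^sub>1 * ((\<integral>\<^sup>+z. ?s z \<partial>lborel) + (\<integral>\<^sup>+z. ?l z \<partial>lborel))"
    by (subst nn_integral_cmult, measurable, subst nn_integral_add, measurable)
  also have "\<dots> < \<infinity>"
    using stable_small_finite[of \<alpha> p, where 'a='a] stable_large_finite[of \<alpha>, where 'a='a] p \<alpha>
    by (simp add: ennreal_mult_less_top)
  finally show ?thesis
    using gauge_nonneg by (intro integrableI_bounded) auto
qed

text \<open>Markov's inequality with the gauge of exponent 2, which is integrable because 2 >
  \<alpha>.\<close>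

lemma nu_outside_finite:
  assumes "0 < \<epsilon>" "\<epsilon> \<le> 1"
  shows "emeasure \<nu> {z. \<epsilon> < norm z} < \<infinity>"
proof -
  have *: "indicator {z. \<epsilon> < norm z} z \<le> (1 / \<epsilon> powr 2) * gauge 2 z" for z :: 'a
  proof (cases "\<epsilon> < norm z")
    case True
    have "\<epsilon> powr 2 \<le> gauge 2 z"
      using True assms powr_mono2[of 2 \<epsilon> "norm z"] powr_mono2[of 2 \<epsilon> 1] by (auto simp: gauge_def)
    then show ?thesis using True assms by (simp add: field_simps)
  qed (use gauge_nonneg in simp)
  have "emeasure \<nu> {z. \<epsilon> < norm z} = (\<integral>\<^sup>+z. indicator {z. \<epsilon> < norm z} z \<partial>\<nu>)" by simp
  also have "\<dots> \<le> (\<integral>\<^sup>+z. ennreal ((1 / \<epsilon> powr 2) * gauge 2 z) \<partial>\<nu>)"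
    using * by (intro nn_integral_mono) (metis ennreal_indicator ennreal_leI)
  also have "\<dots> = ennreal (\<integral>z. (1 / \<epsilon> powr 2) * gauge 2 z \<partial>\<nu>)"
    using \<alpha> gauge_nonneg by (intro nn_integral_eq_integral integrable_mult_right gauge_integrable) auto
  finally show ?thesis by (simp add: le_less_trans)
qed

lemma integrable_bounded_outside:
  fixes f :: "'a \<Rightarrow> 'b::{banach, second_countable_topology}"
  assumes "0 < \<epsilon>" "\<epsilon> \<le> 1" and f: "f \<in> borel_measurable borel"
    and b: "\<And>z. norm (f z) \<le> C * indicator {z. \<epsilon> < norm z} z"
  shows "integrable \<nu> f"
proof (rule Bochner_Integration.integrable_bound)
  show "integrable \<nu> (\<lambda>z. C * indicator {z. \<epsilon> < norm z} z)"
    using nu_outside_finite[OF assms(1,2)] by (intro integrable_mult_right integrable_real_indicator) auto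
  show "AE z in \<nu>. norm (f z) \<le> norm (C * indicator {z. \<epsilon> < norm z} z)"
    using b by (intro AE_I2) (metis abs_ge_self order_trans real_norm_def)
qed (use f in simp)

end

section \<open>The operator and its truncations on functions with Hoelder gradient\<close>

locale stable_function = stable_measure \<alpha> \<kappa>\<^sub>1 \<kappa>t
  for \<alpha> \<kappa>\<^sub>1 and \<kappa>t :: "'a::euclidean_space \<Rightarrow> real" +
  fixes \<sigma> :: "'a \<Rightarrow> 'a \<Rightarrow> real" and k\<^sub>1 :: real and f :: "'a \<Rightarrow> real" and C \<theta> :: real
  assumes sigma_meas: "(\<lambda>(y, z). \<sigma> y z) \<in> borel_measurable borel"
    and sigma_sym: "\<And>y z. \<sigma> y z = \<sigma> y (- z)"
    and sigma_bounds: "\<And>y z. 0 \<le> \<sigma> y z" "\<And>y z. \<sigma> y z \<le> k\<^sub>1"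
    and C: "0 < C" and \<theta>: "\<alpha> - 1 < \<theta>" "0 < \<theta>" "\<theta> \<le> 1"
    and f_deriv: "\<And>x. (f has_derivative (\<lambda>v. grad f x \<bullet> v)) (at x)"
    and f_bound: "\<And>x. \<bar>f x\<bar> \<le> C" and grad_bound: "\<And>x. norm (grad f x) \<le> C"
    and grad_holder: "\<And>x y. norm (grad f x - grad f y) \<le> C * norm (x - y) powr \<theta>"
begin

lemma f_cont: "continuous_on UNIV f"
  using f_deriv by (intro has_derivative_continuous_on) auto

lemma grad_isCont: "isCont (grad f) x"
proof -
  have "((\<lambda>y. C * norm (y - x) powr \<theta>) \<longlongrightarrow> C * 0) (at x)"
    by (intro tendsto_mult tendsto_const tendsto_zero_powrI[where b = \<theta>] tendsto_norm_zero LIM_zero tendsto_ident_at)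
      (use \<theta> in auto)
  then have *: "((\<lambda>y. C * norm (y - x) powr \<theta>) \<longlongrightarrow> 0) (at x)" by simp
  have "((\<lambda>y. grad f y - grad f x) \<longlongrightarrow> 0) (at x)"
    by (rule Lim_null_comparison[OF always_eventually *]) (intro allI grad_holder)
  then show ?thesis unfolding isCont_def by (rule LIM_zero_cancel)
qed

lemma f_isCont: "isCont f x" using f_deriv by (rule has_derivative_continuous)

lemma grad_cont: "continuous_on UNIV (grad f)"
  using grad_isCont by (simp add: continuous_on_eq_continuous_at)

lemma f_measurable [measurable]: "f \<in> borel_measurable borel"
  by (rule borel_measurable_continuous_onI[OF f_cont])

lemma grad_measurable [measurable]: "grad f \<in> borel_measurable borel"
  by (rule borel_measurable_continuous_onI[OF grad_cont])

lemma sigma_measurable2: "(\<lambda>x. \<sigma> (g x) (h x)) \<in> borel_measurable L"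
  if "g \<in> borel_measurable L" "h \<in> borel_measurable L"
proof -
  have "(\<lambda>x. (g x, h x)) \<in> measurable L borel" using that by (rule borel_measurable_Pair)
  from measurable_compose[OF this sigma_meas] show ?thesis by simp
qed

text \<open>The gradient bound covers |z| \<le> 1 and boundedness of \<open>f\<close> the rest; the
  factor 2 is due to the second case.\<close>

lemma f_increment: "\<bar>f (y + z) - f y\<bar> \<le> 2 * C * gauge 1 z"
proof (cases "norm z \<le> 1")
  case True
  have "0 \<le> C * norm z" using C by simp
  with grad_increment_bound[OF f_deriv C grad_bound, of y z] have "\<bar>f (y + z) - f y\<bar> \<le> 2 * (C * norm z)" by linarith
  then show ?thesis using True by (simp add: gauge_def powr_one)
next
  case False
  then show ?thesis using f_bound[of "y + z"] f_bound[of y] by (simp add: gauge_def)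
qed

definition rem :: "'a \<Rightarrow> 'a \<Rightarrow> real" where
  "rem y z = f (y + z) - f y - (if norm z \<le> 1 then grad f y \<bullet> z else 0)"

lemma rem_measurable: "(\<lambda>x. rem (g x) (h x)) \<in> borel_measurable L"
  if [measurable]: "g \<in> borel_measurable L" "h \<in> borel_measurable L"
  unfolding rem_def by measurable

lemma rem_bound: "\<bar>rem y z\<bar> \<le> 2 * C * gauge (1 + \<theta>) z"
proof (cases "norm z \<le> 1")
  case True
  have "0 \<le> C * norm z powr (1 + \<theta>)" using C by simp
  with grad_taylor_bound[OF f_deriv C \<theta>(2) grad_holder, of y z]
  have "\<bar>f (y + z) - f y - grad f y \<bullet> z\<bar> \<le> 2 * (C * norm z powr (1 + \<theta>))" by linarith
  then show ?thesis using True by (simp add: gauge_def rem_def)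
next
  case False
  then show ?thesis using f_bound[of "y + z"] f_bound[of y] by (simp add: gauge_def rem_def)
qed

lemma rem_sigma_bound: "\<bar>rem y z * \<sigma> x z\<bar> \<le> 2 * C * k\<^sub>1 * gauge (1 + \<theta>) z"
proof -
  have "\<bar>rem y z * \<sigma> x z\<bar> \<le> (2 * C * gauge (1 + \<theta>) z) * k\<^sub>1"
    unfolding abs_mult using sigma_bounds[of x z] rem_bound[of y z] C gauge_nonneg[of "1 + \<theta>" z]
    by (intro mult_mono) auto
  then show ?thesis by (simp add: mult_ac)
qed

lemma envelope_integrable: "integrable \<nu> (\<lambda>z. 2 * C * k\<^sub>1 * gauge (1 + \<theta>) z)"
  using \<theta> by (intro integrable_mult_right gauge_integrable) auto

lemma rem_sigma_integrable: "integrable \<nu> (\<lambda>z. rem y z * \<sigma> x z)"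
proof (rule Bochner_Integration.integrable_bound[OF envelope_integrable])
  show "(\<lambda>z. rem y z * \<sigma> x z) \<in> borel_measurable \<nu>"
    by (intro borel_measurable_times rem_measurable sigma_measurable2) auto
  show "AE z in \<nu>. norm (rem y z * \<sigma> x z) \<le> norm (2 * C * k\<^sub>1 * gauge (1 + \<theta>) z)"
    unfolding real_norm_def by (intro AE_I2 order_trans[OF rem_sigma_bound abs_ge_self])
qed

text \<open>The principal value in absolutely convergent form, with the gradient term removed on the
  unit ball; \<open>stable_op_eq\<close> is the identification.\<close>

definition Lf :: "'a \<Rightarrow> real" where
  "Lf x = (\<integral>z. rem x z * \<sigma> x z \<partial>\<nu>)"

text \<open>Two points are kept apart: \<open>f\<close> is evaluated around \<open>y\<close>, while
  the jump intensity is taken at \<open>x\<close>. The truncated process sits at \<open>y\<close>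
  but jumps at the rate that the original process has at \<open>x\<close>.\<close>

definition trunc_gen :: "real \<Rightarrow> 'a \<Rightarrow> 'a \<Rightarrow> real" where
  "trunc_gen \<epsilon> y x = (\<integral>z. indicator {z. \<epsilon> < norm z} z * ((f (y + z) - f y) * \<sigma> x z) \<partial>\<nu>)"

text \<open>The gradient term is odd in z because \<open>\<sigma> x\<close> and the jump measure are
  symmetric, so it integrates to 0 over the truncated region. What is left has an integrable bound
  that does not depend on the truncation.\<close>

lemma trunc_gen_eq:
  assumes \<epsilon>: "0 < \<epsilon>" "\<epsilon> \<le> 1"
  shows "trunc_gen \<epsilon> y x = (\<integral>z. indicator {z. \<epsilon> < norm z} z * (rem y z * \<sigma> x z) \<partial>\<nu>)"
proof -
  let ?A = "{z::'a. \<epsilon> < norm z}"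
  let ?o = "\<lambda>z. indicator ?A z * ((if norm z \<le> 1 then grad f y \<bullet> z else 0) * \<sigma> x z)"
  let ?r = "\<lambda>z. indicator ?A z * (rem y z * \<sigma> x z)"
  have om: "?o \<in> borel_measurable borel"
    by (intro borel_measurable_times sigma_measurable2) auto
  have 0: "(\<integral>z. ?o z \<partial>\<nu>) = 0"
    by (rule integral_odd_zero[OF om]) (use sigma_sym[of x] in \<open>simp add: indicator_def\<close>)
  have "integrable \<nu> ?o"
  proof (rule integrable_bounded_outside[OF \<epsilon> om, where C = "C * k\<^sub>1"])
    fix z
    have "\<bar>(if norm z \<le> 1 then grad f y \<bullet> z else 0) * \<sigma> x z\<bar> \<le> C * k\<^sub>1"
      unfolding abs_mult
    proof (rule mult_mono)
      have "\<bar>grad f y \<bullet> z\<bar> \<le> C" if "norm z \<le> 1"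
      proof -
        have "\<bar>grad f y \<bullet> z\<bar> \<le> norm (grad f y) * norm z" by (rule Cauchy_Schwarz_ineq2)
        also have "\<dots> \<le> C * 1" using grad_bound[of y] that C by (intro mult_mono) auto
        finally show ?thesis by simp
      qed
      then show "\<bar>if norm z \<le> 1 then grad f y \<bullet> z else 0\<bar> \<le> C" using C by auto
    qed (use sigma_bounds[of x z] C in auto)
    then show "norm (?o z) \<le> C * k\<^sub>1 * indicator ?A z"
      by (cases "z \<in> ?A")
        (simp_all only: indicator_simps mult_1_left mult_1_right mult_zero_left mult_zero_right real_norm_def abs_zero order_refl
          if_False if_True not_True_eq_False not_False_eq_True)
  qed
  moreover have "integrable \<nu> ?r"
    using integrable_mult_indicator[OF _ rem_sigma_integrable[of y x], of ?A] by simp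
  ultimately have "(\<integral>z. ?r z + ?o z \<partial>\<nu>) = (\<integral>z. ?r z \<partial>\<nu>)" by (simp add: 0)
  moreover have "?r z + ?o z = indicator ?A z * ((f (y + z) - f y) * \<sigma> x z)" for z
    by (simp add: rem_def algebra_simps)
  ultimately show ?thesis unfolding trunc_gen_def by simp
qed

text \<open>Dominated convergence below the gauge of exponent 1 + \<theta> > \<alpha>. Truncation
  level and base point move together while the argument of \<open>\<sigma>\<close> stays put, so
  continuity of \<open>f\<close> and its gradient gives the pointwise limit. A constant
  \<open>y\<close> yields the principal value, a varying one the limit along truncated
  paths.\<close>

lemma trunc_gen_lim:
  assumes \<epsilon>: "\<And>n. 0 < \<epsilon> n" "\<And>n. \<epsilon> n \<le> 1" "\<epsilon> \<longlonglongrightarrow> 0" and y: "y \<longlonglongrightarrow> x"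
  shows "(\<lambda>n. trunc_gen (\<epsilon> n) (y n) x) \<longlonglongrightarrow> Lf x"
  unfolding trunc_gen_eq[OF \<epsilon>(1,2)] Lf_def
proof (rule integral_dominated_convergence[OF _ _ envelope_integrable])
  show "(\<lambda>z. rem x z * \<sigma> x z) \<in> borel_measurable \<nu>"
    by (intro borel_measurable_times rem_measurable sigma_measurable2) auto
  show "(\<lambda>z. indicator {z. \<epsilon> n < norm z} z * (rem (y n) z * \<sigma> x z)) \<in> borel_measurable \<nu>" for n
    by (intro borel_measurable_times rem_measurable sigma_measurable2) auto
  show "AE z in \<nu>. norm (indicator {z. \<epsilon> n < norm z} z * (rem (y n) z * \<sigma> x z)) \<le> 2 * C * k\<^sub>1 * gauge (1 + \<theta>) z" for n
  proof (rule AE_I2)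
    fix z
    have "norm (indicator {z. \<epsilon> n < norm z} z * (rem (y n) z * \<sigma> x z)) \<le> \<bar>rem (y n) z * \<sigma> x z\<bar>"
      by (simp add: indicator_def)
    also have "\<dots> \<le> 2 * C * k\<^sub>1 * gauge (1 + \<theta>) z" by (rule rem_sigma_bound)
    finally show "norm (indicator {z. \<epsilon> n < norm z} z * (rem (y n) z * \<sigma> x z)) \<le> 2 * C * k\<^sub>1 * gauge (1 + \<theta>) z" .
  qed
  show "AE z in \<nu>. (\<lambda>n. indicator {z. \<epsilon> n < norm z} z * (rem (y n) z * \<sigma> x z)) \<longlonglongrightarrow> rem x z * \<sigma> x z"
  proof (rule AE_I2)
    fix z
    have "(\<lambda>n. rem (y n) z) \<longlonglongrightarrow> rem x z"
      unfolding rem_def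
      by (auto intro!: tendsto_intros isCont_tendsto_compose[OF f_isCont] isCont_tendsto_compose[OF grad_isCont] y)
    then have l: "(\<lambda>n. rem (y n) z * \<sigma> x z) \<longlonglongrightarrow> rem x z * \<sigma> x z" by (intro tendsto_intros)
    show "(\<lambda>n. indicator {z. \<epsilon> n < norm z} z * (rem (y n) z * \<sigma> x z)) \<longlonglongrightarrow> rem x z * \<sigma> x z"
    proof (cases "z = 0")
      \<comment> \<open>No truncated region contains the origin, which is harmless since
        \<open>rem\<close> vanishes at z = 0.\<close>
      case True
      then show ?thesis by (simp add: rem_def)
    next
      case False
      then have "\<forall>\<^sub>F n in sequentially. \<epsilon> n < norm z"
        using order_tendstoD(2)[OF \<epsilon>(3), of "norm z"] by simp
      then have "\<forall>\<^sub>F n in sequentially. rem (y n) z * \<sigma> x z = indicator {z. \<epsilon> n < norm z} z * (rem (y n) z * \<sigma> x z)"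
        by eventually_elim simp
      then show ?thesis using l by (rule Lim_transform_eventually[rotated])
    qed
  qed
qed

lemma stable_op_eq: "stable_op \<alpha> (\<lambda>y z. \<sigma> y z * \<kappa>t z) f x = Lf x"
proof -
  let ?I = "\<lambda>\<epsilon>. LINT z:{z. \<epsilon> < norm z}|lborel. (f (x + z) - f x) * (\<sigma> x z * \<kappa>t z / norm z powr (real DIM('a) + \<alpha>))"
  have I: "?I \<epsilon> = trunc_gen \<epsilon> x x" for \<epsilon>
  proof -
    have [measurable]: "(\<lambda>z. \<sigma> x z) \<in> borel_measurable borel" by (intro sigma_measurable2) auto
    have "trunc_gen \<epsilon> x x = (\<integral>z. wt z *\<^sub>R (indicator {z. \<epsilon> < norm z} z * ((f (x + z) - f x) * \<sigma> x z)) \<partial>lborel)"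
      unfolding trunc_gen_def by (rule integral_nu) measurable
    also have "\<dots> = ?I \<epsilon>"
      unfolding set_lebesgue_integral_def
    proof (rule Bochner_Integration.integral_cong[OF refl])
      fix z :: 'a
      have "norm z powr (- real DIM('a) - \<alpha>) = 1 / norm z powr (real DIM('a) + \<alpha>)"
      proof -
        have e: "- real DIM('a) - \<alpha> = - (real DIM('a) + \<alpha>)" by simp
        show ?thesis unfolding e by (rule powr_minus_divide)
      qed
      then show "wt z *\<^sub>R (indicator {z. \<epsilon> < norm z} z * ((f (x + z) - f x) * \<sigma> x z)) =
          indicator {z. \<epsilon> < norm z} z *\<^sub>R ((f (x + z) - f x) * (\<sigma> x z * \<kappa>t z / norm z powr (real DIM('a) + \<alpha>)))"
        by (simp add: wt_def)
    qed
    finally show ?thesis ..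
  qed
  have "(?I \<longlongrightarrow> Lf x) (at_right 0)"
  \<comment> \<open>The bound 1 keeps the truncation levels in the range where the gradient term may
    be subtracted.\<close>
  proof (rule tendsto_at_right_sequentially[of 0 1])
    fix S :: "nat \<Rightarrow> real" assume S: "\<And>n. 0 < S n" "\<And>n. S n < 1" "S \<longlonglongrightarrow> 0"
    show "(\<lambda>n. ?I (S n)) \<longlonglongrightarrow> Lf x"
      unfolding I by (rule trunc_gen_lim) (use S in \<open>auto intro: less_imp_le\<close>)
  qed simp
  then show ?thesis unfolding stable_op_def by (intro tendsto_Lim) auto
qed

lemma Lf_measurable [measurable]: "Lf \<in> borel_measurable borel"
  unfolding Lf_def[abs_def]
proof (rule sigma_finite_measure.borel_measurable_lebesgue_integral[OF sigma_finite_nu])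
  show "(\<lambda>(x, z). rem x z * \<sigma> x z) \<in> borel_measurable (borel \<Otimes>\<^sub>M \<nu>)"
    unfolding case_prod_unfold
    by (intro borel_measurable_times rem_measurable sigma_measurable2) measurable
qed

definition Lbound :: real where "Lbound = (\<integral>z. 2 * C * k\<^sub>1 * gauge (1 + \<theta>) z \<partial>\<nu>)"

lemma trunc_gen_bound:
  assumes \<epsilon>: "0 < \<epsilon>" "\<epsilon> \<le> 1"
  shows "\<bar>trunc_gen \<epsilon> y x\<bar> \<le> Lbound"
proof -
  let ?r = "\<lambda>z. indicator {z. \<epsilon> < norm z} z * (rem y z * \<sigma> x z)"
  have i: "integrable \<nu> ?r"
    using integrable_mult_indicator[OF _ rem_sigma_integrable[of y x], of "{z. \<epsilon> < norm z}"] by simp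
  have "\<bar>trunc_gen \<epsilon> y x\<bar> \<le> (\<integral>z. \<bar>?r z\<bar> \<partial>\<nu>)" unfolding trunc_gen_eq[OF \<epsilon>] by (rule integral_abs_bound)
  also have "\<dots> \<le> Lbound"
    unfolding Lbound_def
  proof (rule integral_mono[OF integrable_abs[OF i] envelope_integrable])
    fix z
    have "\<bar>?r z\<bar> \<le> \<bar>rem y z * \<sigma> x z\<bar>" by (simp add: indicator_def)
    then show "\<bar>?r z\<bar> \<le> 2 * C * k\<^sub>1 * gauge (1 + \<theta>) z" using rem_sigma_bound by (rule order_trans)
  qed
  finally show ?thesis .
qed

lemma Lf_bound: "\<bar>Lf x\<bar> \<le> Lbound"
proof -
  have "(\<lambda>n. \<bar>trunc_gen (1 / real (Suc n)) x x\<bar>) \<longlonglongrightarrow> \<bar>Lf x\<bar>"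
    using LIMSEQ_inverse_real_of_nat by (intro tendsto_rabs trunc_gen_lim) (auto simp: inverse_eq_divide)
  then show ?thesis by (rule LIMSEQ_le_const2) (use trunc_gen_bound in auto)
qed

end

section \<open>Cadlag paths\<close>

text \<open>A rational chosen in the gap to the left of each point determines the point, which
  injects the set into the rationals.\<close>

lemma countable_left_isolated:
  fixes A :: "real set"
  assumes "\<And>s. s \<in> A \<Longrightarrow> \<exists>d>0. {s - d<..<s} \<inter> A = {}"
  shows "countable A"
proof -
  have "\<forall>s\<in>A. \<exists>q::rat. of_rat q < s \<and> {of_rat q<..<s} \<inter> A = {}"
  proof
    fix s assume "s \<in> A"
    then obtain d where d: "0 < d" "{s - d<..<s} \<inter> A = {}" using assms by blast
    obtain q where "s - d < of_rat q" "of_rat q < s" using of_rat_dense[of "s - d" s] d by auto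
    moreover from this have "{of_rat q<..<s} \<subseteq> {s - d<..<s}" by auto
    ultimately show "\<exists>q::rat. of_rat q < s \<and> {of_rat q<..<s} \<inter> A = {}" using d by blast
  qed
  from bchoice[OF this] obtain q :: "real \<Rightarrow> rat" where
    q: "\<forall>s\<in>A. of_rat (q s) < s \<and> {of_rat (q s)<..<s} \<inter> A = {}" ..
  have "inj_on q A"
  proof (rule inj_onI, rule ccontr)
    fix s s' assume s: "s \<in> A" "s' \<in> A" "q s = q s'" "s \<noteq> s'"
    have *: False if "u < v" "u \<in> A" "v \<in> A" "q u = q v" for u v
    proof -
      have "of_rat (q v) < u" using q that by force
      then have "u \<in> {of_rat (q v)<..<v} \<inter> A" using that by simp
      then show False using q that by blast
    qed
    show False using *[of s s'] *[of s' s] s by (cases "s < s'") auto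
  qed
  then show ?thesis using countable_image_inj_on[of q A] by (auto intro: countableI_type)
qed

text \<open>Jumps larger than a fixed e are isolated from the left: shortly before \<open>s\<close>
  all values, and hence all left limits, lie within e/4 of \<open>l s\<close>, which leaves no room
  for another such jump.\<close>

lemma left_jumps_countable:
  fixes x :: "real \<Rightarrow> 'b::metric_space"
  assumes "\<And>s. 0 < s \<Longrightarrow> (x \<longlongrightarrow> l s) (at_left s)"
  shows "countable {s. 0 < s \<and> l s \<noteq> x s}"
proof -
  let ?D = "\<lambda>n::nat. {s. 0 < s \<and> 1 / real (Suc n) < dist (x s) (l s)}"
  have "countable (?D n)" for n
  proof (rule countable_left_isolated)
    fix s assume s: "s \<in> ?D n"
    define e where "e = 1 / real (Suc n)"
    have e: "0 < e" by (simp add: e_def)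
    have "\<forall>\<^sub>F u in at_left s. dist (x u) (l s) < e / 4"
      using tendstoD[OF assms, of s "e / 4"] s e by auto
    then obtain b where b: "b < s" "\<And>u. b < u \<Longrightarrow> u < s \<Longrightarrow> dist (x u) (l s) < e / 4"
      unfolding eventually_at_left_field by blast
    define d where "d = min (s - b) s"
    have d: "0 < d" using b s by (simp add: d_def)
    have "u \<notin> ?D n" if u: "u \<in> {s - d<..<s}" for u
    proof
      assume uD: "u \<in> ?D n"
      have ub: "b < u" "u < s" "0 < u" using u by (auto simp: d_def)
      have "\<forall>\<^sub>F v in at_left u. dist (x v) (l s) \<le> e / 4"
        unfolding eventually_at_left_field
        using b(2) ub by (intro exI[of _ b]) (auto intro!: less_imp_le)
      moreover have "((\<lambda>v. dist (x v) (l s)) \<longlongrightarrow> dist (l u) (l s)) (at_left u)"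
        by (intro tendsto_dist tendsto_const assms ub)
      ultimately have "dist (l u) (l s) \<le> e / 4"
        by (intro tendsto_upperbound[of _ _ "at_left u"]) auto
      moreover have "dist (x u) (l s) < e / 4" using b(2) ub by blast
      ultimately have "dist (x u) (l u) < e"
        using dist_triangle2[of "x u" "l u" "l s"] e by linarith
      then show False using uD by (simp add: e_def)
    qed
    then show "\<exists>d>0. {s - d<..<s} \<inter> ?D n = {}" using d by (intro exI[of _ d]) blast
  qed
  then have "countable (\<Union>n. ?D n)" by auto
  moreover have "{s. 0 < s \<and> l s \<noteq> x s} \<subseteq> (\<Union>n. ?D n)"
  proof
    fix s assume s: "s \<in> {s. 0 < s \<and> l s \<noteq> x s}"
    then have "0 < dist (x s) (l s)" by auto
    then obtain n where "1 / real (Suc n) < dist (x s) (l s)" using nat_approx_posE by blast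
    then show "s \<in> (\<Union>n. ?D n)" using s by blast
  qed
  ultimately show ?thesis by (rule countable_subset[rotated])
qed

lemma cadlag_left_lim:
  fixes x :: "real \<Rightarrow> 'b::metric_space"
  assumes "cadlag x" "0 < s"
  shows "(x \<longlongrightarrow> Lim (at_left s) x) (at_left s)"
proof -
  obtain l where l: "(x \<longlongrightarrow> l) (at_left s)" using assms by (auto simp: cadlag_def)
  then have "Lim (at_left s) x = l" by (intro tendsto_Lim) auto
  then show ?thesis using l by simp
qed

lemma cadlag_AE_left_lim:
  fixes x :: "real \<Rightarrow> 'b::metric_space"
  assumes "cadlag x"
  shows "AE s in lborel. 0 < s \<longrightarrow> Lim (at_left s) x = x s"
proof (rule AE_I')
  show "{s. 0 < s \<and> Lim (at_left s) x \<noteq> x s} \<in> null_sets lborel"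
    by (intro countable_imp_null_set_lborel left_jumps_countable cadlag_left_lim[OF assms])
qed auto

section \<open>The pathwise change of variables formula\<close>

lemma indefinite_integral_continuous:
  fixes \<beta> :: "real \<Rightarrow> 'b::{banach, second_countable_topology}"
  assumes \<beta>: "integrable lborel \<beta>"
  shows "continuous_on UNIV (\<lambda>s. \<integral>u. indicator {0<..s} u *\<^sub>R \<beta> u \<partial>lborel)"
proof (rule continuous_at_imp_continuous_on, rule ballI)
  fix s :: real
  show "isCont (\<lambda>s. \<integral>u. indicator {0<..s} u *\<^sub>R \<beta> u \<partial>lborel) s"
  proof (rule continuous_at_sequentiallyI)
    fix r assume r: "r \<longlonglongrightarrow> s"
    show "(\<lambda>n. \<integral>u. indicator {0<..r n} u *\<^sub>R \<beta> u \<partial>lborel) \<longlonglongrightarrow> (\<integral>u. indicator {0<..s} u *\<^sub>R \<beta> u \<partial>lborel)"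
    proof (rule integral_dominated_convergence[where w = "\<lambda>u. norm (\<beta> u)"])
      show "AE u in lborel. (\<lambda>n. indicator {0<..r n} u *\<^sub>R \<beta> u) \<longlonglongrightarrow> indicator {0<..s} u *\<^sub>R \<beta> u"
        using AE_lborel_singleton[of s]
      proof eventually_elim
        case (elim u)
        have "\<forall>\<^sub>F n in sequentially. indicator {0<..r n} u *\<^sub>R \<beta> u = indicator {0<..s} u *\<^sub>R \<beta> u"
        proof (cases "u < s")
          case True
          show ?thesis using order_tendstoD(1)[OF r True]
            by eventually_elim (use True in \<open>simp add: indicator_def\<close>)
        next
          case False
          then have "s < u" using elim by simp
          show ?thesis using order_tendstoD(2)[OF r \<open>s < u\<close>]
            by eventually_elim (use \<open>s < u\<close> in \<open>simp add: indicator_def\<close>)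
        qed
        then show ?case by (rule tendsto_eventually)
      qed
      show "AE u in lborel. norm (indicator {0<..r n} u *\<^sub>R \<beta> u) \<le> norm (\<beta> u)" for n
        by (intro AE_I2) (simp add: indicator_def)
    qed (use \<beta> in auto)
  qed
qed

text \<open>Bisecting the range of \<open>V\<close> improves the bound by the factor \<open>2 powr - \<theta>\<close> each time.\<close>

lemma superadditive_increment_zero:
  fixes D V :: "real \<Rightarrow> real"
  assumes V: "continuous_on UNIV V" "\<And>a b. 0 \<le> a \<Longrightarrow> a \<le> b \<Longrightarrow> V a \<le> V b" and \<theta>: "0 < \<theta>"
    and D: "\<And>a b. 0 \<le> a \<Longrightarrow> a \<le> b \<Longrightarrow> \<bar>D b - D a\<bar> \<le> K * (V b - V a) powr (1 + \<theta>)"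
    and ab: "0 \<le> a" "a \<le> b"
  shows "D b = D a"
proof -
  have *: "\<bar>D b - D a\<bar> \<le> (2 powr - \<theta>) ^ n * (K * (V b - V a) powr (1 + \<theta>))" if "0 \<le> a" "a \<le> b" for n a b
    using that
  proof (induction n arbitrary: a b)
    case 0
    then show ?case using D by simp
  next
    case (Suc n)
    let ?v = "(V a + V b) / 2"
    have "V a \<le> ?v" "?v \<le> V b" using V(2)[OF Suc.prems] by auto
    then obtain c where c: "a \<le> c" "c \<le> b" "V c = ?v"
      using IVT'[of V a ?v b] Suc.prems continuous_on_subset[OF V(1)] by auto
    have half: "((V b - V a) / 2) powr (1 + \<theta>) = (V b - V a) powr (1 + \<theta>) * 2 powr - \<theta> / 2"
      using V(2)[OF Suc.prems] by (simp add: powr_divide powr_add powr_minus field_simps)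
    have d1: "V c - V a = (V b - V a) / 2" "V b - V c = (V b - V a) / 2"
      using c(3) by (auto simp: field_simps)
    have "\<bar>D b - D a\<bar> \<le> \<bar>D c - D a\<bar> + \<bar>D b - D c\<bar>" by simp
    also have "\<dots> \<le> (2 powr - \<theta>) ^ n * (K * (V c - V a) powr (1 + \<theta>)) + (2 powr - \<theta>) ^ n * (K * (V b - V c) powr (1 + \<theta>))"
      using Suc.prems c by (intro add_mono Suc.IH) auto
    also have "\<dots> = (2 powr - \<theta>) ^ Suc n * (K * (V b - V a) powr (1 + \<theta>))"
      unfolding d1 half by (simp add: algebra_simps)
    finally show ?case .
  qed
  have "(\<lambda>n. (2 powr - \<theta>) ^ n * (K * (V b - V a) powr (1 + \<theta>))) \<longlonglongrightarrow> 0 * (K * (V b - V a) powr (1 + \<theta>))"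
    using \<theta> by (intro tendsto_mult tendsto_const LIMSEQ_power_zero) (simp add: powr_less_one)
  then have "\<bar>D b - D a\<bar> \<le> 0"
    using *[OF ab] by (intro LIMSEQ_le_const[where X = "\<lambda>n. (2 powr - \<theta>) ^ n * (K * (V b - V a) powr (1 + \<theta>))"]) auto
  then show ?thesis by simp
qed

context stable_function
begin

context
  fixes \<beta> :: "real \<Rightarrow> 'a"
  assumes \<beta>: "integrable lborel \<beta>"
begin

definition drift :: "real \<Rightarrow> 'a" where
  "drift s = (\<integral>u. indicator {0<..s} u *\<^sub>R \<beta> u \<partial>lborel)"

lemma drift_cont: "continuous_on UNIV drift"
  unfolding drift_def[abs_def] by (rule indefinite_integral_continuous[OF \<beta>])

lemma drift_measurable: "drift \<in> borel_measurable borel"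
  by (rule borel_measurable_continuous_onI[OF drift_cont])

lemma drift_0: "drift s = 0" if "s \<le> 0"
proof -
  have "{0<..s} = {}" using that by auto
  then show ?thesis by (simp add: drift_def)
qed

lemma \<beta>_meas: "\<beta> \<in> borel_measurable lborel" using \<beta> by auto

lemma grad_dot_integrable:
  assumes L: "L \<in> borel_measurable borel"
  shows "integrable lborel (\<lambda>u. indicator {r<..s} u * (grad f (L u) \<bullet> \<beta> u))"
proof (rule Bochner_Integration.integrable_bound[of lborel "\<lambda>u. C * norm (\<beta> u)"])
  show "(\<lambda>u. indicator {r<..s} u * (grad f (L u) \<bullet> \<beta> u)) \<in> borel_measurable lborel"
    using measurable_compose[OF L grad_measurable] \<beta>_meas by simp
  show "AE u in lborel. norm (indicator {r<..s} u * (grad f (L u) \<bullet> \<beta> u)) \<le> norm (C * norm (\<beta> u))"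
  proof (rule AE_I2)
    fix u
    have "norm (indicator {r<..s} u * (grad f (L u) \<bullet> \<beta> u)) \<le> \<bar>grad f (L u) \<bullet> \<beta> u\<bar>"
      by (simp add: indicator_def)
    also have "\<dots> \<le> norm (grad f (L u)) * norm (\<beta> u)" by (rule Cauchy_Schwarz_ineq2)
    also have "\<dots> \<le> C * norm (\<beta> u)" by (intro mult_right_mono grad_bound) simp
    also have "\<dots> \<le> norm (C * norm (\<beta> u))" by simp
    finally show "norm (indicator {r<..s} u * (grad f (L u) \<bullet> \<beta> u)) \<le> norm (C * norm (\<beta> u))" .
  qed
qed (use \<beta> in simp)

text \<open>The difference \<open>D\<close> of the two sides, as a function of the end time, has
  increments of order (V b - V a)^(1 + \<theta>), where \<open>V\<close> is the integral of
  |\<beta>|; by \<open>superadditive_increment_zero\<close> it is constant. The argument avoids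
  differentiating the drift almost everywhere.\<close>

lemma chain_rule:
  assumes ab: "0 \<le> a" "a \<le> b"
  shows "f (c + drift b) - f (c + drift a) = (\<integral>u. indicator {a<..b} u * (grad f (c + drift u) \<bullet> \<beta> u) \<partial>lborel)"
proof -
  define V where "V s = (\<integral>u. indicator {0<..s} u *\<^sub>R norm (\<beta> u) \<partial>lborel)" for s
  define H where "H a b = (\<integral>u. indicator {a<..b} u * (grad f (c + drift u) \<bullet> \<beta> u) \<partial>lborel)" for a b
  define D where "D s = f (c + drift s) - H 0 s" for s
  have cm: "(\<lambda>u. c + drift u) \<in> borel_measurable borel" using drift_measurable by simp
  have n\<beta>: "integrable lborel (\<lambda>u. norm (\<beta> u))" using \<beta> by simp
  have Vcont: "continuous_on UNIV V" unfolding V_def[abs_def] by (rule indefinite_integral_continuous[OF n\<beta>])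
  have ind: "indicator {0<..b} u - indicator {0<..a} u = (indicator {a<..b} u :: real)" if "0 \<le> a" "a \<le> b" for a b u :: real
    using that by (auto simp: indicator_def)
  have i1: "integrable lborel (\<lambda>u. indicator {r<..s} u *\<^sub>R \<beta> u)" and i2: "integrable lborel (\<lambda>u. indicator {r<..s} u *\<^sub>R norm (\<beta> u))" for r s
    by (intro integrable_mult_indicator \<beta> n\<beta>; simp)+
  have dV: "V b - V a = (\<integral>u. indicator {a<..b} u *\<^sub>R norm (\<beta> u) \<partial>lborel)" if "0 \<le> a" "a \<le> b" for a b
    unfolding V_def by (subst Bochner_Integration.integral_diff[symmetric, OF i2 i2])
      (simp only: scaleR_diff_left[symmetric] ind[OF that])
  have dA: "drift b - drift a = (\<integral>u. indicator {a<..b} u *\<^sub>R \<beta> u \<partial>lborel)" if "0 \<le> a" "a \<le> b" for a b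
    unfolding drift_def by (subst Bochner_Integration.integral_diff[symmetric, OF i1 i1])
      (simp only: scaleR_diff_left[symmetric] ind[OF that])
  have dH: "H 0 b - H 0 a = H a b" if "0 \<le> a" "a \<le> b" for a b
    unfolding H_def by (subst Bochner_Integration.integral_diff[symmetric, OF grad_dot_integrable[OF cm] grad_dot_integrable[OF cm]])
      (simp only: left_diff_distrib[symmetric] ind[OF that])
  have Vmono: "V a \<le> V b" if "0 \<le> a" "a \<le> b" for a b
  proof -
    have "0 \<le> V b - V a" unfolding dV[OF that] by (intro integral_nonneg_AE) simp
    then show ?thesis by simp
  qed
  have AV: "norm (drift b - drift a) \<le> V b - V a" if "0 \<le> a" "a \<le> b" for a b
  proof -
    have "norm (drift b - drift a) \<le> (\<integral>u. norm (indicator {a<..b} u *\<^sub>R \<beta> u) \<partial>lborel)"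
      unfolding dA[OF that] by (rule integral_norm_bound)
    also have "\<dots> = V b - V a" unfolding dV[OF that] by (intro Bochner_Integration.integral_cong) (auto simp: indicator_def)
    finally show ?thesis .
  qed
  \<comment> \<open>The increment of \<open>f\<close> and the integral are both compared with the
    gradient frozen at the left endpoint. Taylor's bound and the oscillation of the gradient each
    cost one \<open>C\<close>, hence \<open>2 * C\<close>.\<close>
  have inc: "\<bar>D b - D a\<bar> \<le> (2 * C) * (V b - V a) powr (1 + \<theta>)" if ab: "0 \<le> a" "a \<le> b" for a b
  proof -
    let ?w = "V b - V a" and ?G = "grad f (c + drift a)"
    have w: "0 \<le> ?w" using Vmono[OF ab] by simp
    have "\<bar>f ((c + drift a) + (drift b - drift a)) - f (c + drift a) - ?G \<bullet> (drift b - drift a)\<bar>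
        \<le> C * norm (drift b - drift a) powr (1 + \<theta>)"
      by (rule grad_taylor_bound[OF f_deriv C \<theta>(2) grad_holder])
    also have "\<dots> \<le> C * ?w powr (1 + \<theta>)"
      using AV[OF ab] C \<theta> by (intro mult_left_mono powr_mono2) auto
    finally have 1: "\<bar>f (c + drift b) - f (c + drift a) - ?G \<bullet> (drift b - drift a)\<bar> \<le> C * ?w powr (1 + \<theta>)" by simp
    have e: "?G \<bullet> (drift b - drift a) = (\<integral>u. indicator {a<..b} u * (?G \<bullet> \<beta> u) \<partial>lborel)"
      unfolding dA[OF ab] using integral_inner_right[OF i1, of ?G] by simp
    have gi: "integrable lborel (\<lambda>u. indicator {a<..b} u * (?G \<bullet> \<beta> u))"
      using grad_dot_integrable[of "\<lambda>_. c + drift a"] by simp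
    have "\<bar>?G \<bullet> (drift b - drift a) - H a b\<bar> = \<bar>\<integral>u. indicator {a<..b} u * (?G \<bullet> \<beta> u) - indicator {a<..b} u * (grad f (c + drift u) \<bullet> \<beta> u) \<partial>lborel\<bar>"
      unfolding e H_def by (subst Bochner_Integration.integral_diff[OF gi grad_dot_integrable[OF cm]]) simp
    also have "\<dots> \<le> (\<integral>u. \<bar>indicator {a<..b} u * (?G \<bullet> \<beta> u) - indicator {a<..b} u * (grad f (c + drift u) \<bullet> \<beta> u)\<bar> \<partial>lborel)"
      by (rule integral_abs_bound)
    also have "\<dots> \<le> (\<integral>u. (C * ?w powr \<theta>) * (indicator {a<..b} u *\<^sub>R norm (\<beta> u)) \<partial>lborel)"
    proof (rule integral_mono)
      fix u
      show "\<bar>indicator {a<..b} u * (?G \<bullet> \<beta> u) - indicator {a<..b} u * (grad f (c + drift u) \<bullet> \<beta> u)\<bar> \<le> (C * ?w powr \<theta>) * (indicator {a<..b} u *\<^sub>R norm (\<beta> u))"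
      proof (cases "u \<in> {a<..b}")
        case True
        have "norm (?G - grad f (c + drift u)) \<le> C * norm ((c + drift a) - (c + drift u)) powr \<theta>" by (rule grad_holder)
        also have "\<dots> \<le> C * ?w powr \<theta>"
          using AV[of a u] Vmono[of u b] ab True C \<theta> by (intro mult_left_mono powr_mono2) (auto simp: norm_minus_commute)
        finally have "norm (?G - grad f (c + drift u)) * norm (\<beta> u) \<le> (C * ?w powr \<theta>) * norm (\<beta> u)" by (rule mult_right_mono) simp
        then have "\<bar>(?G - grad f (c + drift u)) \<bullet> \<beta> u\<bar> \<le> (C * ?w powr \<theta>) * norm (\<beta> u)"
          using Cauchy_Schwarz_ineq2[of "?G - grad f (c + drift u)" "\<beta> u"] by linarith
        then show ?thesis using True by (simp add: inner_diff_left)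
      qed simp
    next
      show "integrable lborel (\<lambda>u. \<bar>indicator {a<..b} u * (?G \<bullet> \<beta> u) - indicator {a<..b} u * (grad f (c + drift u) \<bullet> \<beta> u)\<bar>)"
        by (intro integrable_abs Bochner_Integration.integrable_diff gi grad_dot_integrable[OF cm])
    qed (intro integrable_mult_right i2)
    also have "\<dots> = (C * ?w powr \<theta>) * ?w" using dV[OF ab] by simp
    also have "\<dots> = C * ?w powr (1 + \<theta>)" using w \<theta> by (cases "?w = 0") (simp_all add: powr_add powr_one)
    finally have 2: "\<bar>?G \<bullet> (drift b - drift a) - H a b\<bar> \<le> C * ?w powr (1 + \<theta>)" .
    have "D b - D a = (f (c + drift b) - f (c + drift a) - ?G \<bullet> (drift b - drift a)) + (?G \<bullet> (drift b - drift a) - H a b)"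
      using dH[OF ab] by (simp add: D_def)
    with 1 2 show ?thesis by linarith
  qed
  have "D b = D a" by (rule superadditive_increment_zero[OF Vcont Vmono \<theta>(2) inc ab])
  then show ?thesis using dH[OF ab] unfolding D_def H_def by linarith
qed

text \<open>The left limit of the path: the strict \<open>r<..\<close> leaves out a jump at time
  \<open>u\<close> itself, so that at a jump time \<open>r\<close> the path moves from
  \<open>jump_left\<close> by \<open>J r\<close>.\<close>

definition jump_left :: "real set \<Rightarrow> (real \<Rightarrow> 'a) \<Rightarrow> 'a \<Rightarrow> real \<Rightarrow> 'a" where
  "jump_left T J x u = x + drift u + (\<Sum>r\<in>T. indicator {r<..} u *\<^sub>R J r)"

lemma jump_left_measurable: "jump_left T J x \<in> borel_measurable borel"
  unfolding jump_left_def[abs_def] using drift_measurable by measurable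

text \<open>Induction that adds a new largest jump time \<open>b\<close>: up to \<open>b\<close> the
  left path is the old one, and after \<open>b\<close> it is pure drift from a constant, where
  \<open>chain_rule\<close> applies. The increment across \<open>b\<close> is the new
  summand.\<close>

lemma jump_ito:
  assumes "finite T" "\<And>r. r \<in> T \<Longrightarrow> 0 < r" "0 \<le> s"
  shows "f (x + drift s + (\<Sum>r\<in>T. indicator {r..} s *\<^sub>R J r)) - f x =
    (\<Sum>r\<in>T. indicator {r..} s * (f (jump_left T J x r + J r) - f (jump_left T J x r))) +
    (\<integral>u. indicator {0<..s} u * (grad f (jump_left T J x u) \<bullet> \<beta> u) \<partial>lborel)"
  using assms
proof (induction T arbitrary: s rule: finite_linorder_max_induct)
  case empty
  then show ?case using chain_rule[of 0 s x] drift_0[of 0] by (simp add: jump_left_def[abs_def])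
next
  case (insert b A)
  have bA: "b \<notin> A" using insert.hyps by auto
  have b0: "0 < b" using insert.prems by simp
  let ?L = "jump_left (insert b A) J x" and ?L' = "jump_left A J x"
  have L: "?L u = ?L' u" if "u \<le> b" for u
    unfolding jump_left_def sum.insert[OF insert.hyps(1) bA] using that by simp
  have Lb: "?L u = (x + (\<Sum>r\<in>A. J r) + J b) + drift u" if "b < u" for u
  proof -
    have "(\<Sum>r\<in>A. indicator {r<..} u *\<^sub>R J r) = (\<Sum>r\<in>A. J r)"
      using that insert.hyps(2) by (intro sum.cong) (auto simp: indicator_def)
    then show ?thesis unfolding jump_left_def sum.insert[OF insert.hyps(1) bA] using that
      by (simp only:) (simp add: algebra_simps)
  qed
  have IH: "f (x + drift s + (\<Sum>r\<in>A. indicator {r..} s *\<^sub>R J r)) - f x =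
    (\<Sum>r\<in>A. indicator {r..} s * (f (?L' r + J r) - f (?L' r))) +
    (\<integral>u. indicator {0<..s} u * (grad f (?L' u) \<bullet> \<beta> u) \<partial>lborel)" if "0 \<le> s" for s
    using insert.IH[OF _ that] insert.prems by auto
  have sumL: "(\<Sum>r\<in>A. indicator {r..} s * (f (?L r + J r) - f (?L r))) = (\<Sum>r\<in>A. indicator {r..} s * (f (?L' r + J r) - f (?L' r)))" for s
  proof (intro sum.cong refl)
    fix r assume "r \<in> A"
    then have "?L r = ?L' r" using insert.hyps(2) by (intro L less_imp_le) auto
    then show "indicator {r..} s * (f (?L r + J r) - f (?L r)) = indicator {r..} s * (f (?L' r + J r) - f (?L' r))" by simp
  qed
  have intL: "(\<integral>u. indicator {0<..s} u * (grad f (?L u) \<bullet> \<beta> u) \<partial>lborel) = (\<integral>u. indicator {0<..s} u * (grad f (?L' u) \<bullet> \<beta> u) \<partial>lborel)" if "s \<le> b" for s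
    using that L by (intro Bochner_Integration.integral_cong refl) (auto simp: indicator_def)
  show ?case
  proof (cases "s < b")
    case True
    then show ?thesis
      using IH[OF insert.prems(2)] insert.hyps(1) bA sumL intL[of s] by (simp add: indicator_def)
  next
    case False
    then have bs: "b \<le> s" by simp
    have all: "indicator {r..} s = (1::real)" "indicator {r..} b = (1::real)" "indicator {r<..} b = (1::real)" if "r \<in> A" for r
    proof -
      have "r < b" using that insert.hyps(2) by blast
      then show "indicator {r..} s = (1::real)" "indicator {r..} b = (1::real)" "indicator {r<..} b = (1::real)"
        using bs by simp_all
    qed
    have s1: "(\<Sum>r\<in>A. indicator {r..} s *\<^sub>R J r) = (\<Sum>r\<in>A. J r)" "(\<Sum>r\<in>A. indicator {r..} b *\<^sub>R J r) = (\<Sum>r\<in>A. J r)"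
        "(\<Sum>r\<in>A. indicator {r<..} b *\<^sub>R J r) = (\<Sum>r\<in>A. J r)"
      by (intro sum.cong refl, simp only: all scaleR_one)+
    have s2: "(\<Sum>r\<in>A. indicator {r..} s * (f (?L' r + J r) - f (?L' r))) = (\<Sum>r\<in>A. indicator {r..} b * (f (?L' r + J r) - f (?L' r)))"
      by (intro sum.cong refl) (simp only: all)
    let ?c = "x + (\<Sum>r\<in>A. J r) + J b"
    have Lbb: "?L b = x + drift b + (\<Sum>r\<in>A. J r)"
      unfolding L[OF order_refl] by (simp add: jump_left_def s1)
    have "f (?c + drift s) - f (?c + drift b) = (\<integral>u. indicator {b<..s} u * (grad f (?c + drift u) \<bullet> \<beta> u) \<partial>lborel)"
      using b0 bs by (intro chain_rule) auto
    also have "\<dots> = (\<integral>u. indicator {b<..s} u * (grad f (?L u) \<bullet> \<beta> u) \<partial>lborel)"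
      using Lb by (intro Bochner_Integration.integral_cong refl) (auto simp: indicator_def)
    finally have 1: "f (?c + drift s) - f (?L b + J b) = (\<integral>u. indicator {b<..s} u * (grad f (?L u) \<bullet> \<beta> u) \<partial>lborel)"
      unfolding Lbb by (simp add: algebra_simps)
    have 2: "f (?L b) - f x = (\<Sum>r\<in>A. indicator {r..} s * (f (?L r + J r) - f (?L r))) + (\<integral>u. indicator {0<..b} u * (grad f (?L u) \<bullet> \<beta> u) \<partial>lborel)"
      using IH[of b] b0 unfolding Lbb sumL s2 s1 intL[OF order_refl] by simp
    have "(\<integral>u. indicator {0<..s} u * (grad f (?L u) \<bullet> \<beta> u) \<partial>lborel) =
        (\<integral>u. indicator {0<..b} u * (grad f (?L u) \<bullet> \<beta> u) + indicator {b<..s} u * (grad f (?L u) \<bullet> \<beta> u) \<partial>lborel)"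
      using b0 bs by (intro Bochner_Integration.integral_cong refl) (auto simp: indicator_def)
    also have "\<dots> = (\<integral>u. indicator {0<..b} u * (grad f (?L u) \<bullet> \<beta> u) \<partial>lborel) + (\<integral>u. indicator {b<..s} u * (grad f (?L u) \<bullet> \<beta> u) \<partial>lborel)"
      by (intro Bochner_Integration.integral_add grad_dot_integrable jump_left_measurable)
    finally have 3: "(\<integral>u. indicator {0<..s} u * (grad f (?L u) \<bullet> \<beta> u) \<partial>lborel) =
      (\<integral>u. indicator {0<..b} u * (grad f (?L u) \<bullet> \<beta> u) \<partial>lborel) + (\<integral>u. indicator {b<..s} u * (grad f (?L u) \<bullet> \<beta> u) \<partial>lborel)" .
    have lhs: "x + drift s + (\<Sum>r\<in>insert b A. indicator {r..} s *\<^sub>R J r) = ?c + drift s"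
      unfolding sum.insert[OF insert.hyps(1) bA] s1 using bs by (simp add: algebra_simps)
    have rhs: "(\<Sum>r\<in>insert b A. indicator {r..} s * (f (?L r + J r) - f (?L r))) =
        (f (?L b + J b) - f (?L b)) + (\<Sum>r\<in>A. indicator {r..} s * (f (?L r + J r) - f (?L r)))"
      unfolding sum.insert[OF insert.hyps(1) bA] using bs by simp
    show ?thesis unfolding lhs rhs 3 using 1 2 by linarith
  qed
qed

end

end

section \<open>Predictability of left limits\<close>

text \<open>The largest multiple of 2^(-n) strictly below \<open>s\<close>, hence the ceiling minus
  one. Strictness makes limits along these points left limits and makes the sampled process
  predictable.\<close>

definition dyadic_below :: "nat \<Rightarrow> real \<Rightarrow> real" where
  "dyadic_below n s = (of_int \<lceil>s * 2 ^ n\<rceil> - 1) / 2 ^ n"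

lemma dyadic_below_less: "dyadic_below n s < s"
  and dyadic_below_ge: "s - 1 / 2 ^ n \<le> dyadic_below n s"
proof -
  have "of_int \<lceil>s * 2 ^ n\<rceil> - 1 < s * 2 ^ n" by linarith
  then show "dyadic_below n s < s" by (simp add: dyadic_below_def divide_less_eq)
  have "s * 2 ^ n - 1 \<le> of_int \<lceil>s * 2 ^ n\<rceil> - 1" by linarith
  then have "(s * 2 ^ n - 1) / 2 ^ n \<le> dyadic_below n s" unfolding dyadic_below_def by (rule divide_right_mono) simp
  then show "s - 1 / 2 ^ n \<le> dyadic_below n s" by (simp add: diff_divide_distrib)
qed

lemma dyadic_below_nonneg: "0 < s \<Longrightarrow> 0 \<le> dyadic_below n s"
proof -
  assume "0 < s"
  then have "1 \<le> \<lceil>s * 2 ^ n\<rceil>" by simp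
  then have "real_of_int 1 \<le> of_int \<lceil>s * 2 ^ n\<rceil>" by (simp only: of_int_le_iff)
  then show ?thesis by (simp add: dyadic_below_def)
qed

lemma dyadic_below_at_left: "filterlim (\<lambda>n. dyadic_below n s) (at_left s) sequentially"
  unfolding filterlim_at
proof
  show "\<forall>\<^sub>F n in sequentially. dyadic_below n s \<in> {..<s} \<and> dyadic_below n s \<noteq> s"
    using dyadic_below_less by (intro always_eventually) (simp add: less_imp_neq)
  have l: "(\<lambda>n. s - 1 / 2 ^ n) \<longlonglongrightarrow> s - 0"
    using LIMSEQ_power_zero[of "1/2::real"] by (intro tendsto_diff tendsto_const) (simp add: power_one_over)
  show "(\<lambda>n. dyadic_below n s) \<longlonglongrightarrow> s"
  proof (rule tendsto_sandwich[OF _ _ _ tendsto_const])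
    show "(\<lambda>n. s - 1 / 2 ^ n) \<longlonglongrightarrow> s" using l by simp
  qed (use dyadic_below_ge dyadic_below_less in \<open>auto intro!: always_eventually less_imp_le\<close>)
qed

context poisson_basis
begin

lemma gen_in_PA: "H \<in> sets (F r) \<Longrightarrow> B \<in> sets m \<Longrightarrow> 0 \<le> r \<Longrightarrow> r \<le> r' \<Longrightarrow> H \<times> (B \<times> {r<..r'}) \<in> sets PA"
  unfolding sets_PA by (rule sigma_sets.Basic) (auto simp: gens_def)

lemma space_in_F: "space M \<in> sets (F r)" using sets.top[of "F r"] by simp

lemma PA_time [measurable]: "(\<lambda>x. snd (snd x)) \<in> borel_measurable PA"
proof (rule borel_measurableI_greater)
  fix a :: real
  have "{x \<in> space PA. a < snd (snd x)} = (\<Union>n. space M \<times> (space m \<times> {max a 0<..max a 0 + real n}))"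
  proof (intro equalityI subsetI)
    fix y assume y: "y \<in> {x \<in> space PA. a < snd (snd x)}"
    obtain n where "snd (snd y) \<le> real n" using real_arch_simple by blast
    then have "snd (snd y) \<le> max a 0 + real n" by linarith
    then show "y \<in> (\<Union>n. space M \<times> (space m \<times> {max a 0<..max a 0 + real n}))" using y by (cases y) auto
  qed auto
  also have "\<dots> \<in> sets PA" by (intro sets.countable_UN image_subsetI gen_in_PA space_in_F) auto
  finally show "{x \<in> space PA. a < snd (snd x)} \<in> sets PA" .
qed

lemma PA_mark [measurable]: "(\<lambda>x. fst (snd x)) \<in> measurable PA m"
proof (rule measurableI)
  fix B assume B: "B \<in> sets m"
  have "(\<lambda>x. fst (snd x)) -` B \<inter> space PA = (\<Union>n. space M \<times> (B \<times> {0<..real n}))"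
  proof (intro equalityI subsetI)
    fix y assume y: "y \<in> (\<lambda>x. fst (snd x)) -` B \<inter> space PA"
    obtain n where "snd (snd y) \<le> real n" using real_arch_simple by blast
    then show "y \<in> (\<Union>n. space M \<times> (B \<times> {0<..real n}))" using y by (cases y) auto
  next
    fix y assume "y \<in> (\<Union>n. space M \<times> (B \<times> {0<..real n}))"
    then show "y \<in> (\<lambda>x. fst (snd x)) -` B \<inter> space PA" using sets.sets_into_space[OF B] by auto
  qed
  also have "\<dots> \<in> sets PA" using B by (intro sets.countable_UN image_subsetI gen_in_PA space_in_F) auto
  finally show "(\<lambda>x. fst (snd x)) -` B \<inter> space PA \<in> sets PA" .
qed auto

text \<open>The elementary predictable process: a variable known at time \<open>r\<close> and held
  until \<open>r'\<close>, with \<open>r\<close> itself excluded.\<close>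

lemma PA_strip:
  fixes V :: "'w \<Rightarrow> 'b::euclidean_space"
  assumes V: "V \<in> borel_measurable (F r)" and r: "0 \<le> r" "r \<le> r'"
  shows "(\<lambda>x. indicator {r<..r'} (snd (snd x)) *\<^sub>R V (fst x)) \<in> borel_measurable PA"
proof -
  let ?R = "space M \<times> (space m \<times> {r<..r'})"
  have R: "?R \<in> sets PA" using r by (intro gen_in_PA space_in_F) auto
  have RI: "?R \<inter> space PA = ?R" using sets.sets_into_space[OF R] by blast
  have "fst \<in> measurable (restrict_space PA ?R) (F r)"
  proof (rule measurableI)
    fix H assume H: "H \<in> sets (F r)"
    have "fst -` H \<inter> space (restrict_space PA ?R) = H \<times> (space m \<times> {r<..r'})"
      using sets.sets_into_space[OF H] RI by (auto simp: space_restrict_space)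
    moreover have "H \<times> (space m \<times> {r<..r'}) \<in> sets PA" using H r by (intro gen_in_PA) auto
    moreover have "H \<times> (space m \<times> {r<..r'}) \<subseteq> ?R" using sets.sets_into_space[OF H] by auto
    ultimately show "fst -` H \<inter> space (restrict_space PA ?R) \<in> sets (restrict_space PA ?R)"
      unfolding sets_restrict_space by (metis Int_absorb1 imageI)
  qed (auto simp: space_restrict_space)
  then have "(\<lambda>x. V (fst x)) \<in> borel_measurable (restrict_space PA ?R)" by (rule measurable_compose[OF _ V])
  then have "(\<lambda>x. indicator ?R x *\<^sub>R V (fst x)) \<in> borel_measurable PA"
    using R RI by (subst (asm) borel_measurable_restrict_space_iff) auto
  then show ?thesis
    by (rule measurable_cong[THEN iffD1, rotated]) (auto simp: indicator_def)
qed

text \<open>At level n the sampled process is constant in time on each of countably many strips, and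
  on a strip it uses only the value at the left endpoint.\<close>

lemma PA_dyadic:
  fixes Y :: "real \<Rightarrow> 'w \<Rightarrow> 'b::euclidean_space"
  assumes Y: "\<And>t. 0 \<le> t \<Longrightarrow> Y t \<in> borel_measurable (F t)"
  shows "(\<lambda>x. Y (dyadic_below n (snd (snd x))) (fst x)) \<in> borel_measurable PA"
proof -
  define idx where "idx x = nat (\<lceil>snd (snd x) * 2 ^ n\<rceil> - 1)" for x :: "'w \<times> 'e \<times> real"
  define g where "g i x = indicator {real i / 2 ^ n<..real (Suc i) / 2 ^ n} (snd (snd x)) *\<^sub>R Y (real i / 2 ^ n) (fst x)"
    for i and x :: "'w \<times> 'e \<times> real"
  have "idx \<in> measurable PA (count_space UNIV)" unfolding idx_def by measurable
  moreover have "g i \<in> borel_measurable PA" for i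
    unfolding g_def[abs_def] by (intro PA_strip Y divide_right_mono) auto
  ultimately have meas: "(\<lambda>x. g (idx x) x) \<in> borel_measurable PA" by (rule measurable_compose_countable[rotated])
  have eq: "g (idx x) x = Y (dyadic_below n (snd (snd x))) (fst x)" if x: "x \<in> space PA" for x
  proof -
    have s: "0 < snd (snd x)" using x by auto
    then have "1 \<le> \<lceil>snd (snd x) * 2 ^ n\<rceil>" by simp
    then have i: "real (idx x) = of_int \<lceil>snd (snd x) * 2 ^ n\<rceil> - 1" by (simp add: idx_def)
    then have "real (idx x) < snd (snd x) * 2 ^ n" "snd (snd x) * 2 ^ n \<le> real (Suc (idx x))" by (simp_all, linarith+)
    then have "snd (snd x) \<in> {real (idx x) / 2 ^ n<..real (Suc (idx x)) / 2 ^ n}"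
      by (simp add: divide_less_eq le_divide_eq)
    then show ?thesis unfolding g_def dyadic_below_def i[symmetric] by (simp del: greaterThanAtMost_iff)
  qed
  show ?thesis by (rule measurable_cong[THEN iffD1, OF eq meas])
qed

text \<open>The pointwise \<open>lim\<close> of measurable functions is measurable with its default
  value included. This provides a predictable candidate for the left limit of processes, such as
  \<open>V k\<close> below, whose paths are known to be regular only almost surely.\<close>

lemma PA_dyadic_lim:
  fixes Y :: "real \<Rightarrow> 'w \<Rightarrow> 'b::euclidean_space"
  assumes Y: "\<And>t. 0 \<le> t \<Longrightarrow> Y t \<in> borel_measurable (F t)"
  shows "(\<lambda>x. lim (\<lambda>n. Y (dyadic_below n (snd (snd x))) (fst x))) \<in> borel_measurable PA"
  by (intro borel_measurable_lim_metric PA_dyadic Y)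

lemma dyadic_lim_left_lim:
  fixes Y :: "real \<Rightarrow> 'b::metric_space"
  assumes "(Y \<longlongrightarrow> l) (at_left s)"
  shows "(\<lambda>n. Y (dyadic_below n s)) \<longlonglongrightarrow> l"
  by (rule filterlim_compose[OF assms dyadic_below_at_left])

lemma PA_left_lim:
  fixes X :: "real \<Rightarrow> 'w \<Rightarrow> 'b::euclidean_space"
  assumes X: "\<And>t. 0 \<le> t \<Longrightarrow> X t \<in> borel_measurable (F t)" and cad: "\<And>\<omega>. \<omega> \<in> space M \<Longrightarrow> cadlag (\<lambda>t. X t \<omega>)"
  shows "(\<lambda>x. left_lim X (snd (snd x)) (fst x)) \<in> borel_measurable PA"
proof (rule measurable_cong[THEN iffD1, OF _ PA_dyadic_lim[OF X]])
  fix x assume "x \<in> space PA"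
  then have "fst x \<in> space M" "0 < snd (snd x)" by auto
  then have "((\<lambda>t. X t (fst x)) \<longlongrightarrow> left_lim X (snd (snd x)) (fst x)) (at_left (snd (snd x)))"
    unfolding left_lim_def by (intro cadlag_left_lim cad)
  from dyadic_lim_left_lim[OF this]
  show "lim (\<lambda>n. X (dyadic_below n (snd (snd x))) (fst x)) = left_lim X (snd (snd x)) (fst x)"
    by (rule limI)
qed

text \<open>Functions of time only are recovered from predictable ones by freezing the mark.\<close>

lemma PA_time_section:
  fixes h :: "'w \<times> 'e \<times> real \<Rightarrow> 'b::euclidean_space"
  assumes h: "h \<in> borel_measurable PA" and e: "e \<in> space m"
  shows "(\<lambda>(\<omega>, s). indicator {0<..t} s *\<^sub>R h (\<omega>, e, s)) \<in> borel_measurable (F t \<Otimes>\<^sub>M lborel)"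
    "(\<lambda>(\<omega>, s). indicator {0<..t} s *\<^sub>R h (\<omega>, e, s)) \<in> borel_measurable (M \<Otimes>\<^sub>M lborel)"
proof -
  have *: "(\<lambda>(\<omega>, s). indicator {0<..t} s *\<^sub>R h (\<omega>, e, s)) \<in> borel_measurable (G \<Otimes>\<^sub>M lborel)"
    if G: "(\<lambda>(\<omega>, q). past_part t h \<omega> q) \<in> borel_measurable (G \<Otimes>\<^sub>M \<mu>)" for G
  proof -
    have "(\<lambda>x. (fst x, (e, snd x))) \<in> measurable (G \<Otimes>\<^sub>M lborel) (G \<Otimes>\<^sub>M (m \<Otimes>\<^sub>M borel))"
      using e by measurable
    then have "(\<lambda>x. (fst x, (e, snd x))) \<in> measurable (G \<Otimes>\<^sub>M lborel) (G \<Otimes>\<^sub>M \<mu>)"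
      using sets_pair_measure_cong[OF refl sets_intensity, of G m] by (simp cong: measurable_cong_sets)
    from measurable_compose[OF this G] show ?thesis by (simp add: past_part_def case_prod_unfold)
  qed
  show "(\<lambda>(\<omega>, s). indicator {0<..t} s *\<^sub>R h (\<omega>, e, s)) \<in> borel_measurable (F t \<Otimes>\<^sub>M lborel)"
    by (rule *[OF past_part_measurable_F[OF h]])
  show "(\<lambda>(\<omega>, s). indicator {0<..t} s *\<^sub>R h (\<omega>, e, s)) \<in> borel_measurable (M \<Otimes>\<^sub>M lborel)"
    by (rule *[OF past_part_measurable[OF h]])
qed

end

section \<open>Thinned jumps\<close>

context stable_function
begin

abbreviation mk :: "('a \<times> real) measure" where "mk \<equiv> mark_measure \<alpha> \<kappa>t"

lemma sets_mk: "sets mk = sets borel"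
  unfolding mark_measure_def borel_prod[symmetric] by (rule sets_pair_measure_cong) simp_all

lemma space_mk [simp]: "space mk = UNIV"
  using sets_eq_imp_space_eq[OF sets_mk] by simp

lemma pair_sigma_finite_nu: "pair_sigma_finite \<nu> half_line"
  using sigma_finite_nu sigma_finite_half_line by (simp add: pair_sigma_finite_def)

lemma sigma_finite_mk: "sigma_finite_measure mk"
proof -
  interpret pair_sigma_finite \<nu> half_line by (rule pair_sigma_finite_nu)
  show ?thesis unfolding mark_measure_def by (rule sigma_finite_measure_axioms)
qed

lemma pair_sigma_finite_mk: "pair_sigma_finite mk half_line"
  using sigma_finite_mk sigma_finite_half_line by (simp add: pair_sigma_finite_def)

lemma sets_int_mk: "sets (intensity mk) = sets borel"
proof -
  have "sets (mk \<Otimes>\<^sub>M borel) = sets ((borel :: ('a \<times> real) measure) \<Otimes>\<^sub>M (borel :: real measure))"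
    by (rule sets_pair_measure_cong[OF sets_mk refl])
  then show ?thesis unfolding sets_intensity borel_prod .
qed

lemma emeasure_half_line_Icc: "0 \<le> s \<Longrightarrow> emeasure half_line {0..s} = ennreal s"
proof -
  assume *: "0 \<le> s"
  have "emeasure half_line {0..s} = (\<integral>\<^sup>+x. indicator {0..s} x \<partial>lborel)"
    unfolding half_line_def using *
    by (subst emeasure_density) (auto intro!: nn_integral_cong simp del: nn_integral_indicator split: split_indicator)
  then show ?thesis using * by simp
qed

lemma k1_nonneg: "0 \<le> k\<^sub>1" using sigma_bounds[of 0 0] by linarith

lemma nn_integral_intensity:
  assumes \<phi>: "\<phi> \<in> borel_measurable borel" and t: "0 \<le> t"
  shows "(\<integral>\<^sup>+q. \<phi> (fst (fst q)) * indicator {0..k\<^sub>1} (snd (fst q)) * indicator {0<..t} (snd q) \<partial>intensity mk) =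
    (\<integral>\<^sup>+z. \<phi> z \<partial>\<nu>) * ennreal k\<^sub>1 * ennreal t"
proof -
  have \<phi>m[measurable]: "\<phi> \<in> borel_measurable \<nu>" using \<phi> by simp
  let ?h = "\<lambda>e :: 'a \<times> real. \<phi> (fst e) * indicator {0..k\<^sub>1} (snd e)"
  have hm: "?h \<in> borel_measurable (\<nu> \<Otimes>\<^sub>M half_line)" by measurable
  have hm'[measurable]: "?h \<in> borel_measurable mk" using hm by (simp add: mark_measure_def)
  have "(\<integral>\<^sup>+q. \<phi> (fst (fst q)) * indicator {0..k\<^sub>1} (snd (fst q)) * indicator {0<..t} (snd q) \<partial>intensity mk) =
      (\<integral>\<^sup>+e. \<integral>\<^sup>+s. ?h e * indicator {0<..t} s \<partial>half_line \<partial>mk)"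
  proof -
    have m: "(\<lambda>q. ?h (fst q) * indicator {0<..t} (snd q)) \<in> borel_measurable (mk \<Otimes>\<^sub>M half_line)" by measurable
    show ?thesis
      unfolding intensity_def
      using sigma_finite_measure.nn_integral_fst[OF sigma_finite_half_line m] by simp
  qed
  also have "\<dots> = (\<integral>\<^sup>+e. ?h e * ennreal t \<partial>mk)"
    using t by (intro nn_integral_cong) (simp add: nn_integral_cmult emeasure_half_line_Ioc)
  also have "\<dots> = (\<integral>\<^sup>+e. ?h e \<partial>mk) * ennreal t" by (rule nn_integral_multc[OF hm'])
  also have "(\<integral>\<^sup>+e. ?h e \<partial>mk) = (\<integral>\<^sup>+z. \<integral>\<^sup>+r. \<phi> z * indicator {0..k\<^sub>1} r \<partial>half_line \<partial>\<nu>)"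
    unfolding mark_measure_def
    using sigma_finite_measure.nn_integral_fst[OF sigma_finite_half_line hm] by simp
  also have "\<dots> = (\<integral>\<^sup>+z. \<phi> z * ennreal k\<^sub>1 \<partial>\<nu>)"
    using k1_nonneg by (intro nn_integral_cong) (simp add: nn_integral_cmult emeasure_half_line_Icc)
  also have "\<dots> = (\<integral>\<^sup>+z. \<phi> z \<partial>\<nu>) * ennreal k\<^sub>1" by (rule nn_integral_multc[OF \<phi>m])
  finally show ?thesis .
qed

lemma integral_half_line_indicator:
  fixes v :: "'b::{banach, second_countable_topology}"
  assumes "0 \<le> s"
  shows "(\<integral>r. indicator {0..s} r *\<^sub>R v \<partial>half_line) = s *\<^sub>R v"
proof -
  have "has_bochner_integral half_line (\<lambda>r. indicator {0..s} r *\<^sub>R v) (measure half_line {0..s} *\<^sub>R v)"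
    using assms by (intro has_bochner_integral_indicator) (auto simp: emeasure_half_line_Icc)
  then show ?thesis using assms
    by (simp add: has_bochner_integral_iff measure_def emeasure_half_line_Icc)
qed

text \<open>The heights stop at \<open>k\<^sub>1\<close> because no thinning indicator reaches above
  it. The cut makes the intensity of the set finite and loses no jump.\<close>

definition big_marks :: "real \<Rightarrow> ('a \<times> real) set" where
  "big_marks \<epsilon> = {z. \<epsilon> < norm z} \<times> {0..k\<^sub>1}"

lemma big_marks_sets: "big_marks \<epsilon> \<in> sets mk"
  unfolding mark_measure_def big_marks_def by (intro pair_measureI) auto

lemma big_marks_finite:
  assumes "0 < \<epsilon>" "\<epsilon> \<le> 1"
  shows "emeasure mk (big_marks \<epsilon>) < \<infinity>"
proof -
  have "emeasure mk (big_marks \<epsilon>) = emeasure \<nu> {z. \<epsilon> < norm z} * emeasure half_line {0..k\<^sub>1}"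
    unfolding mark_measure_def big_marks_def
    by (intro sigma_finite_measure.emeasure_pair_measure_Times[OF sigma_finite_half_line]) auto
  then show ?thesis
    using nu_outside_finite[OF assms] k1_nonneg by (simp add: emeasure_half_line_Icc ennreal_mult_less_top)
qed

lemma emeasure_big_region:
  assumes "0 < \<epsilon>" "\<epsilon> \<le> 1" "0 \<le> t"
  shows "emeasure (intensity mk) (big_marks \<epsilon> \<times> {0<..t}) < \<infinity>" "big_marks \<epsilon> \<times> {0<..t} \<in> sets (intensity mk)"
proof -
  have "emeasure (intensity mk) (big_marks \<epsilon> \<times> {0<..t}) = emeasure mk (big_marks \<epsilon>) * emeasure half_line {0<..t}"
    unfolding intensity_def
    by (intro sigma_finite_measure.emeasure_pair_measure_Times[OF sigma_finite_half_line] big_marks_sets) auto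
  then show "emeasure (intensity mk) (big_marks \<epsilon> \<times> {0<..t}) < \<infinity>"
    using big_marks_finite[OF assms(1,2)] assms(3) by (simp add: emeasure_half_line_Ioc ennreal_mult_less_top)
  show "big_marks \<epsilon> \<times> {0<..t} \<in> sets (intensity mk)"
    unfolding sets_intensity by (intro pair_measureI big_marks_sets) auto
qed

text \<open>Fubini: integrating out the height turns the thinning indicator into the factor
  \<open>\<sigma> (y s) z\<close>. Since \<open>\<psi>\<close> vanishes for |z| \<le> \<epsilon> and
  the heights are at most \<open>k\<^sub>1\<close>, the integrand lives on a region of finite
  intensity, which justifies the exchange.\<close>

lemma thin_integral:
  fixes \<psi> :: "real \<Rightarrow> 'a \<Rightarrow> 'b::{banach, second_countable_topology}"
  assumes y: "y \<in> borel_measurable borel" and \<psi>: "(\<lambda>(s, z). \<psi> s z) \<in> borel_measurable borel"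
    and bd: "\<And>s z. norm (\<psi> s z) \<le> D * indicator {z. \<epsilon> < norm z} z"
    and \<epsilon>: "0 < \<epsilon>" "\<epsilon> \<le> 1" and t: "0 \<le> t"
  defines "\<Phi> \<equiv> \<lambda>q. (indicator {0<..t} (snd q) * indicator {0..\<sigma> (y (snd q)) (fst (fst q))} (snd (fst q))) *\<^sub>R \<psi> (snd q) (fst (fst q))"
  shows "integrable (intensity mk) \<Phi>"
    "(\<integral>q. \<Phi> q \<partial>intensity mk) = (\<integral>s. indicator {0<..t} s *\<^sub>R (\<integral>z. \<sigma> (y s) z *\<^sub>R \<psi> s z \<partial>\<nu>) \<partial>lborel)"
proof -
  note [measurable] = y
  have \<sigma>m: "(\<lambda>q. \<sigma> (y (g q)) (h q)) \<in> borel_measurable L" if [measurable]: "g \<in> borel_measurable L" "h \<in> borel_measurable L"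
    for g h and L :: "'c measure"
    by (intro sigma_measurable2) measurable
  have \<psi>m: "(\<lambda>q. \<psi> (g q) (h q)) \<in> borel_measurable L" if "g \<in> borel_measurable L" "h \<in> borel_measurable L"
    for g h and L :: "'c measure"
    using measurable_compose[OF borel_measurable_Pair[OF that] \<psi>] by simp
  \<comment> \<open>Writes the interval with a moving endpoint as a half-line evaluated at a
    difference, which exposes joint measurability.\<close>
  have ind: "indicator {0..a} r = (indicator {0..} r * indicator {..0} (r - a) :: real)" for a r :: real
    by (simp add: indicator_def)
  have im: "(\<lambda>q. indicator A (g q) :: real) \<in> borel_measurable L" if "g \<in> borel_measurable L" "A \<in> sets borel"
    for g and L :: "'c measure" and A :: "real set"
    using measurable_compose[OF that(1) borel_measurable_indicator[OF that(2)]] .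
  have b1: "(\<lambda>q :: ('a \<times> real) \<times> real. fst (fst q)) \<in> borel_measurable borel"
    "(\<lambda>q :: ('a \<times> real) \<times> real. snd (fst q)) \<in> borel_measurable borel"
    "(snd :: ('a \<times> real) \<times> real \<Rightarrow> real) \<in> borel_measurable borel"
    by (rule borel_measurable_continuous_onI, intro continuous_intros)+
  have m1: "(\<lambda>q. fst (fst q)) \<in> borel_measurable (intensity mk)" "(\<lambda>q. snd (fst q)) \<in> borel_measurable (intensity mk)"
    "snd \<in> borel_measurable (intensity mk)"
    using b1 by (simp_all only: measurable_cong_sets[OF sets_int_mk refl])
  have \<Phi>m: "\<Phi> \<in> borel_measurable (intensity mk)"
    unfolding \<Phi>_def ind
    by (intro borel_measurable_scaleR borel_measurable_times borel_measurable_diff \<psi>m m1 im \<sigma>m) auto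
  let ?R = "big_marks \<epsilon> \<times> {0<..t}"
  have D: "0 \<le> D"
  proof -
    obtain z :: 'a where z: "norm z = 2" using vector_choose_size[of 2] by auto
    have "0 \<le> norm (\<psi> 0 z)" by simp
    also have "\<dots> \<le> D * indicator {z. \<epsilon> < norm z} z" by (rule bd)
    finally show ?thesis using z \<epsilon> by simp
  qed
  have \<Phi>b: "norm (\<Phi> q) \<le> D * indicator ?R q" for q
  proof (cases "q \<in> ?R")
    case True
    have "norm (\<Phi> q) \<le> norm (\<psi> (snd q) (fst (fst q)))" by (simp add: \<Phi>_def indicator_def)
    also have "\<dots> \<le> D * indicator {z. \<epsilon> < norm z} (fst (fst q))" by (rule bd)
    also have "\<dots> \<le> D * indicator ?R q" using True D by (auto simp: indicator_def)
    finally show ?thesis .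
  next
    case False
    have "\<Phi> q = 0"
    proof (rule ccontr)
      assume nz: "\<Phi> q \<noteq> 0"
      then have "snd q \<in> {0<..t}" "0 \<le> snd (fst q)" "snd (fst q) \<le> \<sigma> (y (snd q)) (fst (fst q))" "\<psi> (snd q) (fst (fst q)) \<noteq> 0"
        by (auto simp: \<Phi>_def indicator_def split: if_splits)
      moreover have "\<epsilon> < norm (fst (fst q))"
      proof (rule ccontr)
        assume "\<not> \<epsilon> < norm (fst (fst q))"
        then have "norm (\<psi> (snd q) (fst (fst q))) \<le> 0" using bd[of "snd q" "fst (fst q)"] by simp
        then show False using \<open>\<psi> (snd q) (fst (fst q)) \<noteq> 0\<close> by simp
      qed
      moreover have "snd (fst q) \<le> k\<^sub>1" using sigma_bounds(2)[of "y (snd q)" "fst (fst q)"] calculation(3) by linarith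
      ultimately show False using False by (cases q) (auto simp: big_marks_def)
    qed
    then show ?thesis using False by simp
  qed
  have Ri: "integrable (intensity mk) (\<lambda>q. D * indicator ?R q)"
    using emeasure_big_region[OF \<epsilon> t] by (intro integrable_mult_right integrable_real_indicator)
  show int: "integrable (intensity mk) \<Phi>"
    by (rule Bochner_Integration.integrable_bound[OF Ri \<Phi>m])
      (intro AE_I2, unfold real_norm_def, rule order_trans[OF \<Phi>b abs_ge_self])
  interpret P: pair_sigma_finite mk half_line by (rule pair_sigma_finite_mk)
  interpret Q: pair_sigma_finite \<nu> half_line by (rule pair_sigma_finite_nu)
  have int': "integrable (mk \<Otimes>\<^sub>M half_line) (case_prod (\<lambda>e s. \<Phi> (e, s)))"
    using int by (simp add: intensity_def case_prod_unfold)
  have "(\<integral>q. \<Phi> q \<partial>intensity mk) = (\<integral>s. \<integral>e. \<Phi> (e, s) \<partial>mk \<partial>half_line)"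
    using P.integral_snd[OF int'] by (simp add: intensity_def case_prod_unfold)
  also have "\<dots> = (\<integral>s. indicator {0<..t} s *\<^sub>R (\<integral>z. \<sigma> (y s) z *\<^sub>R \<psi> s z \<partial>\<nu>) \<partial>half_line)"
  proof (rule Bochner_Integration.integral_cong[OF refl])
    fix s
    let ?g = "\<lambda>z r. (indicator {0<..t} s * indicator {0..\<sigma> (y s) z} r) *\<^sub>R \<psi> s z"
    have gi: "integrable (\<nu> \<Otimes>\<^sub>M half_line) (case_prod ?g)"
    proof (rule Bochner_Integration.integrable_bound)
      show "integrable (\<nu> \<Otimes>\<^sub>M half_line) (\<lambda>e. D * indicator (big_marks \<epsilon>) e)"
        using big_marks_finite[OF \<epsilon>] big_marks_sets[of \<epsilon>] unfolding mark_measure_def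
        by (intro integrable_mult_right integrable_real_indicator)
      show "AE e in \<nu> \<Otimes>\<^sub>M half_line. norm (case_prod ?g e) \<le> norm (D * indicator (big_marks \<epsilon>) e)"
      proof (rule AE_I2)
        fix e :: "'a \<times> real"
        have "norm (case_prod ?g e) = norm (\<Phi> (e, s))" by (simp add: \<Phi>_def case_prod_unfold)
        also have "\<dots> \<le> D * indicator ?R (e, s)" by (rule \<Phi>b)
        also have "\<dots> \<le> norm (D * indicator (big_marks \<epsilon>) e)" using D by (auto simp: indicator_def)
        finally show "norm (case_prod ?g e) \<le> norm (D * indicator (big_marks \<epsilon>) e)" .
      qed
      have m2: "fst \<in> borel_measurable (\<nu> \<Otimes>\<^sub>M half_line)" "snd \<in> borel_measurable (\<nu> \<Otimes>\<^sub>M half_line)"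
        by (simp_all cong: measurable_cong_sets)
      show "case_prod ?g \<in> borel_measurable (\<nu> \<Otimes>\<^sub>M half_line)"
        unfolding case_prod_unfold ind
        by (intro borel_measurable_scaleR borel_measurable_times borel_measurable_diff borel_measurable_const \<psi>m m2 im \<sigma>m) auto
    qed
    have "(\<integral>e. \<Phi> (e, s) \<partial>mk) = (\<integral>z. \<integral>r. ?g z r \<partial>half_line \<partial>\<nu>)"
      using Q.integral_fst[OF gi] by (simp add: mark_measure_def \<Phi>_def case_prod_unfold)
    also have "\<dots> = (\<integral>z. indicator {0<..t} s *\<^sub>R (\<sigma> (y s) z *\<^sub>R \<psi> s z) \<partial>\<nu>)"
      using sigma_bounds(1)
      by (intro Bochner_Integration.integral_cong refl) (simp add: scaleR_scaleR[symmetric] integral_half_line_indicator del: scaleR_scaleR)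
    also have "\<dots> = indicator {0<..t} s *\<^sub>R (\<integral>z. \<sigma> (y s) z *\<^sub>R \<psi> s z \<partial>\<nu>)" by (rule integral_scaleR_right)
    finally show "(\<integral>e. \<Phi> (e, s) \<partial>mk) = indicator {0<..t} s *\<^sub>R (\<integral>z. \<sigma> (y s) z *\<^sub>R \<psi> s z \<partial>\<nu>)" .
  qed
  also have "\<dots> = (\<integral>s. indicator {0..} s *\<^sub>R (indicator {0<..t} s *\<^sub>R (\<integral>z. \<sigma> (y s) z *\<^sub>R \<psi> s z \<partial>\<nu>)) \<partial>lborel)"
  proof -
    have "(\<lambda>s. \<integral>z. \<sigma> (y s) z *\<^sub>R \<psi> s z \<partial>\<nu>) \<in> borel_measurable borel"
    proof (rule sigma_finite_measure.borel_measurable_lebesgue_integral[OF sigma_finite_nu])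
      have m3: "fst \<in> borel_measurable (borel \<Otimes>\<^sub>M \<nu>)" "snd \<in> borel_measurable (borel \<Otimes>\<^sub>M \<nu>)"
        by (simp_all cong: measurable_cong_sets)
      show "(\<lambda>(s, z). \<sigma> (y s) z *\<^sub>R \<psi> s z) \<in> borel_measurable (borel \<Otimes>\<^sub>M \<nu>)"
        unfolding case_prod_unfold by (intro borel_measurable_scaleR \<sigma>m \<psi>m m3)
    qed
    then have "(\<lambda>s. indicator {0<..t} s *\<^sub>R (\<integral>z. \<sigma> (y s) z *\<^sub>R \<psi> s z \<partial>\<nu>)) \<in> borel_measurable lborel" by simp
    then show ?thesis
      unfolding half_line_def ennreal_indicator[symmetric] by (intro integral_density) auto
  qed
  also have "\<dots> = (\<integral>s. indicator {0<..t} s *\<^sub>R (\<integral>z. \<sigma> (y s) z *\<^sub>R \<psi> s z \<partial>\<nu>) \<partial>lborel)"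
    by (intro Bochner_Integration.integral_cong refl) (simp add: indicator_def)
  finally show "(\<integral>q. \<Phi> q \<partial>intensity mk) = (\<integral>s. indicator {0<..t} s *\<^sub>R (\<integral>z. \<sigma> (y s) z *\<^sub>R \<psi> s z \<partial>\<nu>) \<partial>lborel)" .
qed

end

section \<open>Truncated processes\<close>

locale sde_ito = stable_function \<alpha> \<kappa>\<^sub>1 \<kappa>t \<sigma> k\<^sub>1 f C \<theta> + poisson_basis M F "mark_measure \<alpha> \<kappa>t" N
  for \<alpha> \<kappa>\<^sub>1 and \<kappa>t :: "'a::euclidean_space \<Rightarrow> real" and \<sigma> k\<^sub>1 f C \<theta>
    and M :: "'w measure" and F and N :: "'w \<Rightarrow> (('a \<times> real) \<times> real) measure" +
  fixes b :: "'a \<Rightarrow> 'a" and X :: "real \<Rightarrow> 'w \<Rightarrow> 'a" and x :: 'a and Zs :: "real \<Rightarrow> 'w \<Rightarrow> 'a"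
  assumes b_meas [measurable]: "b \<in> borel_measurable borel"
    and X_adapted: "\<And>t. 0 \<le> t \<Longrightarrow> X t \<in> borel_measurable (F t)"
    and X_cadlag: "\<And>\<omega>. \<omega> \<in> space M \<Longrightarrow> cadlag (\<lambda>t. X t \<omega>)"
    and Zs: "has_comp_integral M F (mark_measure \<alpha> \<kappa>t) N
            (\<lambda>\<omega> e s. indicator {e. norm (fst e) \<le> 1} e *\<^sub>R thinned_jump \<sigma> (left_lim X s \<omega>) e) Zs"
    and eqn: "AE \<omega> in M. \<forall>t\<ge>0.
           integrable (N \<omega>) (\<lambda>(e, s). indicator {0<..t} s *\<^sub>R
             (indicator {e. 1 < norm (fst e)} e *\<^sub>R thinned_jump \<sigma> (left_lim X s \<omega>) e)) \<and>
           set_integrable lborel {0..t} (\<lambda>s. b (X s \<omega>)) \<and>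
           X t \<omega> = x + Zs t \<omega> +
             (\<integral>(e, s). indicator {0<..t} s *\<^sub>R
               (indicator {e. 1 < norm (fst e)} e *\<^sub>R thinned_jump \<sigma> (left_lim X s \<omega>) e) \<partial>N \<omega>) +
             (LINT s:{0..t}|lborel. b (X s \<omega>))"
begin

abbreviation Xm :: "'w \<Rightarrow> real \<Rightarrow> 'a" where "Xm \<omega> s \<equiv> left_lim X s \<omega>"

definition tj :: "'w \<Rightarrow> ('a \<times> real) \<times> real \<Rightarrow> 'a" where
  "tj \<omega> q = indicator {0..\<sigma> (Xm \<omega> (snd q)) (fst (fst q))} (snd (fst q)) *\<^sub>R fst (fst q)"

lemma thinned_eq: "thinned_jump \<sigma> (Xm \<omega> s) e = tj \<omega> (e, s)"
  by (simp add: thinned_jump_def tj_def case_prod_unfold)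

lemma tj_outside: "snd (fst q) \<notin> {0..k\<^sub>1} \<Longrightarrow> tj \<omega> q = 0"
  using sigma_bounds(2)[of "Xm \<omega> (snd q)" "fst (fst q)"] by (auto simp: tj_def indicator_def)

lemma norm_tj: "norm (tj \<omega> q) \<le> indicator {0..k\<^sub>1} (snd (fst q)) * norm (fst (fst q))"
  using tj_outside[of q \<omega>] by (cases "snd (fst q) \<in> {0..k\<^sub>1}") (auto simp: tj_def indicator_def)

lemma increment_bound: "\<bar>f (w + tj \<omega> q) - f w\<bar> \<le> 2 * C * (indicator {0..k\<^sub>1} (snd (fst q)) * gauge 1 (fst (fst q)))"
proof (cases "tj \<omega> q = 0")
  case True
  then show ?thesis using C gauge_nonneg by simp
next
  case False
  then have "snd (fst q) \<in> {0..k\<^sub>1}" "tj \<omega> q = fst (fst q)"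
    using tj_outside[of q \<omega>] by (auto simp: tj_def indicator_def split: if_splits)
  then show ?thesis using f_increment[of w "fst (fst q)"] by simp
qed

lemma Xm_PA: "(\<lambda>y. Xm (fst y) (snd (snd y))) \<in> borel_measurable PA"
  by (rule PA_left_lim[OF X_adapted X_cadlag])

lemma mark_PA: "(\<lambda>y. fst (fst (snd y))) \<in> borel_measurable PA" "(\<lambda>y. snd (fst (snd y))) \<in> borel_measurable PA"
proof -
  have m: "(\<lambda>y. fst (snd y)) \<in> borel_measurable PA" using PA_mark by (simp cong: measurable_cong_sets add: sets_mk)
  have c: "(fst :: 'a \<times> real \<Rightarrow> 'a) \<in> borel_measurable borel" "(snd :: 'a \<times> real \<Rightarrow> real) \<in> borel_measurable borel"
    by (rule borel_measurable_continuous_onI, intro continuous_intros)+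
  show "(\<lambda>y. fst (fst (snd y))) \<in> borel_measurable PA" "(\<lambda>y. snd (fst (snd y))) \<in> borel_measurable PA"
    using measurable_compose[OF m c(1)] measurable_compose[OF m c(2)] by simp_all
qed

lemma tj_PA: "(\<lambda>y. tj (fst y) (snd y)) \<in> borel_measurable PA"
proof -
  have ind: "indicator {0..a} r = (indicator {0..} r * indicator {..0} (r - a) :: real)" for a r :: real
    by (simp add: indicator_def)
  have im: "(\<lambda>q. indicator A (g q) :: real) \<in> borel_measurable PA" if "g \<in> borel_measurable PA" "A \<in> sets borel"
    for g and A :: "real set"
    using measurable_compose[OF that(1) borel_measurable_indicator[OF that(2)]] .
  show ?thesis unfolding tj_def ind
    by (intro borel_measurable_scaleR borel_measurable_times borel_measurable_diff im mark_PA sigma_measurable2 Xm_PA) auto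
qed

lemma increment_PA:
  assumes "(\<lambda>y. W (fst y) (snd (snd y))) \<in> borel_measurable PA"
  shows "(\<lambda>y. f (W (fst y) (snd (snd y)) + tj (fst y) (snd y)) - f (W (fst y) (snd (snd y)))) \<in> borel_measurable PA"
  by (intro borel_measurable_diff measurable_compose[OF _ f_measurable] borel_measurable_add assms tj_PA)

definition eps :: "nat \<Rightarrow> real" where "eps k = (1/2) ^ k"

lemma eps: "0 < eps k" "eps k \<le> 1" "eps \<longlonglongrightarrow> 0"
  unfolding eps_def[abs_def] by (auto simp: power_le_one intro!: LIMSEQ_power_zero)

abbreviation Bk :: "nat \<Rightarrow> ('a \<times> real) set" where "Bk k \<equiv> big_marks (eps k)"
abbreviation region :: "nat \<Rightarrow> real \<Rightarrow> (('a \<times> real) \<times> real) set" where "region k t \<equiv> Bk k \<times> {0<..t}"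

lemma window: "0 \<le> t \<Longrightarrow> euclidean_window M F mk N (Bk k) t"
  using big_marks_sets big_marks_finite[OF eps(1,2)[of k]] sets_mk by unfold_locales auto

lemma pwindow: "0 \<le> t \<Longrightarrow> poisson_window M F mk N (Bk k) t"
  using window by (rule euclidean_window.axioms)

lemma region_sets: "region k t \<in> sets \<mu>"
  using big_marks_sets by (simp add: sets_intensity)

lemma section_borel:
  fixes h :: "'w \<times> ('a \<times> real) \<times> real \<Rightarrow> 'b::euclidean_space"
  assumes h: "h \<in> borel_measurable PA" and \<omega>: "\<omega> \<in> space M"
  shows "past_part t h \<omega> \<in> borel_measurable borel"
  using past_part_section[OF h \<omega>, of t] by (simp cong: measurable_cong_sets add: sets_int_mk)

lemma time_section_borel:
  fixes W :: "'w \<Rightarrow> real \<Rightarrow> 'b::euclidean_space"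
  assumes W: "(\<lambda>y. W (fst y) (snd (snd y))) \<in> borel_measurable PA" and \<omega>: "\<omega> \<in> space M"
  shows "(\<lambda>s. indicator {0<..t} s *\<^sub>R W \<omega> s) \<in> borel_measurable borel"
proof -
  have "(\<lambda>(\<omega>, s). indicator {0<..t} s *\<^sub>R W \<omega> s) \<in> borel_measurable (M \<Otimes>\<^sub>M lborel)"
    using PA_time_section(2)[OF W, of "(0, 0)" t] by simp
  from measurable_Pair2[OF this \<omega>] show ?thesis by simp
qed

text \<open>The jumps are read through the finite kernel and the drift through left limits, so that
  \<open>V k t\<close> is measurable for \<open>F t\<close> at every \<omega>. Passing to left
  limits alters the drift integrand only on a null set of times.\<close>

definition V :: "nat \<Rightarrow> real \<Rightarrow> 'w \<Rightarrow> 'a" where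
  "V k t \<omega> = x + (\<integral>q. indicator (region k t) q *\<^sub>R tj \<omega> q \<partial>fin_restr N (region k t) \<omega>) +
     (\<integral>u. indicator {0<..t} u *\<^sub>R b (Xm \<omega> u) \<partial>lborel)"

lemma b_Xm_PA: "(\<lambda>y. b (Xm (fst y) (snd (snd y)))) \<in> borel_measurable PA"
  by (rule measurable_compose[OF Xm_PA b_meas])

lemma V_adapted:
  assumes t: "0 \<le> t"
  shows "V k t \<in> borel_measurable (F t)"
proof -
  interpret W: poisson_window M F mk N "Bk k" t by (rule pwindow[OF t])
  have 1: "(\<lambda>(\<omega>, q). past_part t (\<lambda>y. tj (fst y) (snd y)) \<omega> q) \<in> borel_measurable (F t \<Otimes>\<^sub>M \<mu>)"
    by (rule past_part_measurable_F[OF tj_PA])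
  have "(\<lambda>y. indicator (region k t) (snd y) *\<^sub>R (case y of (\<omega>, q) \<Rightarrow> past_part t (\<lambda>y. tj (fst y) (snd y)) \<omega> q)) \<in> borel_measurable (F t \<Otimes>\<^sub>M \<mu>)"
    using region_sets by (intro borel_measurable_scaleR 1 measurable_compose[OF measurable_snd] borel_measurable_indicator)
  then have 2: "(\<lambda>(\<omega>, q). indicator (region k t) q *\<^sub>R tj \<omega> q) \<in> borel_measurable (F t \<Otimes>\<^sub>M \<mu>)"
    by (rule measurable_cong[THEN iffD1, rotated]) (auto simp: past_part_def indicator_def)
  have 3: "(\<lambda>\<omega>. \<integral>q. indicator (region k t) q *\<^sub>R tj \<omega> q \<partial>fin_restr N (region k t) \<omega>) \<in> borel_measurable (F t)"
    by (rule W.KF.integral_fin_restr_measurable[OF 2])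
  have 4: "(\<lambda>(\<omega>, u). indicator {0<..t} u *\<^sub>R b (Xm \<omega> u)) \<in> borel_measurable (F t \<Otimes>\<^sub>M lborel)"
    using PA_time_section(1)[OF b_Xm_PA, of "(0, 0)" t] by simp
  have 5: "(\<lambda>\<omega>. \<integral>u. indicator {0<..t} u *\<^sub>R b (Xm \<omega> u) \<partial>lborel) \<in> borel_measurable (F t)"
    by (rule lborel.borel_measurable_lebesgue_integral[OF 4])
  show ?thesis unfolding V_def[abs_def] by (intro borel_measurable_add borel_measurable_const 3 5)
qed

text \<open>On good paths this is the left limit of \<open>V k\<close>; the limit along dyadic times
  makes it predictable without an exceptional set.\<close>

definition W :: "nat \<Rightarrow> 'w \<Rightarrow> real \<Rightarrow> 'a" where
  "W k \<omega> s = lim (\<lambda>n. V k (dyadic_below n s) \<omega>)"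

lemma W_PA: "(\<lambda>y. W k (fst y) (snd (snd y))) \<in> borel_measurable PA"
  unfolding W_def by (rule PA_dyadic_lim[OF V_adapted])

definition solves :: "'w \<Rightarrow> bool" where
  "solves \<omega> \<longleftrightarrow> (\<forall>t\<ge>0.
           integrable (N \<omega>) (\<lambda>(e, s). indicator {0<..t} s *\<^sub>R
             (indicator {e. 1 < norm (fst e)} e *\<^sub>R thinned_jump \<sigma> (left_lim X s \<omega>) e)) \<and>
           set_integrable lborel {0..t} (\<lambda>s. b (X s \<omega>)) \<and>
           X t \<omega> = x + Zs t \<omega> +
             (\<integral>(e, s). indicator {0<..t} s *\<^sub>R
               (indicator {e. 1 < norm (fst e)} e *\<^sub>R thinned_jump \<sigma> (left_lim X s \<omega>) e) \<partial>N \<omega>) +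
             (LINT s:{0..t}|lborel. b (X s \<omega>)))"

definition atoms :: "nat \<Rightarrow> real \<Rightarrow> 'w \<Rightarrow> (('a \<times> real) \<times> real) set \<Rightarrow> bool" where
  "atoms k t \<omega> S \<longleftrightarrow> euclidean_window.atoms_of N (Bk k) t \<omega> S"

text \<open>The almost sure event of all pathwise arguments up to time \<open>t\<close>, for all
  truncation levels at once.\<close>

definition good :: "real \<Rightarrow> 'w \<Rightarrow> bool" where
  "good t \<omega> \<longleftrightarrow> \<omega> \<in> space M \<and> solves \<omega> \<and> (\<forall>k. \<exists>S. atoms k t \<omega> S) \<and> (\<forall>k. emeasure (N \<omega>) (region k t) < \<infinity>)"

lemma AE_good:
  assumes t: "0 \<le> t"
  shows "AE \<omega> in M. good t \<omega>"
proof -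
  have 1: "AE \<omega> in M. \<forall>k. \<exists>S. atoms k t \<omega> S"
    unfolding atoms_def by (subst AE_all_countable) (use euclidean_window.AE_atoms[OF window[OF t]] in blast)
  have 2: "AE \<omega> in M. \<forall>k. emeasure (N \<omega>) (region k t) < \<infinity>"
    by (subst AE_all_countable) (use poisson_window.AE_E_finite[OF pwindow[OF t]] in blast)
  have 3: "AE \<omega> in M. solves \<omega>" using eqn unfolding solves_def .
  show ?thesis using AE_space 1 2 3 by eventually_elim (simp add: good_def)
qed

lemma atomsD:
  assumes "0 \<le> t" "atoms k t \<omega> S"
  shows "finite S" "S \<subseteq> region k t" "inj_on snd S"
  using assms(2) unfolding atoms_def euclidean_window.atoms_of_def[OF window[OF assms(1)]] by auto

lemma atoms_integral:
  fixes g :: "('a \<times> real) \<times> real \<Rightarrow> 'b::{banach, second_countable_topology}"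
  assumes "0 \<le> t" "atoms k t \<omega> S" "\<omega> \<in> space M" "g \<in> borel_measurable borel" "\<And>p. p \<notin> region k t \<Longrightarrow> g p = 0"
  shows "integrable (N \<omega>) g" "(\<integral>p. g p \<partial>N \<omega>) = (\<Sum>p\<in>S. g p)"
  using euclidean_window.atoms_integral[OF window[OF assms(1)] assms(2)[unfolded atoms_def] assms(3-5)] by auto

lemma region_tj_borel:
  assumes \<omega>: "\<omega> \<in> space M"
  shows "(\<lambda>q. indicator (region k u) q *\<^sub>R tj \<omega> q) \<in> borel_measurable borel"
proof -
  have "(\<lambda>q. indicator (region k u) q *\<^sub>R past_part u (\<lambda>y. tj (fst y) (snd y)) \<omega> q) \<in> borel_measurable borel"
    using region_sets[of k u] by (intro borel_measurable_scaleR section_borel[OF tj_PA \<omega>] borel_measurable_indicator) (simp add: sets_int_mk)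
  then show ?thesis by (rule measurable_cong[THEN iffD1, rotated]) (auto simp: past_part_def indicator_def)
qed

lemma fin_restr_integral:
  fixes g :: "('a \<times> real) \<times> real \<Rightarrow> 'b::{banach, second_countable_topology}"
  assumes fin: "emeasure (N \<omega>) (region k u) < \<infinity>" and \<omega>: "\<omega> \<in> space M"
    and g: "g \<in> borel_measurable borel" "\<And>p. p \<notin> region k u \<Longrightarrow> g p = 0"
  shows "(\<integral>p. g p \<partial>fin_restr N (region k u) \<omega>) = (\<integral>p. g p \<partial>N \<omega>)"
proof -
  have K: "fin_restr N (region k u) \<omega> = density (N \<omega>) (\<lambda>p. ennreal (indicator (region k u) p))"
    using fin by (simp add: fin_restr_def ennreal_indicator)
  have sN: "sets (N \<omega>) = sets borel" using sets_N[OF \<omega>] sets_int_mk by simp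
  have "(\<integral>p. g p \<partial>fin_restr N (region k u) \<omega>) = (\<integral>p. indicator (region k u) p *\<^sub>R g p \<partial>N \<omega>)"
    unfolding K using g(1) sN region_sets[of k u] sets_N[OF \<omega>]
    by (intro integral_density) (auto cong: measurable_cong_sets)
  also have "\<dots> = (\<integral>p. g p \<partial>N \<omega>)"
    using g(2) by (intro Bochner_Integration.integral_cong refl) (auto simp: indicator_def)
  finally show ?thesis .
qed

text \<open>The atoms found for the horizon \<open>t\<close> serve every earlier time: a time
  \<open>u\<close> only selects those that have occurred by then. Hence one null set covers the
  whole path up to \<open>t\<close>.\<close>

lemma jump_sum:
  assumes g: "good t \<omega>" and S: "atoms k t \<omega> S" and u: "0 \<le> u" "u \<le> t"
  shows "(\<integral>q. indicator (region k u) q *\<^sub>R tj \<omega> q \<partial>fin_restr N (region k u) \<omega>) = (\<Sum>p\<in>S. indicator {snd p..} u *\<^sub>R tj \<omega> p)"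
    "(\<integral>q. indicator (region k u) q *\<^sub>R tj \<omega> q \<partial>N \<omega>) = (\<Sum>p\<in>S. indicator {snd p..} u *\<^sub>R tj \<omega> p)"
proof -
  have t: "0 \<le> t" using u by simp
  have \<omega>: "\<omega> \<in> space M" using g by (simp add: good_def)
  have sN: "sets (N \<omega>) = sets borel" using sets_N[OF \<omega>] sets_int_mk by simp
  have "emeasure (N \<omega>) (region k u) \<le> emeasure (N \<omega>) (region k t)"
    using u region_sets[of k t] sets_N[OF \<omega>] by (intro emeasure_mono) auto
  also have "\<dots> < \<infinity>" using g by (simp add: good_def)
  finally have fin: "emeasure (N \<omega>) (region k u) < \<infinity>" .
  have "(\<integral>q. indicator (region k u) q *\<^sub>R tj \<omega> q \<partial>N \<omega>) = (\<Sum>p\<in>S. indicator (region k u) p *\<^sub>R tj \<omega> p)"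
    using u by (intro atoms_integral(2)[OF t S \<omega> region_tj_borel[OF \<omega>]]) (auto simp: indicator_def)
  also have "\<dots> = (\<Sum>p\<in>S. indicator {snd p..} u *\<^sub>R tj \<omega> p)"
  proof (intro sum.cong refl)
    fix p assume "p \<in> S"
    then have "p \<in> region k t" using atomsD(2)[OF t S] by blast
    then show "indicator (region k u) p *\<^sub>R tj \<omega> p = indicator {snd p..} u *\<^sub>R tj \<omega> p"
      by (cases p) (auto simp: indicator_def)
  qed
  finally show 2: "(\<integral>q. indicator (region k u) q *\<^sub>R tj \<omega> q \<partial>N \<omega>) = (\<Sum>p\<in>S. indicator {snd p..} u *\<^sub>R tj \<omega> p)" .
  have "(\<integral>q. indicator (region k u) q *\<^sub>R tj \<omega> q \<partial>fin_restr N (region k u) \<omega>) = (\<integral>q. indicator (region k u) q *\<^sub>R tj \<omega> q \<partial>N \<omega>)"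
    by (rule fin_restr_integral[OF fin \<omega> region_tj_borel[OF \<omega>]]) simp
  then show "(\<integral>q. indicator (region k u) q *\<^sub>R tj \<omega> q \<partial>fin_restr N (region k u) \<omega>) = (\<Sum>p\<in>S. indicator {snd p..} u *\<^sub>R tj \<omega> p)"
    using 2 by simp
qed

lemma AE_Xm: "\<omega> \<in> space M \<Longrightarrow> AE s in lborel. 0 < s \<longrightarrow> Xm \<omega> s = X s \<omega>"
  using cadlag_AE_left_lim[OF X_cadlag] unfolding left_lim_def .

lemma AE_Xm_Icc:
  assumes "\<omega> \<in> space M"
  shows "AE s in lborel. indicator {0<..t} s *\<^sub>R g (Xm \<omega> s) = indicator {0..t} s *\<^sub>R (g (X s \<omega>) :: 'b::real_normed_vector)"
  using AE_Xm[OF assms] AE_lborel_singleton[of 0]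
  by eventually_elim (auto simp: indicator_def)

text \<open>A cadlag path and its left limits differ at countably many times, so measurability in
  time passes from the predictable left limits to \<open>X\<close>, and the time integrals
  agree.\<close>

lemma time_integral_left:
  fixes g :: "'a \<Rightarrow> 'b::euclidean_space"
  assumes \<omega>: "\<omega> \<in> space M" and g: "g \<in> borel_measurable borel"
  shows "integrable lborel (\<lambda>s. indicator {0<..t} s *\<^sub>R g (Xm \<omega> s)) \<longleftrightarrow> set_integrable lborel {0..t} (\<lambda>s. g (X s \<omega>))"
    "(LINT s:{0..t}|lborel. g (X s \<omega>)) = (\<integral>s. indicator {0<..t} s *\<^sub>R g (Xm \<omega> s) \<partial>lborel)"
proof -
  have m: "(\<lambda>s. indicator {0<..t} s *\<^sub>R g (Xm \<omega> s)) \<in> borel_measurable lborel"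
    using time_section_borel[OF measurable_compose[OF Xm_PA g] \<omega>, of t] by simp
  have m2: "(\<lambda>s. indicator {0..t} s *\<^sub>R g (X s \<omega>)) \<in> borel_measurable lborel"
  proof -
    have c: "countable {s. 0 < s \<and> Lim (at_left s) (\<lambda>t. X t \<omega>) \<noteq> X s \<omega>}"
      by (intro left_jumps_countable cadlag_left_lim X_cadlag \<omega>)
    have "(\<lambda>s. indicator {0..t} s *\<^sub>R g (X s \<omega>)) \<in> borel_measurable borel"
    proof (rule measurable_discrete_difference[OF _ _ _ _ , where X = "insert 0 {s. 0 < s \<and> Lim (at_left s) (\<lambda>t. X t \<omega>) \<noteq> X s \<omega>}"])
      show "(\<lambda>s. indicator {0<..t} s *\<^sub>R g (Xm \<omega> s)) \<in> borel_measurable borel" using m by simp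
    qed (use c in \<open>auto simp: left_lim_def indicator_def\<close>)
    then show ?thesis by simp
  qed
  show "integrable lborel (\<lambda>s. indicator {0<..t} s *\<^sub>R g (Xm \<omega> s)) \<longleftrightarrow> set_integrable lborel {0..t} (\<lambda>s. g (X s \<omega>))"
    unfolding set_integrable_def by (rule integrable_cong_AE[OF m m2 AE_Xm_Icc[OF \<omega>]])
  show "(LINT s:{0..t}|lborel. g (X s \<omega>)) = (\<integral>s. indicator {0<..t} s *\<^sub>R g (Xm \<omega> s) \<partial>lborel)"
    unfolding set_lebesgue_integral_def by (rule integral_cong_AE[OF m2 m]) (use AE_Xm_Icc[OF \<omega>, of t g] in auto)
qed

definition beta :: "real \<Rightarrow> 'w \<Rightarrow> real \<Rightarrow> 'a" where
  "beta t \<omega> u = indicator {0<..t} u *\<^sub>R b (Xm \<omega> u)"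

lemma beta_integrable:
  assumes "good t \<omega>" "0 \<le> t"
  shows "integrable lborel (beta t \<omega>)"
  unfolding beta_def[abs_def]
  by (rule time_integral_left(1)[THEN iffD2, OF _ b_meas]) (use assms in \<open>auto simp: good_def solves_def\<close>)

text \<open>The jump as a function of its time; the inverse is meaningful because atoms have
  distinct times.\<close>

definition jumps :: "(('a \<times> real) \<times> real) set \<Rightarrow> 'w \<Rightarrow> real \<Rightarrow> 'a" where
  "jumps S \<omega> r = tj \<omega> (the_inv_into S snd r)"

lemma sum_over_times:
  fixes \<phi> :: "real \<Rightarrow> 'a \<Rightarrow> 'b::comm_monoid_add"
  assumes "inj_on snd S"
  shows "(\<Sum>r\<in>snd ` S. \<phi> r (jumps S \<omega> r)) = (\<Sum>p\<in>S. \<phi> (snd p) (tj \<omega> p))"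
  using assms by (simp add: sum.reindex jumps_def the_inv_into_f_f)

lemma V_path:
  assumes g: "good t \<omega>" and S: "atoms k t \<omega> S" and u: "0 \<le> u" "u \<le> t"
  shows "V k u \<omega> = x + drift (beta t \<omega>) u + (\<Sum>r\<in>snd ` S. indicator {r..} u *\<^sub>R jumps S \<omega> r)"
proof -
  have t: "0 \<le> t" using u by simp
  have "(\<integral>v. indicator {0<..u} v *\<^sub>R b (Xm \<omega> v) \<partial>lborel) = drift (beta t \<omega>) u"
    unfolding drift_def[OF beta_integrable[OF g t]] using u
    by (intro Bochner_Integration.integral_cong refl) (simp add: beta_def indicator_def)
  then show ?thesis
    unfolding V_def jump_sum(1)[OF g S u]
      sum_over_times[OF atomsD(3)[OF t S], of "\<lambda>r j. indicator {r..} u *\<^sub>R j" \<omega>] by simp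
qed

abbreviation left_path :: "real \<Rightarrow> 'w \<Rightarrow> (('a \<times> real) \<times> real) set \<Rightarrow> real \<Rightarrow> 'a" where
  "left_path t \<omega> S \<equiv> jump_left (beta t \<omega>) (snd ` S) (jumps S \<omega>) x"

text \<open>On a good path \<open>V k\<close> is a continuous drift plus finitely many steps, so its
  left limit exists and is obtained by making the step indicators strict.\<close>

lemma W_path:
  assumes g: "good t \<omega>" and S: "atoms k t \<omega> S" and s: "0 < s" "s \<le> t"
  shows "(\<lambda>n. V k (dyadic_below n s) \<omega>) \<longlonglongrightarrow> W k \<omega> s" "W k \<omega> s = left_path t \<omega> S s"
proof -
  have t: "0 \<le> t" using s by simp
  note \<beta> = beta_integrable[OF g t]
  let ?Y = "\<lambda>v. x + drift (beta t \<omega>) v + (\<Sum>r\<in>snd ` S. indicator {r..} v *\<^sub>R jumps S \<omega> r)"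
  have "(drift (beta t \<omega>) \<longlongrightarrow> drift (beta t \<omega>) s) (at_left s)"
    using drift_cont[OF \<beta>] by (simp add: continuous_on_eq_continuous_at isCont_def filterlim_at_split)
  moreover have "((\<lambda>v. indicator {r..} v *\<^sub>R j) \<longlongrightarrow> indicator {r<..} s *\<^sub>R j) (at_left s)" for r and j :: 'a
  proof (rule tendsto_eventually)
    show "\<forall>\<^sub>F v in at_left s. indicator {r..} v *\<^sub>R j = indicator {r<..} s *\<^sub>R j"
    proof (cases "r < s")
      case True
      then have "\<forall>\<^sub>F v in at_left s. v \<in> {r<..<s}" by (rule eventually_at_left_real)
      then show ?thesis by eventually_elim (use True in \<open>simp add: indicator_def\<close>)
    next
      case False
      have "\<forall>\<^sub>F v in at_left s. v \<in> {s - 1<..<s}" by (rule eventually_at_left_real) simp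
      then show ?thesis by eventually_elim (use False in \<open>simp add: indicator_def\<close>)
    qed
  qed
  ultimately have "(?Y \<longlongrightarrow> left_path t \<omega> S s) (at_left s)"
    unfolding jump_left_def[OF \<beta>] by (intro tendsto_add tendsto_const tendsto_sum) auto
  then have "(\<lambda>n. ?Y (dyadic_below n s)) \<longlonglongrightarrow> left_path t \<omega> S s" by (rule dyadic_lim_left_lim)
  moreover have "V k (dyadic_below n s) \<omega> = ?Y (dyadic_below n s)" for n
    using dyadic_below_nonneg[OF s(1), of n] dyadic_below_less[of n s] s by (intro V_path[OF g S]) auto
  ultimately have l: "(\<lambda>n. V k (dyadic_below n s) \<omega>) \<longlonglongrightarrow> left_path t \<omega> S s" by simp
  then show "W k \<omega> s = left_path t \<omega> S s" unfolding W_def by (rule limI)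
  then show "(\<lambda>n. V k (dyadic_below n s) \<omega>) \<longlonglongrightarrow> W k \<omega> s" using l by simp
qed

text \<open>The increments of \<open>f\<close> at the truncated state, confined to marks of finite
  mass. These are the approximating integrands that \<open>has_comp_integral\<close> asks
  for.\<close>

definition h :: "nat \<Rightarrow> 'w \<Rightarrow> 'a \<times> real \<Rightarrow> real \<Rightarrow> real" where
  "h k \<omega> e s = indicator (Bk k) e * (f (W k \<omega> s + tj \<omega> (e, s)) - f (W k \<omega> s))"

lemma h_predictable: "predictable M F mk (h k)"
proof -
  have "(\<lambda>y. indicator (Bk k) (fst (snd y)) * (f (W k (fst y) (snd (snd y)) + tj (fst y) (snd y)) - f (W k (fst y) (snd (snd y))))) \<in> borel_measurable PA"
    using big_marks_sets
    by (intro borel_measurable_times increment_PA W_PA measurable_compose[OF PA_mark] borel_measurable_indicator)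
  then show ?thesis by (simp add: predictable_def h_def case_prod_unfold)
qed

lemma ito_path:
  assumes g: "good t \<omega>" and S: "atoms k t \<omega> S" and t: "0 \<le> t"
  shows "f (V k t \<omega>) - f x = (\<Sum>p\<in>S. f (W k \<omega> (snd p) + tj \<omega> p) - f (W k \<omega> (snd p))) +
    (\<integral>u. indicator {0<..t} u * (grad f (W k \<omega> u) \<bullet> b (Xm \<omega> u)) \<partial>lborel)"
proof -
  note \<beta> = beta_integrable[OF g t]
  have St: "0 < snd p" "snd p \<le> t" if "p \<in> S" for p using atomsD(2)[OF t S] that by auto
  have fin: "finite (snd ` S)" using atomsD(1)[OF t S] by simp
  have "f (V k t \<omega>) - f x = (\<Sum>r\<in>snd ` S. indicator {r..} t * (f (left_path t \<omega> S r + jumps S \<omega> r) - f (left_path t \<omega> S r))) +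
    (\<integral>u. indicator {0<..t} u * (grad f (left_path t \<omega> S u) \<bullet> beta t \<omega> u) \<partial>lborel)"
    unfolding V_path[OF g S t order_refl] using St by (intro jump_ito[OF \<beta> fin _ t]) auto
  also have "(\<Sum>r\<in>snd ` S. indicator {r..} t * (f (left_path t \<omega> S r + jumps S \<omega> r) - f (left_path t \<omega> S r)))
      = (\<Sum>p\<in>S. indicator {snd p..} t * (f (left_path t \<omega> S (snd p) + tj \<omega> p) - f (left_path t \<omega> S (snd p))))"
    by (rule sum_over_times[OF atomsD(3)[OF t S], of "\<lambda>r j. indicator {r..} t * (f (left_path t \<omega> S r + j) - f (left_path t \<omega> S r))"])
  also have "\<dots> = (\<Sum>p\<in>S. f (W k \<omega> (snd p) + tj \<omega> p) - f (W k \<omega> (snd p)))"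
    using St W_path(2)[OF g S] by (intro sum.cong refl) (simp add: indicator_def)
  also have "(\<integral>u. indicator {0<..t} u * (grad f (left_path t \<omega> S u) \<bullet> beta t \<omega> u) \<partial>lborel) =
      (\<integral>u. indicator {0<..t} u * (grad f (W k \<omega> u) \<bullet> b (Xm \<omega> u)) \<partial>lborel)"
    using W_path(2)[OF g S] by (intro Bochner_Integration.integral_cong refl) (auto simp: beta_def indicator_def)
  finally show ?thesis .
qed

lemma h_jump_integral:
  assumes g: "good t \<omega>" and S: "atoms k t \<omega> S" and t: "0 \<le> t"
  shows "(\<integral>(e, s). indicator {0<..t} s *\<^sub>R h k \<omega> e s \<partial>N \<omega>) = (\<Sum>p\<in>S. f (W k \<omega> (snd p) + tj \<omega> p) - f (W k \<omega> (snd p)))"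
proof -
  have \<omega>: "\<omega> \<in> space M" using g by (simp add: good_def)
  let ?g = "\<lambda>q. past_part t (\<lambda>(\<omega>, e, s). h k \<omega> e s) \<omega> q"
  have gm: "?g \<in> borel_measurable borel"
    by (rule section_borel[OF _ \<omega>]) (use h_predictable in \<open>simp add: predictable_def\<close>)
  have "(\<integral>(e, s). indicator {0<..t} s *\<^sub>R h k \<omega> e s \<partial>N \<omega>) = (\<integral>q. ?g q \<partial>N \<omega>)"
    by (simp add: past_part_def case_prod_unfold)
  also have "\<dots> = (\<Sum>p\<in>S. ?g p)"
    by (rule atoms_integral(2)[OF t S \<omega> gm]) (auto simp: past_part_def h_def indicator_def)
  also have "\<dots> = (\<Sum>p\<in>S. f (W k \<omega> (snd p) + tj \<omega> p) - f (W k \<omega> (snd p)))"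
  proof (intro sum.cong refl)
    fix p assume "p \<in> S"
    then have "p \<in> region k t" using atomsD(2)[OF t S] by blast
    then show "?g p = f (W k \<omega> (snd p) + tj \<omega> p) - f (W k \<omega> (snd p))"
      by (cases p) (auto simp: past_part_def h_def)
  qed
  finally show ?thesis .
qed

text \<open>The state before the jump is \<open>W k\<close>, but the thinning uses the left limit of
  \<open>X\<close>; this is the origin of the two separate points in
  \<open>trunc_gen\<close>.\<close>

lemma h_compensator:
  assumes \<omega>: "\<omega> \<in> space M" and t: "0 \<le> t"
  shows "(\<integral>(e, s). indicator {0<..t} s *\<^sub>R h k \<omega> e s \<partial>\<mu>) =
    (\<integral>s. indicator {0<..t} s * trunc_gen (eps k) (W k \<omega> s) (Xm \<omega> s) \<partial>lborel)"
proof -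
  \<comment> \<open>Time sections are known to be Borel only after cutting to (0, t]; the value 0
    elsewhere does no harm, since the integrand carries the same cut.\<close>
  let ?y = "\<lambda>s. indicator {0<..t} s *\<^sub>R Xm \<omega> s" and ?w = "\<lambda>s. indicator {0<..t} s *\<^sub>R W k \<omega> s"
  have y: "?y \<in> borel_measurable borel" by (rule time_section_borel[OF Xm_PA \<omega>])
  have w: "?w \<in> borel_measurable borel" by (rule time_section_borel[OF W_PA \<omega>])
  let ?\<psi> = "\<lambda>s z. indicator {z. eps k < norm z} z * (f (?w s + z) - f (?w s))"
  have wm: "(\<lambda>q. ?w (fst q)) \<in> borel_measurable (borel \<Otimes>\<^sub>M borel)" by (rule measurable_compose[OF measurable_fst w])
  have \<psi>: "(\<lambda>(s, z). ?\<psi> s z) \<in> borel_measurable borel"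
    unfolding borel_prod[symmetric] case_prod_unfold
    by (intro borel_measurable_times borel_measurable_diff measurable_compose[OF _ f_measurable] borel_measurable_add wm
       measurable_compose[OF measurable_snd borel_measurable_indicator] measurable_snd) auto
  have bd: "norm (?\<psi> s z) \<le> 2 * C * indicator {z. eps k < norm z} z" for s z
  proof -
    have "\<bar>f (?w s + z) - f (?w s)\<bar> \<le> 2 * C" using f_bound[of "?w s + z"] f_bound[of "?w s"] by linarith
    then show ?thesis by (cases "z \<in> {z. eps k < norm z}") (simp_all only: indicator_simps mult_1_left mult_1_right
      mult_zero_left mult_zero_right real_norm_def abs_zero order_refl if_False if_True not_True_eq_False not_False_eq_True)
  qed
  have "(\<integral>(e, s). indicator {0<..t} s *\<^sub>R h k \<omega> e s \<partial>\<mu>) =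
    (\<integral>q. (indicator {0<..t} (snd q) * indicator {0..\<sigma> (?y (snd q)) (fst (fst q))} (snd (fst q))) *\<^sub>R ?\<psi> (snd q) (fst (fst q)) \<partial>\<mu>)"
  proof (intro Bochner_Integration.integral_cong refl)
    fix q :: "('a \<times> real) \<times> real"
    obtain z r s where q: "q = ((z, r), s)" by (cases q) auto
    show "(case q of (e, s) \<Rightarrow> indicator {0<..t} s *\<^sub>R h k \<omega> e s) =
      (indicator {0<..t} (snd q) * indicator {0..\<sigma> (?y (snd q)) (fst (fst q))} (snd (fst q))) *\<^sub>R ?\<psi> (snd q) (fst (fst q))"
    proof (cases "s \<in> {0<..t} \<and> r \<in> {0..\<sigma> (Xm \<omega> s) z}")
      case True
      then have "r \<in> {0..k\<^sub>1}" using sigma_bounds(2)[of "Xm \<omega> s" z] by auto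
      then show ?thesis using True by (simp add: q h_def tj_def big_marks_def indicator_def)
    next
      case False
      then show ?thesis by (auto simp: q h_def tj_def indicator_def)
    qed
  qed
  also have "\<dots> = (\<integral>s. indicator {0<..t} s *\<^sub>R (\<integral>z. \<sigma> (?y s) z *\<^sub>R ?\<psi> s z \<partial>\<nu>) \<partial>lborel)"
    by (rule thin_integral(2)[OF y \<psi> bd eps(1,2) t])
  also have "\<dots> = (\<integral>s. indicator {0<..t} s * trunc_gen (eps k) (W k \<omega> s) (Xm \<omega> s) \<partial>lborel)"
  proof (intro Bochner_Integration.integral_cong refl)
    fix s
    show "indicator {0<..t} s *\<^sub>R (\<integral>z. \<sigma> (?y s) z *\<^sub>R ?\<psi> s z \<partial>\<nu>) = indicator {0<..t} s * trunc_gen (eps k) (W k \<omega> s) (Xm \<omega> s)"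
      by (cases "s \<in> {0<..t}") (simp_all add: trunc_gen_def mult_ac)
  qed
  finally show ?thesis .
qed

text \<open>The compensator is subtracted from both sides of \<open>ito_path\<close>. The formula is
  exact at every truncation level, so only passages to the limit remain.\<close>

lemma comp_path:
  assumes g: "good t \<omega>" and t: "0 \<le> t"
  shows "pathwise_comp_integral mk N (h k) t \<omega> = f (V k t \<omega>) - f x -
    (\<integral>u. indicator {0<..t} u * (grad f (W k \<omega> u) \<bullet> b (Xm \<omega> u)) \<partial>lborel) -
    (\<integral>s. indicator {0<..t} s * trunc_gen (eps k) (W k \<omega> s) (Xm \<omega> s) \<partial>lborel)"
proof -
  have \<omega>: "\<omega> \<in> space M" using g by (simp add: good_def)
  obtain S where S: "atoms k t \<omega> S" using g by (auto simp: good_def)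
  show ?thesis
    unfolding pathwise_comp_integral_def h_jump_integral[OF g S t] h_compensator[OF \<omega> t]
    using ito_path[OF g S t] by simp
qed

text \<open>At each time the retained jumps of size at most 1 have an odd integrand and a symmetric
  intensity, so their compensator is 0. This is why \<open>V k\<close> may contain them
  uncompensated.\<close>

lemma small_compensator:
  assumes \<omega>: "\<omega> \<in> space M" and t: "0 \<le> t"
  shows "(\<integral>q. indicator {0<..t} (snd q) *\<^sub>R (indicator (Bk k) (fst q) * indicator {e. norm (fst e) \<le> 1} (fst q)) *\<^sub>R tj \<omega> q \<partial>\<mu>) = 0"
proof -
  let ?y = "\<lambda>s. indicator {0<..t} s *\<^sub>R Xm \<omega> s"
  have y: "?y \<in> borel_measurable borel" by (rule time_section_borel[OF Xm_PA \<omega>])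
  let ?\<psi> = "\<lambda>(s::real) z::'a. indicator {z. eps k < norm z \<and> norm z \<le> 1} z *\<^sub>R z"
  have \<psi>: "(\<lambda>(s, z). ?\<psi> s z) \<in> borel_measurable borel"
    unfolding borel_prod[symmetric] case_prod_unfold
    by (intro borel_measurable_scaleR measurable_compose[OF measurable_snd borel_measurable_indicator] measurable_snd) auto
  have bd: "norm (?\<psi> s z) \<le> 1 * indicator {z. eps k < norm z} z" for s z by (simp add: indicator_def)
  have "(\<integral>q. indicator {0<..t} (snd q) *\<^sub>R (indicator (Bk k) (fst q) * indicator {e. norm (fst e) \<le> 1} (fst q)) *\<^sub>R tj \<omega> q \<partial>\<mu>) =
    (\<integral>q. (indicator {0<..t} (snd q) * indicator {0..\<sigma> (?y (snd q)) (fst (fst q))} (snd (fst q))) *\<^sub>R ?\<psi> (snd q) (fst (fst q)) \<partial>\<mu>)"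
  proof (intro Bochner_Integration.integral_cong refl)
    fix q :: "('a \<times> real) \<times> real"
    obtain z r s where q: "q = ((z, r), s)" by (cases q) auto
    show "indicator {0<..t} (snd q) *\<^sub>R (indicator (Bk k) (fst q) * indicator {e. norm (fst e) \<le> 1} (fst q)) *\<^sub>R tj \<omega> q =
      (indicator {0<..t} (snd q) * indicator {0..\<sigma> (?y (snd q)) (fst (fst q))} (snd (fst q))) *\<^sub>R ?\<psi> (snd q) (fst (fst q))"
    proof (cases "s \<in> {0<..t} \<and> r \<in> {0..\<sigma> (Xm \<omega> s) z}")
      case True
      then have "r \<in> {0..k\<^sub>1}" using sigma_bounds(2)[of "Xm \<omega> s" z] by auto
      then show ?thesis using True by (simp add: q tj_def big_marks_def indicator_def)
    next
      case False
      then show ?thesis by (auto simp: q tj_def indicator_def)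
    qed
  qed
  also have "\<dots> = (\<integral>s. indicator {0<..t} s *\<^sub>R (\<integral>z. \<sigma> (?y s) z *\<^sub>R ?\<psi> s z \<partial>\<nu>) \<partial>lborel)"
    by (rule thin_integral(2)[OF y \<psi> bd eps(1,2) t])
  also have "\<dots> = 0"
  proof -
    have "(\<integral>z. \<sigma> (?y s) z *\<^sub>R ?\<psi> s z \<partial>\<nu>) = 0" for s
    proof (rule integral_odd_zero)
      show "(\<lambda>z. \<sigma> (?y s) z *\<^sub>R ?\<psi> s z) \<in> borel_measurable borel"
        by (intro borel_measurable_scaleR sigma_measurable2) auto
    qed (use sigma_sym in \<open>simp add: indicator_def\<close>)
    then show ?thesis by simp
  qed
  finally show ?thesis .
qed

text \<open>The part of the small-jump integrand of the equation that \<open>V k\<close> retains;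
  what it lacks of the full integrand is the source of the whole error.\<close>

definition small :: "nat \<Rightarrow> 'w \<Rightarrow> 'a \<times> real \<Rightarrow> real \<Rightarrow> 'a" where
  "small k \<omega> e s = (indicator (Bk k) e * indicator {e. norm (fst e) \<le> 1} e) *\<^sub>R tj \<omega> (e, s)"

lemma small_predictable: "predictable M F mk (small k)"
proof -
  have "(\<lambda>y. (indicator (Bk k) (fst (snd y)) * indicator {z. norm z \<le> 1} (fst (fst (snd y)))) *\<^sub>R tj (fst y) (snd y)) \<in> borel_measurable PA"
    using big_marks_sets
    by (intro borel_measurable_times borel_measurable_scaleR tj_PA measurable_compose[OF PA_mark] borel_measurable_indicator
      measurable_compose[OF mark_PA(1) borel_measurable_indicator]) auto
  then show ?thesis by (simp add: predictable_def small_def case_prod_unfold indicator_def)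
qed

text \<open>The drift and the jumps larger than 1 are common to both processes and cancel. The other
  jumps of \<open>V k\<close> equal their own compensated integral by
  \<open>small_compensator\<close>.\<close>

lemma X_minus_V:
  assumes g: "good t \<omega>" and u: "0 \<le> u" "u \<le> t"
  shows "X u \<omega> - V k u \<omega> = Zs u \<omega> - pathwise_comp_integral mk N (small k) u \<omega>"
proof -
  have t: "0 \<le> t" using u by simp
  have \<omega>: "\<omega> \<in> space M" using g by (simp add: good_def)
  obtain S where S: "atoms k t \<omega> S" using g by (auto simp: good_def)
  let ?G = "\<lambda>q. indicator (region k u) q *\<^sub>R tj \<omega> q"
  let ?L = "\<lambda>q. (indicator (region k u) q * indicator {e. 1 < norm (fst e)} (fst q)) *\<^sub>R tj \<omega> q"
  let ?S = "\<lambda>q. (indicator (region k u) q * indicator {e. norm (fst e) \<le> 1} (fst q)) *\<^sub>R tj \<omega> q"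
  have fm: "(\<lambda>q :: ('a \<times> real) \<times> real. fst (fst q)) \<in> borel_measurable borel"
    by (rule borel_measurable_continuous_onI, intro continuous_intros)
  have im: "(\<lambda>q :: ('a \<times> real) \<times> real. indicator A (fst (fst q)) :: real) \<in> borel_measurable borel" if "A \<in> sets borel" for A
    using measurable_compose[OF fm borel_measurable_indicator[OF that]] .
  have Gm: "?G \<in> borel_measurable borel" by (rule region_tj_borel[OF \<omega>])
  have "(\<lambda>q. indicator {z. 1 < norm z} (fst (fst q)) *\<^sub>R ?G q) \<in> borel_measurable borel"
    by (intro borel_measurable_scaleR Gm im) auto
  then have Lm: "?L \<in> borel_measurable borel" by (rule measurable_cong[THEN iffD1, rotated]) (auto simp: indicator_def)
  have "(\<lambda>q. indicator {z. norm z \<le> 1} (fst (fst q)) *\<^sub>R ?G q) \<in> borel_measurable borel"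
    by (intro borel_measurable_scaleR Gm im) auto
  then have Sm: "?S \<in> borel_measurable borel" by (rule measurable_cong[THEN iffD1, rotated]) (auto simp: indicator_def)
  have out: "p \<notin> region k u" if "p \<notin> region k t" for p using that u by auto
  have Li: "integrable (N \<omega>) ?L" by (rule atoms_integral(1)[OF t S \<omega> Lm]) (use out in auto)
  have Si: "integrable (N \<omega>) ?S" by (rule atoms_integral(1)[OF t S \<omega> Sm]) (use out in auto)
  have "(\<integral>q. ?G q \<partial>N \<omega>) = (\<integral>q. ?L q + ?S q \<partial>N \<omega>)"
    by (intro Bochner_Integration.integral_cong refl) (simp add: indicator_def)
  also have "\<dots> = (\<integral>q. ?L q \<partial>N \<omega>) + (\<integral>q. ?S q \<partial>N \<omega>)" by (rule Bochner_Integration.integral_add[OF Li Si])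
  finally have split: "(\<integral>q. ?G q \<partial>N \<omega>) = (\<integral>q. ?L q \<partial>N \<omega>) + (\<integral>q. ?S q \<partial>N \<omega>)" .
  have L: "(\<integral>(e, s). indicator {0<..u} s *\<^sub>R (indicator {e. 1 < norm (fst e)} e *\<^sub>R thinned_jump \<sigma> (Xm \<omega> s) e) \<partial>N \<omega>) = (\<integral>q. ?L q \<partial>N \<omega>)"
  proof (intro Bochner_Integration.integral_cong refl)
    fix q :: "('a \<times> real) \<times> real"
    obtain z r s where q: "q = ((z, r), s)" by (cases q) auto
    show "(case q of (e, s) \<Rightarrow> indicator {0<..u} s *\<^sub>R (indicator {e. 1 < norm (fst e)} e *\<^sub>R thinned_jump \<sigma> (Xm \<omega> s) e)) = ?L q"
    proof (cases "r \<in> {0..k\<^sub>1}")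
      case True
      have "eps k < norm z" if "1 < norm z" using that eps(2)[of k] by linarith
      then show ?thesis using True by (simp add: q thinned_eq big_marks_def indicator_def)
    next
      case False
      then show ?thesis using tj_outside[of q \<omega>] by (simp add: q thinned_eq)
    qed
  qed
  have S0: "pathwise_comp_integral mk N (small k) u \<omega> = (\<integral>q. ?S q \<partial>N \<omega>)"
  proof -
    have "(\<integral>(e, s). indicator {0<..u} s *\<^sub>R small k \<omega> e s \<partial>N \<omega>) = (\<integral>q. ?S q \<partial>N \<omega>)"
      by (intro Bochner_Integration.integral_cong refl) (auto simp: small_def indicator_def)
    moreover have "(\<integral>(e, s). indicator {0<..u} s *\<^sub>R small k \<omega> e s \<partial>\<mu>) = 0"
      using small_compensator[OF \<omega> u(1), of k] by (simp add: small_def case_prod_unfold)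
    ultimately show ?thesis by (simp add: pathwise_comp_integral_def)
  qed
  have bi: "(LINT s:{0..u}|lborel. b (X s \<omega>)) = (\<integral>v. indicator {0<..u} v *\<^sub>R b (Xm \<omega> v) \<partial>lborel)"
    by (rule time_integral_left(2)[OF \<omega> b_meas])
  have "X u \<omega> = x + Zs u \<omega> + (\<integral>q. ?L q \<partial>N \<omega>) + (\<integral>v. indicator {0<..u} v *\<^sub>R b (Xm \<omega> v) \<partial>lborel)"
    using g u L bi unfolding good_def solves_def by simp
  moreover have "V k u \<omega> = x + ((\<integral>q. ?L q \<partial>N \<omega>) + (\<integral>q. ?S q \<partial>N \<omega>)) + (\<integral>v. indicator {0<..u} v *\<^sub>R b (Xm \<omega> v) \<partial>lborel)"
    unfolding V_def jump_sum(1)[OF g S u] jump_sum(2)[OF g S u, symmetric] split ..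
  ultimately show ?thesis unfolding S0 by simp
qed

end

section \<open>Convergence of the truncated processes\<close>

text \<open>The series of squares has finite mean, hence converges almost everywhere, and its terms
  tend to 0. A geometric rate therefore gives almost sure convergence of the whole sequence without
  passing to a subsequence.\<close>

lemma summable_L2_AE:
  fixes Y :: "nat \<Rightarrow> 'b \<Rightarrow> 'c::euclidean_space"
  assumes Y: "\<And>k. Y k \<in> borel_measurable L" and a: "\<And>k. 0 \<le> a k" "summable a"
    and bd: "\<And>k. (\<integral>\<^sup>+y. ennreal (norm (Y k y) ^ 2) \<partial>L) \<le> ennreal (a k)"
  shows "AE y in L. (\<lambda>k. Y k y) \<longlonglongrightarrow> 0"
proof -
  have "(\<integral>\<^sup>+y. (\<Sum>k. ennreal (norm (Y k y) ^ 2)) \<partial>L) = (\<Sum>k. \<integral>\<^sup>+y. ennreal (norm (Y k y) ^ 2) \<partial>L)"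
    using Y by (intro nn_integral_suminf) simp
  also have "\<dots> \<le> (\<Sum>k. ennreal (a k))" by (intro suminf_le bd summableI)
  also have "\<dots> < \<infinity>" using suminf_ennreal2[OF a] by simp
  finally have "AE y in L. (\<Sum>k. ennreal (norm (Y k y) ^ 2)) \<noteq> \<infinity>"
    using Y by (intro nn_integral_PInf_AE borel_measurable_suminf) (auto simp: less_top)
  then show ?thesis
  proof eventually_elim
    case (elim y)
    then have "summable (\<lambda>k. norm (Y k y) ^ 2)" by (intro summable_suminf_not_top) auto
    then have "(\<lambda>k. norm (Y k y) ^ 2) \<longlonglongrightarrow> 0" by (rule summable_LIMSEQ_zero)
    then have "(\<lambda>k. sqrt (norm (Y k y) ^ 2)) \<longlonglongrightarrow> sqrt 0" by (rule tendsto_real_sqrt)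
    then show ?case by (intro tendsto_norm_zero_cancel[of "\<lambda>k. Y k y"]) simp
  qed
qed

context stable_function
begin

lemma trunc_gen_measurable:
  assumes w: "w \<in> borel_measurable borel" and y: "y \<in> borel_measurable borel"
  shows "(\<lambda>s::real. trunc_gen \<epsilon> (w s) (y s)) \<in> borel_measurable borel"
  unfolding trunc_gen_def
proof (rule sigma_finite_measure.borel_measurable_lebesgue_integral[OF sigma_finite_nu])
  have m3: "fst \<in> borel_measurable (borel \<Otimes>\<^sub>M \<nu>)" "snd \<in> borel_measurable (borel \<Otimes>\<^sub>M \<nu>)"
    by (simp_all cong: measurable_cong_sets)
  show "(\<lambda>(s, z). indicator {z. \<epsilon> < norm z} z * ((f (w s + z) - f (w s)) * \<sigma> (y s) z)) \<in> borel_measurable (borel \<Otimes>\<^sub>M \<nu>)"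
    unfolding case_prod_unfold
    by (intro borel_measurable_times borel_measurable_diff measurable_compose[OF _ f_measurable] borel_measurable_add
      measurable_compose[OF m3(1) w] measurable_compose[OF m3(1) y] m3 sigma_measurable2
      measurable_compose[OF m3(2) borel_measurable_indicator]) auto
qed

text \<open>A null set of times stays null after multiplication with all marks, even where these
  have infinite mass, because infinity times 0 is 0 in the product measure.\<close>

lemma AE_intensity_time:
  assumes "AE s in lborel. P s"
  shows "AE q in intensity mk. P (snd q)"
proof -
  obtain N0 where N0: "{s \<in> space lborel. \<not> P s} \<subseteq> N0" "emeasure lborel N0 = 0" "N0 \<in> sets lborel"
    using AE_E[OF assms] by blast
  have "emeasure half_line N0 = (\<integral>\<^sup>+s. indicator {0..} s * indicator N0 s \<partial>lborel)"
    unfolding half_line_def using N0 by (intro emeasure_density) auto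
  also have "\<dots> \<le> (\<integral>\<^sup>+s. indicator N0 s \<partial>lborel)" by (intro nn_integral_mono) (auto simp: indicator_def)
  also have "\<dots> = 0" using N0 by simp
  finally have "emeasure half_line N0 = 0" by simp
  then have "emeasure (intensity mk) (UNIV \<times> N0) = 0"
    unfolding intensity_def using N0(3) sets.top[of mk]
    by (subst sigma_finite_measure.emeasure_pair_measure_Times[OF sigma_finite_half_line]) auto
  moreover have "UNIV \<times> N0 \<in> sets (intensity mk)"
    unfolding sets_intensity using N0(3) sets.top[of mk] by (intro pair_measureI) auto
  ultimately have "UNIV \<times> N0 \<in> null_sets (intensity mk)" by (intro null_setsI)
  then show ?thesis by (rule AE_I') (use N0(1) in auto)
qed

end

section \<open>The error of the truncation and its rate\<close>

context sde_ito
begin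

definition moment :: "real \<Rightarrow> real" where "moment q = (\<integral>z. gauge q z \<partial>\<nu>)"

lemma moment_nonneg: "0 \<le> moment q"
  unfolding moment_def by (intro integral_nonneg_AE) (simp add: gauge_nonneg)

lemma gauge_intensity:
  assumes "\<alpha> < q" "0 \<le> D" "0 \<le> t"
  shows "(\<integral>\<^sup>+p. ennreal (D * gauge q (fst (fst p))) * indicator {0..k\<^sub>1} (snd (fst p)) * indicator {0<..t} (snd p) \<partial>\<mu>)
    = ennreal (D * moment q * k\<^sub>1 * t)"
proof -
  have "(\<integral>\<^sup>+z. ennreal (D * gauge q z) \<partial>\<nu>) = ennreal (D * moment q)"
    unfolding moment_def using assms gauge_nonneg
    by (subst nn_integral_eq_integral) (auto intro!: integrable_mult_right gauge_integrable)
  then show ?thesis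
    using assms k1_nonneg moment_nonneg
    by (subst nn_integral_intensity[where \<phi> = "\<lambda>z. ennreal (D * gauge q z)"]) (auto simp: ennreal_mult)
qed

text \<open>A deterministic majorant in the mark makes the bound independent of the path: the height
  contributes \<open>k\<^sub>1\<close> and the time contributes \<open>t\<close>.\<close>

lemma power_norm_bound:
  fixes g :: "'w \<Rightarrow> 'a \<times> real \<Rightarrow> real \<Rightarrow> 'b::euclidean_space"
  assumes g: "predictable M F mk g" and q: "\<alpha> < q" "0 \<le> D" "0 \<le> t"
    and bd: "\<And>\<omega> e s. norm (g \<omega> e s) ^ p \<le> D * (indicator {0..k\<^sub>1} (snd e) * gauge q (fst e))"
  shows "power_norm M mk p t g \<le> ennreal (D * moment q * k\<^sub>1 * t)"
proof -
  have "power_norm M mk p t g \<le> (\<integral>\<^sup>+\<omega>. ennreal (D * moment q * k\<^sub>1 * t) \<partial>M)"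
    unfolding power_norm_eq(1)[OF g]
  proof (rule nn_integral_mono)
    fix \<omega>
    have "(\<integral>\<^sup>+p'. ennreal (norm (g \<omega> (fst p') (snd p')) ^ p) * indicator {0<..t} (snd p') \<partial>\<mu>) \<le>
      (\<integral>\<^sup>+p. ennreal (D * gauge q (fst (fst p))) * indicator {0..k\<^sub>1} (snd (fst p)) * indicator {0<..t} (snd p) \<partial>\<mu>)"
    proof (rule nn_integral_mono)
      fix p' :: "('a \<times> real) \<times> real"
      have "ennreal (norm (g \<omega> (fst p') (snd p')) ^ p) \<le> ennreal (D * (indicator {0..k\<^sub>1} (snd (fst p')) * gauge q (fst (fst p'))))"
        by (rule ennreal_leI[OF bd])
      also have "\<dots> = ennreal (D * gauge q (fst (fst p'))) * indicator {0..k\<^sub>1} (snd (fst p'))"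
        by (simp add: indicator_def)
      finally show "ennreal (norm (g \<omega> (fst p') (snd p')) ^ p) * indicator {0<..t} (snd p') \<le>
        ennreal (D * gauge q (fst (fst p'))) * indicator {0..k\<^sub>1} (snd (fst p')) * indicator {0<..t} (snd p')"
        by (rule mult_right_mono) simp
    qed
    also have "\<dots> = ennreal (D * moment q * k\<^sub>1 * t)" by (rule gauge_intensity[OF q])
    finally show "(\<integral>\<^sup>+p'. ennreal (norm (g \<omega> (fst p') (snd p')) ^ p) * indicator {0<..t} (snd p') \<partial>\<mu>) \<le> ennreal (D * moment q * k\<^sub>1 * t)" .
  qed
  also have "\<dots> = ennreal (D * moment q * k\<^sub>1 * t)" by (simp add: emeasure_space_1)
  finally show ?thesis .
qed

text \<open>For removed jumps |z|^2 = |z|^\<delta> |z|^(2 - \<delta>): the first factor is at most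
  \<open>eps k powr \<delta>\<close>, and the second is still integrable because 2 - \<delta> = 1 +
  \<alpha>/2 > \<alpha>.\<close>

definition \<delta> :: real where "\<delta> = 1 - \<alpha> / 2"

lemma \<delta>: "0 < \<delta>" "\<alpha> < 2 - \<delta>"
proof -
  show "0 < \<delta>" "\<alpha> < 2 - \<delta>" using \<alpha>(2) by (simp_all add: \<delta>_def)
qed

text \<open>The factor 4 is the one in \<open>has_comp_integral_estimate\<close>. With
  \<open>eps k\<close> = 2^(-k) the expression is geometric in \<open>k\<close>.\<close>

definition err :: "real \<Rightarrow> nat \<Rightarrow> real" where
  "err t k = 4 * (eps k powr \<delta> * moment (2 - \<delta>) * k\<^sub>1 * t)"

lemma err_nonneg: "0 \<le> t \<Longrightarrow> 0 \<le> err t k"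
  using moment_nonneg[of "2 - \<delta>"] k1_nonneg by (simp add: err_def)

lemma err_summable: "summable (err t)"
proof -
  have "eps k powr \<delta> = (2 powr - \<delta>) ^ k" for k
  proof -
    have "eps k = 2 powr (- real k)" by (simp add: eps_def powr_minus_divide powr_realpow power_one_over)
    then have "eps k powr \<delta> = 2 powr (real k * - \<delta>)" by (simp add: powr_powr)
    then show ?thesis by (simp only: two_powr_pow)
  qed
  then have "err t = (\<lambda>k. (2 powr - \<delta>) ^ k * (4 * (moment (2 - \<delta>) * k\<^sub>1 * t)))"
    by (auto simp: err_def)
  moreover have "summable (\<lambda>k. (2 powr - \<delta>) ^ k * (4 * (moment (2 - \<delta>) * k\<^sub>1 * t)))"
    using \<delta> by (intro summable_mult2 summable_geometric) (simp add: powr_less_one)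
  ultimately show ?thesis by simp
qed

abbreviation small_jump :: "'w \<Rightarrow> 'a \<times> real \<Rightarrow> real \<Rightarrow> 'a" where
  "small_jump \<omega> e s \<equiv> indicator {e. norm (fst e) \<le> 1} e *\<^sub>R thinned_jump \<sigma> (left_lim X s \<omega>) e"

lemma small_diff_bound:
  "norm (small_jump \<omega> e s - small k \<omega> e s) ^ 2 \<le> eps k powr \<delta> * (indicator {0..k\<^sub>1} (snd e) * gauge (2 - \<delta>) (fst e))"
proof (cases "snd e \<in> {0..k\<^sub>1} \<and> norm (fst e) \<le> 1 \<and> norm (fst e) \<le> eps k")
  case True
  let ?n = "norm (fst e)"
  have "small k \<omega> e s = 0" using True by (simp add: small_def big_marks_def indicator_def mem_Times_iff)
  then have "norm (small_jump \<omega> e s - small k \<omega> e s) \<le> ?n"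
    using norm_tj[of \<omega> "(e, s)"] True by (simp add: thinned_eq)
  then have "norm (small_jump \<omega> e s - small k \<omega> e s) ^ 2 \<le> ?n ^ 2" by (rule power_mono) simp
  also have "?n ^ 2 = ?n powr \<delta> * ?n powr (2 - \<delta>)"
    by (cases "?n = 0") (simp_all add: powr_add[symmetric])
  also have "\<dots> \<le> eps k powr \<delta> * ?n powr (2 - \<delta>)"
    using True \<delta> by (intro mult_right_mono powr_mono2) auto
  also have "\<dots> = eps k powr \<delta> * (indicator {0..k\<^sub>1} (snd e) * gauge (2 - \<delta>) (fst e))"
    using True by (simp add: gauge_def)
  finally show ?thesis .
next
  case False
  have "small_jump \<omega> e s - small k \<omega> e s = 0"
  proof (cases "snd e \<in> {0..k\<^sub>1}")
    case True
    then show ?thesis using False by (auto simp: thinned_eq small_def big_marks_def indicator_def mem_Times_iff not_le)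
  next
    case False
    then show ?thesis using tj_outside[of "(e, s)" \<omega>] by (simp add: thinned_eq small_def)
  qed
  then show ?thesis using gauge_nonneg[of "2 - \<delta>" "fst e"] by simp
qed

lemma small_jump_predictable: "predictable M F mk small_jump"
  using Zs by (simp add: has_comp_integral_def)

text \<open>On the retained marks |z| > \<open>eps k\<close>, so |z| \<le> |z|^2 /
  \<open>eps k\<close>: a first moment, which need not be finite near 0 since \<alpha> > 1, is
  traded for a second moment at the price of a constant depending on \<open>k\<close>.\<close>

lemma small_L1: "0 \<le> t \<Longrightarrow> power_norm M mk 1 t (small k) < \<infinity>"
proof -
  assume t: "0 \<le> t"
  have "power_norm M mk 1 t (small k) \<le> ennreal ((1 / eps k) * moment 2 * k\<^sub>1 * t)"
  proof (rule power_norm_bound[OF small_predictable])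
    fix \<omega> e s
    show "norm (small k \<omega> e s) ^ 1 \<le> (1 / eps k) * (indicator {0..k\<^sub>1} (snd e) * gauge 2 (fst e))"
    proof (cases "e \<in> Bk k \<and> norm (fst e) \<le> 1")
      case True
      let ?n = "norm (fst e)"
      have r: "snd e \<in> {0..k\<^sub>1}" and n: "eps k < ?n" using True by (auto simp: big_marks_def)
      have "norm (small k \<omega> e s) ^ 1 \<le> ?n" using norm_tj[of \<omega> "(e, s)"] True r by (simp add: small_def)
      also have "?n \<le> (1 / eps k) * (?n * ?n)"
        using n eps(1)[of k] mult_right_mono[of "eps k" ?n ?n] by (simp add: le_divide_eq mult.commute)
      also have "?n * ?n = gauge 2 (fst e)" using True n eps(1)[of k] by (simp add: gauge_def power2_eq_square)
      finally show ?thesis using r by simp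
    next
      case False
      then have "small k \<omega> e s = 0" by (auto simp: small_def)
      then show ?thesis using gauge_nonneg[of 2 "fst e"] eps(1)[of k] by simp
    qed
  qed (use \<alpha> t eps(1)[of k] in auto)
  then show ?thesis by (rule le_less_trans) simp
qed

lemma V_measurable: "0 \<le> u \<Longrightarrow> V k u \<in> borel_measurable M"
  by (rule measurable_F_M[OF V_adapted])

lemma X_measurable: "0 \<le> u \<Longrightarrow> X u \<in> borel_measurable M"
  by (rule measurable_F_M[OF X_adapted])

text \<open>The bound is uniform over times up to \<open>t\<close>, as the passage to left limits in
  \<open>W_error\<close> requires.\<close>

lemma V_error:
  assumes u: "0 \<le> u" "u \<le> t"
  shows "(\<integral>\<^sup>+\<omega>. ennreal (norm (V k u \<omega> - X u \<omega>) ^ 2) \<partial>M) \<le> ennreal (err t k)"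
proof -
  have "(\<integral>\<^sup>+\<omega>. ennreal (norm (V k u \<omega> - X u \<omega>) ^ 2) \<partial>M) =
    (\<integral>\<^sup>+\<omega>. ennreal (norm (Zs u \<omega> - pathwise_comp_integral mk N (small k) u \<omega>) ^ 2) \<partial>M)"
  proof (rule nn_integral_cong_AE)
    have "0 \<le> t" using u by simp
    from AE_good[OF this]
    show "AE \<omega> in M. ennreal (norm (V k u \<omega> - X u \<omega>) ^ 2) = ennreal (norm (Zs u \<omega> - pathwise_comp_integral mk N (small k) u \<omega>) ^ 2)"
    proof eventually_elim
      case (elim \<omega>)
      then show ?case using X_minus_V[OF elim u, of k] by (simp add: norm_minus_commute)
    qed
  qed
  also have "\<dots> \<le> 4 * power_norm M mk 2 u (\<lambda>\<omega> e s. small_jump \<omega> e s - small k \<omega> e s)"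
    by (rule has_comp_integral_estimate[OF u(1) Zs small_predictable small_L1[OF u(1)]])
  also have "\<dots> \<le> 4 * ennreal (eps k powr \<delta> * moment (2 - \<delta>) * k\<^sub>1 * u)"
    by (intro mult_left_mono power_norm_bound predictable_diff small_jump_predictable small_predictable small_diff_bound)
      (use \<delta> u in auto)
  also have "\<dots> = ennreal (4 * (eps k powr \<delta> * moment (2 - \<delta>) * k\<^sub>1 * u))"
    by (simp add: ennreal_mult')
  also have "\<dots> \<le> ennreal (err t k)"
    unfolding err_def using u moment_nonneg[of "2 - \<delta>"] k1_nonneg by (intro ennreal_leI mult_left_mono) auto
  finally show ?thesis .
qed

lemma AE_V_lim:
  assumes t: "0 \<le> t"
  shows "AE \<omega> in M. (\<lambda>k. V k t \<omega>) \<longlonglongrightarrow> X t \<omega>"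
proof -
  have "AE \<omega> in M. (\<lambda>k. V k t \<omega> - X t \<omega>) \<longlonglongrightarrow> 0"
    using V_measurable[OF t] X_measurable[OF t]
    by (intro summable_L2_AE[OF _ err_nonneg[OF t] err_summable V_error[OF t order_refl]]) simp
  then show ?thesis by eventually_elim (rule LIM_zero_cancel)
qed

lemma X_left_tendsto: "\<omega> \<in> space M \<Longrightarrow> 0 < s \<Longrightarrow> (\<lambda>n. X (dyadic_below n s) \<omega>) \<longlonglongrightarrow> Xm \<omega> s"
  unfolding left_lim_def by (rule dyadic_lim_left_lim[OF cadlag_left_lim[OF X_cadlag]])

text \<open>Fatou's lemma along dyadic times increasing to \<open>s\<close> carries the uniform
  bound for \<open>V k\<close> over to the left limits.\<close>

lemma W_error:
  assumes s: "0 < s" "s \<le> t"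
  shows "(\<integral>\<^sup>+\<omega>. ennreal (norm (W k \<omega> s - Xm \<omega> s) ^ 2) \<partial>M) \<le> ennreal (err t k)"
proof -
  have t: "0 \<le> t" using s by simp
  let ?d = "\<lambda>n. dyadic_below n s"
  have d: "0 \<le> ?d n" "?d n \<le> t" for n
    using dyadic_below_nonneg[OF s(1), of n] dyadic_below_less[of n s] s by auto
  let ?u = "\<lambda>n \<omega>. ennreal (norm (V k (?d n) \<omega> - X (?d n) \<omega>) ^ 2)"
  have "(\<integral>\<^sup>+\<omega>. ennreal (norm (W k \<omega> s - Xm \<omega> s) ^ 2) \<partial>M) = (\<integral>\<^sup>+\<omega>. liminf (\<lambda>n. ?u n \<omega>) \<partial>M)"
  proof (rule nn_integral_cong_AE)
    show "AE \<omega> in M. ennreal (norm (W k \<omega> s - Xm \<omega> s) ^ 2) = liminf (\<lambda>n. ?u n \<omega>)"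
      using AE_good[OF t]
    proof eventually_elim
      case (elim \<omega>)
      obtain S where S: "atoms k t \<omega> S" using elim by (auto simp: good_def)
      have "\<omega> \<in> space M" using elim by (simp add: good_def)
      then have "(\<lambda>n. ?u n \<omega>) \<longlonglongrightarrow> ennreal (norm (W k \<omega> s - Xm \<omega> s) ^ 2)"
        by (intro tendsto_ennrealI tendsto_power tendsto_norm tendsto_diff W_path(1)[OF elim S s] X_left_tendsto s)
      from lim_imp_Liminf[OF sequentially_bot this] show ?case by simp
    qed
  qed
  also have "\<dots> \<le> liminf (\<lambda>n. \<integral>\<^sup>+\<omega>. ?u n \<omega> \<partial>M)"
    using V_measurable[OF d(1)] X_measurable[OF d(1)] by (intro nn_integral_liminf) simp
  also have "\<dots> \<le> ennreal (err t k)"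
    by (rule Liminf_le[OF sequentially_bot], rule always_eventually, rule allI, rule V_error[OF d])
  finally show ?thesis .
qed

text \<open>Tonelli combines the bounds at fixed times into one on probability times (0, t], where
  summability gives convergence. Convergence at almost all times is enough, since all later
  integrals are absolutely continuous in time.\<close>

lemma AE_W_lim:
  assumes t: "0 \<le> t"
  shows "AE \<omega> in M. AE s in lborel. s \<in> {0<..t} \<longrightarrow> (\<lambda>k. W k \<omega> s) \<longlonglongrightarrow> Xm \<omega> s"
proof -
  interpret P: pair_sigma_finite M lborel
    using lborel.sigma_finite_measure_axioms sigma_finite_measure_axioms by (simp add: pair_sigma_finite_def)
  define Y where "Y k y = indicator {0<..t} (snd y) *\<^sub>R (W k (fst y) (snd y) - Xm (fst y) (snd y))" for k y
  have Ym: "Y k \<in> borel_measurable (M \<Otimes>\<^sub>M lborel)" for k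
    using PA_time_section(2)[OF borel_measurable_diff[OF W_PA Xm_PA], of "(0, 0)" t]
    by (simp add: Y_def[abs_def] case_prod_unfold)
  have Yb: "(\<integral>\<^sup>+y. ennreal (norm (Y k y) ^ 2) \<partial>(M \<Otimes>\<^sub>M lborel)) \<le> ennreal (err t k * t)" for k
  proof -
    have "(\<integral>\<^sup>+y. ennreal (norm (Y k y) ^ 2) \<partial>(M \<Otimes>\<^sub>M lborel)) = (\<integral>\<^sup>+s. \<integral>\<^sup>+\<omega>. ennreal (norm (Y k (\<omega>, s)) ^ 2) \<partial>M \<partial>lborel)"
      using Ym by (intro P.nn_integral_snd[symmetric]) simp
    also have "\<dots> \<le> (\<integral>\<^sup>+s. ennreal (err t k) * indicator {0<..t} s \<partial>lborel)"
    proof (rule nn_integral_mono)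
      fix s
      show "(\<integral>\<^sup>+\<omega>. ennreal (norm (Y k (\<omega>, s)) ^ 2) \<partial>M) \<le> ennreal (err t k) * indicator {0<..t} s"
        using W_error[of s t k] by (cases "s \<in> {0<..t}") (auto simp: Y_def)
    qed
    also have "\<dots> = ennreal (err t k * t)"
      using t err_nonneg[OF t, of k] by (subst nn_integral_cmult_indicator) (auto simp: ennreal_mult)
    finally show ?thesis .
  qed
  have "AE y in M \<Otimes>\<^sub>M lborel. (\<lambda>k. Y k y) \<longlonglongrightarrow> 0"
    by (rule summable_L2_AE[OF Ym _ _ Yb]) (use err_nonneg[OF t] t err_summable in \<open>auto intro: summable_mult2\<close>)
  from P.AE_pair[OF this]
  show ?thesis
  proof eventually_elim
    case (elim \<omega>)
    then show ?case
    proof eventually_elim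
      case (elim s)
      show ?case
      proof
        assume "s \<in> {0<..t}"
        then have "(\<lambda>k. W k \<omega> s - Xm \<omega> s) \<longlonglongrightarrow> 0" using elim by (simp add: Y_def)
        then show "(\<lambda>k. W k \<omega> s) \<longlonglongrightarrow> Xm \<omega> s" by (rule LIM_zero_cancel)
      qed
    qed
  qed
qed

section \<open>Convergence of the approximating integrands\<close>

definition g :: "'w \<Rightarrow> 'a \<times> real \<Rightarrow> real \<Rightarrow> real" where
  "g \<omega> e s = f (left_lim X s \<omega> + thinned_jump \<sigma> (left_lim X s \<omega>) e) - f (left_lim X s \<omega>)"

lemma g_eq: "g \<omega> e s = f (Xm \<omega> s + tj \<omega> (e, s)) - f (Xm \<omega> s)"
  by (simp add: g_def thinned_eq)

lemma g_predictable: "predictable M F mk g"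
  using increment_PA[OF Xm_PA] by (simp add: predictable_def g_eq case_prod_unfold)

lemma gauge_sq: "gauge 1 z * gauge 1 z = gauge 2 z"
  by (simp add: gauge_def power2_eq_square)

lemma increment_sq:
  assumes "\<bar>v\<bar> \<le> D * (indicator {0..k\<^sub>1} (snd e) * gauge 1 (fst e))"
  shows "norm v ^ 2 \<le> D ^ 2 * (indicator {0..k\<^sub>1} (snd e) * gauge 2 (fst e))"
proof -
  have "\<bar>v\<bar> ^ 2 \<le> (D * (indicator {0..k\<^sub>1} (snd e) * gauge 1 (fst e))) ^ 2"
    using assms by (intro power_mono) auto
  also have "\<dots> = D ^ 2 * (indicator {0..k\<^sub>1} (snd e) * gauge 2 (fst e))"
    by (simp add: power_mult_distrib power2_eq_square gauge_sq indicator_def)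
  finally show ?thesis by simp
qed

lemma g_bound: "\<bar>g \<omega> e s\<bar> \<le> 2 * C * (indicator {0..k\<^sub>1} (snd e) * gauge 1 (fst e))"
  using increment_bound[of "Xm \<omega> s" \<omega> "(e, s)"] by (simp add: g_eq)

lemma h_bound: "\<bar>h k \<omega> e s\<bar> \<le> 2 * C * (indicator {0..k\<^sub>1} (snd e) * gauge 1 (fst e))"
proof -
  have "\<bar>h k \<omega> e s\<bar> \<le> \<bar>f (W k \<omega> s + tj \<omega> (e, s)) - f (W k \<omega> s)\<bar>" by (simp add: h_def indicator_def)
  then show ?thesis using increment_bound[of "W k \<omega> s" \<omega> "(e, s)"] by simp
qed

lemma diff_bound: "norm (h k \<omega> e s - g \<omega> e s) ^ 2 \<le> (4 * C) ^ 2 * (indicator {0..k\<^sub>1} (snd e) * gauge 2 (fst e))"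
  by (rule increment_sq) (use h_bound[of k \<omega> e s] g_bound[of \<omega> e s] in linarith)

lemma g_L2: "0 \<le> t \<Longrightarrow> power_norm M mk 2 t g < \<infinity>"
  by (rule le_less_trans[OF power_norm_bound[OF g_predictable _ _ _ increment_sq[OF g_bound]]]) (use \<alpha> in auto)

lemma h_L2: "0 \<le> t \<Longrightarrow> power_norm M mk 2 t (h k) < \<infinity>"
  by (rule le_less_trans[OF power_norm_bound[OF h_predictable _ _ _ increment_sq[OF h_bound]]]) (use \<alpha> in auto)

text \<open>On the marks of \<open>h k\<close> the gauge of exponent 1 is at least
  \<open>eps k\<close>, so it is at most its square divided by \<open>eps k\<close>. The square is
  the gauge of exponent 2, whose moment is finite.\<close>

lemma h_L1: "0 \<le> t \<Longrightarrow> power_norm M mk 1 t (h k) < \<infinity>"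
proof -
  assume t: "0 \<le> t"
  have "norm (h k \<omega> e s) ^ 1 \<le> (2 * C / eps k) * (indicator {0..k\<^sub>1} (snd e) * gauge 2 (fst e))" for \<omega> e s
  proof (cases "e \<in> Bk k")
    case True
    then have r: "snd e \<in> {0..k\<^sub>1}" and n: "eps k < norm (fst e)" by (auto simp: big_marks_def)
    have "eps k \<le> gauge 1 (fst e)" using n eps(2)[of k] by (simp add: gauge_def)
    then have "eps k * gauge 1 (fst e) \<le> gauge 2 (fst e)"
      using mult_right_mono[OF _ gauge_nonneg[of 1 "fst e"]] gauge_sq[of "fst e"] by metis
    then have "gauge 1 (fst e) \<le> gauge 2 (fst e) / eps k" using eps(1)[of k] by (simp add: le_divide_eq mult.commute)
    then have "2 * C * gauge 1 (fst e) \<le> 2 * C * (gauge 2 (fst e) / eps k)" using C by (intro mult_left_mono) auto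
    then show ?thesis using h_bound[of k \<omega> e s] r by simp
  next
    case False
    then show ?thesis using gauge_nonneg[of 2 "fst e"] C eps(1)[of k] by (simp add: h_def)
  qed
  then show ?thesis
    by (intro le_less_trans[OF power_norm_bound[OF h_predictable, of 2 "2 * C / eps k"]])
      (use \<alpha> C eps(1)[of k] t in auto)
qed

text \<open>A nonzero jump has |z| > 0 and therefore survives all but finitely many truncations;
  from then on continuity of \<open>f\<close> gives the limit.\<close>

lemma h_tendsto:
  assumes "(\<lambda>k. W k \<omega> s) \<longlonglongrightarrow> Xm \<omega> s"
  shows "(\<lambda>k. h k \<omega> e s) \<longlonglongrightarrow> g \<omega> e s"
proof (cases "tj \<omega> (e, s) = 0")
  case True
  then show ?thesis by (simp add: h_def g_eq)
next
  case False
  then have r: "snd e \<in> {0..k\<^sub>1}" using tj_outside[of "(e, s)" \<omega>] by auto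
  have z: "0 < norm (fst e)" using False norm_tj[of \<omega> "(e, s)"] by (auto simp: indicator_def)
  have l: "(\<lambda>k. f (W k \<omega> s + tj \<omega> (e, s)) - f (W k \<omega> s)) \<longlonglongrightarrow> f (Xm \<omega> s + tj \<omega> (e, s)) - f (Xm \<omega> s)"
    by (intro tendsto_diff isCont_tendsto_compose[OF f_isCont] tendsto_add tendsto_const assms)
  have "\<forall>\<^sub>F k in sequentially. eps k < norm (fst e)" using order_tendstoD(2)[OF eps(3) z] .
  then have "\<forall>\<^sub>F k in sequentially. f (W k \<omega> s + tj \<omega> (e, s)) - f (W k \<omega> s) = h k \<omega> e s"
    by eventually_elim (use r in \<open>simp add: h_def big_marks_def mem_Times_iff\<close>)
  with l show ?thesis unfolding g_eq by (rule Lim_transform_eventually)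
qed

text \<open>Dominated convergence twice, first against the intensity for fixed \<omega> and then in
  mean. The majorant is a multiple of the gauge of exponent 2 and free of \<omega>, so its integral
  over the intensity is a constant majorant for the second step.\<close>

lemma h_L2_tendsto:
  assumes t: "0 \<le> t"
  shows "(\<lambda>k. power_norm M mk 2 t (\<lambda>\<omega> e s. h k \<omega> e s - g \<omega> e s)) \<longlonglongrightarrow> 0"
proof -
  let ?d = "\<lambda>k \<omega> q. ennreal (norm (h k \<omega> (fst q) (snd q) - g \<omega> (fst q) (snd q)) ^ 2) * indicator {0<..t} (snd q)"
  let ?w = "\<lambda>p :: ('a \<times> real) \<times> real. ennreal ((4 * C) ^ 2 * gauge 2 (fst (fst p))) * indicator {0..k\<^sub>1} (snd (fst p)) * indicator {0<..t} (snd p) :: ennreal"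
  let ?B = "(4 * C) ^ 2 * moment 2 * k\<^sub>1 * t"
  have wint: "(\<integral>\<^sup>+p. ?w p \<partial>\<mu>) = ennreal ?B" by (rule gauge_intensity) (use \<alpha> t in auto)
  have pr: "predictable M F mk (\<lambda>\<omega> e s. h k \<omega> e s - g \<omega> e s)" for k
    by (rule predictable_diff[OF h_predictable g_predictable])
  have dm: "(\<lambda>(\<omega>, q). ?d k \<omega> q) \<in> borel_measurable (M \<Otimes>\<^sub>M \<mu>)" for k
    using power_norm_eq(2)[OF pr[of k], where p = 2 and t = t] by (simp add: case_prod_unfold)
  have dms: "?d k \<omega> \<in> borel_measurable \<mu>" if "\<omega> \<in> space M" for k \<omega>
    using measurable_Pair2[OF dm that] by simp
  have dle: "?d k \<omega> q \<le> ?w q" for k \<omega> q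
  proof -
    have "ennreal (norm (h k \<omega> (fst q) (snd q) - g \<omega> (fst q) (snd q)) ^ 2) \<le> ennreal ((4 * C) ^ 2 * (indicator {0..k\<^sub>1} (snd (fst q)) * gauge 2 (fst (fst q))))"
      by (rule ennreal_leI[OF diff_bound])
    also have "\<dots> = ennreal ((4 * C) ^ 2 * gauge 2 (fst (fst q))) * indicator {0..k\<^sub>1} (snd (fst q))" by (simp add: indicator_def)
    finally show ?thesis by (rule mult_right_mono) simp
  qed
  have wm: "?w \<in> borel_measurable \<mu>"
  proof -
    have b1: "(\<lambda>q :: ('a \<times> real) \<times> real. fst (fst q)) \<in> borel_measurable borel"
      "(\<lambda>q :: ('a \<times> real) \<times> real. snd (fst q)) \<in> borel_measurable borel"
      "(snd :: ('a \<times> real) \<times> real \<Rightarrow> real) \<in> borel_measurable borel"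
      by (rule borel_measurable_continuous_onI, intro continuous_intros)+
    have g2: "(\<lambda>z::'a. ennreal ((4 * C) ^ 2 * gauge 2 z)) \<in> borel_measurable borel" by measurable
    have "?w \<in> borel_measurable borel"
      by (intro borel_measurable_times_ennreal measurable_compose[OF b1(1) g2] measurable_compose[OF b1(2) borel_measurable_indicator]
        measurable_compose[OF b1(3) borel_measurable_indicator]) auto
    then show ?thesis by (simp only: measurable_cong_sets[OF sets_int_mk refl])
  qed
  have inner: "AE \<omega> in M. (\<lambda>k. \<integral>\<^sup>+q. ?d k \<omega> q \<partial>\<mu>) \<longlonglongrightarrow> 0"
    using AE_W_lim[OF t] AE_space
  proof eventually_elim
    case (elim \<omega>)
    have "(\<lambda>k. \<integral>\<^sup>+q. ?d k \<omega> q \<partial>\<mu>) \<longlonglongrightarrow> (\<integral>\<^sup>+q. 0 \<partial>\<mu>)"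
    proof (rule nn_integral_dominated_convergence[where w = ?w])
      show "AE q in \<mu>. (\<lambda>k. ?d k \<omega> q) \<longlonglongrightarrow> 0"
        using AE_intensity_time[OF elim(1)]
      proof eventually_elim
        case (elim q)
        show ?case
        proof (cases "snd q \<in> {0<..t}")
          case True
          then have "(\<lambda>k. h k \<omega> (fst q) (snd q)) \<longlonglongrightarrow> g \<omega> (fst q) (snd q)" using elim by (intro h_tendsto) auto
          then have "(\<lambda>k. h k \<omega> (fst q) (snd q) - g \<omega> (fst q) (snd q)) \<longlonglongrightarrow> 0" by (rule LIM_zero)
          then have "(\<lambda>k. norm (h k \<omega> (fst q) (snd q) - g \<omega> (fst q) (snd q)) ^ 2) \<longlonglongrightarrow> norm (0::real) ^ 2"
            by (intro tendsto_power tendsto_norm)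
          then have "(\<lambda>k. ennreal (norm (h k \<omega> (fst q) (snd q) - g \<omega> (fst q) (snd q)) ^ 2)) \<longlonglongrightarrow> ennreal 0"
            by (intro tendsto_ennrealI) simp
          then show ?thesis using True by simp
        qed simp
      qed
      show "(\<integral>\<^sup>+q. ?w q \<partial>\<mu>) < \<infinity>" unfolding wint by simp
    qed (use dms[OF elim(2)] wm dle in auto)
    then show ?case by simp
  qed
  have "(\<lambda>k. \<integral>\<^sup>+\<omega>. \<integral>\<^sup>+q. ?d k \<omega> q \<partial>\<mu> \<partial>M) \<longlonglongrightarrow> (\<integral>\<^sup>+\<omega>. 0 \<partial>M)"
  proof (rule nn_integral_dominated_convergence[where w = "\<lambda>_. ennreal ?B"])
    show "(\<lambda>\<omega>. \<integral>\<^sup>+q. ?d k \<omega> q \<partial>\<mu>) \<in> borel_measurable M" for k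
      using sigma_finite_measure.borel_measurable_nn_integral_fst[OF sigma_finite_intensity dm[of k]] by simp
    show "AE \<omega> in M. (\<integral>\<^sup>+q. ?d k \<omega> q \<partial>\<mu>) \<le> ennreal ?B" for k
      unfolding wint[symmetric] by (intro AE_I2 nn_integral_mono dle)
    show "(\<integral>\<^sup>+\<omega>. ennreal ?B \<partial>M) < \<infinity>" by (simp add: emeasure_space_1)
  qed (use inner in auto)
  then show ?thesis unfolding power_norm_eq(1)[OF pr] by simp
qed

section \<open>The limit of the truncated formulas\<close>

abbreviation gen :: "'a \<Rightarrow> real" where
  "gen \<equiv> generator_op \<alpha> (\<lambda>y z. \<sigma> y z * \<kappa>t z) b f"

lemma gen_eq: "gen y = Lf y + grad f y \<bullet> b y"
  by (simp add: generator_op_def stable_op_eq inner_commute)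

lemma gen_measurable: "gen \<in> borel_measurable borel"
  unfolding gen_eq[abs_def] by measurable

text \<open>Chosen as the left-hand side of the formula: the identity becomes immediate, and the
  content is that \<open>Z\<close> is a cadlag version of the compensated integral.\<close>

definition Z :: "real \<Rightarrow> 'w \<Rightarrow> real" where
  "Z t \<omega> = f (X t \<omega>) - f x - (LINT s:{0..t}|lborel. gen (X s \<omega>))"

lemma gen_integrable:
  assumes gd: "good t \<omega>" and t: "0 \<le> t"
  shows "integrable lborel (\<lambda>s. indicator {0<..t} s *\<^sub>R gen (Xm \<omega> s))"
    "(\<integral>s. indicator {0<..t} s *\<^sub>R gen (Xm \<omega> s) \<partial>lborel) =
      (\<integral>s. indicator {0<..t} s * (grad f (Xm \<omega> s) \<bullet> b (Xm \<omega> s)) \<partial>lborel) + (\<integral>s. indicator {0<..t} s * Lf (Xm \<omega> s) \<partial>lborel)"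
proof -
  have \<omega>: "\<omega> \<in> space M" using gd by (simp add: good_def)
  have m: "(\<lambda>s. indicator {0<..t} s *\<^sub>R v (Xm \<omega> s)) \<in> borel_measurable lborel" if "v \<in> borel_measurable borel" for v :: "'a \<Rightarrow> real"
    using time_section_borel[OF measurable_compose[OF Xm_PA that] \<omega>, of t] by simp
  have bi: "integrable lborel (beta t \<omega>)" by (rule beta_integrable[OF gd t])
  have 1: "integrable lborel (\<lambda>s. indicator {0<..t} s * (grad f (Xm \<omega> s) \<bullet> b (Xm \<omega> s)))"
  proof (rule Bochner_Integration.integrable_bound[of lborel "\<lambda>u. C * norm (beta t \<omega> u)"])
    show "(\<lambda>s. indicator {0<..t} s * (grad f (Xm \<omega> s) \<bullet> b (Xm \<omega> s))) \<in> borel_measurable lborel"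
      using m[of "\<lambda>y. grad f y \<bullet> b y"] by simp
    show "AE s in lborel. norm (indicator {0<..t} s * (grad f (Xm \<omega> s) \<bullet> b (Xm \<omega> s))) \<le> norm (C * norm (beta t \<omega> s))"
    proof (rule AE_I2)
      fix s
      have "\<bar>grad f (Xm \<omega> s) \<bullet> b (Xm \<omega> s)\<bar> \<le> C * norm (b (Xm \<omega> s))"
        by (rule order_trans[OF Cauchy_Schwarz_ineq2 mult_right_mono[OF grad_bound norm_ge_zero]])
      then show "norm (indicator {0<..t} s * (grad f (Xm \<omega> s) \<bullet> b (Xm \<omega> s))) \<le> norm (C * norm (beta t \<omega> s))"
        using C by (cases "s \<in> {0<..t}") (auto simp: beta_def abs_mult)
    qed
  qed (use bi in simp)
  have 2: "integrable lborel (\<lambda>s. indicator {0<..t} s * Lf (Xm \<omega> s))"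
  proof (rule Bochner_Integration.integrable_bound[of lborel "\<lambda>s. Lbound * indicator {0<..t} s"])
    show "(\<lambda>s. indicator {0<..t} s * Lf (Xm \<omega> s)) \<in> borel_measurable lborel" using m[of Lf] by simp
    show "integrable lborel (\<lambda>s. Lbound * indicator {0<..t} s)" using t by (intro integrable_mult_right integrable_real_indicator) auto
    show "AE s in lborel. norm (indicator {0<..t} s * Lf (Xm \<omega> s)) \<le> norm (Lbound * indicator {0<..t} s)"
      using Lf_bound by (intro AE_I2) (auto simp: indicator_def intro: order_trans[OF _ abs_ge_self])
  qed
  have e: "indicator {0<..t} s *\<^sub>R gen (Xm \<omega> s) = indicator {0<..t} s * (grad f (Xm \<omega> s) \<bullet> b (Xm \<omega> s)) + indicator {0<..t} s * Lf (Xm \<omega> s)" for s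
    by (simp only: gen_eq) (simp add: algebra_simps)
  show "integrable lborel (\<lambda>s. indicator {0<..t} s *\<^sub>R gen (Xm \<omega> s))"
    unfolding e by (rule Bochner_Integration.integrable_add[OF 1 2])
  show "(\<integral>s. indicator {0<..t} s *\<^sub>R gen (Xm \<omega> s) \<partial>lborel) =
      (\<integral>s. indicator {0<..t} s * (grad f (Xm \<omega> s) \<bullet> b (Xm \<omega> s)) \<partial>lborel) + (\<integral>s. indicator {0<..t} s * Lf (Xm \<omega> s) \<partial>lborel)"
    unfolding e by (rule Bochner_Integration.integral_add[OF 1 2])
qed

lemma Z_measurable:
  assumes t: "0 \<le> t"
  shows "Z t \<in> borel_measurable M"
proof -
  have 1: "(\<lambda>(\<omega>, s). indicator {0<..t} s *\<^sub>R gen (Xm \<omega> s)) \<in> borel_measurable (M \<Otimes>\<^sub>M lborel)"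
    using PA_time_section(2)[OF measurable_compose[OF Xm_PA gen_measurable], of "(0, 0)" t] by simp
  have "(\<lambda>\<omega>. \<integral>s. indicator {0<..t} s *\<^sub>R gen (Xm \<omega> s) \<partial>lborel) \<in> borel_measurable M"
    by (rule lborel.borel_measurable_lebesgue_integral[OF 1])
  then have "(\<lambda>\<omega>. f (X t \<omega>) - f x - (\<integral>s. indicator {0<..t} s *\<^sub>R gen (Xm \<omega> s) \<partial>lborel)) \<in> borel_measurable M"
    using measurable_compose[OF X_measurable[OF t] f_measurable] by simp
  then show ?thesis
    by (rule measurable_cong[THEN iffD1, rotated]) (simp add: Z_def time_integral_left(2)[OF _ gen_measurable])
qed

text \<open>The limit of \<open>comp_path\<close> term by term: \<open>V k\<close> converges at the
  fixed time \<open>t\<close>, and the time integrals converge dominatedly, with majorant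
  \<open>C\<close> times |b| for the gradient term and \<open>Lbound\<close> for the truncated
  operator.\<close>

lemma AE_comp_lim:
  assumes t: "0 \<le> t"
  shows "AE \<omega> in M. (\<lambda>k. pathwise_comp_integral mk N (h k) t \<omega>) \<longlonglongrightarrow> Z t \<omega>"
  using AE_good[OF t] AE_V_lim[OF t] AE_W_lim[OF t]
proof eventually_elim
  case (elim \<omega>)
  have \<omega>: "\<omega> \<in> space M" using elim by (simp add: good_def)
  have bi: "integrable lborel (beta t \<omega>)" by (rule beta_integrable[OF elim(1) t])
  let ?y = "\<lambda>s. indicator {0<..t} s *\<^sub>R Xm \<omega> s" and ?w = "\<lambda>k s. indicator {0<..t} s *\<^sub>R W k \<omega> s"
  have y: "?y \<in> borel_measurable borel" by (rule time_section_borel[OF Xm_PA \<omega>])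
  have w: "?w k \<in> borel_measurable borel" for k by (rule time_section_borel[OF W_PA \<omega>])
  have gbm: "(\<lambda>u. indicator {0<..t} u * (grad f (W k \<omega> u) \<bullet> b (Xm \<omega> u))) \<in> borel_measurable lborel" for k
  proof -
    have "(\<lambda>y. grad f (W k (fst y) (snd (snd y))) \<bullet> b (Xm (fst y) (snd (snd y)))) \<in> borel_measurable PA"
      by (intro borel_measurable_inner measurable_compose[OF W_PA grad_measurable] b_Xm_PA)
    from time_section_borel[OF this \<omega>, of t] show ?thesis by simp
  qed
  have gbm': "(\<lambda>u. indicator {0<..t} u * (grad f (Xm \<omega> u) \<bullet> b (Xm \<omega> u))) \<in> borel_measurable lborel"
  proof -
    have "(\<lambda>y. grad f (Xm (fst y) (snd (snd y))) \<bullet> b (Xm (fst y) (snd (snd y)))) \<in> borel_measurable PA"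
      by (intro borel_measurable_inner measurable_compose[OF Xm_PA grad_measurable] b_Xm_PA)
    from time_section_borel[OF this \<omega>, of t] show ?thesis by simp
  qed
  have 1: "(\<lambda>k. \<integral>u. indicator {0<..t} u * (grad f (W k \<omega> u) \<bullet> b (Xm \<omega> u)) \<partial>lborel) \<longlonglongrightarrow>
    (\<integral>u. indicator {0<..t} u * (grad f (Xm \<omega> u) \<bullet> b (Xm \<omega> u)) \<partial>lborel)"
  proof (rule integral_dominated_convergence[where w = "\<lambda>u. C * norm (beta t \<omega> u)", OF gbm' gbm])
    show "AE u in lborel. (\<lambda>k. indicator {0<..t} u * (grad f (W k \<omega> u) \<bullet> b (Xm \<omega> u))) \<longlonglongrightarrow> indicator {0<..t} u * (grad f (Xm \<omega> u) \<bullet> b (Xm \<omega> u))"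
      using elim(3)
    proof eventually_elim
      case (elim u)
      show ?case
      proof (cases "u \<in> {0<..t}")
        case True
        then show ?thesis using elim
          by (intro tendsto_mult tendsto_const tendsto_inner isCont_tendsto_compose[OF grad_isCont]) auto
      qed simp
    qed
    show "AE u in lborel. norm (indicator {0<..t} u * (grad f (W k \<omega> u) \<bullet> b (Xm \<omega> u))) \<le> C * norm (beta t \<omega> u)" for k
    proof (rule AE_I2)
      fix s
      have "\<bar>grad f (W k \<omega> s) \<bullet> b (Xm \<omega> s)\<bar> \<le> C * norm (b (Xm \<omega> s))"
        by (rule order_trans[OF Cauchy_Schwarz_ineq2 mult_right_mono[OF grad_bound norm_ge_zero]])
      then show "norm (indicator {0<..t} s * (grad f (W k \<omega> s) \<bullet> b (Xm \<omega> s))) \<le> C * norm (beta t \<omega> s)"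
        by (cases "s \<in> {0<..t}") (auto simp: beta_def)
    qed
  qed (use bi in simp)
  have 2: "(\<lambda>k. \<integral>s. indicator {0<..t} s * trunc_gen (eps k) (W k \<omega> s) (Xm \<omega> s) \<partial>lborel) \<longlonglongrightarrow>
    (\<integral>s. indicator {0<..t} s * Lf (Xm \<omega> s) \<partial>lborel)"
  proof (rule integral_dominated_convergence[where w = "\<lambda>s. Lbound * indicator {0<..t} s"])
    show "(\<lambda>s. indicator {0<..t} s * Lf (Xm \<omega> s)) \<in> borel_measurable lborel"
      using time_section_borel[OF measurable_compose[OF Xm_PA Lf_measurable] \<omega>, of t] by simp
    show "(\<lambda>s. indicator {0<..t} s * trunc_gen (eps k) (W k \<omega> s) (Xm \<omega> s)) \<in> borel_measurable lborel" for k
    proof -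
      have "(\<lambda>s. indicator {0<..t} s * trunc_gen (eps k) (?w k s) (?y s)) \<in> borel_measurable borel"
        by (intro borel_measurable_times borel_measurable_indicator trunc_gen_measurable w y) simp
      moreover have "indicator {0<..t} s * trunc_gen (eps k) (?w k s) (?y s) = indicator {0<..t} s * trunc_gen (eps k) (W k \<omega> s) (Xm \<omega> s)" for s
        by (simp add: indicator_def)
      ultimately show ?thesis by simp
    qed
    show "integrable lborel (\<lambda>s. Lbound * indicator {0<..t} s)" using t by (intro integrable_mult_right integrable_real_indicator) auto
    show "AE s in lborel. norm (indicator {0<..t} s * trunc_gen (eps k) (W k \<omega> s) (Xm \<omega> s)) \<le> Lbound * indicator {0<..t} s" for k
      using trunc_gen_bound[OF eps(1,2)] by (intro AE_I2) (simp add: indicator_def)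
    show "AE s in lborel. (\<lambda>k. indicator {0<..t} s * trunc_gen (eps k) (W k \<omega> s) (Xm \<omega> s)) \<longlonglongrightarrow> indicator {0<..t} s * Lf (Xm \<omega> s)"
      using elim(3)
    proof eventually_elim
      case (elim s)
      show ?case
      proof (cases "s \<in> {0<..t}")
        case True
        then show ?thesis using elim by (intro tendsto_mult tendsto_const trunc_gen_lim eps) auto
      qed simp
    qed
  qed
  have 3: "(\<lambda>k. f (V k t \<omega>)) \<longlonglongrightarrow> f (X t \<omega>)" by (rule isCont_tendsto_compose[OF f_isCont elim(2)])
  show ?case
    unfolding comp_path[OF elim(1) t] Z_def time_integral_left(2)[OF \<omega> gen_measurable] gen_integrable(2)[OF elim(1) t] diff_diff_eq[symmetric]
    by (intro tendsto_diff 1 2 3 tendsto_const)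
qed

text \<open>Upgrades the almost sure limit to an L2 limit. The integrals of the \<open>h k\<close>
  are Cauchy in L2 by the isometry; Fatou's lemma in the second index \<open>l\<close> replaces one
  of the two integrals by its almost sure limit \<open>Z\<close>, and the error in \<open>l\<close>
  disappears.\<close>

lemma comp_L2_tendsto:
  assumes t: "0 \<le> t"
  shows "(\<lambda>k. \<integral>\<^sup>+\<omega>. ennreal (norm (pathwise_comp_integral mk N (h k) t \<omega> - Z t \<omega>) ^ 2) \<partial>M) \<longlonglongrightarrow> 0"
proof -
  let ?I = "\<lambda>k. pathwise_comp_integral mk N (h k) t"
  have "\<forall>k. \<exists>P. P \<in> borel_measurable M \<and> (AE \<omega> in M. P \<omega> = ?I k \<omega>)"
    using comp_isometry(2)[OF t h_predictable h_L1[OF t]] by blast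
  \<comment> \<open>Fatou's lemma needs measurable functions of \<omega>, so the pathwise integrals
    are exchanged for measurable versions, outside one null set for all \<open>k\<close>.\<close>
  from choice[OF this] obtain P where P: "\<And>k. P k \<in> borel_measurable M" "\<And>k. AE \<omega> in M. P k \<omega> = ?I k \<omega>" by blast
  have Pall: "AE \<omega> in M. \<forall>k. P k \<omega> = ?I k \<omega>" by (subst AE_all_countable) (use P(2) in blast)
  let ?e = "\<lambda>k. power_norm M mk 2 t (\<lambda>\<omega> e s. h k \<omega> e s - g \<omega> e s)"
  note e0 = h_L2_tendsto[OF t]
  have e': "power_norm M mk 2 t (\<lambda>\<omega> e s. g \<omega> e s - h l \<omega> e s) = ?e l" for l
    using power_norm_minus[of 2 t "\<lambda>\<omega> e s. h l \<omega> e s - g \<omega> e s"] by simp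
  have bound: "(\<integral>\<^sup>+\<omega>. ennreal (norm (?I k \<omega> - Z t \<omega>) ^ 2) \<partial>M) \<le> 2 * ?e k" for k
  proof -
    have "(\<integral>\<^sup>+\<omega>. ennreal (norm (?I k \<omega> - Z t \<omega>) ^ 2) \<partial>M) = (\<integral>\<^sup>+\<omega>. liminf (\<lambda>l. ennreal (norm (P k \<omega> - P l \<omega>) ^ 2)) \<partial>M)"
    proof (rule nn_integral_cong_AE)
      show "AE \<omega> in M. ennreal (norm (?I k \<omega> - Z t \<omega>) ^ 2) = liminf (\<lambda>l. ennreal (norm (P k \<omega> - P l \<omega>) ^ 2))"
        using AE_comp_lim[OF t] Pall
      proof eventually_elim
        case (elim \<omega>)
        then have "(\<lambda>l. P l \<omega>) \<longlonglongrightarrow> Z t \<omega>" by simp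
        then have "(\<lambda>l. ennreal (norm (P k \<omega> - P l \<omega>) ^ 2)) \<longlonglongrightarrow> ennreal (norm (P k \<omega> - Z t \<omega>) ^ 2)"
          by (intro tendsto_ennrealI tendsto_power tendsto_norm tendsto_diff tendsto_const)
        from lim_imp_Liminf[OF sequentially_bot this] show ?case using elim(2) by simp
      qed
    qed
    also have "\<dots> \<le> liminf (\<lambda>l. \<integral>\<^sup>+\<omega>. ennreal (norm (P k \<omega> - P l \<omega>) ^ 2) \<partial>M)"
      using P(1) by (intro nn_integral_liminf) simp
    also have "\<dots> \<le> liminf (\<lambda>l. 2 * ?e k + 2 * ?e l)"
    proof (rule Liminf_mono, rule always_eventually, rule allI)
      fix l
      have "(\<integral>\<^sup>+\<omega>. ennreal (norm (P k \<omega> - P l \<omega>) ^ 2) \<partial>M) = (\<integral>\<^sup>+\<omega>. ennreal (norm (?I k \<omega> - ?I l \<omega>) ^ 2) \<partial>M)"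
        using Pall by (intro nn_integral_cong_AE) auto
      also have "\<dots> \<le> power_norm M mk 2 t (\<lambda>\<omega> e s. h k \<omega> e s - h l \<omega> e s)"
        by (rule comp_isometry_diff[OF t h_predictable h_L1[OF t] h_predictable h_L1[OF t]])
      also have "\<dots> \<le> 2 * ?e k + 2 * ?e l"
        using power_norm_diff[OF h_predictable g_predictable h_predictable, of t k l] unfolding e' .
      finally show "(\<integral>\<^sup>+\<omega>. ennreal (norm (P k \<omega> - P l \<omega>) ^ 2) \<partial>M) \<le> 2 * ?e k + 2 * ?e l" .
    qed
    also have "\<dots> = 2 * ?e k"
    proof -
      have "(\<lambda>l. 2 * ?e k + 2 * ?e l) \<longlonglongrightarrow> 2 * ?e k + 2 * 0"
        by (intro tendsto_add tendsto_const ennreal_tendsto_cmult e0) simp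
      from lim_imp_Liminf[OF sequentially_bot this] show ?thesis by simp
    qed
    finally show ?thesis .
  qed
  have "(\<lambda>k. 2 * ?e k) \<longlonglongrightarrow> 2 * 0" by (intro ennreal_tendsto_cmult e0) simp
  then have lim: "(\<lambda>k. 2 * ?e k) \<longlonglongrightarrow> 0" by simp
  show ?thesis
    by (rule tendsto_sandwich[OF _ _ tendsto_const lim]) (use bound in auto)
qed

text \<open>The time integral is continuous, \<open>f\<close> is continuous and \<open>X\<close> is
  cadlag. Each time is treated inside an integer horizon, so countably many null sets suffice for
  all times.\<close>

lemma Z_cadlag:
  assumes \<omega>: "\<omega> \<in> space M" and gd: "\<And>n::nat. good (real n) \<omega>"
  shows "cadlag (\<lambda>t. Z t \<omega>)"
proof -
  define A where "A t = (\<integral>s. indicator {0<..t} s *\<^sub>R gen (Xm \<omega> s) \<partial>lborel)" for t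
  have isC: "isCont A t" for t
  proof -
    obtain n :: nat where n: "t < real n" using reals_Archimedean2 by blast
    have i: "integrable lborel (\<lambda>s. indicator {0<..real n} s *\<^sub>R gen (Xm \<omega> s))" by (rule gen_integrable(1)[OF gd]) simp
    have "isCont (\<lambda>t. \<integral>u. indicator {0<..t} u *\<^sub>R (indicator {0<..real n} u *\<^sub>R gen (Xm \<omega> u)) \<partial>lborel) t"
      using indefinite_integral_continuous[OF i] by (simp add: continuous_on_eq_continuous_at)
    moreover have "\<forall>\<^sub>F v in nhds t. A v = (\<integral>u. indicator {0<..v} u *\<^sub>R (indicator {0<..real n} u *\<^sub>R gen (Xm \<omega> u)) \<partial>lborel)"
    proof -
      have "\<forall>\<^sub>F v in nhds t. v < real n" using n by (intro eventually_nhds_in_open[of "{..<real n}", simplified])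
      then show ?thesis
      proof eventually_elim
        case (elim v)
        then show ?case unfolding A_def
          by (intro Bochner_Integration.integral_cong refl) (simp add: indicator_def)
      qed
    qed
    ultimately show ?thesis by (rule isCont_cong[THEN iffD2, rotated])
  qed
  have At: "(A \<longlongrightarrow> A t) (at t within S)" for t S
    using isC[of t] by (meson continuous_within isCont_def tendsto_within_subset subset_UNIV)
  have Z: "Z t \<omega> = f (X t \<omega>) - f x - A t" for t
    by (simp add: Z_def A_def time_integral_left(2)[OF \<omega> gen_measurable])
  have X: "cadlag (\<lambda>t. X t \<omega>)" by (rule X_cadlag[OF \<omega>])
  show ?thesis
    unfolding cadlag_def Z
  proof (intro conjI allI impI)
    fix t :: real assume "0 \<le> t"
    then have "((\<lambda>t. X t \<omega>) \<longlongrightarrow> X t \<omega>) (at_right t)" using X by (simp add: cadlag_def)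
    then show "((\<lambda>t. f (X t \<omega>) - f x - A t) \<longlongrightarrow> f (X t \<omega>) - f x - A t) (at_right t)"
      by (intro tendsto_diff tendsto_const At isCont_tendsto_compose[OF f_isCont])
  next
    fix t :: real assume "0 < t"
    then obtain l where "((\<lambda>t. X t \<omega>) \<longlongrightarrow> l) (at_left t)" using X by (auto simp: cadlag_def)
    then have "((\<lambda>t. f (X t \<omega>) - f x - A t) \<longlongrightarrow> f l - f x - A t) (at_left t)"
      by (intro tendsto_diff tendsto_const At isCont_tendsto_compose[OF f_isCont])
    then show "\<exists>l. ((\<lambda>t. f (X t \<omega>) - f x - A t) \<longlongrightarrow> l) (at_left t)" ..
  qed
qed

lemma AE_good_all: "AE \<omega> in M. \<forall>n::nat. good (real n) \<omega>"
  by (subst AE_all_countable) (use AE_good in auto)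

theorem ito_formula:
  "has_comp_integral M F mk N g Z"
  "AE \<omega> in M. \<forall>t\<ge>0. set_integrable lborel {0..t} (\<lambda>s. gen (X s \<omega>)) \<and>
     f (X t \<omega>) - f x - (LINT s:{0..t}|lborel. gen (X s \<omega>)) = Z t \<omega>"
proof -
  have 1: "AE \<omega> in M. cadlag (\<lambda>t. Z t \<omega>)"
    using AE_good_all AE_space by eventually_elim (intro Z_cadlag, auto)
  show "has_comp_integral M F mk N g Z"
    unfolding has_comp_integral_def
    by (intro conjI allI impI g_predictable 1 Z_measurable g_L2 exI[of _ h] h_predictable h_L1 h_L2 h_L2_tendsto comp_L2_tendsto)
  show "AE \<omega> in M. \<forall>t\<ge>0. set_integrable lborel {0..t} (\<lambda>s. gen (X s \<omega>)) \<and>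
     f (X t \<omega>) - f x - (LINT s:{0..t}|lborel. gen (X s \<omega>)) = Z t \<omega>"
    using AE_good_all AE_space
  proof eventually_elim
    case (elim \<omega>)
    show ?case
    proof (intro allI impI conjI)
      fix t :: real assume t: "0 \<le> t"
      obtain n :: nat where n: "t \<le> real n" using real_arch_simple by blast
      have "set_integrable lborel {0..real n} (\<lambda>s. gen (X s \<omega>))"
        using elim gen_integrable(1)[of "real n" \<omega>] time_integral_left(1)[OF elim(2) gen_measurable] by simp
      then show "set_integrable lborel {0..t} (\<lambda>s. gen (X s \<omega>))"
        by (rule set_integrable_subset) (use n in auto)
    qed (simp add: Z_def)
  qed
qed

end

section \<open>Ito's formula\<close>

theorem lemma5p1:
  fixes M :: "'w measure"
    and F :: "real \<Rightarrow> 'w measure"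
    and N :: "'w \<Rightarrow> (('a::euclidean_space \<times> real) \<times> real) measure"
    and \<alpha> \<beta> \<gamma> \<kappa>\<^sub>0 \<kappa>\<^sub>1 k\<^sub>0 k\<^sub>1 C\<^sub>0 :: real
    and \<kappa>t :: "'a \<Rightarrow> real"
    and \<sigma> :: "'a \<Rightarrow> 'a \<Rightarrow> real"
    and b :: "'a \<Rightarrow> 'a"
    and X :: "real \<Rightarrow> 'w \<Rightarrow> 'a"
    and x :: 'a
    and f :: "'a \<Rightarrow> real"
  assumes alpha: "1 < \<alpha>" "\<alpha> < 2"
    and kt_measurable: "\<kappa>t \<in> borel_measurable borel"
    and kt_symmetric: "\<And>z. \<kappa>t z = \<kappa>t (- z)"
    and kt_bounds: "0 < \<kappa>\<^sub>0" "\<And>z. \<kappa>\<^sub>0 \<le> \<kappa>t z" "\<And>z. \<kappa>t z \<le> \<kappa>\<^sub>1"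
    and beta: "0 < \<beta>" "\<beta> < 1" "\<alpha> + \<beta> < 2"
    and sigma_measurable: "(\<lambda>(y, z). \<sigma> y z) \<in> borel_measurable borel"
    and sigma_symmetric: "\<And>y z. \<sigma> y z = \<sigma> y (- z)"
    and sigma_bounds: "0 < k\<^sub>0" "\<And>y z. k\<^sub>0 \<le> \<sigma> y z" "\<And>y z. \<sigma> y z \<le> k\<^sub>1"
    and sigma_holder: "\<And>y y' z. \<bar>\<sigma> y z - \<sigma> y' z\<bar> \<le> C\<^sub>0 * norm (y - y') powr \<beta>"
    and b_measurable: "b \<in> borel_measurable borel"
    and prob: "prob_space M"
    and filtr: "filtration (space M) F" "\<And>t. sets (F t) \<subseteq> sets M"
    and poisson: "poisson_random_measure M (intensity (mark_measure \<alpha> \<kappa>t)) N"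
      "adapted_random_measure M F (mark_measure \<alpha> \<kappa>t) N"
    and sde: "sde_solution M F (mark_measure \<alpha> \<kappa>t) N \<sigma> b x X"
    and gamma: "\<alpha> < \<gamma>"
    and f: "f \<in> holder_space \<gamma>"
  shows "\<exists>Z. has_comp_integral M F (mark_measure \<alpha> \<kappa>t) N
               (\<lambda>\<omega> e s. f (left_lim X s \<omega> + thinned_jump \<sigma> (left_lim X s \<omega>) e) - f (left_lim X s \<omega>)) Z \<and>
             (AE \<omega> in M. \<forall>t\<ge>0.
               set_integrable lborel {0..t}
                 (\<lambda>s. generator_op \<alpha> (\<lambda>y z. \<sigma> y z * \<kappa>t z) b f (X s \<omega>)) \<and>
               f (X t \<omega>) - f x -
                 (LINT s:{0..t}|lborel. generator_op \<alpha> (\<lambda>y z. \<sigma> y z * \<kappa>t z) b f (X s \<omega>)) = Z t \<omega>)"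
proof -
  obtain Zs where Zs: "has_comp_integral M F (mark_measure \<alpha> \<kappa>t) N
      (\<lambda>\<omega> e s. indicator {e. norm (fst e) \<le> 1} e *\<^sub>R thinned_jump \<sigma> (left_lim X s \<omega>) e) Zs"
    and eqn: "AE \<omega> in M. \<forall>t\<ge>0.
           integrable (N \<omega>) (\<lambda>(e, s). indicator {0<..t} s *\<^sub>R
             (indicator {e. 1 < norm (fst e)} e *\<^sub>R thinned_jump \<sigma> (left_lim X s \<omega>) e)) \<and>
           set_integrable lborel {0..t} (\<lambda>s. b (X s \<omega>)) \<and>
           X t \<omega> = x + Zs t \<omega> +
             (\<integral>(e, s). indicator {0<..t} s *\<^sub>R
               (indicator {e. 1 < norm (fst e)} e *\<^sub>R thinned_jump \<sigma> (left_lim X s \<omega>) e) \<partial>N \<omega>) +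
             (LINT s:{0..t}|lborel. b (X s \<omega>))"
    using sde unfolding sde_solution_def by (elim conjE exE) (rule that)
  obtain C \<theta> where reg: "0 < C" "\<alpha> - 1 < \<theta>" "0 < \<theta>" "\<theta> \<le> 1"
    "\<And>x. (f has_derivative (\<lambda>v. grad f x \<bullet> v)) (at x)"
    "\<And>x. \<bar>f x\<bar> \<le> C" "\<And>x. norm (grad f x) \<le> C"
    "\<And>x y. norm (grad f x - grad f y) \<le> C * norm (x - y) powr \<theta>"
    using holder_space_regularity[OF f alpha gamma] by blast
  have kt0: "0 \<le> \<kappa>t z" for z using kt_bounds(1) kt_bounds(2)[of z] by linarith
  have sg0: "0 \<le> \<sigma> y z" for y z using sigma_bounds(1) sigma_bounds(2)[where y = y and z = z] by linarith
  have S: "stable_function \<alpha> \<kappa>\<^sub>1 \<kappa>t \<sigma> k\<^sub>1 f C \<theta>"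
    by (rule stable_function.intro[OF
          stable_measure.intro[OF alpha kt_measurable kt_symmetric kt0 kt_bounds(3)]
          stable_function_axioms.intro[OF sigma_measurable sigma_symmetric sg0 sigma_bounds(3) reg]])
  interpret S: stable_function \<alpha> \<kappa>\<^sub>1 \<kappa>t \<sigma> k\<^sub>1 f C \<theta> by (rule S)
  have sp: "space (mark_measure \<alpha> \<kappa>t) \<noteq> {}" by (simp add: S.space_mk)
  have B: "poisson_basis M F (mark_measure \<alpha> \<kappa>t) N"
    by (rule poisson_basis.intro[OF prob
          poisson_basis_axioms.intro[OF filtr S.sigma_finite_mk sp poisson]])
  have X1: "X t \<in> borel_measurable (F t)" if "0 \<le> t" for t
    using sde[unfolded sde_solution_def, THEN conjunct1] that by blast
  have X2: "cadlag (\<lambda>t. X t \<omega>)" if "\<omega> \<in> space M" for \<omega>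
    using sde[unfolded sde_solution_def, THEN conjunct2, THEN conjunct1] that by blast
  have I: "sde_ito \<alpha> \<kappa>\<^sub>1 \<kappa>t \<sigma> k\<^sub>1 f C \<theta> M F N b X x Zs"
    by (rule sde_ito.intro[OF S B sde_ito_axioms.intro[OF b_measurable X1 X2 Zs eqn]])
  show ?thesis
    by (rule exI, rule conjI)
      (rule sde_ito.ito_formula[OF I, unfolded sde_ito.g_def[OF I, abs_def]])+
qed

end
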